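(* Let $\Sigma$ be a $(4,2)$-polygraph satisfying the $2$-Squier condition of depth $2$. For every pair of parallel $3$-cells $A,B$ of $\Sigma^{*(2)}_3$ whose $1$-target is a normal form, there exists a $4$-cell $\alpha : A \to B$ in the free $(4,2)$-category $\Sigma^{*(2)}_4$ generated by $\Sigma$.
   Context: **Higher categories.** All $n$-categories are strict and globular; $s_i(x),t_i(x)$ denote $i$-source and $i$-target of a cell, $s,t$ the source and target in codimension one; $\star_i$ is composition along $i$-cells, written in diagrammatic order; a lower-dimensional cell occurring in a composite stands for its identity. Two $k$-cells are parallel if they have the same source and the same target. An $(n,p)$-category is an $n$-category in which every $(i+1)$-cell is invertible for $\star_i$, for all $i\ge p$. **Polygraphs.** An $n$-polygraph $\Sigma$ consists of sets $\Sigma_0,\dots,\Sigma_n$ of generating cells, where inductively $\Sigma_{k+1}$ comes with source and target maps into parallel $k$-cells of the free $k$-category $\Sigma_k^*$ generated by the generating cells of dimension $\le k$, and $\Sigma_{k+1}^*$ is obtained from $\Sigma_k^*$ by freely adjoining $\Sigma_{k+1}$. An $(n,p)$-polygraph is defined in the same way, except that for $k\geq p$ the generating $(k+1)$-cells are attached to the free $(k,p)$-category $\Sigma_k^{*(p)}$ (with $\Sigma_p^{*(p)}=\Sigma_p^*$), and $\Sigma_{k+1}^{*(p)}$ is obtained by freely adjoining the generating $(k+1)$-cells together with inverses. So a $(4,2)$-polygraph has generating $3$-cells with source and target in $\Sigma_2^*$, and generating $4$-cells with source and target in the free $(3,2)$-category $\Sigma_3^{*(2)}$. **Rewriting in dimension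 2.** For $1$-cells $u,v\in\Sigma_1^*$ write $u\to_2^* v$ if there is a $2$-cell $u\Rightarrow v$ in $\Sigma_2^*$. $\Sigma$ is $2$-terminating if $\to_2^*$ is a well-founded (partial) ordering. A normal form is a $1$-cell minimal for $\to_2^*$. A rewriting step is a $2$-cell of $\Sigma_2^*$ of length $1$, i.e. containing exactly one generating $2$-cell. $\Sigma$ is $2$-confluent if for all $2$-cells $f,g\in\Sigma_2^*$ with the same source there are $f',g'\in\Sigma_2^*$ such that $f\star_1 f'$ and $g\star_1 g'$ are defined and have the same target. $\Sigma$ is $2$-convergent if it is $2$-terminating and $2$-confluent. **Branchings.** A $k$-fold local branching is a $k$-tuple $(f_1,\dots,f_k)$ of rewriting steps with the same source; the symmetric group $S_k$ acts on them by permutation, and the class of $(f_1,\dots,f_k)$ is denoted $[f_1,\dots,f_k]$ (its elements are called representatives). A local branching is aspherical if it has, up to permutation, two consecutive equal entries. It is strict Peiffer if it is not aspherical and its source is $v_1\star_0 v_2$ with $v_1,v_2\in\Sigma_1^*$ and there are $1\le m<k$ and $f'_1,\dots,f'_k\in\Sigma_2^*$ with $f_j=f'_j\star_0 v_2$ for $j\le m$ and $f_j=v_1\star_0 f'_j$ for $j>m$; it is Peiffer if some permutation of it is strict Peiffer. Otherwise it is overlapping. Order local branchings by $(f_1,\dots,f_k)\subseteq(u\star_0 f_1\star_0 v,\dots,u\star_0 f_k\star_0 v)$ for $1$-cells $u,v$. A critical branching is an overlapping branching that is minimal for $\subseteq$; critical pairs and critical triples are the $2$-fold and $3$-fold critical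 branchings, considered up to permutation (i.e. as classes under $S_k$) in the bijections below. **Fillings of pairs and the $2$-Squier condition.** A filling of a local branching $(f,g)$ is a $3$-cell $A: f\star_1 f'\Rrightarrow g\star_1 g'$ in $\Sigma_3^{*(2)}$ for some $f',g'\in \Sigma_2^*$. $\Sigma$ satisfies the $2$-Squier condition if it is $2$-convergent and there is a bijection from $\Sigma_3$ to the set of critical pairs of $\Sigma_2$ associating to each $A\in\Sigma_3$ a critical pair $b$ such that $A$ is a filling of a representative of $b$. **Canonical fillings.** Assume the $2$-Squier condition. The canonical filling $A_{f,g}$ of a local branching $(f,g)$ is: the identity $1_f$ if $f=g$; if $(f,g)=(f'\star_0 v_1, v_2\star_0 g')$ is Peiffer (resp. $(f,g)=(v_1\star_0 f', g'\star_0 v_2)$), the identity of $f'\star_0 g'$ (resp. of $g'\star_0 f'$); if $(f,g)$ is a critical pair with associated generating $3$-cell $A$, then $A$ if $A$ is a filling of $(f,g)$, and $A^{-1}$ otherwise (when $A$ is a filling of $(g,f)$); and the canonical filling of $(u\star_0 f\star_0 v,u\star_0 g\star_0 v)$ is $u\star_0 A_{f,g}\star_0 v$. **Fillings of triples and depth 2.** A filling of a local branching $(f,g,h)$ is a $4$-cell $\alpha\in\Sigma_4^{*(2)}$ of the form $$\alpha:\ (A_{f,g}\star_1 a)\star_2 (g\star_1 A)\star_2 (A_{g,h}\star_1 b)\ \longrightarrow\ (f\star_1 B_1)\star_2 (A_{f,h}\star_1 c)\star_2 (h\star_1 B_2),$$ where $A_{f,g},A_{g,h},A_{f,h}$ are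 the canonical fillings, $a,b,c$ are $2$-cells of $\Sigma_2^*$ and $A,B_1,B_2$ are $3$-cells of $\Sigma_3^{*(2)}$. $\Sigma$ satisfies the $2$-Squier condition of depth $2$ if it satisfies the $2$-Squier condition and there is a bijection from $\Sigma_4$ to the set of critical triples of $\Sigma_2$ associating to each $\alpha\in\Sigma_4$ a critical triple $b$ such that $\alpha$ is a filling of a representative of $b$.
   Formalization: 2-termination is taken to mean that there is no infinite chain of non-identity 2-cells, so non-identity 2-cells from a 1-cell to itself are excluded; with well-foundedness of the bare relation on 1-cells the claim fails. *)

theory Defs
  imports "HOL-Library.Multiset"
begin

section \<open>Strict higher categories\<close>

text \<open>
  Strict globular \<open>n\<close>-categories in one-sorted form: a single set of cells on which
  \<open>src C i\<close> and \<open>tgt C i\<close> give the \<open>i\<close>-source and \<open>i\<close>-target. A cell of dimension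
  \<open>i\<close> is identified with its identities in higher dimensions, so the cells of dimension \<open>i\<close> are
  those fixed by \<open>src C i\<close>, and a lower-dimensional cell in a composite stands for its identity
  by construction. Composition \<open>cmp C i x y\<close> is in diagrammatic order and is meaningful
  if \<open>tgt C i x = src C i y\<close>.
\<close>

record 'c ncat =
  dim :: nat
  cells :: "'c set"
  src :: "nat \<Rightarrow> 'c \<Rightarrow> 'c"
  tgt :: "nat \<Rightarrow> 'c \<Rightarrow> 'c"
  cmp :: "nat \<Rightarrow> 'c \<Rightarrow> 'c \<Rightarrow> 'c"

definition kcells :: "('c, 'm) ncat_scheme \<Rightarrow> nat \<Rightarrow> 'c set" where
  "kcells C k = {x \<in> cells C. src C k x = x}"

locale strict_category =
  fixes C :: "'c ncat"
  assumes src_closed: "x \<in> cells C \<Longrightarrow> src C i x \<in> cells C"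
    and tgt_closed: "x \<in> cells C \<Longrightarrow> tgt C i x \<in> cells C"
    and src_top: "x \<in> cells C \<Longrightarrow> dim C \<le> i \<Longrightarrow> src C i x = x"
    and tgt_top: "x \<in> cells C \<Longrightarrow> dim C \<le> i \<Longrightarrow> tgt C i x = x"
    and src_src: "x \<in> cells C \<Longrightarrow> src C i (src C j x) = src C (min i j) x"
    and tgt_tgt: "x \<in> cells C \<Longrightarrow> tgt C i (tgt C j x) = tgt C (min i j) x"
    and src_tgt: "x \<in> cells C \<Longrightarrow> src C i (tgt C j x) = (if i < j then src C i x else tgt C j x)"
    and tgt_src: "x \<in> cells C \<Longrightarrow> tgt C i (src C j x) = (if i < j then tgt C i x else src C j x)"
    and cmp_closed: "\<lbrakk>x \<in> cells C; y \<in> cells C; i < dim C; tgt C i x = src C i y\<rbrakk>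
      \<Longrightarrow> cmp C i x y \<in> cells C"
    and src_cmp: "\<lbrakk>x \<in> cells C; y \<in> cells C; i < dim C; tgt C i x = src C i y\<rbrakk>
      \<Longrightarrow> src C j (cmp C i x y) = (if j \<le> i then src C j x else cmp C i (src C j x) (src C j y))"
    and tgt_cmp: "\<lbrakk>x \<in> cells C; y \<in> cells C; i < dim C; tgt C i x = src C i y\<rbrakk>
      \<Longrightarrow> tgt C j (cmp C i x y) = (if j \<le> i then tgt C j y else cmp C i (tgt C j x) (tgt C j y))"
    and unit_left: "\<lbrakk>x \<in> cells C; i < dim C\<rbrakk> \<Longrightarrow> cmp C i (src C i x) x = x"
    and unit_right: "\<lbrakk>x \<in> cells C; i < dim C\<rbrakk> \<Longrightarrow> cmp C i x (tgt C i x) = x"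
    and cmp_assoc: "\<lbrakk>x \<in> cells C; y \<in> cells C; z \<in> cells C; i < dim C;
        tgt C i x = src C i y; tgt C i y = src C i z\<rbrakk>
      \<Longrightarrow> cmp C i (cmp C i x y) z = cmp C i x (cmp C i y z)"
    and interchange: "\<lbrakk>x \<in> cells C; y \<in> cells C; z \<in> cells C; w \<in> cells C; i < j; j < dim C;
        tgt C j x = src C j y; tgt C j z = src C j w; tgt C i x = src C i z\<rbrakk>
      \<Longrightarrow> cmp C i (cmp C j x y) (cmp C j z w) = cmp C j (cmp C i x z) (cmp C i y w)"

definition inverse_cells :: "'c ncat \<Rightarrow> nat \<Rightarrow> 'c \<Rightarrow> 'c \<Rightarrow> bool" where
  "inverse_cells C i x y \<longleftrightarrow> x \<in> cells C \<and> y \<in> cells C \<and>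
     tgt C i x = src C i y \<and> tgt C i y = src C i x \<and>
     cmp C i x y = src C i x \<and> cmp C i y x = tgt C i x"

definition np_category :: "nat \<Rightarrow> nat \<Rightarrow> 'c ncat \<Rightarrow> bool" where
  "np_category n p C \<longleftrightarrow> strict_category C \<and> dim C = n \<and>
     (\<forall>i. p \<le> i \<and> i < n \<longrightarrow> (\<forall>x \<in> kcells C (Suc i). \<exists>y \<in> kcells C (Suc i). inverse_cells C i x y))"

text \<open>Functors, as maps on cells; values outside the set of cells are irrelevant.\<close>

definition ncat_functor :: "'c ncat \<Rightarrow> 'd ncat \<Rightarrow> ('c \<Rightarrow> 'd) \<Rightarrow> bool" where
  "ncat_functor C D F \<longleftrightarrow>
     (\<forall>x \<in> cells C. F x \<in> cells D \<and> (\<forall>i. F (src C i x) = src D i (F x) \<and> F (tgt C i x) = tgt D i (F x))) \<and>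
     (\<forall>x \<in> cells C. \<forall>y \<in> cells C. \<forall>i < dim C. tgt C i x = src C i y \<longrightarrow>
        F (cmp C i x y) = cmp D i (F x) (F y))"

text \<open>\<open>parallel_cells C k x y\<close>: same source and same target in codimension one (no condition on \<open>0\<close>-cells).\<close>

definition parallel_cells :: "'c ncat \<Rightarrow> nat \<Rightarrow> 'c \<Rightarrow> 'c \<Rightarrow> bool" where
  "parallel_cells C k x y \<longleftrightarrow> x \<in> kcells C k \<and> y \<in> kcells C k \<and>
     (\<forall>i. Suc i = k \<longrightarrow> src C i x = src C i y \<and> tgt C i x = tgt C i y)"


section \<open>Freely adjoining cells\<close>

text \<open>
  Data for adjoining to a \<open>k\<close>-category \<open>base E\<close> (\<open>k = dim (base E)\<close>) a set \<open>gset E\<close> of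
  generating \<open>(k+1)\<close>-cells with sources and targets in \<open>base E\<close>; if \<open>ginv E\<close> holds they are
  adjoined together with inverses for the composition along \<open>k\<close>-cells.
\<close>

record ('x, 'c) ext =
  base :: "'c ncat"
  gset :: "'x set"
  gsrc :: "'x \<Rightarrow> 'c"
  gtgt :: "'x \<Rightarrow> 'c"
  ginv :: bool

definition attached :: "('x, 'c) ext \<Rightarrow> bool" where
  "attached E \<longleftrightarrow> (\<forall>x \<in> gset E. parallel_cells (base E) (dim (base E)) (gsrc E x) (gtgt E x))"

datatype ('x, 'c) trm =
    Old 'c
  | Gen 'x
  | Comp nat "('x, 'c) trm" "('x, 'c) trm"
  | Inv "('x, 'c) trm"

text \<open>
  For \<open>i \<le> k\<close> the \<open>i\<close>-source and \<open>i\<close>-target of a term are cells of the base. An inverse is taken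
  along \<open>k\<close>-cells, so it exchanges only the \<open>k\<close>-source and the \<open>k\<close>-target.
\<close>

fun tsrc :: "('x, 'c) ext \<Rightarrow> nat \<Rightarrow> ('x, 'c) trm \<Rightarrow> 'c"
  and ttgt :: "('x, 'c) ext \<Rightarrow> nat \<Rightarrow> ('x, 'c) trm \<Rightarrow> 'c" where
  "tsrc E i (Old c) = src (base E) i c"
| "tsrc E i (Gen x) = src (base E) i (gsrc E x)"
| "tsrc E i (Comp j a b) =
     (if i \<le> j then tsrc E i a else cmp (base E) j (tsrc E i a) (tsrc E i b))"
| "tsrc E i (Inv a) = (if i = dim (base E) then ttgt E i a else tsrc E i a)"
| "ttgt E i (Old c) = tgt (base E) i c"
| "ttgt E i (Gen x) = tgt (base E) i (gtgt E x)"
| "ttgt E i (Comp j a b) =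
     (if i \<le> j then ttgt E i b else cmp (base E) j (ttgt E i a) (ttgt E i b))"
| "ttgt E i (Inv a) = (if i = dim (base E) then tsrc E i a else ttgt E i a)"

fun wft :: "('x, 'c) ext \<Rightarrow> ('x, 'c) trm \<Rightarrow> bool" where
  "wft E (Old c) \<longleftrightarrow> c \<in> cells (base E)"
| "wft E (Gen x) \<longleftrightarrow> x \<in> gset E"
| "wft E (Comp j a b) \<longleftrightarrow> j \<le> dim (base E) \<and> wft E a \<and> wft E b \<and> ttgt E j a = tsrc E j b"
| "wft E (Inv a) \<longleftrightarrow> ginv E \<and> wft E a"

text \<open>The congruence on well-formed terms generated by the axioms of \<open>(k+1)\<close>-categories,
  the composition of the base and, if applicable, the laws of inverses.\<close>

inductive teq :: "('x, 'c) ext \<Rightarrow> ('x, 'c) trm \<Rightarrow> ('x, 'c) trm \<Rightarrow> bool" for E where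
  teq_refl: "wft E a \<Longrightarrow> teq E a a"
| teq_sym: "teq E a b \<Longrightarrow> teq E b a"
| teq_trans: "teq E a b \<Longrightarrow> teq E b c \<Longrightarrow> teq E a c"
| teq_comp: "teq E a a' \<Longrightarrow> teq E b b' \<Longrightarrow> wft E (Comp j a b) \<Longrightarrow> teq E (Comp j a b) (Comp j a' b')"
| teq_inv: "teq E a a' \<Longrightarrow> ginv E \<Longrightarrow> teq E (Inv a) (Inv a')"
| teq_old: "j < dim (base E) \<Longrightarrow> c \<in> cells (base E) \<Longrightarrow> d \<in> cells (base E) \<Longrightarrow>
    tgt (base E) j c = src (base E) j d \<Longrightarrow>
    teq E (Comp j (Old c) (Old d)) (Old (cmp (base E) j c d))"
| teq_unit_left: "wft E a \<Longrightarrow> j \<le> dim (base E) \<Longrightarrow> teq E (Comp j (Old (tsrc E j a)) a) a"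
| teq_unit_right: "wft E a \<Longrightarrow> j \<le> dim (base E) \<Longrightarrow> teq E (Comp j a (Old (ttgt E j a))) a"
| teq_assoc: "wft E (Comp j (Comp j a b) c) \<Longrightarrow>
    teq E (Comp j (Comp j a b) c) (Comp j a (Comp j b c))"
| teq_interchange: "i < j \<Longrightarrow> wft E (Comp j a b) \<Longrightarrow> wft E (Comp j c d) \<Longrightarrow>
    ttgt E i a = tsrc E i c \<Longrightarrow>
    teq E (Comp i (Comp j a b) (Comp j c d)) (Comp j (Comp i a c) (Comp i b d))"
| teq_inv_right: "wft E a \<Longrightarrow> ginv E \<Longrightarrow>
    teq E (Comp (dim (base E)) a (Inv a)) (Old (tsrc E (dim (base E)) a))"
| teq_inv_left: "wft E a \<Longrightarrow> ginv E \<Longrightarrow>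
    teq E (Comp (dim (base E)) (Inv a) a) (Old (ttgt E (dim (base E)) a))"

definition tcls :: "('x, 'c) ext \<Rightarrow> ('x, 'c) trm \<Rightarrow> ('x, 'c) trm set" where
  "tcls E a = {b. teq E a b}"

text \<open>
  The classes of ill-formed terms are empty, hence undefined composites are empty and never are
  cells: an equation between a cell and a composite includes that the composite is defined.
\<close>

definition free_ext :: "('x, 'c) ext \<Rightarrow> ('x, 'c) trm set ncat" where
  "free_ext E = \<lparr>
     dim = Suc (dim (base E)),
     cells = {tcls E a | a. wft E a},
     src = (\<lambda>i K. if i \<le> dim (base E) then (\<Union>a \<in> K. tcls E (Old (tsrc E i a))) else K),
     tgt = (\<lambda>i K. if i \<le> dim (base E) then (\<Union>a \<in> K. tcls E (Old (ttgt E i a))) else K),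
     cmp = (\<lambda>i K L. \<Union>a \<in> K. \<Union>b \<in> L. tcls E (Comp i a b)) \<rparr>"

definition old_cell :: "('x, 'c) ext \<Rightarrow> 'c \<Rightarrow> ('x, 'c) trm set" where
  "old_cell E c = tcls E (Old c)"

definition gen_cell :: "('x, 'c) ext \<Rightarrow> 'x \<Rightarrow> ('x, 'c) trm set" where
  "gen_cell E x = tcls E (Gen x)"

primrec num_gens :: "('x, 'c) trm \<Rightarrow> nat" where
  "num_gens (Old c) = 0"
| "num_gens (Gen x) = 1"
| "num_gens (Comp j a b) = num_gens a + num_gens b"
| "num_gens (Inv a) = num_gens a"

text \<open>Well-formed terms and their equations are compatible with sources and targets.\<close>

lemma trm_bounds:
  assumes "strict_category (base E)" "attached E" "wft E t" "j \<le> dim (base E)"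
  shows "tsrc E j t \<in> cells (base E) \<and> ttgt E j t \<in> cells (base E) \<and>
    (\<forall>i. src (base E) i (tsrc E j t) = tsrc E (min i j) t \<and>
         tgt (base E) i (ttgt E j t) = ttgt E (min i j) t \<and>
         src (base E) i (ttgt E j t) = (if i < j then tsrc E i t else ttgt E j t) \<and>
         tgt (base E) i (tsrc E j t) = (if i < j then ttgt E i t else tsrc E j t))"
  using assms(3,4)
proof (induction t arbitrary: j)
  case (Old c)
  interpret strict_category "base E" by fact
  show ?case using Old by (simp add: src_closed tgt_closed src_src tgt_tgt src_tgt tgt_src)
next
  case (Gen x)
  interpret strict_category "base E" by fact
  let ?k = "dim (base E)"
  let ?s = "gsrc E x" and ?t = "gtgt E x"
  have p: "parallel_cells (base E) ?k ?s ?t" using Gen assms(2) by (simp add: attached_def)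
  then have c: "?s \<in> cells (base E)" "?t \<in> cells (base E)"
    by (auto simp: parallel_cells_def kcells_def)
  have g: "src (base E) i ?s = src (base E) i ?t \<and> tgt (base E) i ?s = tgt (base E) i ?t"
    if "i < ?k" for i
  proof -
    obtain l where l: "Suc l = ?k" "i \<le> l" using \<open>i < ?k\<close>
      by (metis Suc_le_mono Suc_le_eq less_imp_Suc_add le_add1 add_Suc_right)
    have e: "src (base E) l ?s = src (base E) l ?t" "tgt (base E) l ?s = tgt (base E) l ?t"
      using p l by (auto simp: parallel_cells_def)
    have "src (base E) i ?s = src (base E) i (src (base E) l ?s)"
         "tgt (base E) i ?s = tgt (base E) i (tgt (base E) l ?s)"
      using l c by (simp_all add: src_src tgt_tgt)
    then show ?thesis using l c e by (simp add: src_src tgt_tgt)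
  qed
  show ?case using c g Gen.prems
    by (auto simp: src_closed tgt_closed src_src tgt_tgt src_tgt tgt_src)
next
  case (Comp l a b)
  interpret strict_category "base E" by fact
  have w: "l \<le> dim (base E)" "wft E a" "wft E b" "ttgt E l a = tsrc E l b"
    using Comp.prems by auto
  note A = Comp.IH(1)[OF w(2)] and B = Comp.IH(2)[OF w(3)]
  have low: "tsrc E i a = tsrc E i b \<and> ttgt E i a = ttgt E i b" if "i < l" for i
  proof -
    have "src (base E) i (ttgt E l a) = tsrc E i a" "src (base E) i (tsrc E l b) = tsrc E i b"
      "tgt (base E) i (ttgt E l a) = ttgt E i a" "tgt (base E) i (tsrc E l b) = ttgt E i b"
      using A[OF w(1)] B[OF w(1)] that by simp_all
    then show ?thesis unfolding w(4) by simp
  qed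
  show ?case
  proof (cases "j \<le> l")
    case True
    then show ?thesis using A[OF Comp.prems(2)] B[OF Comp.prems(2)] low by auto
  next
    case False
    then have l: "l < j" "l < dim (base E)" using Comp.prems(2) by auto
    note A' = A[OF Comp.prems(2)] and B' = B[OF Comp.prems(2)]
    have cs: "tgt (base E) l (tsrc E j a) = src (base E) l (tsrc E j b)"
         "tgt (base E) l (ttgt E j a) = src (base E) l (ttgt E j b)"
      using A' B' l w(4) by (simp_all add: min_def)
    show ?thesis using A' B' l cs False low
      by (auto simp: cmp_closed src_cmp tgt_cmp min_def)
  qed
next
  case (Inv a)
  then have "wft E a" by simp
  note A = Inv.IH[OF this]
  show ?case using A[OF Inv.prems(2)] A[OF order_refl] Inv.prems(2) by (auto simp: min_def)
qed

lemma teq_sound: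
  assumes "strict_category (base E)" "attached E" "teq E a b"
  shows "wft E a \<and> wft E b \<and> (\<forall>i \<le> dim (base E). tsrc E i a = tsrc E i b \<and> ttgt E i a = ttgt E i b)"
  using assms(3)
proof (induction rule: teq.induct)
  case (teq_old j c d)
  interpret strict_category "base E" by fact
  show ?case using teq_old by (auto simp: cmp_closed src_cmp tgt_cmp)
next
  case (teq_unit_left a j)
  interpret strict_category "base E" by fact
  note A = trm_bounds[OF assms(1,2) teq_unit_left(1)]
  have 1: "src (base E) i (tsrc E j a) = tsrc E i a" if "i \<le> j" for i
    using A[OF teq_unit_left(2)] that by (simp add: min_def)
  have 2: "cmp (base E) j (tsrc E j a) (tsrc E i a) = tsrc E i a"
    "cmp (base E) j (tsrc E j a) (ttgt E i a) = ttgt E i a" if "j < i" "i \<le> dim (base E)" for i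
    using A[OF that(2)] that unit_left[of "tsrc E i a" j] unit_left[of "ttgt E i a" j]
    by (auto simp: min_def)
  show ?case using teq_unit_left A[OF teq_unit_left(2)] 1 2 by (auto simp: min_def)
next
  case (teq_unit_right a j)
  interpret strict_category "base E" by fact
  note A = trm_bounds[OF assms(1,2) teq_unit_right(1)]
  have 2: "cmp (base E) j (tsrc E i a) (ttgt E j a) = tsrc E i a"
    "cmp (base E) j (ttgt E i a) (ttgt E j a) = ttgt E i a" if "j < i" "i \<le> dim (base E)" for i
    using A[OF that(2)] that unit_right[of "tsrc E i a" j] unit_right[of "ttgt E i a" j]
    by (auto simp: min_def)
  show ?case using teq_unit_right A[OF teq_unit_right(2)] 2 by (auto simp: min_def)
next
  case (teq_assoc j a b c)
  interpret strict_category "base E" by fact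
  have w: "wft E a" "wft E b" "wft E c" "j \<le> dim (base E)" "ttgt E j a = tsrc E j b" "ttgt E j b = tsrc E j c"
    using teq_assoc by auto
  note A = trm_bounds[OF assms(1,2) w(1)] trm_bounds[OF assms(1,2) w(2)] trm_bounds[OF assms(1,2) w(3)]
  have 1: "cmp (base E) j (cmp (base E) j (tsrc E i a) (tsrc E i b)) (tsrc E i c)
      = cmp (base E) j (tsrc E i a) (cmp (base E) j (tsrc E i b) (tsrc E i c))"
    "cmp (base E) j (cmp (base E) j (ttgt E i a) (ttgt E i b)) (ttgt E i c)
      = cmp (base E) j (ttgt E i a) (cmp (base E) j (ttgt E i b) (ttgt E i c))"
    if "j < i" "i \<le> dim (base E)" for i
    using A[OF that(2)] w that by (auto intro!: cmp_assoc simp: min_def)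
  show ?case using w 1 by auto
next
  case (teq_interchange i j a b c d)
  interpret strict_category "base E" by fact
  have w: "wft E a" "wft E b" "wft E c" "wft E d" "j \<le> dim (base E)" "ttgt E j a = tsrc E j b"
    "ttgt E j c = tsrc E j d" "i < j"
    using teq_interchange by auto
  note A = trm_bounds[OF assms(1,2) w(1)] trm_bounds[OF assms(1,2) w(2)]
    trm_bounds[OF assms(1,2) w(3)] trm_bounds[OF assms(1,2) w(4)]
  have e: "ttgt E i a = ttgt E i b" "tsrc E i c = tsrc E i d" "ttgt E i b = tsrc E i d"
  proof -
    have "tgt (base E) i (ttgt E j a) = ttgt E i a" "tgt (base E) i (tsrc E j b) = ttgt E i b"
      "src (base E) i (ttgt E j c) = tsrc E i c" "src (base E) i (tsrc E j d) = tsrc E i d"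
      using A[OF w(5)] w(8) by simp_all
    then show 1: "ttgt E i a = ttgt E i b" "tsrc E i c = tsrc E i d"
      unfolding w(6,7) by simp_all
    show "ttgt E i b = tsrc E i d" using 1 teq_interchange(4) by simp
  qed
  have 1: "cmp (base E) i (cmp (base E) j (tsrc E l a) (tsrc E l b)) (cmp (base E) j (tsrc E l c) (tsrc E l d))
     = cmp (base E) j (cmp (base E) i (tsrc E l a) (tsrc E l c)) (cmp (base E) i (tsrc E l b) (tsrc E l d))"
     "cmp (base E) i (cmp (base E) j (ttgt E l a) (ttgt E l b)) (cmp (base E) j (ttgt E l c) (ttgt E l d))
     = cmp (base E) j (cmp (base E) i (ttgt E l a) (ttgt E l c)) (cmp (base E) i (ttgt E l b) (ttgt E l d))"
    if "j < l" "l \<le> dim (base E)" for l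
    using A[OF that(2)] w e that by (auto intro!: interchange simp: min_def)
  show ?case using w e teq_interchange(4) 1 by auto
next
  case (teq_inv_right a)
  then show ?case using trm_bounds[OF assms(1,2) teq_inv_right(1) order_refl] by (auto simp: min_def)
next
  case (teq_inv_left a)
  then show ?case using trm_bounds[OF assms(1,2) teq_inv_left(1) order_refl] by (auto simp: min_def)
qed auto

lemma tcls_eq_iff: "wft E a \<Longrightarrow> tcls E a = tcls E b \<longleftrightarrow> teq E a b"
proof
  assume "wft E a" "tcls E a = tcls E b"
  then have "a \<in> tcls E b" using teq_refl[of E a] by (auto simp: tcls_def)
  then show "teq E a b" by (simp add: tcls_def teq_sym)
next
  assume ab: "teq E a b"
  show "tcls E a = tcls E b"
    unfolding tcls_def using teq_trans[OF ab] teq_trans[OF teq_sym[OF ab]] by blast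
qed

lemma cells_free_ext: "K \<in> cells (free_ext E) \<longleftrightarrow> (\<exists>a. wft E a \<and> K = tcls E a)"
  by (auto simp: free_ext_def)

lemma dim_free_ext [simp]: "dim (free_ext E) = Suc (dim (base E))"
  by (simp add: free_ext_def)

context
  fixes E :: "('x, 'c) ext"
  assumes S: "strict_category (base E)" and At: "attached E"
begin

lemma src_free_ext:
  assumes "wft E a"
  shows "src (free_ext E) i (tcls E a) = (if i \<le> dim (base E) then tcls E (Old (tsrc E i a)) else tcls E a)"
proof (cases "i \<le> dim (base E)")
  case True
  have a: "a \<in> tcls E a" using assms by (simp add: tcls_def teq_refl)
  have "tcls E (Old (tsrc E i b)) = tcls E (Old (tsrc E i a))" if "b \<in> tcls E a" for b
  proof -
    have "teq E a b" using that by (simp add: tcls_def)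
    then have "tsrc E i a = tsrc E i b" using teq_sound[OF S At] True by blast
    then show ?thesis by simp
  qed
  with a have "(\<Union>b \<in> tcls E a. tcls E (Old (tsrc E i b))) = tcls E (Old (tsrc E i a))"
    by blast
  with True show ?thesis by (simp add: free_ext_def)
next
  case False
  then show ?thesis by (simp add: free_ext_def)
qed

lemma tgt_free_ext:
  assumes "wft E a"
  shows "tgt (free_ext E) i (tcls E a) = (if i \<le> dim (base E) then tcls E (Old (ttgt E i a)) else tcls E a)"
proof (cases "i \<le> dim (base E)")
  case True
  have a: "a \<in> tcls E a" using assms by (simp add: tcls_def teq_refl)
  have "tcls E (Old (ttgt E i b)) = tcls E (Old (ttgt E i a))" if "b \<in> tcls E a" for b
  proof -
    have "teq E a b" using that by (simp add: tcls_def)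
    then have "ttgt E i a = ttgt E i b" using teq_sound[OF S At] True by blast
    then show ?thesis by simp
  qed
  with a have "(\<Union>b \<in> tcls E a. tcls E (Old (ttgt E i b))) = tcls E (Old (ttgt E i a))"
    by blast
  with True show ?thesis by (simp add: free_ext_def)
next
  case False
  then show ?thesis by (simp add: free_ext_def)
qed

lemma cmp_free_ext: "cmp (free_ext E) i (tcls E a) (tcls E b) = tcls E (Comp i a b)"
proof (intro equalityI subsetI)
  fix c assume "c \<in> cmp (free_ext E) i (tcls E a) (tcls E b)"
  then obtain a' b' where t: "teq E a a'" "teq E b b'" "teq E (Comp i a' b') c"
    by (auto simp: free_ext_def tcls_def)
  have "wft E (Comp i a b)"
    using teq_sound[OF S At t(1)] teq_sound[OF S At t(2)] teq_sound[OF S At t(3)] by simp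
  from teq_trans[OF teq_comp[OF t(1,2) this] t(3)] show "c \<in> tcls E (Comp i a b)"
    by (simp add: tcls_def)
next
  fix c assume c: "c \<in> tcls E (Comp i a b)"
  then have "teq E (Comp i a b) c" by (simp add: tcls_def)
  then have "wft E (Comp i a b)" using teq_sound[OF S At] by blast
  then have "a \<in> tcls E a" "b \<in> tcls E b" by (simp_all add: tcls_def teq_refl)
  with c show "c \<in> cmp (free_ext E) i (tcls E a) (tcls E b)" by (auto simp: free_ext_def)
qed

lemma Old_inject: "c \<in> cells (base E) \<Longrightarrow> teq E (Old c) (Old d) \<Longrightarrow> c = d"
proof -
  assume "c \<in> cells (base E)" and t: "teq E (Old c) (Old d)"
  interpret strict_category "base E" by (fact S)
  show "c = d" using teq_sound[OF S At t] by (force simp: src_top)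
qed

lemma Old_eq_iff: "c \<in> cells (base E) \<Longrightarrow> tcls E (Old c) = tcls E (Old d) \<longleftrightarrow> c = d"
  using Old_inject tcls_eq_iff[of E "Old c" "Old d"] by auto

lemma composable_free_ext:
  assumes "wft E a" "wft E b" "i \<le> dim (base E)"
  shows "tgt (free_ext E) i (tcls E a) = src (free_ext E) i (tcls E b) \<longleftrightarrow> ttgt E i a = tsrc E i b"
  using assms trm_bounds[OF S At] by (simp add: src_free_ext tgt_free_ext Old_eq_iff)

lemma tcls_Comp_Old:
  assumes "j < dim (base E)" "c \<in> cells (base E)" "d \<in> cells (base E)" "tgt (base E) j c = src (base E) j d"
  shows "tcls E (Comp j (Old c) (Old d)) = tcls E (Old (cmp (base E) j c d))"
  using teq_old[OF assms] assms by (subst tcls_eq_iff) auto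

theorem strict_category_free_ext: "strict_category (free_ext E)"
proof
  interpret strict_category "base E" by (fact S)
  note b = trm_bounds[OF S At]
  note simps = cells_free_ext src_free_ext tgt_free_ext cmp_free_ext Old_eq_iff
  show "src (free_ext E) i x \<in> cells (free_ext E)" if "x \<in> cells (free_ext E)" for x i
  proof -
    obtain a where a: "wft E a" "x = tcls E a" using \<open>x \<in> cells (free_ext E)\<close> by (auto simp: simps)
    with b have "wft E (if i \<le> dim (base E) then Old (tsrc E i a) else a)" by simp
    moreover have "src (free_ext E) i x = tcls E (if i \<le> dim (base E) then Old (tsrc E i a) else a)"
      using a by (simp add: simps)
    ultimately show ?thesis unfolding cells_free_ext by blast
  qed
  show "tgt (free_ext E) i x \<in> cells (free_ext E)" if "x \<in> cells (free_ext E)" for x i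
  proof -
    obtain a where a: "wft E a" "x = tcls E a" using \<open>x \<in> cells (free_ext E)\<close> by (auto simp: simps)
    with b have "wft E (if i \<le> dim (base E) then Old (ttgt E i a) else a)" by simp
    moreover have "tgt (free_ext E) i x = tcls E (if i \<le> dim (base E) then Old (ttgt E i a) else a)"
      using a by (simp add: simps)
    ultimately show ?thesis unfolding cells_free_ext by blast
  qed
  show "src (free_ext E) i x = x" "tgt (free_ext E) i x = x"
    if "x \<in> cells (free_ext E)" "dim (free_ext E) \<le> i" for x i
    using that by (auto simp: simps)
  show "src (free_ext E) i (src (free_ext E) j x) = src (free_ext E) (min i j) x"
    "tgt (free_ext E) i (tgt (free_ext E) j x) = tgt (free_ext E) (min i j) x"
    "src (free_ext E) i (tgt (free_ext E) j x) = (if i < j then src (free_ext E) i x else tgt (free_ext E) j x)"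
    "tgt (free_ext E) i (src (free_ext E) j x) = (if i < j then tgt (free_ext E) i x else src (free_ext E) j x)"
    if "x \<in> cells (free_ext E)" for x i j
  proof -
    obtain a where a: "wft E a" "x = tcls E a" using \<open>x \<in> cells (free_ext E)\<close> by (auto simp: simps)
    have w: "wft E (Old (tsrc E l a))" "wft E (Old (ttgt E l a))" if "l \<le> dim (base E)" for l
      using b[OF a(1) that] by simp_all
    note bj = b[OF a(1), of j]
    show "src (free_ext E) i (src (free_ext E) j x) = src (free_ext E) (min i j) x"
      "tgt (free_ext E) i (tgt (free_ext E) j x) = tgt (free_ext E) (min i j) x"
      "src (free_ext E) i (tgt (free_ext E) j x) = (if i < j then src (free_ext E) i x else tgt (free_ext E) j x)"
      "tgt (free_ext E) i (src (free_ext E) j x) = (if i < j then tgt (free_ext E) i x else src (free_ext E) j x)"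
      using a w bj by (cases "i \<le> dim (base E)"; cases "j \<le> dim (base E)";
          simp add: src_free_ext tgt_free_ext min_def split del: if_split; simp)+
  qed
next
  fix x y i assume "x \<in> cells (free_ext E)" "y \<in> cells (free_ext E)" "i < dim (free_ext E)"
    and c: "tgt (free_ext E) i x = src (free_ext E) i y"
  then obtain a b' where w: "wft E a" "x = tcls E a" "wft E b'" "y = tcls E b'" "i \<le> dim (base E)"
    by (auto simp: cells_free_ext)
  with c have e: "ttgt E i a = tsrc E i b'" by (simp add: composable_free_ext)
  have wc: "wft E (Comp i a b')" using w e by simp
  note bs = trm_bounds[OF S At w(1)] trm_bounds[OF S At w(3)]
  have c1: "tgt (base E) i (tsrc E j a) = src (base E) i (tsrc E j b')"
    "tgt (base E) i (ttgt E j a) = src (base E) i (ttgt E j b')" if "i < j" "j \<le> dim (base E)" for j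
    using bs[OF that(2)] that e by (auto simp: min_def)
  show "cmp (free_ext E) i x y \<in> cells (free_ext E)"
    unfolding cells_free_ext w(2,4) cmp_free_ext using wc by blast
  show "src (free_ext E) j (cmp (free_ext E) i x y) =
    (if j \<le> i then src (free_ext E) j x else cmp (free_ext E) i (src (free_ext E) j x) (src (free_ext E) j y))" for j
    using w wc bs[of j] c1[of j] by (auto simp: src_free_ext cmp_free_ext tcls_Comp_Old)
  show "tgt (free_ext E) j (cmp (free_ext E) i x y) =
    (if j \<le> i then tgt (free_ext E) j y else cmp (free_ext E) i (tgt (free_ext E) j x) (tgt (free_ext E) j y))" for j
    using w wc bs[of j] c1[of j] by (auto simp: tgt_free_ext cmp_free_ext tcls_Comp_Old)
next
  fix x i assume "x \<in> cells (free_ext E)" "i < dim (free_ext E)"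
  then obtain a where w: "wft E a" "x = tcls E a" "i \<le> dim (base E)" by (auto simp: cells_free_ext)
  show "cmp (free_ext E) i (src (free_ext E) i x) x = x"
    using teq_sym[OF teq_unit_left[OF w(1,3)]] tcls_eq_iff[OF w(1)] w
    by (auto simp: src_free_ext cmp_free_ext)
  show "cmp (free_ext E) i x (tgt (free_ext E) i x) = x"
    using teq_sym[OF teq_unit_right[OF w(1,3)]] tcls_eq_iff[OF w(1)] w
    by (auto simp: tgt_free_ext cmp_free_ext)
next
  fix x y z i assume "x \<in> cells (free_ext E)" "y \<in> cells (free_ext E)" "z \<in> cells (free_ext E)"
    "i < dim (free_ext E)" and c: "tgt (free_ext E) i x = src (free_ext E) i y"
    "tgt (free_ext E) i y = src (free_ext E) i z"
  then obtain a b c' where w: "wft E a" "x = tcls E a" "wft E b" "y = tcls E b" "wft E c'" "z = tcls E c'"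
    "i \<le> dim (base E)"
    by (auto simp: cells_free_ext)
  with c have "wft E (Comp i (Comp i a b) c')" by (simp add: composable_free_ext)
  from teq_assoc[OF this] tcls_eq_iff[OF this]
  show "cmp (free_ext E) i (cmp (free_ext E) i x y) z = cmp (free_ext E) i x (cmp (free_ext E) i y z)"
    by (simp add: w cmp_free_ext)
next
  fix x y z w i j assume "x \<in> cells (free_ext E)" "y \<in> cells (free_ext E)" "z \<in> cells (free_ext E)"
    "w \<in> cells (free_ext E)" "i < j" "j < dim (free_ext E)"
    and c: "tgt (free_ext E) j x = src (free_ext E) j y"
    "tgt (free_ext E) j z = src (free_ext E) j w" "tgt (free_ext E) i x = src (free_ext E) i z"
  then obtain a b c' d where w: "wft E a" "x = tcls E a" "wft E b" "y = tcls E b" "wft E c'" "z = tcls E c'"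
    "wft E d" "w = tcls E d" "i < j" "j \<le> dim (base E)"
    by (auto simp: cells_free_ext)
  with c have *: "wft E (Comp j a b)" "wft E (Comp j c' d)" "ttgt E i a = tsrc E i c'"
    by (simp_all add: composable_free_ext)
  from teq_interchange[OF w(9) *]
  have t: "teq E (Comp i (Comp j a b) (Comp j c' d)) (Comp j (Comp i a c') (Comp i b d))" .
  from t teq_sound[OF S At t]
  show "cmp (free_ext E) i (cmp (free_ext E) j x y) (cmp (free_ext E) j z w) =
    cmp (free_ext E) j (cmp (free_ext E) i x z) (cmp (free_ext E) i y w)"
    by (simp add: w cmp_free_ext tcls_eq_iff)
qed

lemma inverse_cells_free_ext:
  assumes "ginv E" "wft E a"
  shows "inverse_cells (free_ext E) (dim (base E)) (tcls E a) (tcls E (Inv a))"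
proof -
  have w: "wft E (Inv a)" using assms by simp
  have "tcls E (Comp (dim (base E)) a (Inv a)) = tcls E (Old (tsrc E (dim (base E)) a))"
    "tcls E (Comp (dim (base E)) (Inv a) a) = tcls E (Old (ttgt E (dim (base E)) a))"
    using assms w by (auto simp: tcls_eq_iff intro: teq_inv_right teq_inv_left)
  with assms w show ?thesis
    by (auto simp: inverse_cells_def cells_free_ext src_free_ext tgt_free_ext cmp_free_ext simp del: wft.simps)
qed

lemma kcells_free_ext:
  assumes "k \<le> dim (base E)"
  shows "kcells (free_ext E) k = old_cell E ` kcells (base E) k"
proof -
  interpret strict_category "base E" by (fact S)
  show ?thesis
  proof (intro equalityI subsetI)
    fix K assume "K \<in> kcells (free_ext E) k"
    then obtain a where a: "wft E a" "K = tcls E a" "tcls E (Old (tsrc E k a)) = tcls E a"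
      using assms by (auto simp: kcells_def cells_free_ext src_free_ext)
    have "tsrc E k a \<in> kcells (base E) k" using trm_bounds[OF S At a(1) assms] by (auto simp: kcells_def)
    then show "K \<in> old_cell E ` kcells (base E) k" using a by (auto simp: old_cell_def)
  next
    fix K assume "K \<in> old_cell E ` kcells (base E) k"
    then obtain c where c: "c \<in> kcells (base E) k" "K = tcls E (Old c)" by (auto simp: old_cell_def)
    then have w: "wft E (Old c)" by (simp add: kcells_def)
    have "K \<in> cells (free_ext E)" unfolding cells_free_ext using c w by blast
    moreover have "src (free_ext E) k K = K"
      unfolding c(2) src_free_ext[OF w] using c(1) assms by (simp add: kcells_def)
    ultimately show "K \<in> kcells (free_ext E) k" by (simp add: kcells_def)
  qed
qed

theorem np_category_free_ext:
  assumes "np_category (dim (base E)) p (base E)" "p \<le> dim (base E) \<longrightarrow> ginv E"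
  shows "np_category (Suc (dim (base E))) p (free_ext E)"
  unfolding np_category_def
proof (intro conjI allI impI ballI strict_category_free_ext dim_free_ext)
  interpret strict_category "base E" by (fact S)
  fix i x assume i: "p \<le> i \<and> i < Suc (dim (base E))" and x: "x \<in> kcells (free_ext E) (Suc i)"
  show "\<exists>y \<in> kcells (free_ext E) (Suc i). inverse_cells (free_ext E) i x y"
  proof (cases "i = dim (base E)")
    case True
    from x obtain a where a: "wft E a" "x = tcls E a" by (auto simp: kcells_def cells_free_ext)
    have g: "ginv E" using i assms(2) True by simp
    then have w: "wft E (Inv a)" using a by simp
    have "tcls E (Inv a) \<in> kcells (free_ext E) (Suc i)"
      unfolding kcells_def using src_free_ext[OF w] w True by (auto simp: cells_free_ext simp del: wft.simps)
    with inverse_cells_free_ext[OF g a(1)] show ?thesis using a True by auto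
  next
    case False
    with i have i': "i < dim (base E)" by simp
    with x obtain c where c: "c \<in> kcells (base E) (Suc i)" "x = old_cell E c"
      using kcells_free_ext[of "Suc i"] by auto
    from assms(1) i i' c(1) obtain d where d: "d \<in> kcells (base E) (Suc i)" "inverse_cells (base E) i c d"
      unfolding np_category_def by blast
    then have "inverse_cells (free_ext E) i (old_cell E c) (old_cell E d)"
      using i' by (auto simp: inverse_cells_def old_cell_def cells_free_ext src_free_ext tgt_free_ext
          cmp_free_ext tcls_Comp_Old intro: exI[of _ "Old _"])
    moreover have "old_cell E d \<in> kcells (free_ext E) (Suc i)"
      using d(1) i' kcells_free_ext[of "Suc i"] by auto
    ultimately show ?thesis using c by auto
  qed
qed

end

lemma inverse_cells_unique:
  assumes "strict_category D" "i < dim D" "inverse_cells D i x y" "inverse_cells D i x z"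
  shows "y = z"
proof -
  interpret strict_category D by fact
  have "y = cmp D i y (cmp D i x z)"
    using assms unit_right[of y i] by (simp add: inverse_cells_def)
  also have "\<dots> = cmp D i (cmp D i y x) z"
    using assms by (intro cmp_assoc[symmetric]) (auto simp: inverse_cells_def)
  also have "\<dots> = z" using assms unit_left[of z i] by (simp add: inverse_cells_def)
  finally show ?thesis .
qed

primrec teval :: "'d ncat \<Rightarrow> nat \<Rightarrow> ('c \<Rightarrow> 'd) \<Rightarrow> ('x \<Rightarrow> 'd) \<Rightarrow> ('x, 'c) trm \<Rightarrow> 'd" where
  "teval D k F g (Old c) = F c"
| "teval D k F g (Gen x) = g x"
| "teval D k F g (Comp j a b) = cmp D j (teval D k F g a) (teval D k F g b)"
| "teval D k F g (Inv a) = (SOME y. inverse_cells D k (teval D k F g a) y)"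

context
  fixes E :: "('x, 'c) ext" and D :: "'d ncat" and F :: "'c \<Rightarrow> 'd" and g :: "'x \<Rightarrow> 'd"
  assumes S: "strict_category (base E)" and At: "attached E"
    and SD: "strict_category D" and dimD: "dim D = Suc (dim (base E))"
    and F: "ncat_functor (base E) D F"
    and g: "\<And>x. x \<in> gset E \<Longrightarrow> g x \<in> cells D \<and>
      src D (dim (base E)) (g x) = F (gsrc E x) \<and> tgt D (dim (base E)) (g x) = F (gtgt E x)"
    and inv_D: "\<And>x. ginv E \<Longrightarrow> x \<in> cells D \<Longrightarrow> \<exists>y. inverse_cells D (dim (base E)) x y"
begin

interpretation D: strict_category D by (fact SD)

abbreviation (input) ev where "ev \<equiv> teval D (dim (base E)) F g"

lemma F_cells: "c \<in> cells (base E) \<Longrightarrow> F c \<in> cells D \<and> F (src (base E) i c) = src D i (F c)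
    \<and> F (tgt (base E) i c) = tgt D i (F c)"
  using F by (auto simp: ncat_functor_def)

lemma F_cmp: "c \<in> cells (base E) \<Longrightarrow> d \<in> cells (base E) \<Longrightarrow> i < dim (base E) \<Longrightarrow>
    tgt (base E) i c = src (base E) i d \<Longrightarrow> F (cmp (base E) i c d) = cmp D i (F c) (F d)"
  using F by (auto simp: ncat_functor_def)

lemma teval_inv: "ginv E \<Longrightarrow> ev a \<in> cells D \<Longrightarrow> inverse_cells D (dim (base E)) (ev a) (ev (Inv a))"
  using someI_ex[OF inv_D[of "ev a"]] by simp

lemma teval_bounds:
  "wft E t \<Longrightarrow> ev t \<in> cells D \<and>
    (\<forall>i \<le> dim (base E). src D i (ev t) = F (tsrc E i t) \<and> tgt D i (ev t) = F (ttgt E i t))"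
proof (induction t)
  case (Old c) then show ?case by (simp add: F_cells)
next
  case (Gen x)
  have p: "gsrc E x \<in> cells (base E)" "gtgt E x \<in> cells (base E)"
    using Gen At by (auto simp: attached_def parallel_cells_def kcells_def)
  note gx = g[of x]
  have 1: "src D i (g x) = src D i (F (gsrc E x))" "tgt D i (g x) = tgt D i (F (gtgt E x))"
    if "i \<le> dim (base E)" for i
  proof -
    have x: "x \<in> gset E" using Gen by simp
    then have "g x \<in> cells D" using gx by blast
    then have "src D i (src D (dim (base E)) (g x)) = src D i (g x)"
      "tgt D i (tgt D (dim (base E)) (g x)) = tgt D i (g x)"
      using that by (simp_all only: D.src_src D.tgt_tgt min.absorb1)
    then show "src D i (g x) = src D i (F (gsrc E x))" "tgt D i (g x) = tgt D i (F (gtgt E x))"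
      using gx[OF x] by simp_all
  qed
  show ?case using gx Gen 1 p by (simp add: F_cells)
next
  case (Comp j a b)
  note ba = trm_bounds[OF S At, of a] trm_bounds[OF S At, of b]
  have w: "j \<le> dim (base E)" "wft E a" "wft E b" "ttgt E j a = tsrc E j b" using Comp.prems by auto
  note IH = Comp.IH(1)[OF w(2)] Comp.IH(2)[OF w(3)]
  have c: "tgt D j (ev a) = src D j (ev b)" using IH w by auto
  have "F (cmp (base E) j (tsrc E i a) (tsrc E i b)) = cmp D j (F (tsrc E i a)) (F (tsrc E i b))"
    "F (cmp (base E) j (ttgt E i a) (ttgt E i b)) = cmp D j (F (ttgt E i a)) (F (ttgt E i b))"
    if "j < i" "i \<le> dim (base E)" for i
    using ba(1)[OF w(2) that(2)] ba(2)[OF w(3) that(2)] w that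
    by (auto intro!: F_cmp simp: min_def)
  then show ?case using IH w c dimD by (simp add: D.cmp_closed D.src_cmp D.tgt_cmp)
next
  case (Inv a)
  then have w: "ginv E" "wft E a" by auto
  note IH = Inv.IH[OF w(2)]
  have i: "inverse_cells D (dim (base E)) (ev a) (ev (Inv a))" using teval_inv[OF w(1)] IH by simp
  let ?k = "dim (base E)"
  let ?y = "ev (Inv a)"
  have y: "?y \<in> cells D" "src D ?k ?y = tgt D ?k (ev a)" "tgt D ?k ?y = src D ?k (ev a)"
    using i by (auto simp: inverse_cells_def)
  have "src D l ?y = src D l (ev a) \<and> tgt D l ?y = tgt D l (ev a)" if l: "l < ?k" for l
  proof -
    have "src D l (src D ?k ?y) = src D l ?y" "tgt D l (tgt D ?k ?y) = tgt D l ?y"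
      using l y(1) by (simp_all only: D.src_src D.tgt_tgt min.absorb3)
    moreover have "ev a \<in> cells D" using IH by simp
    then have "src D l (tgt D ?k (ev a)) = src D l (ev a)" "tgt D l (src D ?k (ev a)) = tgt D l (ev a)"
      using l by (simp_all only: D.src_tgt D.tgt_src if_True)
    ultimately show ?thesis unfolding y(2,3) by metis
  qed
  then show ?case using y IH by (auto simp del: teval.simps)
qed

lemma teval_teq: "teq E a b \<Longrightarrow> ev a = ev b"
proof (induction rule: teq.induct)
  case (teq_old j c d) then show ?case by (simp add: F_cmp)
next
  case (teq_unit_left a j) then show ?case
    using teval_bounds[of a] dimD D.unit_left[of "ev a" j] by simp
next
  case (teq_unit_right a j) then show ?case
    using teval_bounds[of a] dimD D.unit_right[of "ev a" j] by simp
next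
  case (teq_assoc j a b c) then show ?case
    using teval_bounds[of a] teval_bounds[of b] teval_bounds[of c] dimD by (simp add: D.cmp_assoc)
next
  case (teq_interchange i j a b c d) then show ?case
    using teval_bounds[of a] teval_bounds[of b] teval_bounds[of c] teval_bounds[of d] dimD
    by (auto intro!: D.interchange)
next
  case (teq_inv_right a) then show ?case
    using teval_bounds[of a] teval_inv[of a] by (simp add: inverse_cells_def del: teval.simps(4))
next
  case (teq_inv_left a) then show ?case
    using teval_bounds[of a] teval_inv[of a] by (simp add: inverse_cells_def del: teval.simps(4))
qed auto

text \<open>
  Universal property: a functor \<open>F\<close> on the base and images \<open>g\<close> of the generating cells, compatible
  with sources and targets (and with values in a category having the inverses in question),
  extend uniquely to a functor on \<open>free_ext E\<close>.
\<close>

theorem free_ext_universal: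
  "\<exists>H. ncat_functor (free_ext E) D H \<and>
     (\<forall>c \<in> cells (base E). H (old_cell E c) = F c) \<and> (\<forall>x \<in> gset E. H (gen_cell E x) = g x) \<and>
     (\<forall>H'. ncat_functor (free_ext E) D H' \<and>
        (\<forall>c \<in> cells (base E). H' (old_cell E c) = F c) \<and> (\<forall>x \<in> gset E. H' (gen_cell E x) = g x)
        \<longrightarrow> (\<forall>K \<in> cells (free_ext E). H' K = H K))"
proof -
  define H where "H K = ev (SOME a. a \<in> K)" for K
  have H: "H (tcls E a) = ev a" if "wft E a" for a
  proof -
    have "teq E a (SOME b. teq E a b)" by (rule someI[of _ a]) (rule teq_refl[OF that])
    then show ?thesis unfolding H_def tcls_def by (simp add: teval_teq)
  qed
  note simps = cells_free_ext src_free_ext[OF S At] tgt_free_ext[OF S At] cmp_free_ext[OF S At]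
  have 1: "ncat_functor (free_ext E) D H"
    unfolding ncat_functor_def
  proof (intro conjI ballI allI impI)
    fix K i assume "K \<in> cells (free_ext E)"
    then obtain a where a: "wft E a" "K = tcls E a" unfolding cells_free_ext by blast
    note ba = trm_bounds[OF S At a(1), of i] and e = teval_bounds[OF a(1)]
    show "H K \<in> cells D" using a e by (simp add: H)
    show "H (src (free_ext E) i K) = src D i (H K)"
      using a ba e dimD by (simp add: simps H D.src_top)
    show "H (tgt (free_ext E) i K) = tgt D i (H K)"
      using a ba e dimD by (simp add: simps H D.tgt_top)
  next
    fix K L i assume "K \<in> cells (free_ext E)" "L \<in> cells (free_ext E)" "i < dim (free_ext E)"
      and c: "tgt (free_ext E) i K = src (free_ext E) i L"
    then obtain a b where a: "wft E a" "K = tcls E a" "wft E b" "L = tcls E b" "i \<le> dim (base E)"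
      unfolding cells_free_ext dim_free_ext less_Suc_eq_le by blast
    with c have "wft E (Comp i a b)" using composable_free_ext[OF S At a(1,3,5)] by simp
    from H[OF this] show "H (cmp (free_ext E) i K L) = cmp D i (H K) (H L)"
      using a by (simp add: simps H)
  qed
  have 2: "H' (tcls E a) = ev a"
    if H': "ncat_functor (free_ext E) D H'" "\<forall>c \<in> cells (base E). H' (old_cell E c) = F c"
      "\<forall>x \<in> gset E. H' (gen_cell E x) = g x" and "wft E a" for H' a
    using \<open>wft E a\<close>
  proof (induction a)
    case (Comp j a b)
    have "H' (cmp (free_ext E) j (tcls E a) (tcls E b)) = cmp D j (H' (tcls E a)) (H' (tcls E b))"
    proof -
      have w: "wft E a" "wft E b" "j \<le> dim (base E)" "ttgt E j a = tsrc E j b" using Comp.prems by auto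
      have "tcls E a \<in> cells (free_ext E)" "tcls E b \<in> cells (free_ext E)" "j < dim (free_ext E)"
        using w by (auto simp: cells_free_ext)
      moreover have "tgt (free_ext E) j (tcls E a) = src (free_ext E) j (tcls E b)"
        using composable_free_ext[OF S At w(1-3)] w(4) by simp
      ultimately show ?thesis using H'(1) unfolding ncat_functor_def by blast
    qed
    then show ?case using Comp by (simp add: simps)
  next
    case (Inv a)
    have w: "ginv E" "wft E a" using Inv.prems by auto
    have "inverse_cells (free_ext E) (dim (base E)) (tcls E a) (tcls E (Inv a))"
      by (rule inverse_cells_free_ext[OF S At w])
    then have "inverse_cells D (dim (base E)) (H' (tcls E a)) (H' (tcls E (Inv a)))"
      using H'(1) unfolding inverse_cells_def ncat_functor_def dim_free_ext by (metis lessI)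
    moreover have "inverse_cells D (dim (base E)) (ev a) (ev (Inv a))"
      using teval_inv[OF w(1)] teval_bounds[OF w(2)] by simp
    ultimately show ?case
      using Inv.IH[OF w(2)] inverse_cells_unique[OF SD] dimD by (metis lessI)
  qed (use H' in \<open>auto simp: old_cell_def gen_cell_def\<close>)
  have 3: "\<forall>c \<in> cells (base E). H (old_cell E c) = F c" "\<forall>x \<in> gset E. H (gen_cell E x) = g x"
    using H[of "Old _"] H[of "Gen _"] by (auto simp: old_cell_def gen_cell_def)
  have 4: "H' K = H K"
    if "ncat_functor (free_ext E) D H'" "\<forall>c \<in> cells (base E). H' (old_cell E c) = F c"
      "\<forall>x \<in> gset E. H' (gen_cell E x) = g x" and K: "K \<in> cells (free_ext E)" for H' K
  proof -
    obtain a where a: "wft E a" "K = tcls E a" using K unfolding cells_free_ext by blast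
    show ?thesis using 2[OF that(1-3) a(1)] H[OF a(1)] a(2) by simp
  qed
  show ?thesis using 1 3 4 by blast
qed

end

text \<open>Without inverses the number of generating cells is an invariant of cells.\<close>

lemma num_gens_teq:
  assumes "teq E a b" "\<not> ginv E"
  shows "num_gens a = num_gens b"
  using assms by (induction rule: teq.induct) auto


section \<open>\<open>(4,2)\<close>-polygraphs\<close>

type_synonym ('a, 'b) cell1 = "('b, 'a) trm set"
type_synonym ('a, 'b, 'c) cell2 = "('c, ('a, 'b) cell1) trm set"
type_synonym ('a, 'b, 'c, 'd) cell3 = "('d, ('a, 'b, 'c) cell2) trm set"
type_synonym ('a, 'b, 'c, 'd, 'e) cell4 = "('e, ('a, 'b, 'c, 'd) cell3) trm set"

record ('a, 'b, 'c, 'd, 'e) polygraph =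
  gens0 :: "'a set"
  gens1 :: "'b set"
  gens2 :: "'c set"
  gens3 :: "'d set"
  gens4 :: "'e set"
  src0 :: "'b \<Rightarrow> 'a"
  tgt0 :: "'b \<Rightarrow> 'a"
  src1 :: "'c \<Rightarrow> ('a, 'b) cell1"
  tgt1 :: "'c \<Rightarrow> ('a, 'b) cell1"
  src2 :: "'d \<Rightarrow> ('a, 'b, 'c) cell2"
  tgt2 :: "'d \<Rightarrow> ('a, 'b, 'c) cell2"
  src3 :: "'e \<Rightarrow> ('a, 'b, 'c, 'd) cell3"
  tgt3 :: "'e \<Rightarrow> ('a, 'b, 'c, 'd) cell3"

text \<open>In a \<open>0\<close>-category there is no composition; the value given for it below is arbitrary.\<close>

definition free0 :: "('a, 'b, 'c, 'd, 'e) polygraph \<Rightarrow> 'a ncat" where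
  "free0 P = \<lparr> dim = 0, cells = gens0 P, src = (\<lambda>i x. x), tgt = (\<lambda>i x. x), cmp = (\<lambda>i x y. x) \<rparr>"

definition ext1 :: "('a, 'b, 'c, 'd, 'e) polygraph \<Rightarrow> ('b, 'a) ext" where
  "ext1 P = \<lparr> base = free0 P, gset = gens1 P, gsrc = src0 P, gtgt = tgt0 P, ginv = False \<rparr>"

definition free1 :: "('a, 'b, 'c, 'd, 'e) polygraph \<Rightarrow> ('a, 'b) cell1 ncat" where
  "free1 P = free_ext (ext1 P)"

definition ext2 :: "('a, 'b, 'c, 'd, 'e) polygraph \<Rightarrow> ('c, ('a, 'b) cell1) ext" where
  "ext2 P = \<lparr> base = free1 P, gset = gens2 P, gsrc = src1 P, gtgt = tgt1 P, ginv = False \<rparr>"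

definition free2 :: "('a, 'b, 'c, 'd, 'e) polygraph \<Rightarrow> ('a, 'b, 'c) cell2 ncat" where
  "free2 P = free_ext (ext2 P)"

text \<open>Inverses are adjoined from dimension \<open>3\<close> on: \<open>free3\<close> and \<open>free4\<close> are the free
  \<open>(3,2)\<close>- and \<open>(4,2)\<close>-category.\<close>

definition ext3 :: "('a, 'b, 'c, 'd, 'e) polygraph \<Rightarrow> ('d, ('a, 'b, 'c) cell2) ext" where
  "ext3 P = \<lparr> base = free2 P, gset = gens3 P, gsrc = src2 P, gtgt = tgt2 P, ginv = True \<rparr>"

definition free3 :: "('a, 'b, 'c, 'd, 'e) polygraph \<Rightarrow> ('a, 'b, 'c, 'd) cell3 ncat" where
  "free3 P = free_ext (ext3 P)"

definition ext4 :: "('a, 'b, 'c, 'd, 'e) polygraph \<Rightarrow> ('e, ('a, 'b, 'c, 'd) cell3) ext" where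
  "ext4 P = \<lparr> base = free3 P, gset = gens4 P, gsrc = src3 P, gtgt = tgt3 P, ginv = True \<rparr>"

definition free4 :: "('a, 'b, 'c, 'd, 'e) polygraph \<Rightarrow> ('a, 'b, 'c, 'd, 'e) cell4 ncat" where
  "free4 P = free_ext (ext4 P)"

definition polygraph42 :: "('a, 'b, 'c, 'd, 'e) polygraph \<Rightarrow> bool" where
  "polygraph42 P \<longleftrightarrow> attached (ext1 P) \<and> attached (ext2 P) \<and> attached (ext3 P) \<and> attached (ext4 P)"

lemma np_category_free:
  assumes "polygraph42 P"
  shows "np_category 2 2 (free2 P)" "np_category 3 2 (free3 P)" "np_category 4 2 (free4 P)"
proof -
  have 0: "strict_category (free0 P)" by standard (auto simp: free0_def)
  have a: "attached (ext1 P)" "attached (ext2 P)" "attached (ext3 P)" "attached (ext4 P)"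
    using assms by (auto simp: polygraph42_def)
  have s1: "np_category 1 2 (free1 P)"
    using np_category_free_ext[of "ext1 P" 2] 0 a(1) by (simp add: ext1_def free1_def np_category_def free0_def)
  have s2: "np_category 2 2 (free2 P)"
    using np_category_free_ext[of "ext2 P" 2] s1 a(2) by (simp add: ext2_def free2_def np_category_def numeral_2_eq_2)
  have s3: "np_category 3 2 (free3 P)"
    using np_category_free_ext[of "ext3 P" 2] s2 a(3) by (simp add: ext3_def free3_def np_category_def numeral_3_eq_3)
  have s4: "np_category 4 2 (free4 P)"
    using np_category_free_ext[of "ext4 P" 2] s3 a(4) by (simp add: ext4_def free4_def np_category_def eval_nat_numeral)
  show "np_category 2 2 (free2 P)" "np_category 3 2 (free3 P)" "np_category 4 2 (free4 P)"
    by (fact s2 s3 s4)+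
qed

abbreviation up3 :: "('a, 'b, 'c, 'd, 'e) polygraph \<Rightarrow> ('a, 'b, 'c) cell2 \<Rightarrow> ('a, 'b, 'c, 'd) cell3" where
  "up3 P \<equiv> old_cell (ext3 P)"

abbreviation up4 :: "('a, 'b, 'c, 'd, 'e) polygraph \<Rightarrow> ('a, 'b, 'c, 'd) cell3 \<Rightarrow> ('a, 'b, 'c, 'd, 'e) cell4" where
  "up4 P \<equiv> old_cell (ext4 P)"


section \<open>Rewriting in dimension 2\<close>

text \<open>Here \<open>1\<close>-cells are regarded as cells of \<open>free2 P\<close>, that is, \<open>u\<close> ranges over \<open>kcells (free2 P) 1\<close>.\<close>

definition two_cell :: "('a, 'b, 'c, 'd, 'e) polygraph \<Rightarrow>
    ('a, 'b, 'c) cell2 \<Rightarrow> ('a, 'b, 'c) cell2 \<Rightarrow> ('a, 'b, 'c) cell2 \<Rightarrow> bool" where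
  "two_cell P f u v \<longleftrightarrow> f \<in> cells (free2 P) \<and> src (free2 P) 1 f = u \<and> tgt (free2 P) 1 f = v"

definition rew :: "('a, 'b, 'c, 'd, 'e) polygraph \<Rightarrow> ('a, 'b, 'c) cell2 \<Rightarrow> ('a, 'b, 'c) cell2 \<Rightarrow> bool" where
  "rew P u v \<longleftrightarrow> (\<exists>f. two_cell P f u v)"

text \<open>
  Well-foundedness of \<open>rew P\<close> concerns its strict part, here the relation given by the
  \<open>2\<close>-cells that are not identities; thus a non-identity \<open>2\<close>-cell from \<open>u\<close> to \<open>u\<close> contradicts
  termination, and \<open>rew P\<close> is a partial ordering on a terminating polygraph.
\<close>

definition terminating2 :: "('a, 'b, 'c, 'd, 'e) polygraph \<Rightarrow> bool" where
  "terminating2 P \<longleftrightarrow> wfp (\<lambda>v u. \<exists>f. two_cell P f u v \<and> f \<notin> kcells (free2 P) 1)"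

definition normal_form :: "('a, 'b, 'c, 'd, 'e) polygraph \<Rightarrow> ('a, 'b, 'c) cell2 \<Rightarrow> bool" where
  "normal_form P u \<longleftrightarrow> u \<in> kcells (free2 P) 1 \<and> (\<forall>v. rew P u v \<longrightarrow> v = u)"

definition rewriting_step :: "('a, 'b, 'c, 'd, 'e) polygraph \<Rightarrow> ('a, 'b, 'c) cell2 \<Rightarrow> bool" where
  "rewriting_step P f \<longleftrightarrow> f \<in> cells (free2 P) \<and> (\<exists>a \<in> f. num_gens a = 1)"

definition confluent2 :: "('a, 'b, 'c, 'd, 'e) polygraph \<Rightarrow> bool" where
  "confluent2 P \<longleftrightarrow> (\<forall>f \<in> cells (free2 P). \<forall>g \<in> cells (free2 P).
     src (free2 P) 1 f = src (free2 P) 1 g \<longrightarrow>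
     (\<exists>f' \<in> cells (free2 P). \<exists>g' \<in> cells (free2 P).
        tgt (free2 P) 1 f = src (free2 P) 1 f' \<and> tgt (free2 P) 1 g = src (free2 P) 1 g' \<and>
        tgt (free2 P) 1 (cmp (free2 P) 1 f f') = tgt (free2 P) 1 (cmp (free2 P) 1 g g')))"

definition convergent2 :: "('a, 'b, 'c, 'd, 'e) polygraph \<Rightarrow> bool" where
  "convergent2 P \<longleftrightarrow> terminating2 P \<and> confluent2 P"


section \<open>Branchings\<close>

type_synonym ('a, 'b, 'c) branching = "('a, 'b, 'c) cell2 list"

definition perm_class :: "'z list \<Rightarrow> 'z list set" where
  "perm_class xs = {ys. mset ys = mset xs}"

definition local_branching :: "('a, 'b, 'c, 'd, 'e) polygraph \<Rightarrow> ('a, 'b, 'c) branching \<Rightarrow> bool" where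
  "local_branching P fs \<longleftrightarrow> (\<forall>f \<in> set fs. rewriting_step P f) \<and>
     (\<forall>f \<in> set fs. \<forall>g \<in> set fs. src (free2 P) 1 f = src (free2 P) 1 g)"

definition aspherical :: "('a, 'b, 'c) branching \<Rightarrow> bool" where
  "aspherical fs \<longleftrightarrow> (\<exists>gs \<in> perm_class fs. \<exists>i. Suc i < length gs \<and> gs ! i = gs ! Suc i)"

definition strict_peiffer :: "('a, 'b, 'c, 'd, 'e) polygraph \<Rightarrow> ('a, 'b, 'c) branching \<Rightarrow> bool" where
  "strict_peiffer P fs \<longleftrightarrow> local_branching P fs \<and> \<not> aspherical fs \<and>
     (\<exists>v1 \<in> kcells (free2 P) 1. \<exists>v2 \<in> kcells (free2 P) 1. \<exists>m fs'.
        (\<forall>f \<in> set fs. src (free2 P) 1 f = cmp (free2 P) 0 v1 v2) \<and>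
        1 \<le> m \<and> m < length fs \<and> length fs' = length fs \<and> set fs' \<subseteq> cells (free2 P) \<and>
        (\<forall>j < m. fs ! j = cmp (free2 P) 0 (fs' ! j) v2) \<and>
        (\<forall>j. m \<le> j \<and> j < length fs \<longrightarrow> fs ! j = cmp (free2 P) 0 v1 (fs' ! j)))"

definition peiffer :: "('a, 'b, 'c, 'd, 'e) polygraph \<Rightarrow> ('a, 'b, 'c) branching \<Rightarrow> bool" where
  "peiffer P fs \<longleftrightarrow> (\<exists>gs \<in> perm_class fs. strict_peiffer P gs)"

definition overlapping :: "('a, 'b, 'c, 'd, 'e) polygraph \<Rightarrow> ('a, 'b, 'c) branching \<Rightarrow> bool" where
  "overlapping P fs \<longleftrightarrow> local_branching P fs \<and> \<not> aspherical fs \<and> \<not> peiffer P fs"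

definition whisk2 :: "('a, 'b, 'c, 'd, 'e) polygraph \<Rightarrow>
    ('a, 'b, 'c) cell2 \<Rightarrow> ('a, 'b, 'c) cell2 \<Rightarrow> ('a, 'b, 'c) cell2 \<Rightarrow> ('a, 'b, 'c) cell2" where
  "whisk2 P u f v = cmp (free2 P) 0 (cmp (free2 P) 0 u f) v"

definition branching_le :: "('a, 'b, 'c, 'd, 'e) polygraph \<Rightarrow>
    ('a, 'b, 'c) branching \<Rightarrow> ('a, 'b, 'c) branching \<Rightarrow> bool" where
  "branching_le P fs gs \<longleftrightarrow> local_branching P fs \<and> local_branching P gs \<and>
     (\<exists>u \<in> kcells (free2 P) 1. \<exists>v \<in> kcells (free2 P) 1. gs = map (\<lambda>f. whisk2 P u f v) fs)"

definition critical :: "('a, 'b, 'c, 'd, 'e) polygraph \<Rightarrow> ('a, 'b, 'c) branching \<Rightarrow> bool" where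
  "critical P fs \<longleftrightarrow> overlapping P fs \<and> (\<forall>gs. branching_le P gs fs \<longrightarrow> gs = fs)"

definition critical_classes :: "('a, 'b, 'c, 'd, 'e) polygraph \<Rightarrow> nat \<Rightarrow> ('a, 'b, 'c) branching set set" where
  "critical_classes P k = {perm_class fs | fs. length fs = k \<and> critical P fs}"


section \<open>Fillings and the \<open>2\<close>-Squier condition\<close>

definition pair_filling :: "('a, 'b, 'c, 'd, 'e) polygraph \<Rightarrow> ('a, 'b, 'c, 'd) cell3 \<Rightarrow>
    ('a, 'b, 'c) cell2 \<Rightarrow> ('a, 'b, 'c) cell2 \<Rightarrow> bool" where
  "pair_filling P A f g \<longleftrightarrow> local_branching P [f, g] \<and> A \<in> cells (free3 P) \<and>
     (\<exists>f' \<in> cells (free2 P). \<exists>g' \<in> cells (free2 P).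
        src (free3 P) 2 A = up3 P (cmp (free2 P) 1 f f') \<and>
        tgt (free3 P) 2 A = up3 P (cmp (free2 P) 1 g g'))"

text \<open>The bijection is a parameter \<open>\<phi>\<close>, since canonical fillings refer to it.\<close>

definition squier2_by :: "('a, 'b, 'c, 'd, 'e) polygraph \<Rightarrow> ('d \<Rightarrow> ('a, 'b, 'c) branching set) \<Rightarrow> bool" where
  "squier2_by P \<phi> \<longleftrightarrow> convergent2 P \<and> bij_betw \<phi> (gens3 P) (critical_classes P 2) \<and>
     (\<forall>x \<in> gens3 P. \<exists>f g. [f, g] \<in> \<phi> x \<and> pair_filling P (gen_cell (ext3 P) x) f g)"

definition squier2 :: "('a, 'b, 'c, 'd, 'e) polygraph \<Rightarrow> bool" where
  "squier2 P \<longleftrightarrow> (\<exists>\<phi>. squier2_by P \<phi>)"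

text \<open>\<open>canonical_filling P \<phi> f g A\<close>: the canonical filling of \<open>(f, g)\<close> is \<open>A\<close>. In the Peiffer rules
  the outer \<open>1\<close>-cells are the sources of the \<open>2\<close>-cells next to them.\<close>

inductive canonical_filling :: "('a, 'b, 'c, 'd, 'e) polygraph \<Rightarrow> ('d \<Rightarrow> ('a, 'b, 'c) branching set) \<Rightarrow>
    ('a, 'b, 'c) cell2 \<Rightarrow> ('a, 'b, 'c) cell2 \<Rightarrow> ('a, 'b, 'c, 'd) cell3 \<Rightarrow> bool" for P \<phi> where
  aspherical_filling: "rewriting_step P f \<Longrightarrow> canonical_filling P \<phi> f f (up3 P f)"
| peiffer_filling: "\<lbrakk>f' \<in> cells (free2 P); g' \<in> cells (free2 P);
    v1 = src (free2 P) 1 g'; v2 = src (free2 P) 1 f';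
    f = cmp (free2 P) 0 f' v1; g = cmp (free2 P) 0 v2 g'; peiffer P [f, g]\<rbrakk>
    \<Longrightarrow> canonical_filling P \<phi> f g (up3 P (cmp (free2 P) 0 f' g'))"
| peiffer_filling': "\<lbrakk>f' \<in> cells (free2 P); g' \<in> cells (free2 P);
    v1 = src (free2 P) 1 g'; v2 = src (free2 P) 1 f';
    f = cmp (free2 P) 0 v1 f'; g = cmp (free2 P) 0 g' v2; peiffer P [f, g]\<rbrakk>
    \<Longrightarrow> canonical_filling P \<phi> f g (up3 P (cmp (free2 P) 0 g' f'))"
| critical_filling: "\<lbrakk>critical P [f, g]; x \<in> gens3 P; \<phi> x = perm_class [f, g];
    pair_filling P (gen_cell (ext3 P) x) f g\<rbrakk>
    \<Longrightarrow> canonical_filling P \<phi> f g (gen_cell (ext3 P) x)"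
| critical_filling': "\<lbrakk>critical P [f, g]; x \<in> gens3 P; \<phi> x = perm_class [f, g];
    \<not> pair_filling P (gen_cell (ext3 P) x) f g; inverse_cells (free3 P) 2 (gen_cell (ext3 P) x) B\<rbrakk>
    \<Longrightarrow> canonical_filling P \<phi> f g B"
| whisker_filling: "\<lbrakk>canonical_filling P \<phi> f g A; u \<in> kcells (free2 P) 1; v \<in> kcells (free2 P) 1;
    local_branching P [whisk2 P u f v, whisk2 P u g v]\<rbrakk>
    \<Longrightarrow> canonical_filling P \<phi> (whisk2 P u f v) (whisk2 P u g v)
          (cmp (free3 P) 0 (cmp (free3 P) 0 (up3 P u) A) (up3 P v))"

definition triple_filling :: "('a, 'b, 'c, 'd, 'e) polygraph \<Rightarrow> ('d \<Rightarrow> ('a, 'b, 'c) branching set) \<Rightarrow>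
    ('a, 'b, 'c, 'd, 'e) cell4 \<Rightarrow> ('a, 'b, 'c) cell2 \<Rightarrow> ('a, 'b, 'c) cell2 \<Rightarrow> ('a, 'b, 'c) cell2 \<Rightarrow> bool" where
  "triple_filling P \<phi> \<alpha> f g h \<longleftrightarrow> local_branching P [f, g, h] \<and> \<alpha> \<in> cells (free4 P) \<and>
     (\<exists>Afg Agh Afh. canonical_filling P \<phi> f g Afg \<and> canonical_filling P \<phi> g h Agh \<and>
        canonical_filling P \<phi> f h Afh \<and>
        (\<exists>a \<in> cells (free2 P). \<exists>b \<in> cells (free2 P). \<exists>c \<in> cells (free2 P).
         \<exists>A \<in> cells (free3 P). \<exists>B1 \<in> cells (free3 P). \<exists>B2 \<in> cells (free3 P).
          src (free4 P) 3 \<alpha> = up4 P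
            (cmp (free3 P) 2 (cmp (free3 P) 2
               (cmp (free3 P) 1 Afg (up3 P a))
               (cmp (free3 P) 1 (up3 P g) A))
               (cmp (free3 P) 1 Agh (up3 P b))) \<and>
          tgt (free4 P) 3 \<alpha> = up4 P
            (cmp (free3 P) 2 (cmp (free3 P) 2
               (cmp (free3 P) 1 (up3 P f) B1)
               (cmp (free3 P) 1 Afh (up3 P c)))
               (cmp (free3 P) 1 (up3 P h) B2))))"

definition squier2_depth2 :: "('a, 'b, 'c, 'd, 'e) polygraph \<Rightarrow> bool" where
  "squier2_depth2 P \<longleftrightarrow> (\<exists>\<phi>. squier2_by P \<phi> \<and>
     (\<exists>\<psi>. bij_betw \<psi> (gens4 P) (critical_classes P 3) \<and>
        (\<forall>x \<in> gens4 P. \<exists>f g h. [f, g, h] \<in> \<psi> x \<and> triple_filling P \<phi> (gen_cell (ext4 P) x) f g h)))"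

end

theory Submission
  imports Defs
begin

text \<open>
  Identifying \<open>3\<close>-cells connected by a \<open>4\<close>-cell yields a \<open>(3,2)\<close>-category, in which one shows, by
  induction on a \<open>1\<close>-cell \<open>w\<close> along the rewriting order, that any two \<open>2\<close>-cells from \<open>w\<close> to a normal
  form are joined by exactly one \<open>3\<close>-cell. As this is known below \<open>w\<close>, a \<open>3\<close>-cell between \<open>2\<close>-cells
  that start with the steps \<open>f\<close> and \<open>g\<close> amounts to a comparison of \<open>f\<close> with \<open>g\<close>; let \<open>T f g\<close> be the one
  given by the canonical filling. The generating \<open>4\<close>-cells for critical triples, and interchange for
  Peiffer triples, say that \<open>T f g \<bullet> T g h = T f h\<close>. Hence normalizations of the \<open>2\<close>-cells from \<open>w\<close> can be
  compared coherently, and every \<open>3\<close>-cell, being composed of fillings of critical pairs in contexts,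
  respects these comparisons.

  On the side of the free \<open>2\<close>-category this needs that \<open>2\<close>-cells are left cancellative and that two
  steps with which the same \<open>2\<close>-cell can start are equal or disjoint. Both follow from presenting
  \<open>2\<close>-cells as paths of steps at numbered positions, up to exchange of disjoint steps: deleting a step
  from such a path is compatible with exchanges.
\<close>

text \<open>At \<open>w\<close> itself the induction hypothesis is silent. What saves the step is
  that a \<open>2\<close>-cell out of \<open>w\<close> is an identity or begins with a step, and
  everything behind that step lies below \<open>w\<close>, where it is rigid. The only freedom left
  is the family \<open>T f g\<close>, indexed by pairs of steps at \<open>w\<close>, and the
  identity \<open>T f g \<bullet> T g h = T f h\<close> makes it a coboundary: comparisons
  \<open>K f\<close> with the chosen \<open>2\<close>-cell \<open>sg w\<close> can be picked so that
  \<open>K f = T f g \<bullet> K g\<close>. They extend to a comparison \<open>S c\<close> for every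
  \<open>2\<close>-cell \<open>c\<close> from \<open>w\<close>. A \<open>2\<close>-cell does not
  determine its first step, so \<open>S\<close> is well defined only because two different possible
  first steps are disjoint, and there \<open>T\<close> comes from an identity. A
  \<open>3\<close>-cell \<open>X\<close> from \<open>c\<close> to \<open>d\<close>, both ending in
  the normal form, then satisfies \<open>X \<bullet> S d = S c\<close>; as \<open>S d\<close> is
  invertible, \<open>X\<close> is unique. The normal form serves twice: by confluence all
  \<open>2\<close>-cells from \<open>w\<close> can be continued to it, and nothing but an identity
  starts there, so at the end no continuation is left to compare.\<close>

declare One_nat_def [simp del]

section \<open>Words and one-cells\<close>

text \<open>The class of an ill-formed term is empty, so a composite that is a cell comes from a
  well-formed \<open>Comp\<close> term, whose side conditions are the conclusion.\<close>

lemma cmp_free_extD: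
  assumes "strict_category (base E)" "attached E" "K \<in> cells (free_ext E)" "L \<in> cells (free_ext E)"
    and "cmp (free_ext E) i K L \<in> cells (free_ext E)"
  shows "i \<le> dim (base E)" "tgt (free_ext E) i K = src (free_ext E) i L"
proof -
  obtain a b where ab: "wft E a" "K = tcls E a" "wft E b" "L = tcls E b"
    using assms(3,4) by (auto simp: cells_free_ext)
  obtain c where c: "wft E c" "cmp (free_ext E) i K L = tcls E c"
    using assms(5) by (auto simp: cells_free_ext)
  have "c \<in> tcls E (Comp i a b)"
    using c ab by (metis cmp_free_ext[OF assms(1,2)] teq_refl tcls_def mem_Collect_eq)
  then have "wft E (Comp i a b)"
    using teq_sound[OF assms(1,2), of "Comp i a b" c] by (simp add: tcls_def)
  then show "i \<le> dim (base E)" "tgt (free_ext E) i K = src (free_ext E) i L"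
    using ab composable_free_ext[OF assms(1,2), of a b i] by auto
qed

lemma old_cell_cells: "old_cell E c \<in> cells (free_ext E) \<Longrightarrow> strict_category (base E) \<Longrightarrow> attached E \<Longrightarrow> c \<in> cells (base E)"
proof -
  assume a: "old_cell E c \<in> cells (free_ext E)" "strict_category (base E)" "attached E"
  then obtain t where t: "wft E t" "old_cell E c = tcls E t" by (auto simp: cells_free_ext)
  then have "t \<in> tcls E (Old c)" unfolding old_cell_def by (metis teq_refl tcls_def mem_Collect_eq)
  then have "wft E (Old c)" using teq_sound[OF a(2,3), of "Old c" t] by (simp add: tcls_def)
  then show ?thesis by simp
qed

primrec word :: "('x, 'c) trm \<Rightarrow> 'x list" where
  "word (Old c) = []"
| "word (Gen x) = [x]"
| "word (Comp j a b) = word a @ word b"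
| "word (Inv a) = word a"

text \<open>Right-nested composite of the letters. The empty word needs a \<open>0\<close>-cell to
  be the identity of, which is \<open>p\<close>; behind a letter its target takes this role.\<close>

primrec of_word :: "('x, 'c) ext \<Rightarrow> 'c \<Rightarrow> 'x list \<Rightarrow> ('x, 'c) trm" where
  "of_word E p [] = Old p"
| "of_word E p (x # xs) = Comp 0 (Gen x) (of_word E (gtgt E x) xs)"

text \<open>Over a base of dimension \<open>0\<close> only composition along \<open>0\<close>-cells
  exists and the interchange law has no instances, so all remaining laws preserve the sequence of
  generators.\<close>

lemma word_teq:
  assumes "teq E a b" "dim (base E) = 0" "\<not> ginv E"
  shows "word a = word b"
  using assms by (induction rule: teq.induct) auto

lemma word_of_word [simp]: "word (of_word E p xs) = xs"
  by (induction xs arbitrary: p) auto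

locale free_polygraph =
  fixes P :: "('a, 'b, 'c, 'd, 'e) polygraph"
  assumes poly: "polygraph42 P"
begin

lemma free0_simps [simp]:
  "dim (free0 P) = 0" "cells (free0 P) = gens0 P" "src (free0 P) i x = x" "tgt (free0 P) i x = x"
  by (simp_all add: free0_def)

lemma ext_simps [simp]:
  "base (ext1 P) = free0 P" "gset (ext1 P) = gens1 P" "gsrc (ext1 P) = src0 P" "gtgt (ext1 P) = tgt0 P"
  "\<not> ginv (ext1 P)"
  "base (ext2 P) = free1 P" "gset (ext2 P) = gens2 P" "gsrc (ext2 P) = src1 P" "gtgt (ext2 P) = tgt1 P"
  "\<not> ginv (ext2 P)"
  "base (ext3 P) = free2 P" "gset (ext3 P) = gens3 P" "gsrc (ext3 P) = src2 P" "gtgt (ext3 P) = tgt2 P"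
  "ginv (ext3 P)"
  "base (ext4 P) = free3 P" "gset (ext4 P) = gens4 P" "gsrc (ext4 P) = src3 P" "gtgt (ext4 P) = tgt3 P"
  "ginv (ext4 P)"
  by (simp_all add: ext1_def ext2_def ext3_def ext4_def)

lemma dim_simps [simp]: "dim (free1 P) = 1" "dim (free2 P) = 2" "dim (free3 P) = 3" "dim (free4 P) = 4"
  by (simp_all add: free1_def free2_def free3_def free4_def)

lemma att [simp]: "attached (ext1 P)" "attached (ext2 P)" "attached (ext3 P)" "attached (ext4 P)"
  using poly by (auto simp: polygraph42_def)

lemma strict [simp]:
  "strict_category (free0 P)" "strict_category (free1 P)" "strict_category (free2 P)"
  "strict_category (free3 P)" "strict_category (free4 P)"
proof -
  show 0: "strict_category (free0 P)" by standard (auto simp: free0_def)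
  then show "strict_category (free1 P)"
    using strict_category_free_ext[of "ext1 P"] by (simp add: free1_def)
  show "strict_category (free2 P)" "strict_category (free3 P)" "strict_category (free4 P)"
    using np_category_free[OF poly] by (auto simp: np_category_def)
qed

lemma strict_base1: "strict_category (base (ext1 P))" by simp

sublocale c1: strict_category "free1 P" by simp
sublocale c2: strict_category "free2 P" by simp
sublocale c3: strict_category "free3 P" by simp
sublocale c4: strict_category "free4 P" by simp

lemma teq_of_word_append:
  "wft (ext1 P) (Comp 0 (of_word (ext1 P) p xs) (of_word (ext1 P) q ys)) \<Longrightarrow>
   teq (ext1 P) (Comp 0 (of_word (ext1 P) p xs) (of_word (ext1 P) q ys)) (of_word (ext1 P) p (xs @ ys))"
proof (induction xs arbitrary: p)
  case Nil
  then show ?case using teq_unit_left[of "ext1 P" "of_word (ext1 P) q ys" 0]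
    by (cases ys) auto
next
  case (Cons x xs)
  let ?t = "of_word (ext1 P) (tgt0 P x) xs" and ?u = "of_word (ext1 P) q ys"
  have w: "wft (ext1 P) (Comp 0 (Comp 0 (Gen x) ?t) ?u)" using Cons.prems by simp
  then have w': "wft (ext1 P) (Comp 0 ?t ?u)" by simp
  have "wft (ext1 P) (Comp 0 (Gen x) (Comp 0 ?t ?u))" using w by simp
  then have "teq (ext1 P) (Comp 0 (Gen x) (Comp 0 ?t ?u)) (Comp 0 (Gen x) (of_word (ext1 P) (tgt0 P x) (xs @ ys)))"
    using Cons.IH[OF w'] w by (intro teq_comp teq_refl) simp_all
  with teq_assoc[OF w] show ?case by (auto intro: teq_trans)
qed

lemma teq_of_word:
  "wft (ext1 P) t \<Longrightarrow> teq (ext1 P) t (of_word (ext1 P) (tsrc (ext1 P) 0 t) (word t))"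
proof (induction t)
  case (Old c) then show ?case by (simp add: teq_refl)
next
  case (Gen x) then show ?case using teq_sym[OF teq_unit_right[of "ext1 P" "Gen x" 0]] by simp
next
  case (Comp j a b)
  have j: "j = 0" and w: "wft (ext1 P) a" "wft (ext1 P) b" using Comp.prems by auto
  let ?a = "of_word (ext1 P) (tsrc (ext1 P) 0 a) (word a)"
  let ?b = "of_word (ext1 P) (tsrc (ext1 P) 0 b) (word b)"
  have t: "teq (ext1 P) (Comp 0 a b) (Comp 0 ?a ?b)"
    using Comp j w by (intro teq_comp) auto
  then have "wft (ext1 P) (Comp 0 ?a ?b)" using teq_sound[OF _ _ t] by simp
  from teq_trans[OF t teq_of_word_append[OF this]] show ?case using j by simp
next
  case (Inv a) then show ?case by simp
qed

definition word1 :: "('a, 'b) cell1 \<Rightarrow> 'b list" where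
  "word1 k = word (SOME s. s \<in> k)"

lemma word1_tcls: "wft (ext1 P) s \<Longrightarrow> word1 (tcls (ext1 P) s) = word s"
proof -
  assume "wft (ext1 P) s"
  then have "teq (ext1 P) s (SOME t. teq (ext1 P) s t)" by (metis someI_ex teq_refl)
  then show ?thesis unfolding word1_def tcls_def using word_teq[of "ext1 P" s] by simp
qed

lemma cells1E:
  assumes "k \<in> cells (free1 P)"
  obtains s where "wft (ext1 P) s" "k = tcls (ext1 P) s"
  using assms by (auto simp: free1_def cells_free_ext)

lemma word1_cmp:
  assumes "k \<in> cells (free1 P)" "l \<in> cells (free1 P)" "tgt (free1 P) 0 k = src (free1 P) 0 l"
  shows "word1 (cmp (free1 P) 0 k l) = word1 k @ word1 l"
proof -
  obtain s t where s: "wft (ext1 P) s" "k = tcls (ext1 P) s" and t: "wft (ext1 P) t" "l = tcls (ext1 P) t"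
    using assms by (metis cells1E)
  have "wft (ext1 P) (Comp 0 s t)"
    using assms s t composable_free_ext[of "ext1 P" s t 0] by (simp add: free1_def)
  then show ?thesis using s t word1_tcls by (simp add: free1_def cmp_free_ext)
qed

lemma word1_inj:
  assumes "k \<in> cells (free1 P)" "l \<in> cells (free1 P)" "src (free1 P) 0 k = src (free1 P) 0 l" "word1 k = word1 l"
  shows "k = l"
proof -
  obtain s t where s: "wft (ext1 P) s" "k = tcls (ext1 P) s" and t: "wft (ext1 P) t" "l = tcls (ext1 P) t"
    using assms by (metis cells1E)
  have "tsrc (ext1 P) 0 s \<in> gens0 P" using trm_bounds[of "ext1 P" s 0] s by simp
  then have "tsrc (ext1 P) 0 s = tsrc (ext1 P) 0 t"
    using assms(3) s t Old_eq_iff[of "ext1 P" "tsrc (ext1 P) 0 s"] by (simp add: free1_def src_free_ext)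
  then have "teq (ext1 P) s t"
    using teq_of_word[OF s(1)] teq_of_word[OF t(1)] assms(4) s t by (simp add: word1_tcls) (metis teq_sym teq_trans)
  then show ?thesis using s t tcls_eq_iff by blast
qed

lemma word1_src0: "k \<in> cells (free1 P) \<Longrightarrow> word1 (src (free1 P) 0 k) = []"
proof -
  assume "k \<in> cells (free1 P)"
  then obtain s where s: "wft (ext1 P) s" "k = tcls (ext1 P) s" by (metis cells1E)
  have "tsrc (ext1 P) 0 s \<in> gens0 P" using trm_bounds[of "ext1 P" s 0] s by simp
  then show ?thesis using s word1_tcls[of "Old (tsrc (ext1 P) 0 s)"] by (simp add: free1_def src_free_ext)
qed

text \<open>The second premise says that \<open>p\<close> is the actual source. When
  \<open>xs\<close> is empty, this is what makes the identity of \<open>p\<close> composable with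
  the rest.\<close>

lemma of_word_split:
  assumes "wft (ext1 P) (of_word (ext1 P) p (xs @ ys))" "tsrc (ext1 P) 0 (of_word (ext1 P) p (xs @ ys)) = p"
  shows "\<exists>q. wft (ext1 P) (Comp 0 (of_word (ext1 P) p xs) (of_word (ext1 P) q ys))
    \<and> tsrc (ext1 P) 0 (of_word (ext1 P) p xs) = p"
  using assms
proof (induction xs arbitrary: p)
  case Nil
  have "p \<in> gens0 P" using trm_bounds[of "ext1 P" "of_word (ext1 P) p ys" 0] Nil by simp
  with Nil show ?case by (intro exI[of _ p]) simp
next
  case (Cons x xs)
  then have w: "wft (ext1 P) (of_word (ext1 P) (tgt0 P x) (xs @ ys))"
    "tsrc (ext1 P) 0 (of_word (ext1 P) (tgt0 P x) (xs @ ys)) = tgt0 P x" by simp_all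
  from Cons.IH[OF this] Cons.prems show ?case by auto
qed

lemma word1_split:
  assumes "k \<in> cells (free1 P)" "word1 k = xs @ ys"
  obtains l m where "l \<in> cells (free1 P)" "m \<in> cells (free1 P)" "tgt (free1 P) 0 l = src (free1 P) 0 m"
    "k = cmp (free1 P) 0 l m" "word1 l = xs" "word1 m = ys"
proof -
  obtain s where s: "wft (ext1 P) s" "k = tcls (ext1 P) s" using assms(1) by (rule cells1E)
  let ?p = "tsrc (ext1 P) 0 s"
  have ws: "word s = xs @ ys" using assms s by (simp add: word1_tcls)
  have t: "teq (ext1 P) s (of_word (ext1 P) ?p (xs @ ys))" using teq_of_word[OF s(1)] ws by simp
  note sd = teq_sound[OF strict_base1 att(1) t]
  have w: "wft (ext1 P) (of_word (ext1 P) ?p (xs @ ys))" by (rule sd[THEN conjunct2, THEN conjunct1])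
  have w0: "tsrc (ext1 P) 0 (of_word (ext1 P) ?p (xs @ ys)) = ?p"
    by (rule sd[THEN conjunct2, THEN conjunct2, rule_format, THEN conjunct1, symmetric]) (rule le0)
  then obtain q where q: "wft (ext1 P) (Comp 0 (of_word (ext1 P) ?p xs) (of_word (ext1 P) q ys))"
    using of_word_split[OF w w0] by blast
  let ?l = "of_word (ext1 P) ?p xs" and ?m = "of_word (ext1 P) q ys"
  have "k = tcls (ext1 P) (Comp 0 ?l ?m)"
    using teq_trans[OF t teq_sym[OF teq_of_word_append[OF q]]] s tcls_eq_iff by blast
  then have "k = cmp (free1 P) 0 (tcls (ext1 P) ?l) (tcls (ext1 P) ?m)"
    by (simp add: free1_def cmp_free_ext)
  moreover have "tgt (free1 P) 0 (tcls (ext1 P) ?l) = src (free1 P) 0 (tcls (ext1 P) ?m)"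
    using q composable_free_ext[of "ext1 P" ?l ?m 0] by (simp add: free1_def)
  moreover have "tcls (ext1 P) ?l \<in> cells (free1 P)" "tcls (ext1 P) ?m \<in> cells (free1 P)"
    using q by (auto simp: free1_def cells_free_ext)
  moreover have "word1 (tcls (ext1 P) ?l) = xs" "word1 (tcls (ext1 P) ?m) = ys"
    using q by (simp_all add: word1_tcls)
  ultimately show ?thesis using that by blast
qed

end

section \<open>Two-cells\<close>

context strict_category
begin

lemma src_fix_tgt: "x \<in> cells C \<Longrightarrow> src C i x = x \<Longrightarrow> tgt C i x = x"
  using tgt_src[of x i i] by simp

lemma globular:
  assumes "x \<in> cells C" "y \<in> cells C" "i < j" "tgt C j x = src C j y"
  shows "src C i x = src C i y" "tgt C i x = tgt C i y"
proof -
  have "src C i (tgt C j x) = src C i x" "src C i (src C j y) = src C i y"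
    "tgt C i (tgt C j x) = tgt C i x" "tgt C i (src C j y) = tgt C i y"
    using assms(1-3) by (simp_all add: src_src tgt_tgt src_tgt tgt_src)
  then show "src C i x = src C i y" "tgt C i x = tgt C i y" using assms(4) by metis+
qed

text \<open>Interchange, with the \<open>j\<close>-identity \<open>x\<close> read as
  \<open>x\<close> composed with itself along \<open>j\<close>.\<close>

lemma whisker_left_cmp:
  assumes "x \<in> cells C" "y \<in> cells C" "z \<in> cells C" "i < j" "j < dim C"
    and "src C j x = x" "tgt C i x = src C i y" "tgt C j y = src C j z"
  shows "cmp C i x (cmp C j y z) = cmp C j (cmp C i x y) (cmp C i x z)"
  using interchange[of x x y z i j] assms src_fix_tgt[of x j] unit_left[of x j] by simp

lemma whisker_right_cmp:
  assumes "x \<in> cells C" "y \<in> cells C" "z \<in> cells C" "i < j" "j < dim C"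
    and "src C j z = z" "tgt C i x = src C i z" "tgt C j x = src C j y"
  shows "cmp C i (cmp C j x y) z = cmp C j (cmp C i x z) (cmp C i y z)"
  using interchange[of x y z z i j] assms src_fix_tgt[of z j] unit_left[of z j] by simp

text \<open>Interchange after padding \<open>x\<close> and \<open>y\<close> with
  \<open>j\<close>-identities: either of the two may be performed first.\<close>

lemma cmp_exchange:
  assumes "x \<in> cells C" "y \<in> cells C" "i < j" "j < dim C" "tgt C i x = src C i y"
  shows "cmp C j (cmp C i x (src C j y)) (cmp C i (tgt C j x) y) = cmp C i x y"
    and "cmp C j (cmp C i (src C j x) y) (cmp C i x (tgt C j y)) = cmp C i x y"
  using interchange[of x "tgt C j x" "src C j y" y i j] interchange[of "src C j x" x y "tgt C j y" i j] assms
    unit_left[of _ j] unit_right[of _ j] src_closed tgt_closed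
  by (simp_all add: tgt_src src_tgt src_src tgt_tgt)

end

context free_polygraph
begin

abbreviation "cl2 \<equiv> cells (free2 P)"
abbreviation "s0 \<equiv> src (free2 P) 0"
abbreviation "t0 \<equiv> tgt (free2 P) 0"
abbreviation "s1 \<equiv> src (free2 P) 1"
abbreviation "t1 \<equiv> tgt (free2 P) 1"
abbreviation comp0 (infixl "\<cdot>" 72) where "x \<cdot> y \<equiv> cmp (free2 P) 0 x y"
abbreviation comp1 (infixl "\<star>" 68) where "x \<star> y \<equiv> cmp (free2 P) 1 x y"
abbreviation "one u \<equiv> u \<in> kcells (free2 P) 1"

lemma oneD:
  assumes "one u"
  shows "u \<in> cl2" "s1 u = u" "t1 u = u"
  using assms c2.src_fix_tgt[of u 1] by (auto simp: kcells_def)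

lemma oneI: "u \<in> cl2 \<Longrightarrow> s1 u = u \<Longrightarrow> one u" by (simp add: kcells_def)

lemma c2_simps [simp]:
  assumes "c \<in> cl2"
  shows "src (free2 P) i c \<in> cl2" "tgt (free2 P) i c \<in> cl2"
    "s0 (s1 c) = s0 c" "s0 (t1 c) = s0 c" "t0 (s1 c) = t0 c" "t0 (t1 c) = t0 c"
    "s1 (s1 c) = s1 c" "s1 (t1 c) = t1 c" "t1 (s1 c) = s1 c" "t1 (t1 c) = t1 c"
    "s1 (s0 c) = s0 c" "t1 (s0 c) = s0 c" "s1 (t0 c) = t0 c" "t1 (t0 c) = t0 c"
    "s0 (s0 c) = s0 c" "s0 (t0 c) = t0 c" "t0 (s0 c) = s0 c" "t0 (t0 c) = t0 c"
    "s1 c \<star> c = c" "c \<star> t1 c = c" "s0 c \<cdot> c = c" "c \<cdot> t0 c = c"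
  using assms by (simp_all add: c2.src_closed c2.tgt_closed c2.src_src c2.tgt_tgt c2.src_tgt c2.tgt_src c2.unit_left c2.unit_right)

lemma cmp0_simps [simp]:
  assumes "c \<in> cl2" "d \<in> cl2" "t0 c = s0 d"
  shows "c \<cdot> d \<in> cl2" "s0 (c \<cdot> d) = s0 c" "t0 (c \<cdot> d) = t0 d"
    "s1 (c \<cdot> d) = s1 c \<cdot> s1 d" "t1 (c \<cdot> d) = t1 c \<cdot> t1 d"
  using assms by (simp_all add: c2.cmp_closed c2.src_cmp c2.tgt_cmp)

lemma par0:
  assumes "c \<in> cl2" "d \<in> cl2" "t1 c = s1 d"
  shows "s0 d = s0 c" "t0 d = t0 c"
  using c2.globular[of c d 0 1] assms by simp_all

lemma par0':
  assumes "c \<in> cl2" "d \<in> cl2" "s1 c = s1 d"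
  shows "s0 d = s0 c" "t0 d = t0 c"
  using assms by (metis c2_simps(3), metis c2_simps(5))

lemma cmp1_simps [simp]:
  assumes "c \<in> cl2" "d \<in> cl2" "t1 c = s1 d"
  shows "c \<star> d \<in> cl2" "s0 (c \<star> d) = s0 c" "t0 (c \<star> d) = t0 c"
    "s1 (c \<star> d) = s1 c" "t1 (c \<star> d) = t1 d"
  using assms par0[OF assms] by (simp_all add: c2.cmp_closed c2.src_cmp c2.tgt_cmp)

lemma cmp0_assoc: "a \<in> cl2 \<Longrightarrow> b \<in> cl2 \<Longrightarrow> c \<in> cl2 \<Longrightarrow> t0 a = s0 b \<Longrightarrow> t0 b = s0 c \<Longrightarrow> a \<cdot> b \<cdot> c = a \<cdot> (b \<cdot> c)"
  by (simp add: c2.cmp_assoc)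

lemma cmp1_assoc: "a \<in> cl2 \<Longrightarrow> b \<in> cl2 \<Longrightarrow> c \<in> cl2 \<Longrightarrow> t1 a = s1 b \<Longrightarrow> t1 b = s1 c \<Longrightarrow> a \<star> b \<star> c = a \<star> (b \<star> c)"
  by (simp add: c2.cmp_assoc)

lemma whisker_l: "one u \<Longrightarrow> c \<in> cl2 \<Longrightarrow> d \<in> cl2 \<Longrightarrow> t0 u = s0 c \<Longrightarrow> t1 c = s1 d \<Longrightarrow> u \<cdot> (c \<star> d) = (u \<cdot> c) \<star> (u \<cdot> d)"
  using c2.whisker_left_cmp[of u c d 0 1] oneD[of u] by simp

lemma whisker_r: "one u \<Longrightarrow> c \<in> cl2 \<Longrightarrow> d \<in> cl2 \<Longrightarrow> t0 c = s0 u \<Longrightarrow> t1 c = s1 d \<Longrightarrow> (c \<star> d) \<cdot> u = (c \<cdot> u) \<star> (d \<cdot> u)"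
  using c2.whisker_right_cmp[of c d u 0 1] oneD[of u] by simp

lemma exch1 : "c \<in> cl2 \<Longrightarrow> d \<in> cl2 \<Longrightarrow> t0 c = s0 d \<Longrightarrow> (c \<cdot> s1 d) \<star> (t1 c \<cdot> d) = c \<cdot> d"
  and exch2: "c \<in> cl2 \<Longrightarrow> d \<in> cl2 \<Longrightarrow> t0 c = s0 d \<Longrightarrow> (s1 c \<cdot> d) \<star> (c \<cdot> t1 d) = c \<cdot> d"
  using c2.cmp_exchange[of c d 0 1] by simp_all

lemma one_s1 [simp]: "c \<in> cl2 \<Longrightarrow> one (s1 c)" and one_t1 [simp]: "c \<in> cl2 \<Longrightarrow> one (t1 c)"
  by (simp_all add: oneI)

lemma one_cmp0: "one u \<Longrightarrow> one v \<Longrightarrow> t0 u = s0 v \<Longrightarrow> one (u \<cdot> v)"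
  using oneD[of u] oneD[of v] by (intro oneI) simp_all

lemma one_s0: "c \<in> cl2 \<Longrightarrow> one (s0 c)" and one_t0: "c \<in> cl2 \<Longrightarrow> one (t0 c)"
  by (simp_all add: oneI)

lemma cmp2D:
  assumes "c \<in> cl2" "d \<in> cl2" "cmp (free2 P) i c d \<in> cl2"
  shows "i \<le> 1" "tgt (free2 P) i c = src (free2 P) i d"
  using cmp_free_extD[of "ext2 P" c d i] assms by (simp_all add: free2_def)

text \<open>\<open>wd c\<close> is the word of generating \<open>1\<close>-cells spelling the \<open>1\<close>-source of \<open>c\<close>.\<close>

definition wd :: "('a, 'b, 'c) cell2 \<Rightarrow> 'b list" where
  "wd c = word1 (tsrc (ext2 P) 1 (SOME t. t \<in> c))"

abbreviation "len c \<equiv> length (wd c)"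

lemma cells2E:
  assumes "c \<in> cl2"
  obtains t where "wft (ext2 P) t" "c = tcls (ext2 P) t"
  using assms by (auto simp: free2_def cells_free_ext)

lemma wd_tcls: "wft (ext2 P) t \<Longrightarrow> wd (tcls (ext2 P) t) = word1 (tsrc (ext2 P) 1 t)"
proof -
  assume w: "wft (ext2 P) t"
  then have "teq (ext2 P) t (SOME s. teq (ext2 P) t s)" by (metis someI_ex teq_refl)
  from teq_sound[OF _ _ this] show ?thesis by (simp add: wd_def tcls_def)
qed

lemma tcls2 [simp]:
  assumes "wft (ext2 P) t"
  shows "tcls (ext2 P) t \<in> cl2"
    "s1 (tcls (ext2 P) t) = old_cell (ext2 P) (tsrc (ext2 P) 1 t)"
    "t1 (tcls (ext2 P) t) = old_cell (ext2 P) (ttgt (ext2 P) 1 t)"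
    "tsrc (ext2 P) 1 t \<in> cells (free1 P)" "ttgt (ext2 P) 1 t \<in> cells (free1 P)"
    "tsrc (ext2 P) 0 t \<in> cells (free1 P)" "ttgt (ext2 P) 0 t \<in> cells (free1 P)"
    "src (free1 P) 0 (tsrc (ext2 P) 1 t) = tsrc (ext2 P) 0 t"
    "tgt (free1 P) 0 (tsrc (ext2 P) 1 t) = ttgt (ext2 P) 0 t"
    "src (free1 P) 0 (ttgt (ext2 P) 1 t) = tsrc (ext2 P) 0 t"
    "tgt (free1 P) 0 (ttgt (ext2 P) 1 t) = ttgt (ext2 P) 0 t"
  using assms trm_bounds[of "ext2 P" t 1] trm_bounds[of "ext2 P" t 0]
  by (auto simp: free2_def cells_free_ext src_free_ext tgt_free_ext old_cell_def)

lemma wd_old: "k \<in> cells (free1 P) \<Longrightarrow> wd (old_cell (ext2 P) k) = word1 k"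
  unfolding old_cell_def by (subst wd_tcls) (simp_all add: c1.src_top)

lemma wd_s1 [simp]: "c \<in> cl2 \<Longrightarrow> wd (s1 c) = wd c"
  by (elim cells2E) (simp add: wd_tcls wd_old)

lemma wd_cmp0 [simp]: "c \<in> cl2 \<Longrightarrow> d \<in> cl2 \<Longrightarrow> t0 c = s0 d \<Longrightarrow> wd (c \<cdot> d) = wd c @ wd d"
proof (elim cells2E)
  fix s t assume a: "t0 c = s0 d" "wft (ext2 P) s" "c = tcls (ext2 P) s" "wft (ext2 P) t" "d = tcls (ext2 P) t"
  then have w: "wft (ext2 P) (Comp 0 s t)" using composable_free_ext[of "ext2 P" s t 0] by (simp add: free2_def)
  have "wd (c \<cdot> d) = word1 (tsrc (ext2 P) 1 (Comp 0 s t))"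
    using wd_tcls[OF w] a cmp_free_ext[of "ext2 P" 0 s t] by (simp add: free2_def del: wft.simps tsrc.simps)
  also have "\<dots> = wd c @ wd d" using a w by (simp add: wd_tcls word1_cmp)
  finally show ?thesis .
qed

lemma oneE:
  assumes "one u"
  obtains k where "k \<in> cells (free1 P)" "u = old_cell (ext2 P) k"
proof -
  have "u \<in> old_cell (ext2 P) ` kcells (free1 P) 1"
    using assms kcells_free_ext[of "ext2 P" 1] by (simp add: free2_def)
  then show ?thesis using that by (auto simp: kcells_def)
qed

lemma old2 [simp]:
  assumes "k \<in> cells (free1 P)"
  shows "old_cell (ext2 P) k \<in> cl2" "one (old_cell (ext2 P) k)"
    "s0 (old_cell (ext2 P) k) = old_cell (ext2 P) (src (free1 P) 0 k)"
    "t0 (old_cell (ext2 P) k) = old_cell (ext2 P) (tgt (free1 P) 0 k)"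
    "s1 (old_cell (ext2 P) k) = old_cell (ext2 P) k"
proof -
  have w: "wft (ext2 P) (Old k)" using assms by simp
  show "old_cell (ext2 P) k \<in> cl2" "s1 (old_cell (ext2 P) k) = old_cell (ext2 P) k"
    using tcls2[OF w] assms by (auto simp: old_cell_def c1.src_top)
  then show "one (old_cell (ext2 P) k)" by (simp add: oneI)
  show "s0 (old_cell (ext2 P) k) = old_cell (ext2 P) (src (free1 P) 0 k)"
    "t0 (old_cell (ext2 P) k) = old_cell (ext2 P) (tgt (free1 P) 0 k)"
    using src_free_ext[of "ext2 P", OF _ _ w] tgt_free_ext[of "ext2 P", OF _ _ w]
    by (simp_all add: free2_def old_cell_def)
qed

lemma old2_cmp0:
  assumes "k \<in> cells (free1 P)" "l \<in> cells (free1 P)" "tgt (free1 P) 0 k = src (free1 P) 0 l"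
  shows "old_cell (ext2 P) (cmp (free1 P) 0 k l) = old_cell (ext2 P) k \<cdot> old_cell (ext2 P) l"
  using tcls_Comp_Old[of "ext2 P" 0 k l] assms by (simp add: free2_def old_cell_def cmp_free_ext)

lemma old2_inj: "k \<in> cells (free1 P) \<Longrightarrow> old_cell (ext2 P) k = old_cell (ext2 P) l \<Longrightarrow> k = l"
  using Old_eq_iff[of "ext2 P" k l] by (simp add: old_cell_def)

text \<open>The empty word does not determine its \<open>0\<close>-cell, hence the condition on
  \<open>s0\<close>.\<close>

lemma wd_inj: "one u \<Longrightarrow> one v \<Longrightarrow> s0 u = s0 v \<Longrightarrow> wd u = wd v \<Longrightarrow> u = v"
  by (elim oneE) (metis c1.src_closed old2(3) old2_inj wd_old word1_inj)

lemma wd_split: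
  assumes "one u" "wd u = xs @ ys"
  obtains v w where "one v" "one w" "t0 v = s0 w" "u = v \<cdot> w" "wd v = xs" "wd w = ys"
proof -
  obtain k where k: "k \<in> cells (free1 P)" "u = old_cell (ext2 P) k" using assms(1) by (rule oneE)
  then have "word1 k = xs @ ys" using assms by (simp add: wd_old)
  from word1_split[OF k(1) this] obtain l m where lm: "l \<in> cells (free1 P)" "m \<in> cells (free1 P)"
    "tgt (free1 P) 0 l = src (free1 P) 0 m" "k = cmp (free1 P) 0 l m" "word1 l = xs" "word1 m = ys" by blast
  show ?thesis
    by (rule that[of "old_cell (ext2 P) l" "old_cell (ext2 P) m"]) (use lm k in \<open>auto simp: wd_old old2_cmp0\<close>)
qed

lemma wd_s0 [simp]: "c \<in> cl2 \<Longrightarrow> wd (s0 c) = []"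
proof -
  assume c: "c \<in> cl2"
  then obtain k where k: "k \<in> cells (free1 P)" "s1 c = old_cell (ext2 P) k" using oneE one_s1 by metis
  have "s0 c = old_cell (ext2 P) (src (free1 P) 0 k)" using k c c2_simps(3)[of c] old2(3)[of k] by simp
  then show ?thesis using k by (simp add: wd_old word1_src0 c1.src_closed)
qed

lemma wd_Nil: "one u \<Longrightarrow> wd u = [] \<Longrightarrow> s0 u = u"
  using wd_inj[of "s0 u" u] by (simp add: oneD one_s0)

text \<open>Prefixes of equal length of one word coincide, and so do the remainders;
  \<open>wd_inj\<close> turns this back into equality of \<open>1\<close>-cells.\<close>

lemma one_cancel_left:
  assumes "one u" "one v" "one u'" "one v'" "t0 u = s0 v" "t0 u' = s0 v'" "u \<cdot> v = u' \<cdot> v'" "len u = len u'"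
  shows "u = u'" "v = v'"
proof -
  have "wd u @ wd v = wd u' @ wd v'" using assms wd_cmp0[of u v] wd_cmp0[of u' v'] by (simp add: oneD)
  then have w: "wd u = wd u'" "wd v = wd v'" using assms(8) by auto
  have "s0 u = s0 u'" using assms cmp0_simps(2)[of u v] cmp0_simps(2)[of u' v'] by (simp add: oneD)
  then show "u = u'" using w assms wd_inj by blast
  with assms w show "v = v'" using wd_inj by metis
qed

end

section \<open>Paths of rewriting steps\<close>

text \<open>
  The pair \<open>(i, a)\<close> stands for an application of \<open>a\<close> at position \<open>i\<close> of a word; \<open>a\<close> replaces
  \<open>m a\<close> letters by \<open>n a\<close> letters. Paths are considered up to exchange of disjoint steps.
\<close>

inductive swaps :: "('c \<Rightarrow> nat) \<Rightarrow> ('c \<Rightarrow> nat) \<Rightarrow> (nat \<times> 'c) list \<Rightarrow> (nat \<times> 'c) list \<Rightarrow> bool" for m n where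
  swaps_refl [simp, intro!]: "swaps m n p p"
| swaps_sym: "swaps m n p q \<Longrightarrow> swaps m n q p"
| swaps_trans [trans]: "swaps m n p q \<Longrightarrow> swaps m n q r \<Longrightarrow> swaps m n p r"
| swaps_swap: "swaps m n (p @ (i, a) # (i + n a + k, b) # q) (p @ (i + m a + k, b) # (i, a) # q)"

lemma swaps_context: "swaps m n p q \<Longrightarrow> swaps m n (x @ p @ y) (x @ q @ y)"
proof (induction rule: swaps.induct)
  case (swaps_swap p i a k b q)
  then show ?case using swaps.swaps_swap[of m n "x @ p" i a k b "q @ y"] by simp
qed (auto intro: swaps_sym swaps_trans)

lemma swaps_append: "swaps m n p p' \<Longrightarrow> swaps m n q q' \<Longrightarrow> swaps m n (p @ q) (p' @ q')"
  using swaps_context[of m n p p' "[]" q] swaps_context[of m n q q' p' "[]"] by (auto intro: swaps_trans)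

lemma swaps_Cons: "swaps m n p q \<Longrightarrow> swaps m n (x # p) (x # q)"
  using swaps_context[of m n p q "[x]" "[]"] by simp

abbreviation shift :: "nat \<Rightarrow> (nat \<times> 'c) list \<Rightarrow> (nat \<times> 'c) list" where
  "shift k \<equiv> map (\<lambda>(i, a). (k + i, a))"

lemma shift_shift: "shift k (shift l p) = shift (k + l) p" by (auto simp: add.assoc)
lemma swaps_shift: "swaps m n p q \<Longrightarrow> swaps m n (shift l p) (shift l q)"
proof (induction rule: swaps.induct)
  case (swaps_swap p i a k b q)
  then show ?case using swaps.swaps_swap[of m n "shift l p" "l + i" a k b "shift l q"] by (simp add: add.assoc)
qed (auto intro: swaps_sym swaps_trans)

lemma swaps_length: "swaps m n p q \<Longrightarrow> length p = length q"
  by (induction rule: swaps.induct) auto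

lemma swaps_Nil [simp]: "swaps m n [] p \<longleftrightarrow> p = []" "swaps m n p [] \<longleftrightarrow> p = []"
  by (auto dest: swaps_length)

lemma swaps_singleton_aux: "swaps m n p q \<Longrightarrow> length p = 1 \<Longrightarrow> p = q"
proof (induction rule: swaps.induct)
  case (swaps_sym p q) then show ?case using swaps_length[of m n p q] by simp
next
  case (swaps_trans p q r) then show ?case using swaps_length[of m n p q] by simp
qed auto

lemma swaps_singleton [simp]: "swaps m n [x] p \<longleftrightarrow> p = [x]" "swaps m n p [x] \<longleftrightarrow> p = [x]"
  using swaps_singleton_aux[of m n "[x]" p] swaps_singleton_aux[of m n p "[x]"] swaps_length[of m n p "[x]"]
  by (auto simp: One_nat_def)

text \<open>A typing of paths by word lengths alone: the letters are forgotten. This is enough to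
  move one path past another that acts to its right.\<close>

primrec run :: "('c \<Rightarrow> nat) \<Rightarrow> ('c \<Rightarrow> nat) \<Rightarrow> nat \<Rightarrow> (nat \<times> 'c) list \<Rightarrow> nat \<Rightarrow> bool" where
  "run m n k [] l \<longleftrightarrow> k = l"
| "run m n k (x # p) l \<longleftrightarrow> fst x + m (snd x) \<le> k \<and> run m n (k - m (snd x) + n (snd x)) p l"

lemma run_append: "run m n k p l \<Longrightarrow> run m n l q r \<Longrightarrow> run m n k (p @ q) r"
  by (induction p arbitrary: k) auto

lemma run_right: "run m n k p l \<Longrightarrow> run m n (k + r) p (l + r)"
proof (induction p arbitrary: k)
  case (Cons x p)
  have "k + r - m (snd x) + n (snd x) = k - m (snd x) + n (snd x) + r" using Cons.prems by simp
  moreover have "run m n (k - m (snd x) + n (snd x) + r) p (l + r)"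
    using Cons.prems by (intro Cons.IH) (simp only: run.simps)
  ultimately show ?case using Cons.prems by (simp only: run.simps, simp)
qed auto

lemma run_shift: "run m n k p l \<Longrightarrow> run m n (r + k) (shift r p) (r + l)"
proof (induction p arbitrary: k)
  case (Cons x p)
  obtain i a where x: "x = (i, a)" by force
  have e: "r + k - m a + n a = r + (k - m a + n a)" and i: "r + i + m a \<le> r + k" using Cons.prems x by simp_all
  have "run m n (r + (k - m a + n a)) (shift r p) (r + l)"
    using Cons.prems unfolding x by (intro Cons.IH) (simp only: run.simps snd_conv)
  then show ?case using i unfolding x by (simp only: run.simps list.map prod.case fst_conv snd_conv e simp_thms)
qed auto

lemma swaps_past1:
  "i + m a \<le> k \<Longrightarrow> swaps m n ((i, a) # shift (k - m a + n a) q) (shift k q @ [(i, a)])"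
proof (induction q)
  case (Cons x q)
  obtain j b where x: "x = (j, b)" by force
  define r where "r = k - (i + m a) + j"
  have "swaps m n ((i, a) # (i + n a + r, b) # shift (k - m a + n a) q) ((i + m a + r, b) # (i, a) # shift (k - m a + n a) q)"
    using swaps_swap[of m n "[]" i a r b] by simp
  also have "swaps m n \<dots> ((i + m a + r, b) # shift k q @ [(i, a)])"
    using Cons by (intro swaps_Cons) simp
  finally show ?case using Cons.prems x unfolding r_def by (simp add: add.commute add.left_commute)
qed auto

text \<open>The interchange law for paths. \<open>p\<close> acts on the first letters only and
  \<open>q\<close> entirely behind them; the shift of \<open>q\<close> is \<open>l\<close> or
  \<open>k\<close> according to whether \<open>p\<close> has already changed their number.\<close>

lemma swaps_past: "run m n k p l \<Longrightarrow> swaps m n (p @ shift l q) (shift k q @ p)"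
proof (induction p arbitrary: k)
  case (Cons x p)
  obtain i a where x: "x = (i, a)" by force
  have "swaps m n (x # p @ shift l q) (x # shift (k - m a + n a) q @ p)"
    using Cons.prems unfolding x by (intro swaps_Cons Cons.IH) (simp only: run.simps snd_conv)
  also have "swaps m n \<dots> ((shift k q @ [x]) @ p)"
    using swaps_context[of m n _ _ "[]" p, OF swaps_past1[of i m a k n q]] Cons.prems x by simp
  finally show ?case by simp
qed auto

text \<open>What remains of a path after its step \<open>x\<close>, moved to the front, is deleted.\<close>

fun residue :: "('c \<Rightarrow> nat) \<Rightarrow> ('c \<Rightarrow> nat) \<Rightarrow> nat \<times> 'c \<Rightarrow> (nat \<times> 'c) list \<Rightarrow> (nat \<times> 'c) list option" where
  "residue m n x [] = None"
| "residue m n (i, a) ((j, b) # p) =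
    (if i = j \<and> a = b then Some p
     else if i + m a \<le> j then map_option (Cons (j - m a + n a, b)) (residue m n (i, a) p)
     else if j + m b \<le> i then map_option (Cons (j, b)) (residue m n (i - m b + n b, a) p)
     else None)"

lemma residue_swaps: "residue m n x p = Some q \<Longrightarrow> swaps m n p (x # q)"
proof (induction m n x p arbitrary: q rule: residue.induct)
  case (2 m n i a j b p)
  show ?case
  proof (cases "i = j \<and> a = b")
    case True with 2 show ?thesis by simp
  next
    case f: False
    show ?thesis
    proof (cases "i + m a \<le> j")
      case True
      with 2(3) f obtain r where r: "residue m n (i, a) p = Some r" "q = (j - m a + n a, b) # r" by auto
      have "swaps m n ((j, b) # p) ((j, b) # (i, a) # r)" using 2(1)[OF f True r(1)] by (rule swaps_Cons)
      also have "swaps m n \<dots> ((i, a) # (j - m a + n a, b) # r)"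
        using swaps_sym[OF swaps_swap[of m n "[]" i a "j - (i + m a)" b r]] True
        by (simp add: add.commute add.left_commute)
      finally show ?thesis using r by simp
    next
      case False
      with 2(3) f obtain r where r: "residue m n (i - m b + n b, a) p = Some r" "q = (j, b) # r" "j + m b \<le> i"
        by (auto split: if_splits)
      have "swaps m n ((j, b) # p) ((j, b) # (i - m b + n b, a) # r)" using 2(2)[OF f False r(3,1)] by (rule swaps_Cons)
      also have "swaps m n \<dots> ((i, a) # (j, b) # r)"
        using swaps_swap[of m n "[]" j b "i - (j + m b)" a r] r(3)
        by (simp add: add.commute add.left_commute)
      finally show ?thesis using r by simp
    qed
  qed
qed auto

text \<open>In both orders of the two disjoint steps, \<open>(l, c)\<close> has the same relative
  position: it is one of them, lies left of both, between them or right of both, or it overlaps one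
  of them, and then both residues are \<open>None\<close>. Positivity of \<open>m\<close> makes
  these alternatives exclude each other; a step with empty source would be disjoint from
  itself.\<close>

lemma residue_swap:
  assumes m: "\<And>c. m c > 0"
  shows "rel_option (swaps m n) (residue m n (l, c) ((i, a) # (i + n a + k, b) # q))
    (residue m n (l, c) ((i + m a + k, b) # (i, a) # q))"
proof -
  note ma = m[of a] and mb = m[of b] and mc = m[of c]
  have R: "rel_option (swaps m n) z z" for z by (cases z) auto
  have R1: "rel_option (swaps m n) (map_option (Cons x) (map_option (Cons y) z)) (map_option (Cons x') (map_option (Cons y') z))"
    if "\<And>q. swaps m n (x # y # q) (x' # y' # q)" for x y x' y' z
    using that by (cases z) auto
  consider "l = i \<and> c = a" | "l = i + m a + k \<and> c = b" | "l + m c \<le> i" "\<not> (l = i \<and> c = a)" |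
    "i + m a \<le> l" "l + m c \<le> i + m a + k" "\<not> (l = i + m a + k \<and> c = b)"
    | "i + m a + k + m b \<le> l" "\<not> (l = i + m a + k \<and> c = b)" | "\<not> (l = i \<and> c = a)" "\<not> (l = i + m a + k \<and> c = b)" "\<not> l + m c \<le> i"
     "\<not> (i + m a \<le> l \<and> l + m c \<le> i + m a + k)" "\<not> i + m a + k + m b \<le> l" by linarith
  then show ?thesis
  proof cases
    case 1
    then show ?thesis using ma mb by (simp add: add.commute add.left_commute)
  next
    case 2
    then show ?thesis using ma mb by (simp add: add.commute add.left_commute)
  next
    case 3
    have "swaps m n ((i - m c + n c, a) # (i + n a + k - m c + n c, b) # r) ((i + m a + k - m c + n c, b) # (i - m c + n c, a) # r)" for r
      using swaps_swap[of m n "[]" "i - m c + n c" a k b r] 3(1) by (simp add: add.commute add.left_commute)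
    then show ?thesis using 3 ma mb mc by (auto intro!: R1)
  next
    case 4
    have "swaps m n ((i, a) # (i + n a + k - m c + n c, b) # r) ((i + m a + k - m c + n c, b) # (i, a) # r)" for r
      using swaps_swap[of m n "[]" i a "k - m c + n c" b r] 4(1,2) by (simp add: add.commute add.left_commute)
    then show ?thesis using 4 ma mb mc by (auto intro!: R1)
  next
    case 5
    define r where "r = l - (i + m a + k + m b)"
    have l: "l = i + m a + k + m b + r" using 5(1) by (simp add: r_def)
    let ?z = "residue m n (i + n a + k + n b + r, c) q"
    have "residue m n (l, c) ((i, a) # (i + n a + k, b) # q) = map_option (Cons (i, a)) (map_option (Cons (i + n a + k, b)) ?z)"
      using ma mb mc unfolding l by (simp add: add.commute add.left_commute)
    moreover have "residue m n (l, c) ((i + m a + k, b) # (i, a) # q) = map_option (Cons (i + m a + k, b)) (map_option (Cons (i, a)) ?z)"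
      using ma mb mc unfolding l by (simp add: add.commute add.left_commute)
    moreover have "swaps m n ((i, a) # (i + n a + k, b) # r) ((i + m a + k, b) # (i, a) # r)" for r
      using swaps_swap[of m n "[]" i a k b r] by simp
    ultimately show ?thesis by (simp only: R1)
  next
    case 6
    have "residue m n (l, c) ((i, a) # (i + n a + k, b) # q) = None"
    proof (cases "i + m a \<le> l")
      case True
      define r where "r = l - (i + m a)"
      have l: "l = i + m a + r" using True by (simp add: r_def)
      have "\<not> (r = k \<and> c = b)" "\<not> r + m c \<le> k" "\<not> k + m b \<le> r" using 6 unfolding l by auto
      then have "residue m n (l - m a + n a, c) ((i + n a + k, b) # q) = None" unfolding l by simp
      then show ?thesis using 6 True by (simp del: residue.simps add: residue.simps(2)[of m n l c i a])
    next
      case False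
      then show ?thesis using 6 by (simp del: residue.simps add: residue.simps(2)[of m n l c i a])
    qed
    moreover have "residue m n (l, c) ((i + m a + k, b) # (i, a) # q) = None"
    proof (cases "l + m c \<le> i + m a + k")
      case True
      then have "\<not> i + m a \<le> l" using 6 by simp
      then have "residue m n (l, c) ((i, a) # q) = None" using 6 by simp
      then show ?thesis using 6 True by (simp del: residue.simps add: residue.simps(2)[of m n l c "i + m a + k" b])
    next
      case False
      then show ?thesis using 6 by (simp del: residue.simps add: residue.simps(2)[of m n l c "i + m a + k" b])
    qed
    ultimately show ?thesis by simp
  qed
qed

text \<open>Deleting a step from the front is thus an operation on paths up to exchange. Left
  cancellation and the comparison of possible first steps of a \<open>2\<close>-cell both rest on
  this.\<close>

lemma residue_cong:
  assumes m: "\<And>c. m c > 0" and "swaps m n p q"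
  shows "rel_option (swaps m n) (residue m n x p) (residue m n x q)"
  using assms(2)
proof (induction arbitrary: x rule: swaps.induct)
  case (swaps_refl p) then show ?case by (cases "residue m n x p") auto
next
  case (swaps_sym p q)
  have "rel_option (swaps m n)\<inverse>\<inverse> (residue m n x q) (residue m n x p)"
    using swaps_sym.IH by (simp add: option.rel_conversep)
  then show ?case by (rule option.rel_mono_strong) (auto intro: swaps.swaps_sym)
next
  case (swaps_trans p q r)
  have "rel_option (swaps m n OO swaps m n) (residue m n x p) (residue m n x r)"
    using swaps_trans.IH unfolding option.rel_compp by blast
  then show ?case by (rule option.rel_mono_strong) (auto intro: swaps.swaps_trans)
next
  case (swaps_swap p i a k b q)
  show ?case
  proof (induction p arbitrary: x)
    case Nil
    show ?case using residue_swap[where m=m and n=n and l="fst x" and c="snd x" and i=i and a=a and k=k and b=b and q=q, OF m] by simp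
  next
    case (Cons y p)
    have S: "swaps m n (p @ (i, a) # (i + n a + k, b) # q) (p @ (i + m a + k, b) # (i, a) # q)"
      by (rule swaps.swaps_swap)
    have R: "rel_option (swaps m n) (map_option (Cons z) u) (map_option (Cons z) v)"
      if "rel_option (swaps m n) u v" for z u v
      using that by (auto simp: option.rel_map elim!: option.rel_mono_strong intro: swaps_Cons)
    obtain l c j d where xy: "x = (l, c)" "y = (j, d)" by force
    show ?case using Cons.IH S by (auto simp: xy intro!: R)
  qed
qed

section \<open>Two-cells as paths up to exchange\<close>

context free_polygraph
begin

text \<open>Symbols that are not generators get the length \<open>1\<close>, so that all source lengths are positive as
  soon as those of the generators are.\<close>

definition slen :: "'c \<Rightarrow> nat" where
  "slen a = (if a \<in> gens2 P then length (word1 (src1 P a)) else 1)"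

definition tlen :: "'c \<Rightarrow> nat" where
  "tlen a = length (word1 (tgt1 P a))"

abbreviation swp (infix "\<approx>" 50) where "p \<approx> q \<equiv> swaps slen tlen p q"

text \<open>In a composite along \<open>0\<close>-cells the left factor is performed first, so the
  right factor acts behind the target of the left one. There are no inverses in dimension
  \<open>2\<close>, hence the default value for \<open>Inv\<close>.\<close>

primrec path :: "('c, ('a, 'b) cell1) trm \<Rightarrow> (nat \<times> 'c) list" where
  "path (Old k) = []"
| "path (Gen a) = [(0, a)]"
| "path (Comp j s t) = path s @ shift (if j = 0 then length (word1 (ttgt (ext2 P) 1 s)) else 0) (path t)"
| "path (Inv s) = []"

lemma gens2_cells: "a \<in> gens2 P \<Longrightarrow> src1 P a \<in> cells (free1 P) \<and> tgt1 P a \<in> cells (free1 P)"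
  using att(2) by (auto simp: attached_def parallel_cells_def kcells_def)

lemma wft_Comp2D:
  assumes "wft (ext2 P) (Comp j s t)"
  shows "wft (ext2 P) s" "wft (ext2 P) t" "ttgt (ext2 P) j s = tsrc (ext2 P) j t" "j = 0 \<or> j = 1"
  using assms by auto

lemma run_path:
  "wft (ext2 P) t \<Longrightarrow> run slen tlen (length (word1 (tsrc (ext2 P) 1 t))) (path t) (length (word1 (ttgt (ext2 P) 1 t)))"
proof (induction t)
  case (Old k) then show ?case by (simp add: c1.src_top c1.tgt_top)
next
  case (Gen a) then show ?case using gens2_cells[of a] by (simp add: c1.src_top c1.tgt_top slen_def tlen_def)
next
  case (Comp j s t)
  note w = wft_Comp2D[OF Comp.prems]
  note IH = Comp.IH(1)[OF w(1)] Comp.IH(2)[OF w(2)]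
  show ?case
  proof (cases "j = 0")
    case True
    let ?s = "length (word1 (tsrc (ext2 P) 1 s))" and ?s' = "length (word1 (ttgt (ext2 P) 1 s))"
    let ?t = "length (word1 (tsrc (ext2 P) 1 t))" and ?t' = "length (word1 (ttgt (ext2 P) 1 t))"
    have "run slen tlen (?s + ?t) (path s @ shift ?s' (path t)) (?s' + ?t')"
      using IH by (intro run_append[OF run_right run_shift]) auto
    then show ?thesis using w True by (simp add: word1_cmp)
  next
    case False
    then show ?thesis using IH w run_append by (auto intro: run_append)
  qed
qed auto

text \<open>Of all laws of a \<open>2\<close>-category only interchange along \<open>0\<close> and
  \<open>1\<close> reorders steps, and there \<open>swaps_past\<close> applies. In the unit law
  along \<open>0\<close>-cells the shift vanishes because identities of \<open>0\<close>-cells have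
  empty words.\<close>

lemma path_teq: "teq (ext2 P) s t \<Longrightarrow> path s \<approx> path t"
proof (induction rule: teq.induct)
  case (teq_trans a b c) then show ?case using swaps_trans by blast
next
  case (teq_comp a a' b b' j)
  have e: "ttgt (ext2 P) 1 a = ttgt (ext2 P) 1 a'" using teq_sound[OF _ _ teq_comp(1)] by simp
  show ?case unfolding path.simps e by (rule swaps_append[OF teq_comp.IH(1) swaps_shift[OF teq_comp.IH(2)]])
next
  case (teq_unit_left a j)
  have "word1 (tsrc (ext2 P) 0 a) = []" using word1_src0[of "tsrc (ext2 P) 1 a"] teq_unit_left(1) by simp
  then show ?case using teq_unit_left by (simp add: c1.tgt_top)
next
  case (teq_assoc j a b c)
  have w: "wft (ext2 P) a" "wft (ext2 P) b" "ttgt (ext2 P) j a = tsrc (ext2 P) j b" "j = 0 \<or> j = 1"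
    using teq_assoc by auto
  then show ?case by (auto simp: word1_cmp shift_shift add.assoc simp del: map_map)
next
  case (teq_interchange i j a b c d)
  then have ij: "i = 0" "j = 1" by auto
  have w: "wft (ext2 P) b" "ttgt (ext2 P) 1 a = tsrc (ext2 P) 1 b" using teq_interchange ij by auto
  have "path b @ shift (length (word1 (ttgt (ext2 P) 1 b))) (path c) \<approx>
    shift (length (word1 (ttgt (ext2 P) 1 a))) (path c) @ path b"
    using swaps_past[OF run_path[OF w(1)]] w by simp
  from swaps_context[OF this, of "path a" "shift (length (word1 (ttgt (ext2 P) 1 b))) (path d)"]
  show ?case by (simp add: ij)
qed (auto intro: swaps_sym)

lemma length_path: "wft (ext2 P) t \<Longrightarrow> length (path t) = num_gens t"
  by (induction t) auto

text \<open>The path of an arbitrary representative, hence meaningful only up to exchange. For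
  identities and single steps it is exact, since lists of length at most one admit no
  exchange.\<close>

definition pth :: "('a, 'b, 'c) cell2 \<Rightarrow> (nat \<times> 'c) list" where
  "pth c = path (SOME t. t \<in> c)"

lemma pth_tcls: "wft (ext2 P) t \<Longrightarrow> pth (tcls (ext2 P) t) \<approx> path t"
proof -
  assume "wft (ext2 P) t"
  then have "teq (ext2 P) t (SOME s. teq (ext2 P) t s)" by (metis someI_ex teq_refl)
  then show ?thesis unfolding pth_def tcls_def by (simp add: path_teq swaps_sym)
qed

lemma tcls_comp2:
  assumes "wft (ext2 P) s" "wft (ext2 P) t" "i \<le> 1"
    "tgt (free2 P) i (tcls (ext2 P) s) = src (free2 P) i (tcls (ext2 P) t)"
  shows "wft (ext2 P) (Comp i s t)"
    "cmp (free2 P) i (tcls (ext2 P) s) (tcls (ext2 P) t) = tcls (ext2 P) (Comp i s t)"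
  using composable_free_ext[of "ext2 P" s t i] cmp_free_ext[of "ext2 P" i s t] assms by (auto simp: free2_def)

lemma wd_t1_tcls: "wft (ext2 P) t \<Longrightarrow> wd (t1 (tcls (ext2 P) t)) = word1 (ttgt (ext2 P) 1 t)"
  by (simp add: wd_old)

lemma pth_cmp0:
  assumes "c \<in> cl2" "d \<in> cl2" "t0 c = s0 d"
  shows "pth (c \<cdot> d) \<approx> pth c @ shift (len (t1 c)) (pth d)"
proof -
  obtain s t where st: "wft (ext2 P) s" "c = tcls (ext2 P) s" "wft (ext2 P) t" "d = tcls (ext2 P) t"
    using assms by (metis cells2E)
  note k = tcls_comp2[OF st(1,3), of 0]
  have "pth (c \<cdot> d) \<approx> path (Comp 0 s t)" using k pth_tcls[of "Comp 0 s t"] st assms by simp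
  also have "\<dots> \<approx> pth c @ shift (len (t1 c)) (pth d)"
    using st wd_t1_tcls[OF st(1)] swaps_append[OF swaps_sym[OF pth_tcls[OF st(1)]] swaps_shift[OF swaps_sym[OF pth_tcls[OF st(3)]]]]
    by simp
  finally show ?thesis .
qed

lemma pth_cmp1:
  assumes "c \<in> cl2" "d \<in> cl2" "t1 c = s1 d"
  shows "pth (c \<star> d) \<approx> pth c @ pth d"
proof -
  obtain s t where st: "wft (ext2 P) s" "c = tcls (ext2 P) s" "wft (ext2 P) t" "d = tcls (ext2 P) t"
    using assms by (metis cells2E)
  note k = tcls_comp2[OF st(1,3), of 1]
  have "pth (c \<star> d) \<approx> path (Comp 1 s t)" using k pth_tcls[of "Comp 1 s t"] st assms by simp
  also have "\<dots> \<approx> pth c @ pth d"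
    using st swaps_append[OF swaps_sym[OF pth_tcls[OF st(1)]] swaps_sym[OF pth_tcls[OF st(3)]]] by simp
  finally show ?thesis .
qed

lemma pth_one [simp]: "one u \<Longrightarrow> pth u = []"
proof -
  assume "one u"
  then obtain k where k: "k \<in> cells (free1 P)" "u = tcls (ext2 P) (Old k)" by (auto elim: oneE simp: old_cell_def)
  then show ?thesis using pth_tcls[of "Old k"] by simp
qed

abbreviation gen2 :: "'c \<Rightarrow> ('a, 'b, 'c) cell2" where "gen2 \<equiv> gen_cell (ext2 P)"

lemma gen2 [simp]:
  assumes "a \<in> gens2 P"
  shows "gen2 a \<in> cl2" "pth (gen2 a) = [(0, a)]" "len (gen2 a) = slen a" "len (t1 (gen2 a)) = tlen a"
    "len (s1 (gen2 a)) = slen a"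
  using tcls2(1,2)[of "Gen a"] pth_tcls[of "Gen a"] wd_tcls[of "Gen a"] wd_t1_tcls[of "Gen a"] gens2_cells[of a] assms
  by (simp_all add: gen_cell_def slen_def tlen_def c1.src_top c1.tgt_top wd_old)

definition ctx :: "('a, 'b, 'c) cell2 \<Rightarrow> ('a, 'b, 'c) cell2 \<Rightarrow> ('a, 'b, 'c) cell2 \<Rightarrow> bool" where
  "ctx u c v \<longleftrightarrow> one u \<and> one v \<and> c \<in> cl2 \<and> t0 u = s0 c \<and> t0 c = s0 v"

abbreviation whisk where "whisk \<equiv> whisk2 P"

lemma ctxD:
  assumes "ctx u c v"
  shows "one u" "one v" "c \<in> cl2" "t0 u = s0 c" "t0 c = s0 v" "u \<in> cl2" "v \<in> cl2" "s1 u = u" "t1 u = u" "s1 v = v" "t1 v = v"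
  using assms by (auto simp: ctx_def oneD)

lemma whisk_simps [simp]:
  assumes "ctx u c v"
  shows "whisk u c v \<in> cl2" "s0 (whisk u c v) = s0 u" "t0 (whisk u c v) = t0 v"
    "s1 (whisk u c v) = u \<cdot> s1 c \<cdot> v" "t1 (whisk u c v) = u \<cdot> t1 c \<cdot> v" "wd (whisk u c v) = wd u @ wd c @ wd v"
  using ctxD[OF assms] by (simp_all add: whisk2_def)

lemma pth_whisk: "ctx u c v \<Longrightarrow> pth (whisk u c v) \<approx> shift (len u) (pth c)"
proof -
  assume a: "ctx u c v"
  note d = ctxD[OF a]
  have "pth (whisk u c v) \<approx> pth (u \<cdot> c) @ shift (len (t1 (u \<cdot> c))) (pth v)"
    using d pth_cmp0[of "u \<cdot> c" v] by (simp add: whisk2_def)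
  moreover have "pth (u \<cdot> c) \<approx> pth u @ shift (len (t1 u)) (pth c)" using d pth_cmp0[of u c] by simp
  ultimately show ?thesis using d swaps_trans by simp blast
qed

lemma levi:
  assumes o: "one u" "one v" "one u'" "one v'" and e: "t0 u = s0 v" "t0 u' = s0 v'" "u \<cdot> v = u' \<cdot> v'"
    and l: "len u \<le> len u'"
  obtains z where "one z" "t0 u = s0 z" "t0 z = s0 v'" "u' = u \<cdot> z" "v = z \<cdot> v'"
proof -
  note d = oneD[OF o(1)] oneD[OF o(2)] oneD[OF o(3)] oneD[OF o(4)]
  have w: "wd u @ wd v = wd u' @ wd v'" using d e wd_cmp0[of u v] wd_cmp0[of u' v'] by simp
  define xs where "xs = drop (len u) (wd u')"
  have "wd u = take (len u) (wd u')" using w l by (metis append_eq_append_conv_if)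
  then have xs: "wd u' = wd u @ xs" unfolding xs_def by (metis append_take_drop_id)
  with w have "wd v = xs @ wd v'" by simp
  note xs = xs this
  obtain z r where z: "one z" "one r" "t0 z = s0 r" "v = z \<cdot> r" "wd z = xs" "wd r = wd v'"
    using wd_split[OF o(2) xs(2)] by metis
  note d = d oneD[OF z(1)] oneD[OF z(2)]
  have uz: "t0 u = s0 z" using e(1) z d by simp
  have e': "u \<cdot> z \<cdot> r = u' \<cdot> v'" using e(3) z d uz by (simp add: cmp0_assoc)
  have l': "len (u \<cdot> z) = len u'" using d uz xs z by simp
  have t: "t0 (u \<cdot> z) = s0 r" using z d uz by simp
  note eq = one_cancel_left[OF one_cmp0[OF o(1) z(1) uz] z(2) o(3,4) t e(2) e' l']
  show ?thesis by (rule that[OF z(1) uz]) (use z(3,4) eq in simp_all)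
qed

text \<open>A converse of \<open>pth\<close> with explicit contexts: performing the steps of the
  path in order gives the cell. It is a relation because a list of positions need not be applicable
  to a given word.\<close>

inductive spell :: "('a, 'b, 'c) cell2 \<Rightarrow> (nat \<times> 'c) list \<Rightarrow> bool" where
  spell_one: "one u \<Longrightarrow> spell u []"
| spell_step: "\<lbrakk>a \<in> gens2 P; ctx u (gen2 a) v; spell c p; t1 (whisk u (gen2 a) v) = s1 c\<rbrakk>
    \<Longrightarrow> spell (whisk u (gen2 a) v \<star> c) ((len u, a) # p)"

lemma spell_cells: "spell c p \<Longrightarrow> c \<in> cl2"
  by (induction rule: spell.induct) (auto simp: oneD simp del: whisk_simps(4,5))

lemma spell_pth: "spell c p \<Longrightarrow> pth c \<approx> p"
proof (induction rule: spell.induct)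
  case (spell_step a u v c p)
  have "pth (whisk u (gen2 a) v \<star> c) \<approx> pth (whisk u (gen2 a) v) @ pth c"
    using pth_cmp1 spell_step spell_cells by simp
  moreover have "pth (whisk u (gen2 a) v) \<approx> [(len u, a)]" using pth_whisk[OF spell_step(2)] spell_step(1) by simp
  ultimately show ?case using swaps_append[OF _ spell_step.IH, of "pth (whisk u (gen2 a) v)" "[(len u, a)]"] swaps_trans by simp blast
qed auto

text \<open>The \<open>1\<close>-source and the position of the first step determine its context, by
  cancellation of words; then the same holds for the rest of the path.\<close>

lemma spell_unique: "spell c p \<Longrightarrow> spell d p \<Longrightarrow> s1 c = s1 d \<Longrightarrow> c = d"
proof (induction arbitrary: d rule: spell.induct)
  case (spell_one u)
  then have "one d" by (auto elim: spell.cases)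
  then show ?case using spell_one by (simp add: oneD)
next
  case (spell_step a u v c p)
  from spell_step.prems(1) obtain u' v' c' where x: "d = whisk u' (gen2 a) v' \<star> c'" "len u' = len u" "ctx u' (gen2 a) v'"
    "spell c' p" "t1 (whisk u' (gen2 a) v') = s1 c'" by (auto elim: spell.cases)
  note cc = spell_cells[OF spell_step(3)] spell_cells[OF x(4)]
  have e: "u \<cdot> s1 (gen2 a) \<cdot> v = u' \<cdot> s1 (gen2 a) \<cdot> v'" using spell_step.prems(2) spell_step x cc by simp
  note d = ctxD[OF spell_step(2)] ctxD[OF x(3)]
  have "u \<cdot> (s1 (gen2 a) \<cdot> v) = u' \<cdot> (s1 (gen2 a) \<cdot> v')" using e d by (simp add: cmp0_assoc)
  note cl = one_cancel_left[OF _ _ _ _ _ _ this]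
  have pr: "one (s1 (gen2 a) \<cdot> v)" "one (s1 (gen2 a) \<cdot> v')" "t0 u = s0 (s1 (gen2 a) \<cdot> v)" "t0 u' = s0 (s1 (gen2 a) \<cdot> v')"
    using d by (simp_all add: one_cmp0)
  note uv = cl[OF d(1) pr(1) d(12) pr(2-4) x(2)[symmetric]]
  have "v = v'" by (rule one_cancel_left(2)[OF _ _ _ _ _ _ uv(2)]) (use d in simp_all)
  have "c = c'" by (rule spell_step.IH[OF x(4)]) (use spell_step(4) x(5) uv(1) \<open>v = v'\<close> in metis)
  then show ?case using uv(1) \<open>v = v'\<close> x(1) by simp
qed

lemma spell_whisk: "a \<in> gens2 P \<Longrightarrow> ctx u (gen2 a) v \<Longrightarrow> spell (whisk u (gen2 a) v) [(len u, a)]"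
  using spell_step[of a u v "t1 (whisk u (gen2 a) v)" "[]"] spell_one[of "t1 (whisk u (gen2 a) v)"]
  by (simp del: whisk_simps(5))

lemma spell_cmp1: "spell c p \<Longrightarrow> spell d q \<Longrightarrow> t1 c = s1 d \<Longrightarrow> spell (c \<star> d) (p @ q)"
proof (induction rule: spell.induct)
  case (spell_one u) then show ?case using spell_cells[of d q] by (simp add: oneD)
next
  case (spell_step a u v c p)
  note cc = spell_cells[OF spell_step(3)] spell_cells[OF spell_step.prems(1)]
  have "spell (whisk u (gen2 a) v \<star> (c \<star> d)) ((len u, a) # (p @ q))"
    using spell_step cc by (intro spell.spell_step) (auto simp del: whisk_simps(5))
  moreover have "whisk u (gen2 a) v \<star> (c \<star> d) = whisk u (gen2 a) v \<star> c \<star> d"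
    using spell_step cc by (subst cmp1_assoc) (auto simp del: whisk_simps(5))
  ultimately show ?case by simp
qed

lemma spell_right: "spell c p \<Longrightarrow> one w \<Longrightarrow> t0 c = s0 w \<Longrightarrow> spell (c \<cdot> w) p"
proof (induction rule: spell.induct)
  case (spell_one u) then show ?case by (simp add: one_cmp0 spell.spell_one)
next
  case (spell_step a u v c p)
  note cc = spell_cells[OF spell_step(3)] ctxD[OF spell_step(2)] oneD[OF spell_step.prems(1)]
  let ?f = "whisk u (gen2 a) v"
  have f: "?f \<in> cl2" "t0 ?f = s0 w" "t0 c = s0 w" "t0 v = s0 w"
    using spell_step par0[of ?f c] cc by (simp_all del: whisk_simps(4,5))
  have k: "ctx u (gen2 a) (v \<cdot> w)" using spell_step(2) spell_step.prems(1) f cc by (simp add: ctx_def one_cmp0)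
  have e: "?f \<cdot> w = whisk u (gen2 a) (v \<cdot> w)" using f cc by (simp add: whisk2_def cmp0_assoc)
  have "(?f \<star> c) \<cdot> w = (?f \<cdot> w) \<star> (c \<cdot> w)"
    using spell_step f cc by (intro whisker_r) (simp_all del: whisk_simps(4,5))
  moreover have "spell (whisk u (gen2 a) (v \<cdot> w) \<star> (c \<cdot> w)) ((len u, a) # p)"
    unfolding e[symmetric]
    using spell.spell_step[OF spell_step(1) k, of "c \<cdot> w" p] spell_step f cc unfolding e[symmetric]
    by (simp del: whisk_simps(4,5))
  ultimately show ?case using e by simp
qed

lemma spell_left: "spell c p \<Longrightarrow> one w \<Longrightarrow> t0 w = s0 c \<Longrightarrow> spell (w \<cdot> c) (shift (len w) p)"
proof (induction rule: spell.induct)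
  case (spell_one u) then show ?case by (simp add: one_cmp0 spell.spell_one)
next
  case (spell_step a u v c p)
  note cc = spell_cells[OF spell_step(3)] ctxD[OF spell_step(2)] oneD[OF spell_step.prems(1)]
  let ?f = "whisk u (gen2 a) v"
  have f: "?f \<in> cl2" "t0 w = s0 ?f" "t0 w = s0 c" "t0 w = s0 u"
    using spell_step par0[of ?f c] cc by (simp_all del: whisk_simps(4,5))
  have k: "ctx (w \<cdot> u) (gen2 a) v" using spell_step(2) spell_step.prems(1) f cc by (simp add: ctx_def one_cmp0)
  have e: "w \<cdot> ?f = whisk (w \<cdot> u) (gen2 a) v" using f cc by (simp add: whisk2_def cmp0_assoc)
  have "w \<cdot> (?f \<star> c) = (w \<cdot> ?f) \<star> (w \<cdot> c)"
    using spell_step f cc by (intro whisker_l) (simp_all del: whisk_simps(4,5))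
  moreover have "spell (w \<cdot> ?f \<star> (w \<cdot> c)) ((len w + len u, a) # shift (len w) p)"
    using spell.spell_step[OF spell_step(1) k, of "w \<cdot> c" "shift (len w) p"] spell_step f cc unfolding e[symmetric]
    by (simp del: whisk_simps(4,5))
  ultimately show ?case by simp
qed

lemma spell_gen: "a \<in> gens2 P \<Longrightarrow> spell (gen2 a) [(0, a)]"
proof -
  assume a: "a \<in> gens2 P"
  then have "ctx (s0 (gen2 a)) (gen2 a) (t0 (gen2 a))" by (simp add: ctx_def one_s0 one_t0)
  from spell_whisk[OF a this] show ?thesis using a by (simp add: whisk2_def)
qed

lemma spell_cmp0:
  assumes "spell c p" "spell d q" "t0 c = s0 d"
  shows "spell (c \<cdot> d) (p @ shift (len (t1 c)) q)"
proof -
  note cc = spell_cells[OF assms(1)] spell_cells[OF assms(2)]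
  have "spell ((c \<cdot> s1 d) \<star> (t1 c \<cdot> d)) (p @ shift (len (t1 c)) q)"
    using assms cc by (intro spell_cmp1 spell_right spell_left) simp_all
  then show ?thesis using exch1[of c d] assms cc by simp
qed

lemma spell_ex: "c \<in> cl2 \<Longrightarrow> \<exists>p. spell c p"
proof -
  have "\<exists>p. spell (tcls (ext2 P) t) p" if "wft (ext2 P) t" for t
    using that
  proof (induction t)
    case (Old k) then show ?case using spell_one old2(2)[of k] by (auto simp: old_cell_def)
  next
    case (Gen a) then show ?case using spell_gen[of a] by (auto simp: gen_cell_def)
  next
    case (Comp j s t)
    note w = wft_Comp2D[OF Comp.prems]
    obtain p q where pq: "spell (tcls (ext2 P) s) p" "spell (tcls (ext2 P) t) q" using Comp.IH w by blast
    have c: "tgt (free2 P) j (tcls (ext2 P) s) = src (free2 P) j (tcls (ext2 P) t)"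
      using composable_free_ext[of "ext2 P" s t j] w by (auto simp: free2_def)
    have e: "tcls (ext2 P) (Comp j s t) = cmp (free2 P) j (tcls (ext2 P) s) (tcls (ext2 P) t)"
      by (simp add: cmp_free_ext free2_def)
    from w(4) show ?case
    proof
      assume "j = 0" then show ?thesis using spell_cmp0[OF pq] c unfolding e by auto
    next
      assume "j = 1" then show ?thesis using spell_cmp1[OF pq] c unfolding e by auto
    qed
  qed auto
  then show "c \<in> cl2 \<Longrightarrow> \<exists>p. spell c p" by (metis cells2E)
qed

lemma spell_appendD:
  "spell c (p @ q) \<Longrightarrow> \<exists>d e. spell d p \<and> spell e q \<and> t1 d = s1 e \<and> c = d \<star> e"
proof (induction p arbitrary: c)
  case Nil
  then show ?case using spell_cells[of c q] spell_one[of "s1 c"] by (intro exI[of _ "s1 c"] exI[of _ c]) simp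
next
  case (Cons x p)
  from Cons.prems obtain u a v c' where x: "x = (len u, a)" "c = whisk u (gen2 a) v \<star> c'" "a \<in> gens2 P" "ctx u (gen2 a) v"
    "spell c' (p @ q)" "t1 (whisk u (gen2 a) v) = s1 c'" by (auto elim: spell.cases)
  from Cons.IH[OF x(5)] obtain d e where de: "spell d p" "spell e q" "t1 d = s1 e" "c' = d \<star> e" by blast
  note cc = spell_cells[OF de(1)] spell_cells[OF de(2)]
  have "spell (whisk u (gen2 a) v \<star> d) (x # p)" using x de cc by (auto intro: spell_step simp del: whisk_simps(5))
  moreover have "c = whisk u (gen2 a) v \<star> d \<star> e" using x de cc by (simp add: cmp1_assoc del: whisk_simps(5))
  ultimately show ?case using x de cc by (intro exI[of _ "whisk u (gen2 a) v \<star> d"] exI[of _ e]) (simp del: whisk_simps(5))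
qed

lemma square_whisk:
  assumes "ctx u x z" "ctx z y v"
  shows "u \<cdot> x \<cdot> s1 (z \<cdot> y \<cdot> v) = whisk u x (z \<cdot> s1 y \<cdot> v)" "u \<cdot> x \<cdot> t1 (z \<cdot> y \<cdot> v) = whisk u x (z \<cdot> t1 y \<cdot> v)"
    "s1 (u \<cdot> x) \<cdot> (z \<cdot> y \<cdot> v) = whisk (u \<cdot> s1 x \<cdot> z) y v" "t1 (u \<cdot> x) \<cdot> (z \<cdot> y \<cdot> v) = whisk (u \<cdot> t1 x \<cdot> z) y v"
    "ctx u x (z \<cdot> s1 y \<cdot> v)" "ctx u x (z \<cdot> t1 y \<cdot> v)" "ctx (u \<cdot> s1 x \<cdot> z) y v" "ctx (u \<cdot> t1 x \<cdot> z) y v"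
  using ctxD[OF assms(1)] ctxD[OF assms(2)]
  by (simp_all add: whisk2_def cmp0_assoc ctx_def one_cmp0)

lemma square_commute:
  assumes "ctx u x z" "ctx z y v"
  shows "whisk u x (z \<cdot> s1 y \<cdot> v) \<star> whisk (u \<cdot> t1 x \<cdot> z) y v = whisk (u \<cdot> s1 x \<cdot> z) y v \<star> whisk u x (z \<cdot> t1 y \<cdot> v)"
  using exch1[of "u \<cdot> x" "z \<cdot> y \<cdot> v"] exch2[of "u \<cdot> x" "z \<cdot> y \<cdot> v"] ctxD[OF assms(1)] ctxD[OF assms(2)]
  by (simp add: square_whisk(1-4)[OF assms, symmetric])

text \<open>Positions only say that the two steps are disjoint. \<open>levi\<close> recovers the
  \<open>1\<close>-cell between them, after which the exchange is the commuting square of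
  \<open>square_commute\<close>.\<close>

lemma spell_swap_head:
  "spell c ((i, a) # (i + tlen a + k, b) # q) \<longleftrightarrow> spell c ((i + slen a + k, b) # (i, a) # q)" (is "?L \<longleftrightarrow> ?R")
proof
  assume ?L
  then obtain u v u' v' e where x: "i = len u" "len u' = i + tlen a + k" "a \<in> gens2 P" "b \<in> gens2 P"
    "c = whisk u (gen2 a) v \<star> (whisk u' (gen2 b) v' \<star> e)" "ctx u (gen2 a) v" "ctx u' (gen2 b) v'" "spell e q"
    "t1 (whisk u (gen2 a) v) = s1 (whisk u' (gen2 b) v' \<star> e)" "t1 (whisk u' (gen2 b) v') = s1 e"
    by (auto elim!: spell.cases[of _ "_ # _"])
  note d = ctxD[OF x(6)] ctxD[OF x(7)] spell_cells[OF x(8)]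
  have "u \<cdot> t1 (gen2 a) \<cdot> v = u' \<cdot> (s1 (gen2 b) \<cdot> v')" using x d by (simp add: cmp0_assoc)
  note lv = levi[OF _ _ _ _ _ _ this]
  have "one (u \<cdot> t1 (gen2 a))" "one (s1 (gen2 b) \<cdot> v')" "t0 (u \<cdot> t1 (gen2 a)) = s0 v" "t0 u' = s0 (s1 (gen2 b) \<cdot> v')"
    "len (u \<cdot> t1 (gen2 a)) \<le> len u'"
    using d x(1-4) by (simp_all add: one_cmp0)
  \<comment> \<open>\<open>z\<close> is the stretch of \<open>k\<close> letters between the target
    of \<open>a\<close> and the source of \<open>b\<close>.\<close>
  then obtain z where z: "one z" "t0 (u \<cdot> t1 (gen2 a)) = s0 z" "t0 z = s0 (s1 (gen2 b) \<cdot> v')" "u' = u \<cdot> t1 (gen2 a) \<cdot> z"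
    "v = z \<cdot> (s1 (gen2 b) \<cdot> v')"
    using lv[OF _ d(2) d(12)] by blast
  have k: "ctx u (gen2 a) z" "ctx z (gen2 b) v'" using z d x by (simp_all add: ctx_def)
  note dz = oneD[OF z(1)] ctxD[OF k(1)] ctxD[OF k(2)]
  have v: "v = z \<cdot> s1 (gen2 b) \<cdot> v'" using z dz by (simp add: cmp0_assoc)
  note sq = square_whisk[OF k]
  have lz: "len (u \<cdot> s1 (gen2 a) \<cdot> z) = i + slen a + k" using x z dz by simp
  let ?g = "whisk (u \<cdot> s1 (gen2 a) \<cdot> z) (gen2 b) v'" and ?f = "whisk u (gen2 a) (z \<cdot> t1 (gen2 b) \<cdot> v')"
  have te: "t1 ?f = s1 e" using x(10) sq dz z(4) by (simp add: cmp0_assoc)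
  have tg: "t1 ?g = s1 ?f" using sq dz by (simp add: cmp0_assoc)
  have ec: "e \<in> cl2" using d by simp
  have f: "?f \<in> cl2" "?g \<in> cl2" using sq by simp_all
  have sf: "spell (?f \<star> e) ((len u, a) # q)" by (rule spell_step[OF x(3) sq(6) x(8) te])
  have "t1 ?g = s1 (?f \<star> e)" using tg te ec f by (simp only: cmp1_simps)
  from spell_step[OF x(4) sq(7) sf this]
  have "spell (?g \<star> (?f \<star> e)) ((i + slen a + k, b) # (i, a) # q)" unfolding lz x(1) .
  moreover have "?g \<star> (?f \<star> e) = c"
  proof -
    have "?g \<star> (?f \<star> e) = ?g \<star> ?f \<star> e" using sq te tg d by (subst cmp1_assoc) (simp_all del: whisk_simps(4,5))
    also have "\<dots> = whisk u (gen2 a) v \<star> whisk u' (gen2 b) v' \<star> e" using square_commute[OF k] v z(4) by simp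
    also have "\<dots> = c" using x d by (subst cmp1_assoc) (simp_all del: whisk_simps(4,5))
    finally show ?thesis .
  qed
  ultimately show ?R by simp
next
  assume ?R
  then obtain u v u' v' e where x: "i = len u" "len u' = i + slen a + k" "a \<in> gens2 P" "b \<in> gens2 P"
    "c = whisk u' (gen2 b) v' \<star> (whisk u (gen2 a) v \<star> e)" "ctx u (gen2 a) v" "ctx u' (gen2 b) v'" "spell e q"
    "t1 (whisk u' (gen2 b) v') = s1 (whisk u (gen2 a) v \<star> e)" "t1 (whisk u (gen2 a) v) = s1 e"
    by (auto elim!: spell.cases[of _ "_ # _"])
  note d = ctxD[OF x(6)] ctxD[OF x(7)] spell_cells[OF x(8)]
  have "u \<cdot> s1 (gen2 a) \<cdot> v = u' \<cdot> (t1 (gen2 b) \<cdot> v')" using x d by (simp add: cmp0_assoc)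
  note lv = levi[OF _ _ _ _ _ _ this]
  have "one (u \<cdot> s1 (gen2 a))" "one (t1 (gen2 b) \<cdot> v')" "t0 (u \<cdot> s1 (gen2 a)) = s0 v" "t0 u' = s0 (t1 (gen2 b) \<cdot> v')"
    "len (u \<cdot> s1 (gen2 a)) \<le> len u'"
    using d x(1-4) by (simp_all add: one_cmp0)
  then obtain z where z: "one z" "t0 (u \<cdot> s1 (gen2 a)) = s0 z" "t0 z = s0 (t1 (gen2 b) \<cdot> v')" "u' = u \<cdot> s1 (gen2 a) \<cdot> z"
    "v = z \<cdot> (t1 (gen2 b) \<cdot> v')"
    using lv[OF _ d(2) d(12)] by blast
  have k: "ctx u (gen2 a) z" "ctx z (gen2 b) v'" using z d x by (simp_all add: ctx_def)
  note dz = oneD[OF z(1)] ctxD[OF k(1)] ctxD[OF k(2)]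
  have v: "v = z \<cdot> t1 (gen2 b) \<cdot> v'" using z dz by (simp add: cmp0_assoc)
  note sq = square_whisk[OF k]
  have lz: "len (u \<cdot> t1 (gen2 a) \<cdot> z) = i + tlen a + k" using x z dz by simp
  let ?g = "whisk (u \<cdot> t1 (gen2 a) \<cdot> z) (gen2 b) v'" and ?f = "whisk u (gen2 a) (z \<cdot> s1 (gen2 b) \<cdot> v')"
  have te: "t1 ?g = s1 e" using x(10) sq dz v by (simp add: cmp0_assoc)
  have tg: "t1 ?f = s1 ?g" using sq dz by (simp add: cmp0_assoc)
  have ec: "e \<in> cl2" using d by simp
  have f: "?f \<in> cl2" "?g \<in> cl2" using sq by simp_all
  have sg: "spell (?g \<star> e) ((i + tlen a + k, b) # q)"
    using spell_step[OF x(4) sq(8) x(8) te] unfolding lz .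
  have "t1 ?f = s1 (?g \<star> e)" using tg te ec f by (simp only: cmp1_simps)
  from spell_step[OF x(3) sq(5) sg this]
  have "spell (?f \<star> (?g \<star> e)) ((i, a) # (i + tlen a + k, b) # q)" unfolding x(1) .
  moreover have "?f \<star> (?g \<star> e) = c"
  proof -
    have "?f \<star> (?g \<star> e) = ?f \<star> ?g \<star> e" using sq te tg d by (subst cmp1_assoc) (simp_all del: whisk_simps(4,5))
    also have "\<dots> = whisk u' (gen2 b) v' \<star> whisk u (gen2 a) v \<star> e" using square_commute[OF k] v z(4) by simp
    also have "\<dots> = c" using x d by (subst cmp1_assoc) (simp_all del: whisk_simps(4,5))
    finally show ?thesis .
  qed
  ultimately show ?L by simp
qed

lemma spell_swaps: "p \<approx> q \<Longrightarrow> spell c p \<longleftrightarrow> spell c q"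
proof (induction arbitrary: c rule: swaps.induct)
  case (swaps_swap p i a k b q)
  have "spell c (p @ x) \<longrightarrow> spell c (p @ y)" if "\<And>e. spell e x \<Longrightarrow> spell e y" for x y
    using spell_appendD[of c p x] spell_cmp1 that by blast
  then show ?case using spell_swap_head by blast
qed auto

lemma spell_iff: "spell c p \<longleftrightarrow> c \<in> cl2 \<and> pth c \<approx> p"
  using spell_ex[of c] spell_pth spell_swaps spell_cells swaps_trans swaps_sym by blast

text \<open>This completes the presentation: a \<open>2\<close>-cell is its \<open>1\<close>-source
  together with a path up to exchange.\<close>

lemma cell_eqI: "c \<in> cl2 \<Longrightarrow> d \<in> cl2 \<Longrightarrow> s1 c = s1 d \<Longrightarrow> pth c \<approx> pth d \<Longrightarrow> c = d"
  using spell_unique[of c "pth d" d] by (simp add: spell_iff)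

end

section \<open>Rewriting steps and branchings\<close>

context free_polygraph
begin

lemma run_pth: "c \<in> cl2 \<Longrightarrow> run slen tlen (len c) (pth c) (len (t1 c))"
proof -
  assume "c \<in> cl2"
  then obtain t where t: "wft (ext2 P) t" "c = tcls (ext2 P) t" by (rule cells2E)
  \<comment> \<open>\<open>pth c\<close> is literally the path of this chosen term, so
    \<open>run_path\<close> applies without showing that exchanges preserve
    \<open>run\<close>.\<close>
  let ?s = "SOME s. s \<in> c"
  have "teq (ext2 P) t ?s" unfolding t(2) tcls_def using someI_ex[of "\<lambda>s. teq (ext2 P) t s"] teq_refl[OF t(1)] by auto
  then have s: "wft (ext2 P) ?s" "c = tcls (ext2 P) ?s"
    using teq_sound[of "ext2 P" t ?s] t tcls_eq_iff[of "ext2 P" t ?s] by auto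
  have "len c = length (word1 (tsrc (ext2 P) 1 ?s))" using wd_tcls[OF s(1)] s(2) by metis
  moreover have "len (t1 c) = length (word1 (ttgt (ext2 P) 1 ?s))" using wd_t1_tcls[OF s(1)] s(2) by metis
  ultimately show ?thesis using run_path[OF s(1)] unfolding pth_def by simp
qed

abbreviation "step \<equiv> rewriting_step P"

lemma step_iff: "step f \<longleftrightarrow> f \<in> cl2 \<and> length (pth f) = 1"
proof
  assume a: "step f"
  then obtain t s where t: "f \<in> cl2" "t \<in> f" "num_gens t = 1" "wft (ext2 P) s" "f = tcls (ext2 P) s"
    by (auto simp: rewriting_step_def elim: cells2E)
  then have "teq (ext2 P) s t" by (simp add: tcls_def)
  then have w: "wft (ext2 P) t" "f = tcls (ext2 P) t"
    using teq_sound[of "ext2 P" s t] tcls_eq_iff[OF t(4)] t(5) by auto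
  then show "f \<in> cl2 \<and> length (pth f) = 1"
    using t swaps_length[OF pth_tcls[OF w(1)]] length_path[OF w(1)] by simp
next
  assume a: "f \<in> cl2 \<and> length (pth f) = 1"
  then obtain t where t: "wft (ext2 P) t" "f = tcls (ext2 P) t" by (auto elim: cells2E)
  then have "num_gens t = 1" using a swaps_length[OF pth_tcls[OF t(1)]] length_path[OF t(1)] by simp
  then show "step f" using a t teq_refl[OF t(1)] by (auto simp: rewriting_step_def tcls_def)
qed

lemma step_cells [simp]: "step f \<Longrightarrow> f \<in> cl2" by (simp add: step_iff)

lemma step_pth:
  assumes "step f"
  obtains i a where "pth f = [(i, a)]"
  using assms by (cases "pth f") (auto simp: step_iff One_nat_def)

lemma step_whisk: "a \<in> gens2 P \<Longrightarrow> ctx u (gen2 a) v \<Longrightarrow> step (whisk u (gen2 a) v) \<and> pth (whisk u (gen2 a) v) = [(len u, a)]"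
  using spell_pth[OF spell_whisk[of a u v]] by (simp add: step_iff)

lemma stepE:
  assumes "step f"
  obtains u a v where "a \<in> gens2 P" "ctx u (gen2 a) v" "f = whisk u (gen2 a) v" "pth f = [(len u, a)]"
proof -
  obtain i a where p: "pth f = [(i, a)]" using assms by (rule step_pth)
  have "spell f [(i, a)]" using assms p by (simp add: spell_iff)
  then obtain u v c where x: "a \<in> gens2 P" "ctx u (gen2 a) v" "f = whisk u (gen2 a) v \<star> c" "one c" "t1 (whisk u (gen2 a) v) = s1 c"
    by (auto elim!: spell.cases[of _ "_ # _"] elim: spell.cases[of _ "[]"])
  have "c = t1 (whisk u (gen2 a) v)" using x(4,5) by (simp add: oneD del: whisk_simps)
  then have "f = whisk u (gen2 a) v" using x(2,3) by (simp del: whisk_simps(5))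
  then show ?thesis using that x(1,2) step_whisk by blast
qed

lemma step_eqI: "step f \<Longrightarrow> step g \<Longrightarrow> s1 f = s1 g \<Longrightarrow> pth f = pth g \<Longrightarrow> f = g"
  by (rule cell_eqI) simp_all

lemma cell_cases:
  assumes "c \<in> cl2"
  obtains "one c" | f d where "step f" "d \<in> cl2" "t1 f = s1 d" "c = f \<star> d"
proof -
  obtain p where "spell c p" using spell_ex[OF assms] by blast
  then show ?thesis
  proof cases
    case spell_one then show ?thesis using that by blast
  next
    case (spell_step a u v d p)
    then show ?thesis using that(2)[of "whisk u (gen2 a) v" d] step_whisk spell_cells by blast
  qed
qed

lemma pth_right: "c \<in> cl2 \<Longrightarrow> one v \<Longrightarrow> t0 c = s0 v \<Longrightarrow> pth (c \<cdot> v) \<approx> pth c"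
  using pth_cmp0[of c v] by (simp add: oneD)

lemma pth_left: "c \<in> cl2 \<Longrightarrow> one u \<Longrightarrow> t0 u = s0 c \<Longrightarrow> pth (u \<cdot> c) \<approx> shift (len u) (pth c)"
  using pth_cmp0[of u c] by (simp add: oneD)

lemma step_right: "one v \<Longrightarrow> c \<in> cl2 \<Longrightarrow> t0 c = s0 v \<Longrightarrow> step (c \<cdot> v) \<longleftrightarrow> step c"
  using swaps_length[OF pth_right[of c v]] by (simp add: step_iff oneD)

lemma step_left: "one u \<Longrightarrow> c \<in> cl2 \<Longrightarrow> t0 u = s0 c \<Longrightarrow> step (u \<cdot> c) \<longleftrightarrow> step c"
  using swaps_length[OF pth_left[of c u]] by (simp add: step_iff oneD)

lemma pth_step_right: "step c \<Longrightarrow> one v \<Longrightarrow> t0 c = s0 v \<Longrightarrow> pth (c \<cdot> v) = pth c"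
  using pth_right[of c v] by (auto elim: step_pth)

lemma pth_step_left: "step c \<Longrightarrow> one u \<Longrightarrow> t0 u = s0 c \<Longrightarrow> pth (u \<cdot> c) = shift (len u) (pth c)"
  using pth_left[of c u] by (auto elim: step_pth)

text \<open>Intended for steps with the same \<open>1\<close>-source, whose paths are singletons;
  there it says that the replaced factors are disjoint and in this order.\<close>

definition left_of :: "('a, 'b, 'c) cell2 \<Rightarrow> ('a, 'b, 'c) cell2 \<Rightarrow> bool" where
  "left_of f g \<longleftrightarrow> fst (hd (pth f)) + slen (snd (hd (pth f))) \<le> fst (hd (pth g))"

text \<open>A Peiffer pair read from left to right. The composite of \<open>f'\<close> and
  \<open>g'\<close> along \<open>0\<close>-cells is the diagonal of the square in which both steps
  are completed.\<close>

definition split_pair :: "('a, 'b, 'c) cell2 \<Rightarrow> ('a, 'b, 'c) cell2 \<Rightarrow> ('a, 'b, 'c) cell2 \<Rightarrow> ('a, 'b, 'c) cell2 \<Rightarrow> bool" where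
  "split_pair f g f' g' \<longleftrightarrow> f' \<in> cl2 \<and> g' \<in> cl2 \<and> t0 f' = s0 g' \<and> f = f' \<cdot> s1 g' \<and> g = s1 f' \<cdot> g'"

text \<open>The letters between the two replaced factors are found by \<open>levi\<close> and given
  to the right factor.\<close>

lemma left_of_split:
  assumes "step f" "step g" "s1 f = s1 g" "left_of f g"
  obtains f' g' where "split_pair f g f' g'"
proof -
  obtain u a v where f: "a \<in> gens2 P" "ctx u (gen2 a) v" "f = whisk u (gen2 a) v" "pth f = [(len u, a)]"
    using assms(1) by (rule stepE)
  obtain u' b v' where g: "b \<in> gens2 P" "ctx u' (gen2 b) v'" "g = whisk u' (gen2 b) v'" "pth g = [(len u', b)]"
    using assms(2) by (rule stepE)
  note d = ctxD[OF f(2)] ctxD[OF g(2)]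
  have "u \<cdot> s1 (gen2 a) \<cdot> v = u' \<cdot> (s1 (gen2 b) \<cdot> v')" using assms(3) f g d by (simp add: cmp0_assoc)
  note lv = levi[OF _ _ _ _ _ _ this]
  have "one (u \<cdot> s1 (gen2 a))" "one (s1 (gen2 b) \<cdot> v')" "t0 (u \<cdot> s1 (gen2 a)) = s0 v" "t0 u' = s0 (s1 (gen2 b) \<cdot> v')"
    "len (u \<cdot> s1 (gen2 a)) \<le> len u'"
    using d f(1,4) g(1,4) assms(4) by (simp_all add: one_cmp0 left_of_def)
  then obtain z where z: "one z" "t0 (u \<cdot> s1 (gen2 a)) = s0 z" "t0 z = s0 (s1 (gen2 b) \<cdot> v')" "u' = u \<cdot> s1 (gen2 a) \<cdot> z"
    "v = z \<cdot> (s1 (gen2 b) \<cdot> v')"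
    using lv[OF _ d(2) d(12)] by blast
  have k: "ctx u (gen2 a) z" "ctx z (gen2 b) v'" using z d by (simp_all add: ctx_def)
  note dz = oneD[OF z(1)] ctxD[OF k(1)] ctxD[OF k(2)]
  have "v = z \<cdot> s1 (gen2 b) \<cdot> v'" using z dz by (simp add: cmp0_assoc)
  then have "f = (u \<cdot> gen2 a) \<cdot> s1 (z \<cdot> gen2 b \<cdot> v')" "g = s1 (u \<cdot> gen2 a) \<cdot> (z \<cdot> gen2 b \<cdot> v')"
    using f(3) g(3) z(4) square_whisk(1,3)[OF k] by simp_all
  then show ?thesis using dz by (intro that[of "u \<cdot> gen2 a" "z \<cdot> gen2 b \<cdot> v'"]) (simp add: split_pair_def)
qed

lemma split_pairD:
  assumes "split_pair f g f' g'" "step f" "step g"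
  shows "step f'" "step g'" "left_of f g" "s1 f = s1 g" "pth f = pth f'" "pth g = shift (len f') (pth g')"
    "s1 f = s1 f' \<cdot> s1 g'"
proof -
  have c: "f' \<in> cl2" "g' \<in> cl2" "t0 f' = s0 g'" "f = f' \<cdot> s1 g'" "g = s1 f' \<cdot> g'" using assms(1) by (auto simp: split_pair_def)
  show s: "step f'" "step g'" using assms c step_right[of "s1 g'" f'] step_left[of "s1 f'" g'] by simp_all
  show "s1 f = s1 g" "s1 f = s1 f' \<cdot> s1 g'" using c by simp_all
  show p: "pth f = pth f'" "pth g = shift (len f') (pth g')"
    using s c pth_step_right[of f' "s1 g'"] pth_step_left[of g' "s1 f'"] by simp_all
  obtain i a j b where ij: "pth f' = [(i, a)]" "pth g' = [(j, b)]" using s by (metis step_pth)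
  show "left_of f g" using p ij run_pth[OF c(1)] by (simp add: left_of_def)
qed

lemma split_pair_square:
  assumes "split_pair f g f' g'"
  shows "f \<star> (t1 f' \<cdot> g') = f' \<cdot> g'" "g \<star> (f' \<cdot> t1 g') = f' \<cdot> g'" "f' \<cdot> g' \<in> cl2"
    "t1 f = s1 (t1 f' \<cdot> g')" "t1 g = s1 (f' \<cdot> t1 g')" "t1 f' \<cdot> g' \<in> cl2" "f' \<cdot> t1 g' \<in> cl2" "f \<in> cl2" "g \<in> cl2"
    "t1 (t1 f' \<cdot> g') = t1 f' \<cdot> t1 g'" "t1 (f' \<cdot> t1 g') = t1 f' \<cdot> t1 g'"
  using assms exch1[of f' g'] exch2[of f' g'] by (auto simp: split_pair_def)

lemma local_branching2: "local_branching P [f, g] \<longleftrightarrow> step f \<and> step g \<and> s1 f = s1 g"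
  by (auto simp: local_branching_def)

lemma perm_class2: "perm_class [f, g] = {[f, g], [g, f]}"
proof -
  have "ys = [f, g] \<or> ys = [g, f]" if "mset ys = {#f, g#}" for ys
  proof -
    have "length ys = 2" using that by (metis size_mset size_add_mset size_empty numeral_2_eq_2)
    then obtain x y where ys: "ys = [x, y]" by (auto simp: numeral_2_eq_2 length_Suc_conv)
    then show ?thesis using that by (auto simp: add_eq_conv_ex)
  qed
  then show ?thesis by (auto simp: perm_class_def add_mset_commute)
qed

lemma aspherical2: "aspherical [f, g] \<longleftrightarrow> f = g"
  unfolding aspherical_def perm_class2 by (auto simp: less_Suc_eq)

text \<open>The definition of a strict Peiffer branching does not fix the sources of the factors
  \<open>f'\<close> and \<open>g'\<close>. They are found by cancelling in the common
  \<open>1\<close>-source, after a comparison of lengths.\<close>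

lemma strict_peiffer2:
  assumes "strict_peiffer P [f, g]"
  obtains f' g' where "split_pair f g f' g'"
proof -
  from assms obtain v1 v2 m fs where p: "step f" "step g" "s1 f = s1 g" "one v1" "one v2" "s1 f = v1 \<cdot> v2" "1 \<le> m" "m < 2"
    "length fs = 2" "set fs \<subseteq> cl2" "\<forall>j<m. [f, g] ! j = fs ! j \<cdot> v2" "\<forall>j. m \<le> j \<and> j < 2 \<longrightarrow> [f, g] ! j = v1 \<cdot> (fs ! j)"
    unfolding strict_peiffer_def local_branching2 by (auto simp: numeral_2_eq_2)
  have m: "m = 1" using p by simp
  obtain f' g' where fs: "fs = [f', g']" using p(9) by (auto simp: numeral_2_eq_2 length_Suc_conv)
  have f: "f = f' \<cdot> v2" "g = v1 \<cdot> g'" "f' \<in> cl2" "g' \<in> cl2" using p(10-12) fs m by (auto simp: One_nat_def)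
  note d = oneD[OF p(4)] oneD[OF p(5)]
  have "f' \<cdot> v2 \<in> cl2" "v1 \<cdot> g' \<in> cl2" "v1 \<cdot> v2 \<in> cl2" using f p(1,2,6) by (metis step_cells c2_simps(1))+
  then have t: "t0 f' = s0 v2" "t0 v1 = s0 g'" "t0 v1 = s0 v2" using cmp2D(2) d f by blast+
  have e1: "s1 f' \<cdot> v2 = v1 \<cdot> v2" using p(6) f d t by simp
  have e2: "v1 \<cdot> s1 g' = v1 \<cdot> v2" using p(3,6) f d t by simp
  have "wd (s1 f') @ wd v2 = wd v1 @ wd v2" using arg_cong[OF e1, of wd] d t f by simp
  then have "len (s1 f') = len v1" by simp
  then have v1: "s1 f' = v1" using one_cancel_left(1)[OF _ p(5) p(4) p(5) _ t(3) e1] f t by simp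
  have v2: "s1 g' = v2" using one_cancel_left(2)[OF p(4) _ p(4) p(5) _ t(3) e2] f t by simp
  show ?thesis using that[of f' g'] f t v1 v2 by (simp add: split_pair_def)
qed

lemma spell_step_cancel_aux: "step f \<Longrightarrow> a \<in> cl2 \<Longrightarrow> t1 f = s1 a \<Longrightarrow> pth f = [x] \<Longrightarrow> pth (f \<star> a) \<approx> x # pth a"
  using pth_cmp1[of f a] by simp

end

section \<open>Termination, left cancellation and first steps of a two-cell\<close>

locale squier_polygraph = free_polygraph P for P :: "('a, 'b, 'c, 'd, 'e) polygraph" +
  fixes \<phi> :: "'d \<Rightarrow> ('a, 'b, 'c) branching set"
  assumes squier: "squier2_by P \<phi>"
begin

lemma terminating: "wfp (\<lambda>v u. \<exists>f. two_cell P f u v \<and> f \<notin> kcells (free2 P) 1)"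
  using squier by (simp add: squier2_by_def convergent2_def terminating2_def)

text \<open>A generator whose source is an identity could be applied indefinitely at the end of a word.\<close>

lemma slen_pos: "slen a > 0"
proof (rule ccontr)
  assume "\<not> slen a > 0"
  then have a: "a \<in> gens2 P" "slen a = 0" by (auto simp: slen_def split: if_splits)
  have s: "s1 (gen2 a) = s0 (gen2 a)"
  proof -
    have "wd (gen2 a) = []" using gen2(3)[OF a(1)] a(2) by (simp del: gen2)
    then show ?thesis using wd_Nil[of "s1 (gen2 a)"] gen2(1)[OF a(1)] by simp
  qed
  have tt: "t0 (gen2 a) = s0 (gen2 a)" using s a c2_simps(5)[of "gen2 a"] by simp
  have "\<not> (one v \<and> t0 v = s0 (gen2 a))" for v
    using terminating
  proof (induction v rule: wfp_induct_rule)
    case (less v)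
    show ?case
    proof
      assume v: "one v \<and> t0 v = s0 (gen2 a)"
      note d = oneD[OF v[THEN conjunct1]]
      have st: "step (v \<cdot> gen2 a)"
      proof -
        have "step (gen2 a)" using gen2(1,2)[OF a(1)] by (simp add: step_iff)
        then show ?thesis using step_left[of v "gen2 a"] v gen2(1)[OF a(1)] by blast
      qed
      have "s1 (v \<cdot> gen2 a) = v" using v d a s c2_simps(22)[OF d(1)] by simp
      then have "two_cell P (v \<cdot> gen2 a) v (v \<cdot> t1 (gen2 a))" using v d a by (simp add: two_cell_def)
      moreover have "\<not> one (v \<cdot> gen2 a)" using st by (auto simp: step_iff)
      ultimately have "\<not> (one (v \<cdot> t1 (gen2 a)) \<and> t0 (v \<cdot> t1 (gen2 a)) = s0 (gen2 a))" using less by blast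
      then show False using v d a tt by (simp add: one_cmp0)
    qed
  qed
  moreover have "one (s0 (gen2 a)) \<and> t0 (s0 (gen2 a)) = s0 (gen2 a)" using a by (simp add: one_s0)
  ultimately show False by blast
qed

lemma left_of_neq: "left_of f g \<Longrightarrow> f \<noteq> g"
  using slen_pos[of "snd (hd (pth f))"] by (auto simp: left_of_def)

lemma left_of_asym: "left_of f g \<Longrightarrow> \<not> left_of g f"
  using slen_pos[of "snd (hd (pth f))"] by (auto simp: left_of_def)

lemma peiffer2_iff:
  assumes "local_branching P [f, g]"
  shows "peiffer P [f, g] \<longleftrightarrow> left_of f g \<or> left_of g f"
proof -
  have A: "strict_peiffer P [f, g] \<longleftrightarrow> left_of f g" if "local_branching P [f, g]" for f g
  proof
    assume "strict_peiffer P [f, g]"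
    then show "left_of f g" using split_pairD(3) strict_peiffer2 that[unfolded local_branching2] by metis
  next
    assume l: "left_of f g"
    note lbr = that
    note lb = that[unfolded local_branching2]
    obtain f' g' where s: "split_pair f g f' g'" using left_of_split[of f g] lb l by blast
    then have c: "f' \<in> cl2" "g' \<in> cl2" "t0 f' = s0 g'" "f = f' \<cdot> s1 g'" "g = s1 f' \<cdot> g'" by (auto simp: split_pair_def)
    have b: "(\<forall>h \<in> set [f, g]. s1 h = s1 f' \<cdot> s1 g') \<and> 1 \<le> (1::nat) \<and> 1 < length [f, g] \<and>
      length [f', g'] = length [f, g] \<and> set [f', g'] \<subseteq> cl2 \<and>
      (\<forall>j < 1. [f, g] ! j = [f', g'] ! j \<cdot> s1 g') \<and>
      (\<forall>j. 1 \<le> j \<and> j < length [f, g] \<longrightarrow> [f, g] ! j = s1 f' \<cdot> ([f', g'] ! j))"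
      using c(1-3) c(4)[symmetric] c(5)[symmetric] by (auto simp: less_Suc_eq nth_Cons')
    have o: "one (s1 f')" "one (s1 g')" using c by simp_all
    show "strict_peiffer P [f, g]"
      unfolding strict_peiffer_def aspherical2
      by (intro conjI lbr left_of_neq[OF l], rule bexI[OF _ o(1)], rule bexI[OF _ o(2)],
          rule exI[of _ 1], rule exI[of _ "[f', g']"], rule b)
  qed
  have "local_branching P [g, f]" using assms by (auto simp: local_branching2)
  then show ?thesis using A assms by (auto simp: peiffer_def perm_class2)
qed

lemma overlapping2_iff: "overlapping P [f, g] \<longleftrightarrow> local_branching P [f, g] \<and> f \<noteq> g \<and> \<not> left_of f g \<and> \<not> left_of g f"
  using peiffer2_iff by (auto simp: overlapping_def aspherical2)

text \<open>The common first step is deleted from both paths; \<open>residue_cong\<close> says that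
  the remainders are still equal up to exchange.\<close>

lemma step_cancel:
  assumes "step f" "a \<in> cl2" "b \<in> cl2" "t1 f = s1 a" "t1 f = s1 b" "f \<star> a = f \<star> b"
  shows "a = b"
proof -
  obtain i c where p: "pth f = [(i, c)]" using assms(1) by (rule step_pth)
  have "(i, c) # pth a \<approx> (i, c) # pth b"
    using swaps_trans[OF swaps_sym[OF spell_step_cancel_aux[OF assms(1,2,4) p], unfolded assms(6)]
      spell_step_cancel_aux[OF assms(1,3,5) p]] .
  from residue_cong[OF slen_pos this, of "(i, c)"] have "pth a \<approx> pth b" by simp
  then show ?thesis by (rule cell_eqI[OF assms(2,3) trans[OF assms(4)[symmetric] assms(5)]])
qed

text \<open>The step of \<open>f\<close> heads the path of \<open>f \<star> a\<close>, so its
  residue in the path of \<open>g \<star> b\<close> exists. Lying to the left of \<open>g\<close>,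
  it passes \<open>g\<close> with unchanged position, hence can be brought to the front of
  \<open>b\<close>: there it is \<open>f\<close> performed after \<open>g\<close>. The form of
  \<open>a\<close> follows by cancelling \<open>f\<close>.\<close>

lemma steps_eq_left:
  assumes "step f" "step g" "a \<in> cl2" "b \<in> cl2" "t1 f = s1 a" "t1 g = s1 b" "f \<star> a = g \<star> b" "left_of f g"
  shows "\<exists>f' g' e. split_pair f g f' g' \<and> e \<in> cl2 \<and> s1 e = t1 f' \<cdot> t1 g' \<and> a = (t1 f' \<cdot> g') \<star> e \<and> b = (f' \<cdot> t1 g') \<star> e"
proof -
  obtain i c where p: "pth f = [(i, c)]" using assms(1) by (rule step_pth)
  obtain j d where q: "pth g = [(j, d)]" using assms(2) by (rule step_pth)
  have l: "i + slen c \<le> j" using assms(8) p q by (simp add: left_of_def)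
  have ij: "\<not> (i = j \<and> c = d)" using l slen_pos[of c] by simp
  have s: "s1 f = s1 g" using cmp1_simps(4)[of f a] cmp1_simps(4)[of g b] assms by simp
  obtain f' g' where sp: "split_pair f g f' g'" using left_of_split[OF assms(1,2) s assms(8)] by blast
  note D = split_pairD[OF sp assms(1,2)] and sq = split_pair_square[OF sp]
  have "(i, c) # pth a \<approx> (j, d) # pth b"
    using swaps_trans[OF swaps_sym[OF spell_step_cancel_aux[OF assms(1,3,5) p], unfolded assms(7)]
      spell_step_cancel_aux[OF assms(2,4,6) q]] .
  from residue_cong[OF slen_pos this, of "(i, c)"] obtain r where r: "residue slen tlen (i, c) (pth b) = Some r"
    using l ij by (auto simp: option_rel_Some1)
  have "spell b ((i, c) # r)" using residue_swaps[OF r] assms(4) by (simp add: spell_iff)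
  then obtain h e where h: "spell h [(i, c)]" "spell e r" "t1 h = s1 e" "b = h \<star> e"
    using spell_appendD[of b "[(i, c)]" r] by auto
  note hc = spell_cells[OF h(1)] spell_cells[OF h(2)]
  have sg: "split_pair f g f' g'" "f' \<in> cl2" "g' \<in> cl2" "t0 f' = s0 g'" using sp by (auto simp: split_pair_def)
  have "h = f' \<cdot> t1 g'"
  proof (rule cell_eqI[OF hc(1) sq(7)])
    show "s1 h = s1 (f' \<cdot> t1 g')" using assms(6) sq(5) h hc by simp
    have "pth (f' \<cdot> t1 g') \<approx> pth f'" using sg by (intro pth_right) simp_all
    then show "pth h \<approx> pth (f' \<cdot> t1 g')" using spell_pth[OF h(1)] D(5) p swaps_sym by simp
  qed
  then have b: "b = (f' \<cdot> t1 g') \<star> e" and e: "s1 e = t1 f' \<cdot> t1 g'" using h sq(11) by simp_all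
  have "f \<star> a = g \<star> (f' \<cdot> t1 g') \<star> e"
    using assms(7) b sq e hc cmp1_assoc[of g "f' \<cdot> t1 g'" e] by (simp del: cmp0_simps)
  also have "\<dots> = f \<star> (t1 f' \<cdot> g') \<star> e" using sq by simp
  also have "\<dots> = f \<star> ((t1 f' \<cdot> g') \<star> e)"
    using sq e hc cmp1_assoc[of f "t1 f' \<cdot> g'" e] by (simp del: cmp0_simps)
  finally have fa: "f \<star> a = f \<star> ((t1 f' \<cdot> g') \<star> e)" .
  have "(t1 f' \<cdot> g') \<star> e \<in> cl2" "t1 f = s1 ((t1 f' \<cdot> g') \<star> e)" using sq e hc by (simp_all del: cmp0_simps)
  from step_cancel[OF assms(1,3) this(1) assms(5) this(2) fa] have "a = (t1 f' \<cdot> g') \<star> e" .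
  then show ?thesis using sp b e hc by blast
qed

text \<open>Two different steps that are not disjoint cannot begin the same \<open>2\<close>-cell:
  the residue of the one would be defined in the path of \<open>f \<star> a\<close> and undefined in
  that of \<open>g \<star> b\<close>.\<close>

lemma steps_eq_cases:
  assumes "step f" "step g" "a \<in> cl2" "b \<in> cl2" "t1 f = s1 a" "t1 g = s1 b" "f \<star> a = g \<star> b"
  obtains "f = g" "a = b"
  | f' g' e where "split_pair f g f' g'" "e \<in> cl2" "s1 e = t1 f' \<cdot> t1 g'" "a = (t1 f' \<cdot> g') \<star> e" "b = (f' \<cdot> t1 g') \<star> e"
  | f' g' e where "split_pair g f f' g'" "e \<in> cl2" "s1 e = t1 f' \<cdot> t1 g'" "b = (t1 f' \<cdot> g') \<star> e" "a = (f' \<cdot> t1 g') \<star> e"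
proof -
  obtain i c where p: "pth f = [(i, c)]" using assms(1) by (rule step_pth)
  obtain j d where q: "pth g = [(j, d)]" using assms(2) by (rule step_pth)
  have s: "s1 f = s1 g" using cmp1_simps(4)[of f a] cmp1_simps(4)[of g b] assms by simp
  have "(i, c) # pth a \<approx> (j, d) # pth b"
    using swaps_trans[OF swaps_sym[OF spell_step_cancel_aux[OF assms(1,3,5) p], unfolded assms(7)]
      spell_step_cancel_aux[OF assms(2,4,6) q]] .
  note rc = residue_cong[OF slen_pos this, of "(i, c)"]
  have "residue slen tlen (i, c) ((i, c) # pth a) = Some (pth a)" by simp
  with rc have "residue slen tlen (i, c) ((j, d) # pth b) \<noteq> None" by (metis option.rel_distinct(2))
  then have "(i = j \<and> c = d) \<or> i + slen c \<le> j \<or> j + slen d \<le> i" by (metis residue.simps(2))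
  then consider "i = j \<and> c = d" | "i + slen c \<le> j" | "j + slen d \<le> i" by blast
  then show ?thesis
  proof cases
    case 1
    then have fg: "f = g" using step_eqI[OF assms(1,2) s] p q by simp
    have "a = b" by (rule step_cancel[OF assms(1,3,4,5)]) (use assms(6,7) fg in simp_all)
    with fg show ?thesis by (rule that(1))
  next
    case 2
    then have "left_of f g" using p q by (simp add: left_of_def)
    then show ?thesis using steps_eq_left[OF assms] that(2) by blast
  next
    case 3
    then have "left_of g f" using p q by (simp add: left_of_def)
    then show ?thesis using steps_eq_left[OF assms(2,1,4,3,6,5) assms(7)[symmetric]] that(3) by blast
  qed
qed

end

section \<open>Three-cells over the free two-category\<close>

text \<open>\<open>D\<close> is kept abstract because this calculus of whiskering is used twice: in
  the free \<open>(3,2)\<close>-category, where the canonical fillings live (prefix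
  \<open>F\<close>), and in its quotient by \<open>4\<close>-cells, where they are compared.\<close>

locale three_cells = free_polygraph P + D: strict_category D
  for P :: "('a, 'b, 'c, 'd, 'e) polygraph" and D :: "'x ncat" +
  fixes j :: "('a, 'b, 'c) cell2 \<Rightarrow> 'x"
  assumes dimD: "dim D = 3"
    and functor_j: "ncat_functor (free2 P) D j"
    and inverse_ex: "A \<in> cells D \<Longrightarrow> \<exists>B. inverse_cells D 2 A B"
begin

lemma j_simps [simp]:
  assumes "c \<in> cl2"
  shows "j c \<in> cells D" "src D i (j c) = j (src (free2 P) i c)" "tgt D i (j c) = j (tgt (free2 P) i c)"
  using functor_j assms by (auto simp: ncat_functor_def)

lemma j_cmp [simp]:
  "c \<in> cl2 \<Longrightarrow> d \<in> cl2 \<Longrightarrow> t0 c = s0 d \<Longrightarrow> cmp D 0 (j c) (j d) = j (c \<cdot> d)"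
  "c \<in> cl2 \<Longrightarrow> d \<in> cl2 \<Longrightarrow> t1 c = s1 d \<Longrightarrow> cmp D 1 (j c) (j d) = j (c \<star> d)"
  using functor_j by (auto simp: ncat_functor_def)

lemma src2_cl2 [simp]: "c \<in> cl2 \<Longrightarrow> src (free2 P) 2 c = c" "c \<in> cl2 \<Longrightarrow> tgt (free2 P) 2 c = c"
  by (simp_all add: c2.src_top c2.tgt_top)

text \<open>\<open>j\<close> is not assumed injective here, so source and target in \<open>D\<close>
  do not determine \<open>c\<close> and \<open>d\<close>; hence these are arguments and their
  parallelism is part of the definition.\<close>

definition is3 :: "'x \<Rightarrow> ('a, 'b, 'c) cell2 \<Rightarrow> ('a, 'b, 'c) cell2 \<Rightarrow> bool" where
  "is3 A c d \<longleftrightarrow> A \<in> cells D \<and> src D 2 A = j c \<and> tgt D 2 A = j d \<and> c \<in> cl2 \<and> d \<in> cl2 \<and> s1 c = s1 d \<and> t1 c = t1 d"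

lemma is3D:
  assumes "is3 A c d"
  shows "A \<in> cells D" "src D 2 A = j c" "tgt D 2 A = j d" "c \<in> cl2" "d \<in> cl2" "s1 d = s1 c" "t1 d = t1 c"
    "src D 1 A = j (s1 c)" "tgt D 1 A = j (t1 c)" "src D 0 A = j (s0 c)" "tgt D 0 A = j (t0 c)"
    "s0 d = s0 c" "t0 d = t0 c"
proof -
  show a: "A \<in> cells D" "src D 2 A = j c" "tgt D 2 A = j d" "c \<in> cl2" "d \<in> cl2" "s1 d = s1 c" "t1 d = t1 c"
    using assms by (auto simp: is3_def)
  have "src D i (src D 2 A) = src D i A" "tgt D i (src D 2 A) = tgt D i A" if "i < 2" for i
    using a(1) that by (simp_all add: D.src_src D.tgt_src min_def)
  from this[of 1] this[of 0]
  show "src D 1 A = j (s1 c)" "tgt D 1 A = j (t1 c)" "src D 0 A = j (s0 c)" "tgt D 0 A = j (t0 c)"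
    unfolding a(2) using a(4) by simp_all
  show "s0 d = s0 c" "t0 d = t0 c" using par0'[OF a(5,4,6)] by simp_all
qed

abbreviation comp2 (infixl "\<bullet>" 64) where "A \<bullet> B \<equiv> cmp D 2 A B"

definition lw :: "('a, 'b, 'c) cell2 \<Rightarrow> 'x \<Rightarrow> 'x" where "lw f A = cmp D 1 (j f) A"
definition rw :: "'x \<Rightarrow> ('a, 'b, 'c) cell2 \<Rightarrow> 'x" where "rw A q = cmp D 1 A (j q)"
definition wl :: "('a, 'b, 'c) cell2 \<Rightarrow> 'x \<Rightarrow> 'x" where "wl u A = cmp D 0 (j u) A"
definition wr :: "'x \<Rightarrow> ('a, 'b, 'c) cell2 \<Rightarrow> 'x" where "wr A v = cmp D 0 A (j v)"

lemma is3_id: "c \<in> cl2 \<Longrightarrow> is3 (j c) c c"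
  by (simp add: is3_def)

lemma is3_comp:
  assumes "is3 A c d" "is3 B d e" shows "is3 (A \<bullet> B) c e"
proof -
  note a = is3D(1-5)[OF assms(1)] is3D(1-5)[OF assms(2)]
  have "s1 c = s1 e" "t1 c = t1 e" using is3D(6,7)[OF assms(1)] is3D(6,7)[OF assms(2)] by simp_all
  with a show ?thesis by (simp add: is3_def dimD D.cmp_closed D.src_cmp D.tgt_cmp)
qed

lemma comp_id [simp]: "is3 A c d \<Longrightarrow> j c \<bullet> A = A" "is3 A c d \<Longrightarrow> A \<bullet> j d = A"
  using D.unit_left[of A 2] D.unit_right[of A 2] is3D(1-3)[of A c d] by (simp_all add: dimD)

lemma comp_assoc: "is3 A c d \<Longrightarrow> is3 B d e \<Longrightarrow> is3 E e f \<Longrightarrow> A \<bullet> B \<bullet> E = A \<bullet> (B \<bullet> E)"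
  using is3D(1-3)[of A c d] is3D(1-3)[of B d e] is3D(1-3)[of E e f] by (simp add: dimD D.cmp_assoc)

lemma is3_cmp1:
  assumes "is3 A c d" "is3 B c' d'" "t1 c = s1 c'"
  shows "is3 (cmp D 1 A B) (c \<star> c') (d \<star> d')"
proof -
  note a = is3D[OF assms(1)] and b = is3D[OF assms(2)]
  have c: "tgt D 1 A = src D 1 B" using a b assms(3) by simp
  have t: "t1 d = s1 d'" using a b assms(3) by simp
  have "cmp D 1 A B \<in> cells D" "src D 2 (cmp D 1 A B) = j (c \<star> c')" "tgt D 2 (cmp D 1 A B) = j (d \<star> d')"
    using a(1-5) b(1-5) c t assms(3) by (simp_all add: dimD D.cmp_closed D.src_cmp D.tgt_cmp)
  moreover have "c \<star> c' \<in> cl2" "d \<star> d' \<in> cl2" "s1 (d \<star> d') = s1 (c \<star> c')" "t1 (d \<star> d') = t1 (c \<star> c')"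
    using a(4-7) b(4-7) t assms(3) by simp_all
  ultimately show ?thesis by (simp add: is3_def)
qed

lemma is3_cmp0:
  assumes "is3 A c d" "is3 B c' d'" "t0 c = s0 c'"
  shows "is3 (cmp D 0 A B) (c \<cdot> c') (d \<cdot> d')"
proof -
  note a = is3D[OF assms(1)] and b = is3D[OF assms(2)]
  have c: "tgt D 0 A = src D 0 B" using a b assms(3) by simp
  have t: "t0 d = s0 d'" using a b assms(3) by simp
  have "cmp D 0 A B \<in> cells D" "src D 2 (cmp D 0 A B) = j (c \<cdot> c')" "tgt D 2 (cmp D 0 A B) = j (d \<cdot> d')"
    using a(1-5) b(1-5) c t assms(3) by (simp_all add: dimD D.cmp_closed D.src_cmp D.tgt_cmp)
  moreover have "c \<cdot> c' \<in> cl2" "d \<cdot> d' \<in> cl2" "s1 (d \<cdot> d') = s1 (c \<cdot> c')" "t1 (d \<cdot> d') = t1 (c \<cdot> c')"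
    using a(4-7) b(4-7) t assms(3) by simp_all
  ultimately show ?thesis by (simp add: is3_def)
qed

lemma is3_lw: "is3 A c d \<Longrightarrow> f \<in> cl2 \<Longrightarrow> t1 f = s1 c \<Longrightarrow> is3 (lw f A) (f \<star> c) (f \<star> d)"
  unfolding lw_def by (intro is3_cmp1 is3_id)

lemma is3_rw: "is3 A c d \<Longrightarrow> q \<in> cl2 \<Longrightarrow> t1 c = s1 q \<Longrightarrow> is3 (rw A q) (c \<star> q) (d \<star> q)"
  unfolding rw_def by (intro is3_cmp1 is3_id)

lemma is3_wl: "is3 A c d \<Longrightarrow> f \<in> cl2 \<Longrightarrow> t0 f = s0 c \<Longrightarrow> is3 (wl f A) (f \<cdot> c) (f \<cdot> d)"
  unfolding wl_def by (intro is3_cmp0 is3_id)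

lemma is3_wr: "is3 A c d \<Longrightarrow> q \<in> cl2 \<Longrightarrow> t0 c = s0 q \<Longrightarrow> is3 (wr A q) (c \<cdot> q) (d \<cdot> q)"
  unfolding wr_def by (intro is3_cmp0 is3_id)

lemma lw_comp: "is3 A c d \<Longrightarrow> is3 B d e \<Longrightarrow> f \<in> cl2 \<Longrightarrow> t1 f = s1 c \<Longrightarrow> lw f (A \<bullet> B) = lw f A \<bullet> lw f B"
  unfolding lw_def using is3D[of A c d] is3D[of B d e] by (intro D.whisker_left_cmp) (simp_all add: dimD)

lemma rw_comp: "is3 A c d \<Longrightarrow> is3 B d e \<Longrightarrow> f \<in> cl2 \<Longrightarrow> t1 c = s1 f \<Longrightarrow> rw (A \<bullet> B) f = rw A f \<bullet> rw B f"
  unfolding rw_def using is3D[of A c d] is3D[of B d e] by (intro D.whisker_right_cmp) (simp_all add: dimD)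

lemma wl_comp: "is3 A c d \<Longrightarrow> is3 B d e \<Longrightarrow> f \<in> cl2 \<Longrightarrow> t0 f = s0 c \<Longrightarrow> wl f (A \<bullet> B) = wl f A \<bullet> wl f B"
  unfolding wl_def using is3D[of A c d] is3D[of B d e] by (intro D.whisker_left_cmp) (simp_all add: dimD)

lemma wr_comp: "is3 A c d \<Longrightarrow> is3 B d e \<Longrightarrow> f \<in> cl2 \<Longrightarrow> t0 c = s0 f \<Longrightarrow> wr (A \<bullet> B) f = wr A f \<bullet> wr B f"
  unfolding wr_def using is3D[of A c d] is3D[of B d e] by (intro D.whisker_right_cmp) (simp_all add: dimD)

lemma lw_id [simp]: "f \<in> cl2 \<Longrightarrow> c \<in> cl2 \<Longrightarrow> t1 f = s1 c \<Longrightarrow> lw f (j c) = j (f \<star> c)"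
  and rw_id [simp]: "f \<in> cl2 \<Longrightarrow> c \<in> cl2 \<Longrightarrow> t1 c = s1 f \<Longrightarrow> rw (j c) f = j (c \<star> f)"
  and wl_id [simp]: "f \<in> cl2 \<Longrightarrow> c \<in> cl2 \<Longrightarrow> t0 f = s0 c \<Longrightarrow> wl f (j c) = j (f \<cdot> c)"
  and wr_id [simp]: "f \<in> cl2 \<Longrightarrow> c \<in> cl2 \<Longrightarrow> t0 c = s0 f \<Longrightarrow> wr (j c) f = j (c \<cdot> f)"
  by (simp_all add: lw_def rw_def wl_def wr_def)

lemma lw_lw: "is3 A c d \<Longrightarrow> f \<in> cl2 \<Longrightarrow> g \<in> cl2 \<Longrightarrow> t1 f = s1 g \<Longrightarrow> t1 g = s1 c \<Longrightarrow> lw f (lw g A) = lw (f \<star> g) A"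
  unfolding lw_def using is3D[of A c d] D.cmp_assoc[of "j f" "j g" A 1] by (simp add: dimD)

lemma rw_rw: "is3 A c d \<Longrightarrow> f \<in> cl2 \<Longrightarrow> g \<in> cl2 \<Longrightarrow> t1 f = s1 g \<Longrightarrow> t1 c = s1 f \<Longrightarrow> rw (rw A f) g = rw A (f \<star> g)"
  unfolding rw_def using is3D[of A c d] D.cmp_assoc[of A "j f" "j g" 1] by (simp add: dimD)

lemma lw_rw: "is3 A c d \<Longrightarrow> f \<in> cl2 \<Longrightarrow> g \<in> cl2 \<Longrightarrow> t1 f = s1 c \<Longrightarrow> t1 c = s1 g \<Longrightarrow> rw (lw f A) g = lw f (rw A g)"
  unfolding rw_def lw_def using is3D[of A c d] D.cmp_assoc[of "j f" A "j g" 1] by (simp add: dimD)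

lemma wl_wl: "is3 A c d \<Longrightarrow> f \<in> cl2 \<Longrightarrow> g \<in> cl2 \<Longrightarrow> t0 f = s0 g \<Longrightarrow> t0 g = s0 c \<Longrightarrow> wl f (wl g A) = wl (f \<cdot> g) A"
  unfolding wl_def using is3D[of A c d] D.cmp_assoc[of "j f" "j g" A 0] by (simp add: dimD)

lemma wr_wr: "is3 A c d \<Longrightarrow> f \<in> cl2 \<Longrightarrow> g \<in> cl2 \<Longrightarrow> t0 f = s0 g \<Longrightarrow> t0 c = s0 f \<Longrightarrow> wr (wr A f) g = wr A (f \<cdot> g)"
  unfolding wr_def using is3D[of A c d] D.cmp_assoc[of A "j f" "j g" 0] by (simp add: dimD)

lemma wl_wr: "is3 A c d \<Longrightarrow> f \<in> cl2 \<Longrightarrow> g \<in> cl2 \<Longrightarrow> t0 f = s0 c \<Longrightarrow> t0 c = s0 g \<Longrightarrow> wr (wl f A) g = wl f (wr A g)"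
  unfolding wr_def wl_def using is3D[of A c d] D.cmp_assoc[of "j f" A "j g" 0] by (simp add: dimD)

lemma lw_one: "is3 A c d \<Longrightarrow> lw (s1 c) A = A"
  unfolding lw_def using is3D[of A c d] D.unit_left[of A 1] by (simp add: dimD)

lemma rw_one: "is3 A c d \<Longrightarrow> rw A (t1 c) = A"
  unfolding rw_def using is3D[of A c d] D.unit_right[of A 1] by (simp add: dimD)

lemma wl_one: "is3 A c d \<Longrightarrow> wl (s0 c) A = A"
  unfolding wl_def using is3D[of A c d] D.unit_left[of A 0] by (simp add: dimD)

lemma wr_one: "is3 A c d \<Longrightarrow> wr A (t0 c) = A"
  unfolding wr_def using is3D[of A c d] D.unit_right[of A 0] by (simp add: dimD)

lemma cmp1_exchange:
  assumes "is3 A c d" "is3 B c' d'" "t1 c = s1 c'"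
  shows "cmp D 1 A B = rw A c' \<bullet> lw d B" "cmp D 1 A B = lw c B \<bullet> rw A d'"
  using D.cmp_exchange[of A B 1 2] is3D[OF assms(1)] is3D[OF assms(2)] assms(3) by (simp_all add: dimD rw_def lw_def)

text \<open>Reduces composition along \<open>0\<close>-cells to composition along
  \<open>1\<close>-cells of cells whiskered by \<open>1\<close>-cells. This is how properties shown
  for the latter reach the former.\<close>

lemma cmp0_exchange:
  assumes "is3 A c d" "is3 B c' d'" "t0 c = s0 c'"
  shows "cmp D 0 A B = cmp D 1 (wr A (s1 c')) (wl (t1 c) B)" "cmp D 0 A B = cmp D 1 (wl (s1 c) B) (wr A (t1 c'))"
  using D.cmp_exchange[of A B 0 1] is3D[OF assms(1)] is3D[OF assms(2)] assms(3) by (simp_all add: dimD wr_def wl_def)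

lemma wl_cmp1: "is3 A c d \<Longrightarrow> is3 B c' d' \<Longrightarrow> t1 c = s1 c' \<Longrightarrow> one u \<Longrightarrow> t0 u = s0 c \<Longrightarrow>
    wl u (cmp D 1 A B) = cmp D 1 (wl u A) (wl u B)"
  unfolding wl_def using is3D[of A c d] is3D[of B c' d'] oneD[of u]
  by (intro D.whisker_left_cmp) (simp_all add: dimD)

lemma wr_cmp1: "is3 A c d \<Longrightarrow> is3 B c' d' \<Longrightarrow> t1 c = s1 c' \<Longrightarrow> one u \<Longrightarrow> t0 c = s0 u \<Longrightarrow>
    wr (cmp D 1 A B) u = cmp D 1 (wr A u) (wr B u)"
  unfolding wr_def using is3D[of A c d] is3D[of B c' d'] oneD[of u]
  by (intro D.whisker_right_cmp) (simp_all add: dimD)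

definition wh :: "('a, 'b, 'c) cell2 \<Rightarrow> 'x \<Rightarrow> ('a, 'b, 'c) cell2 \<Rightarrow> 'x" where
  "wh u A v = wr (wl u A) v"

lemma is3_wh: "is3 A c d \<Longrightarrow> ctx u c v \<Longrightarrow> is3 (wh u A v) (whisk u c v) (whisk u d v)"
  unfolding wh_def whisk2_def using ctxD[of u c v] by (intro is3_wr is3_wl) simp_all

lemma ctx_par: "is3 A c d \<Longrightarrow> ctx u c v \<longleftrightarrow> ctx u d v"
  using is3D[of A c d] by (simp add: ctx_def)

lemma wh_comp: "is3 A c d \<Longrightarrow> is3 B d e \<Longrightarrow> ctx u c v \<Longrightarrow> wh u (A \<bullet> B) v = wh u A v \<bullet> wh u B v"
  using ctxD[of u c v] is3D[of A c d] by (simp add: wh_def wl_comp wr_comp[OF is3_wl is3_wl])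

lemma ctx_cmp1: "c \<in> cl2 \<Longrightarrow> d \<in> cl2 \<Longrightarrow> t1 c = s1 d \<Longrightarrow> ctx u (c \<star> d) v \<longleftrightarrow> ctx u c v"
  "c \<in> cl2 \<Longrightarrow> d \<in> cl2 \<Longrightarrow> t1 c = s1 d \<Longrightarrow> ctx u d v \<longleftrightarrow> ctx u c v"
  using par0[of c d] by (auto simp: ctx_def)

lemma whisk_cmp1: "c \<in> cl2 \<Longrightarrow> d \<in> cl2 \<Longrightarrow> t1 c = s1 d \<Longrightarrow> ctx u c v \<Longrightarrow> whisk u (c \<star> d) v = whisk u c v \<star> whisk u d v"
  using ctxD[of u c v] par0[of c d] by (simp add: whisk2_def whisker_l whisker_r)

lemma wh_cmp1: "is3 A c d \<Longrightarrow> is3 B c' d' \<Longrightarrow> t1 c = s1 c' \<Longrightarrow> ctx u c v \<Longrightarrow>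
    wh u (cmp D 1 A B) v = cmp D 1 (wh u A v) (wh u B v)"
  using ctxD[of u c v] is3D[of A c d] is3D[of B c' d'] par0[of c c']
  by (simp add: wh_def wl_cmp1 wr_cmp1[OF is3_wl is3_wl])

lemma wh_id [simp]: "ctx u c v \<Longrightarrow> wh u (j c) v = j (whisk u c v)"
  using ctxD[of u c v] by (simp add: wh_def whisk2_def)

lemma wh_lw: "is3 A c d \<Longrightarrow> f \<in> cl2 \<Longrightarrow> t1 f = s1 c \<Longrightarrow> ctx u c v \<Longrightarrow> wh u (lw f A) v = lw (whisk u f v) (wh u A v)"
  using wh_cmp1[OF is3_id, of f A c d u v] ctx_cmp1(2)[of f c u v] is3D[of A c d] by (simp add: lw_def)

lemma wh_rw: "is3 A c d \<Longrightarrow> f \<in> cl2 \<Longrightarrow> t1 c = s1 f \<Longrightarrow> ctx u c v \<Longrightarrow> wh u (rw A f) v = rw (wh u A v) (whisk u f v)"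
  using wh_cmp1[OF _ is3_id, of A c d f u v] ctx_cmp1(2)[of c f u v] is3D[of A c d] by (simp add: rw_def)

lemma wh_wh:
  assumes "is3 A c d" "ctx u c v" "one x" "one y" "t0 x = s0 u" "t0 v = s0 y"
  shows "wh x (wh u A v) y = wh (x \<cdot> u) A (v \<cdot> y)" "whisk x (whisk u c v) y = whisk (x \<cdot> u) c (v \<cdot> y)"
    "ctx (x \<cdot> u) c (v \<cdot> y)" "ctx x (whisk u c v) y"
proof -
  note d = is3D[OF assms(1)] ctxD[OF assms(2)] oneD[OF assms(3)] oneD[OF assms(4)]
  have "wh x (wh u A v) y = wr (wl x (wr (wl u A) v)) y" by (simp add: wh_def)
  also have "wl x (wr (wl u A) v) = wr (wl x (wl u A)) v"
    using wl_wr[OF is3_wl[OF assms(1), of u], of x v] d assms by simp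
  also have "wl x (wl u A) = wl (x \<cdot> u) A" using wl_wl[OF assms(1), of x u] d assms by simp
  also have "wr (wr (wl (x \<cdot> u) A) v) y = wr (wl (x \<cdot> u) A) (v \<cdot> y)"
    using wr_wr[OF is3_wl[OF assms(1), of "x \<cdot> u"], of v y] d assms by simp
  finally show "wh x (wh u A v) y = wh (x \<cdot> u) A (v \<cdot> y)" by (simp add: wh_def)
  show "whisk x (whisk u c v) y = whisk (x \<cdot> u) c (v \<cdot> y)"
    using d assms(3-) by (simp add: whisk2_def cmp0_assoc)
  show "ctx (x \<cdot> u) c (v \<cdot> y)" "ctx x (whisk u c v) y" using d assms(2-) by (simp_all add: ctx_def one_cmp0)
qed

lemma is3_of_inverse:
  assumes "is3 A c d" "inverse_cells D 2 A B"
  shows "is3 B d c" "A \<bullet> B = j c" "B \<bullet> A = j d"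
proof -
  note a = is3D[OF assms(1)] and b = assms(2)[unfolded inverse_cells_def]
  show "A \<bullet> B = j c" "B \<bullet> A = j d" using a(2,3) b by simp_all
  have "B \<in> cells D" "src D 2 B = j d" "tgt D 2 B = j c" using a(2,3) b by simp_all
  then show "is3 B d c" unfolding is3_def using a(4-7) by blast
qed

lemma is3_inverse:
  assumes "is3 A c d"
  obtains B where "is3 B d c" "A \<bullet> B = j c" "B \<bullet> A = j d" "inverse_cells D 2 A B"
  using inverse_ex[OF is3D(1)[OF assms]] is3_of_inverse[OF assms] that by blast

lemma comp_cancel_right:
  assumes "is3 A c d" "is3 B e c" "is3 B' e c" "B \<bullet> A = B' \<bullet> A"
  shows "B = B'"
proof -
  obtain I where I: "is3 I d c" "A \<bullet> I = j c" using is3_inverse[OF assms(1)] by metis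
  have "B \<bullet> (A \<bullet> I) = B' \<bullet> (A \<bullet> I)" using comp_assoc[OF assms(2,1) I(1)] comp_assoc[OF assms(3,1) I(1)] assms(4) by metis
  then show ?thesis using I assms by simp
qed

text \<open>\<open>A\<close> performed next to \<open>h\<close> is \<open>A\<close> followed by
  \<open>h\<close> and also \<open>h\<close> followed by \<open>A\<close>. For Peiffer triples this
  moves a filling of two steps behind a third one.\<close>

lemma wr_slide:
  assumes "is3 A c d" "h \<in> cl2" "t0 c = s0 h"
  shows "wr A h = rw (wr A (s1 h)) (t1 c \<cdot> h)" "wr A h = lw (s1 c \<cdot> h) (wr A (t1 h))"
  using cmp0_exchange[OF assms(1) is3_id[OF assms(2)] assms(3)] is3D[OF assms(1)] assms
  by (simp_all add: wr_def[of A h] rw_def lw_def)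

lemma wl_slide:
  assumes "is3 A c d" "h \<in> cl2" "t0 h = s0 c"
  shows "wl h A = rw (wl (s1 h) A) (h \<cdot> t1 c)" "wl h A = lw (h \<cdot> s1 c) (wl (t1 h) A)"
  using cmp0_exchange[OF is3_id[OF assms(2)] assms(1) assms(3)] is3D[OF assms(1)] assms
  by (simp_all add: wl_def[of h A] rw_def lw_def)

end

section \<open>Canonical fillings\<close>

context free_polygraph
begin

abbreviation "cl3 \<equiv> cells (free3 P)"
abbreviation "gen3 \<equiv> gen_cell (ext3 P)"

lemma up3_simps:
  assumes "c \<in> cl2"
  shows "up3 P c \<in> cl3" "src (free3 P) i (up3 P c) = up3 P (src (free2 P) i c)"
    "tgt (free3 P) i (up3 P c) = up3 P (tgt (free2 P) i c)"
proof -
  have w: "wft (ext3 P) (Old c)" using assms by simp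
  then show "up3 P c \<in> cl3" by (auto simp: free3_def cells_free_ext old_cell_def simp del: wft.simps)
  show "src (free3 P) i (up3 P c) = up3 P (src (free2 P) i c)" "tgt (free3 P) i (up3 P c) = up3 P (tgt (free2 P) i c)"
    using src_free_ext[of "ext3 P", OF _ _ w] tgt_free_ext[of "ext3 P", OF _ _ w] assms
    by (auto simp: free3_def old_cell_def c2.src_top c2.tgt_top)
qed

lemma up3_inj: "c \<in> cl2 \<Longrightarrow> up3 P c = up3 P d \<longleftrightarrow> c = d"
  using Old_eq_iff[of "ext3 P" c d] by (simp add: old_cell_def)

lemma up3_cl2D: "up3 P c \<in> cl3 \<Longrightarrow> c \<in> cl2"
  using old_cell_cells[of "ext3 P" c] by (simp add: free3_def)

lemma up3_functor: "ncat_functor (free2 P) (free3 P) (up3 P)"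
proof -
  have "up3 P (cmp (free2 P) i c d) = cmp (free3 P) i (up3 P c) (up3 P d)"
    if "c \<in> cl2" "d \<in> cl2" "i < 2" "tgt (free2 P) i c = src (free2 P) i d" for i c d
    using tcls_Comp_Old[of "ext3 P" i c d] that by (simp add: free3_def old_cell_def cmp_free_ext)
  then show ?thesis by (simp add: ncat_functor_def up3_simps)
qed

lemma inverse3_ex: "A \<in> cl3 \<Longrightarrow> \<exists>B. inverse_cells (free3 P) 2 A B"
proof -
  assume A: "A \<in> cl3"
  then have "A \<in> kcells (free3 P) (Suc 2)" by (simp add: kcells_def c3.src_top)
  then show ?thesis using np_category_free(2)[OF poly] unfolding np_category_def
    by (metis order_refl numeral_less_iff semiring_norm(76,79))
qed

lemma cmp3D:
  assumes "A \<in> cl3" "B \<in> cl3" "cmp (free3 P) i A B \<in> cl3"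
  shows "i \<le> 2" "tgt (free3 P) i A = src (free3 P) i B"
  using cmp_free_extD[of "ext3 P" A B i] assms by (simp_all add: free3_def)

sublocale F: three_cells P "free3 P" "up3 P"
  using up3_functor inverse3_ex by unfold_locales simp_all

text \<open>Parallelism of \<open>c\<close> and \<open>d\<close> is globularity, read back through
  the injective \<open>up3\<close>.\<close>

lemma F_is3I:
  assumes "A \<in> cl3" "src (free3 P) 2 A = up3 P c" "tgt (free3 P) 2 A = up3 P d"
  shows "F.is3 A c d"
proof -
  have c: "c \<in> cl2" "d \<in> cl2" using assms c3.src_closed c3.tgt_closed up3_cl2D by metis+
  have "src (free3 P) 1 (src (free3 P) 2 A) = src (free3 P) 1 (tgt (free3 P) 2 A)"
    "tgt (free3 P) 1 (src (free3 P) 2 A) = tgt (free3 P) 1 (tgt (free3 P) 2 A)"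
    using assms(1) by (simp_all add: c3.src_src c3.src_tgt c3.tgt_src c3.tgt_tgt)
  then have "s1 c = s1 d" "t1 c = t1 d" unfolding assms(2,3) using c by (simp_all add: up3_simps up3_inj)
  with assms c show ?thesis by (simp add: F.is3_def)
qed

lemma F_is3_ex:
  assumes "A \<in> cl3"
  obtains c d where "F.is3 A c d"
proof -
  have "src (free3 P) 2 A \<in> kcells (free3 P) 2" "tgt (free3 P) 2 A \<in> kcells (free3 P) 2"
    using assms by (simp_all add: kcells_def c3.src_closed c3.tgt_closed c3.src_src c3.src_tgt)
  moreover have "kcells (free3 P) 2 = up3 P ` kcells (free2 P) 2"
    using kcells_free_ext[of "ext3 P" 2] by (simp add: free3_def)
  ultimately obtain c d where "src (free3 P) 2 A = up3 P c" "tgt (free3 P) 2 A = up3 P d" by auto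
  then show ?thesis using F_is3I[OF assms] that by blast
qed

lemma step_whisk_iff:
  assumes "ctx u c v"
  shows "step (whisk u c v) \<longleftrightarrow> step c"
  using swaps_length[OF pth_whisk[OF assms]] ctxD[OF assms] whisk_simps(1)[OF assms] by (simp add: step_iff)

lemma pth_step_whisk: "step c \<Longrightarrow> ctx u c v \<Longrightarrow> pth (whisk u c v) = shift (len u) (pth c)"
  using pth_whisk[of u c v] by (auto elim: step_pth)

lemma whisk_inj:
  assumes "step f" "step g" "s1 f = s1 g" "ctx u f v" "ctx u g v" "whisk u f v = whisk u g v"
  shows "f = g"
proof (rule step_eqI[OF assms(1-3)])
  obtain i a j b where "pth f = [(i, a)]" "pth g = [(j, b)]" using assms(1,2) by (metis step_pth)
  then show "pth f = pth g"
    using pth_step_whisk[OF assms(1,4)] pth_step_whisk[OF assms(2,5)] assms(6) by simp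
qed

lemma left_of_whisk:
  assumes "step f" "step g" "ctx u f v" "ctx u g v"
  shows "left_of (whisk u f v) (whisk u g v) \<longleftrightarrow> left_of f g"
proof -
  obtain i a j b where "pth f = [(i, a)]" "pth g = [(j, b)]" using assms(1,2) by (metis step_pth)
  then show ?thesis
    using pth_step_whisk[OF assms(1,3)] pth_step_whisk[OF assms(2,4)] by (simp add: left_of_def)
qed

text \<open>An undefined composite is the empty set, composing with the empty set gives the empty
  set again, and the empty set is not a cell.\<close>

lemma whiskD:
  assumes "one u" "one v" "c \<in> cl2" "whisk u c v \<in> cl2"
  shows "ctx u c v"
proof -
  have d: "u \<in> cl2" "v \<in> cl2" using assms oneD by blast+
  have "u \<cdot> c \<in> cl2"
  proof (rule ccontr)
    assume n: "u \<cdot> c \<notin> cl2"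
    have "u \<cdot> c = {}"
    proof -
      obtain s t where st: "wft (ext2 P) s" "u = tcls (ext2 P) s" "wft (ext2 P) t" "c = tcls (ext2 P) t"
        using d assms(3) by (metis cells2E)
      have e: "u \<cdot> c = tcls (ext2 P) (Comp 0 s t)" using st by (simp add: free2_def cmp_free_ext)
      have "\<not> wft (ext2 P) (Comp 0 s t)" using n tcls2(1) unfolding e by blast
      then show ?thesis unfolding e using teq_sound[of "ext2 P" "Comp 0 s t"] by (auto simp: tcls_def)
    qed
    then have "whisk u c v = {}" by (simp add: whisk2_def free2_def free_ext_def)
    moreover have "{} \<notin> cl2" by (auto elim!: cells2E simp: tcls_def dest: teq_refl)
    ultimately show False using assms(4) by simp
  qed
  then show ?thesis using cmp2D(2)[of u c 0] cmp2D(2)[of "u \<cdot> c" v 0] assms d by (auto simp: ctx_def whisk2_def)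
qed

lemma split_pair_whisk:
  assumes "split_pair f g f' g'" "ctx u f v"
  shows "split_pair (whisk u f v) (whisk u g v) (u \<cdot> f') (g' \<cdot> v)" "ctx u (f' \<cdot> g') v" "whisk u (f' \<cdot> g') v = (u \<cdot> f') \<cdot> (g' \<cdot> v)"
proof -
  have c: "f' \<in> cl2" "g' \<in> cl2" "t0 f' = s0 g'" "f = f' \<cdot> s1 g'" "g = s1 f' \<cdot> g'"
    using assms(1) by (auto simp: split_pair_def)
  note d = ctxD[OF assms(2)]
  have e: "t0 u = s0 f'" "t0 g' = s0 v" using d(4,5) c by simp_all
  show "split_pair (whisk u f v) (whisk u g v) (u \<cdot> f') (g' \<cdot> v)"
  proof -
    have "u \<cdot> f' \<in> cl2" "g' \<cdot> v \<in> cl2" "t0 (u \<cdot> f') = s0 (g' \<cdot> v)" "s1 (g' \<cdot> v) = s1 g' \<cdot> v" "s1 (u \<cdot> f') = u \<cdot> s1 f'"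
      using c(1-3) e d(6-11) by simp_all
    moreover have "whisk u f v = (u \<cdot> f') \<cdot> (s1 g' \<cdot> v)" "whisk u g v = (u \<cdot> s1 f') \<cdot> (g' \<cdot> v)"
      unfolding whisk2_def c(4,5) using c(1-3) e d(6,7) by (simp_all add: cmp0_assoc)
    ultimately show ?thesis by (simp add: split_pair_def)
  qed
  show "ctx u (f' \<cdot> g') v" using c(1-3) e d(1,2) by (simp add: ctx_def)
  show "whisk u (f' \<cdot> g') v = (u \<cdot> f') \<cdot> (g' \<cdot> v)"
    unfolding whisk2_def using c(1-3) e d(6-11) by (simp add: cmp0_assoc)
qed

lemma split_pair_pth:
  assumes "split_pair f g f' g'" "step f" "step g" "pth f = [(i, a)]" "pth g = [(k, b)]"
  shows "pth (f' \<cdot> g') \<approx> [(i, a), (k - slen a + tlen a, b)]"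
proof -
  note D = split_pairD[OF assms(1-3)]
  have c: "f' \<in> cl2" "g' \<in> cl2" "t0 f' = s0 g'" using assms(1) by (auto simp: split_pair_def)
  obtain l d where g: "pth g' = [(l, d)]" using D(2) by (rule step_pth)
  have f: "pth f' = [(i, a)]" using D(5) assms(4) by simp
  have "i + slen a \<le> len f'" "len (t1 f') = len f' - slen a + tlen a" using run_pth[OF c(1)] f by simp_all
  moreover have "k = len f' + l" "b = d" using D(6) g assms(5) by simp_all
  ultimately show ?thesis using pth_cmp0[OF c] f g by (simp add: add.commute add.left_commute)
qed

text \<open>The factors themselves are not determined, since the letters between the two steps may
  belong to either of them; the path of their composite is.\<close>

lemma split_pair_cell_unique:
  assumes "split_pair f g f' g'" "split_pair f g f'' g''" "step f" "step g"
  shows "f' \<cdot> g' = f'' \<cdot> g''"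
proof (rule cell_eqI)
  obtain i a k b where ab: "pth f = [(i, a)]" "pth g = [(k, b)]" using assms(3,4) by (metis step_pth)
  show "pth (f' \<cdot> g') \<approx> pth (f'' \<cdot> g'')"
    using swaps_trans[OF split_pair_pth[OF assms(1,3,4) ab] swaps_sym[OF split_pair_pth[OF assms(2,3,4) ab]]] .
  show "s1 (f' \<cdot> g') = s1 (f'' \<cdot> g'')"
  proof -
    have "s1 (x \<cdot> y) = s1 f" if "split_pair f g x y" for x y
      using that by (auto simp: split_pair_def)
    from this[OF assms(1)] this[OF assms(2)] show ?thesis by simp
  qed
qed (rule split_pair_square(3)[OF assms(1)] split_pair_square(3)[OF assms(2)])+

section \<open>Critical branchings inside overlapping ones\<close>

lemma local_branching_perm: "local_branching P fs \<Longrightarrow> mset gs = mset fs \<Longrightarrow> local_branching P gs"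
  unfolding local_branching_def using mset_eq_setD[of gs fs] by metis

lemma aspherical_perm: "mset gs = mset fs \<Longrightarrow> aspherical gs \<longleftrightarrow> aspherical fs"
  by (simp add: aspherical_def perm_class_def)

lemma peiffer_perm: "mset gs = mset fs \<Longrightarrow> peiffer P gs \<longleftrightarrow> peiffer P fs"
  by (simp add: peiffer_def perm_class_def)

lemma overlapping_perm: "mset gs = mset fs \<Longrightarrow> overlapping P gs \<longleftrightarrow> overlapping P fs"
  using local_branching_perm[of fs gs] local_branching_perm[of gs fs]
  by (auto simp: overlapping_def aspherical_perm[of gs fs] peiffer_perm[of gs fs])

lemma peiffer_local: "peiffer P fs \<Longrightarrow> local_branching P fs"
  using local_branching_perm by (auto simp: peiffer_def strict_peiffer_def perm_class_def)

lemma critical2_swap: "critical P [f, g] \<Longrightarrow> critical P [g, f]"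
  unfolding critical_def
proof (intro conjI allI impI)
  assume a: "overlapping P [f, g] \<and> (\<forall>gs. branching_le P gs [f, g] \<longrightarrow> gs = [f, g])"
  show "overlapping P [g, f]" using a overlapping_perm[of "[g, f]" "[f, g]"] by simp
  fix gs assume "branching_le P gs [g, f]"
  then obtain u v where l: "local_branching P gs" "one u" "one v" "[g, f] = map (\<lambda>f. whisk u f v) gs"
    by (auto simp: branching_le_def)
  then obtain x y where gs: "gs = [x, y]" by (auto simp: map_eq_Cons_conv)
  have "branching_le P [y, x] [f, g]" unfolding branching_le_def
    using l gs a local_branching_perm[of gs "[y, x]"] by (auto simp: overlapping_def)
  with a gs show "gs = [g, f]" by auto
qed

lemma step_trim_left:
  assumes "step f" "one x" "one y" "t0 x = s0 y" "s1 f = x \<cdot> y" "len x \<le> fst (hd (pth f))"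
  obtains f' where "step f'" "t0 x = s0 f'" "f = x \<cdot> f'" "s1 f' = y"
proof -
  obtain u a v where f: "a \<in> gens2 P" "ctx u (gen2 a) v" "f = whisk u (gen2 a) v" "pth f = [(len u, a)]"
    using assms(1) by (rule stepE)
  note d = ctxD[OF f(2)] oneD[OF assms(2)] oneD[OF assms(3)]
  have "x \<cdot> y = u \<cdot> (s1 (gen2 a) \<cdot> v)" using assms(5) f(2,3) d by (simp add: cmp0_assoc)
  note lv = levi[OF assms(2,3) d(1) _ assms(4) _ this]
  have "one (s1 (gen2 a) \<cdot> v)" "t0 u = s0 (s1 (gen2 a) \<cdot> v)" using d by (simp_all add: one_cmp0)
  then obtain z where z: "one z" "t0 x = s0 z" "t0 z = s0 (s1 (gen2 a) \<cdot> v)" "u = x \<cdot> z" "y = z \<cdot> (s1 (gen2 a) \<cdot> v)"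
    using lv assms(6) f(4) by auto
  note dz = oneD[OF z(1)]
  have k: "ctx z (gen2 a) v" using z d by (simp add: ctx_def)
  show ?thesis
  proof (rule that[of "whisk z (gen2 a) v"])
    show "step (whisk z (gen2 a) v)" using step_whisk[OF f(1) k] by blast
    show "t0 x = s0 (whisk z (gen2 a) v)" using k z by simp
    show "f = x \<cdot> whisk z (gen2 a) v" unfolding f(3) z(4) whisk2_def using d(3-) dz z(2,3) by (simp add: cmp0_assoc)
    show "s1 (whisk z (gen2 a) v) = y" unfolding z(5) using k d(3-) dz z(3) by (simp add: cmp0_assoc)
  qed
qed

lemma step_trim_right:
  assumes "step f" "one x" "one y" "t0 y = s0 x" "s1 f = y \<cdot> x" "fst (hd (pth f)) + slen (snd (hd (pth f))) \<le> len y"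
  obtains f' where "step f'" "t0 f' = s0 x" "f = f' \<cdot> x" "s1 f' = y"
proof -
  obtain u a v where f: "a \<in> gens2 P" "ctx u (gen2 a) v" "f = whisk u (gen2 a) v" "pth f = [(len u, a)]"
    using assms(1) by (rule stepE)
  note d = ctxD[OF f(2)] oneD[OF assms(2)] oneD[OF assms(3)]
  have "(u \<cdot> s1 (gen2 a)) \<cdot> v = y \<cdot> x" using assms(5) f(2,3) d by simp
  note lv = levi[OF _ d(2) assms(3,2) _ assms(4) this]
  have "one (u \<cdot> s1 (gen2 a))" "t0 (u \<cdot> s1 (gen2 a)) = s0 v" using d by (simp_all add: one_cmp0)
  moreover have "len (u \<cdot> s1 (gen2 a)) \<le> len y" using assms(6) f d by simp
  ultimately obtain z where z: "one z" "t0 (u \<cdot> s1 (gen2 a)) = s0 z" "t0 z = s0 x" "y = u \<cdot> s1 (gen2 a) \<cdot> z" "v = z \<cdot> x"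
    using lv by blast
  note dz = oneD[OF z(1)]
  have k: "ctx u (gen2 a) z" using z(1,2) d by (simp add: ctx_def)
  show ?thesis
  proof (rule that[of "whisk u (gen2 a) z"])
    show "step (whisk u (gen2 a) z)" using step_whisk[OF f(1) k] by blast
    show "t0 (whisk u (gen2 a) z) = s0 x" using k z by simp
    show "f = whisk u (gen2 a) z \<cdot> x" unfolding f(3) z(5) whisk2_def using ctxD[OF k] d(6-) dz z(3) by (simp add: cmp0_assoc)
    show "s1 (whisk u (gen2 a) z) = y" unfolding z(4) using k by simp
  qed
qed

text \<open>A prefix touched by neither step can be stripped from both, which gives a smaller local
  branching. By minimality that one is the branching itself, so the prefix is empty.\<close>

lemma critical_trim_left:
  assumes "critical P [f, g]" "one x" "one y" "t0 x = s0 y" "s1 f = x \<cdot> y"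
    "len x \<le> fst (hd (pth f))" "len x \<le> fst (hd (pth g))"
  shows "len x = 0"
proof -
  have l: "step f" "step g" "s1 f = s1 g" using assms(1) by (auto simp: critical_def overlapping_def local_branching2)
  obtain f' where f: "step f'" "t0 x = s0 f'" "f = x \<cdot> f'" "s1 f' = y" using step_trim_left[OF l(1) assms(2-6)] .
  obtain g' where g: "step g'" "t0 x = s0 g'" "g = x \<cdot> g'" "s1 g' = y"
    using step_trim_left[OF l(2) assms(2-4) _ assms(7)] assms(5) l(3) by metis
  have "t0 f' = t0 g'" using par0'(2)[of f' g'] f g by simp
  then have "[f, g] = map (\<lambda>c. whisk x c (t0 f')) [f', g']" using f g oneD[OF assms(2)] c2_simps(22)[of "x \<cdot> g'"]
      c2_simps(22)[of "x \<cdot> f'"] by (simp add: whisk2_def)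
  moreover have "one (t0 f')" using f by (simp add: one_t0)
  ultimately have "branching_le P [f', g'] [f, g]"
    unfolding branching_le_def using f g l assms(2) by (auto simp: local_branching2)
  then have "f' = f" using assms(1) by (auto simp: critical_def)
  then have "wd f = wd x @ wd f" using f oneD[OF assms(2)] by (metis step_cells wd_cmp0)
  then show ?thesis by simp
qed

lemma critical_trim_right:
  assumes "critical P [f, g]" "one x" "one y" "t0 y = s0 x" "s1 f = y \<cdot> x"
    "fst (hd (pth f)) + slen (snd (hd (pth f))) \<le> len y" "fst (hd (pth g)) + slen (snd (hd (pth g))) \<le> len y"
  shows "len x = 0"
proof -
  have l: "step f" "step g" "s1 f = s1 g" using assms(1) by (auto simp: critical_def overlapping_def local_branching2)
  obtain f' where f: "step f'" "t0 f' = s0 x" "f = f' \<cdot> x" "s1 f' = y" using step_trim_right[OF l(1) assms(2-6)] .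
  obtain g' where g: "step g'" "t0 g' = s0 x" "g = g' \<cdot> x" "s1 g' = y"
    using step_trim_right[OF l(2) assms(2-4) _ assms(7)] assms(5) l(3) by metis
  have "s0 f' = s0 g'" using par0'(1)[of f' g'] f g by simp
  then have "[f, g] = map (\<lambda>c. whisk (s0 f') c x) [f', g']"
    using f(1,3) g(1,3) c2_simps(21)[of f'] c2_simps(21)[of g'] by (simp add: whisk2_def)
  moreover have "one (s0 f')" using f by (simp add: one_s0)
  ultimately have "branching_le P [f', g'] [f, g]"
    unfolding branching_le_def using f g l assms(2) by (auto simp: local_branching2)
  then have "f' = f" using assms(1) by (auto simp: critical_def)
  then have "wd f = wd f @ wd x" using f oneD[OF assms(2)] by (metis step_cells wd_cmp0)
  then show ?thesis by simp
qed

text \<open>If one context were longer than the other, the difference would be a piece of the source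
  of the other core that neither of its steps touches, against \<open>critical_trim_left\<close> or
  \<open>critical_trim_right\<close>. Equal lengths then give equal cells by cancellation.\<close>

lemma critical_core_unique:
  assumes c: "critical P [f, g]" "critical P [f', g']"
    and k: "ctx u f v" "ctx u g v" "ctx u' f' v'" "ctx u' g' v'"
    and e: "whisk u f v = whisk u' f' v'" "whisk u g v = whisk u' g' v'"
  shows "u = u' \<and> v = v' \<and> f = f' \<and> g = g'"
proof -
  have l: "step f" "step g" "s1 f = s1 g" "step f'" "step g'" "s1 f' = s1 g'"
    using c by (auto simp: critical_def overlapping_def local_branching2)
  note d = ctxD[OF k(1)] ctxD[OF k(3)]
  obtain i a where f: "pth f = [(i, a)]" using l(1) by (rule step_pth)
  obtain i' a' where f': "pth f' = [(i', a')]" using l(4) by (rule step_pth)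
  obtain m b where g: "pth g = [(m, b)]" using l(2) by (rule step_pth)
  obtain m' b' where g': "pth g' = [(m', b')]" using l(5) by (rule step_pth)
  have pos: "len u + i = len u' + i'" "a = a'" "len u + m = len u' + m'" "b = b'"
    using pth_step_whisk[OF l(1) k(1)] pth_step_whisk[OF l(4) k(3)] pth_step_whisk[OF l(2) k(2)] pth_step_whisk[OF l(5) k(4)]
      e f f' g g' by simp_all
  have s: "u \<cdot> s1 f \<cdot> v = u' \<cdot> s1 f' \<cdot> v'" using arg_cong[OF e(1), of s1] k by simp
  \<comment> \<open>The surplus \<open>z\<close> of the longer left context is a prefix of the
    source of \<open>f\<close>. Both \<open>f\<close> and \<open>g\<close> act behind it, because
    the absolute positions of the steps agree.\<close>
  have A: "\<not> len u < len u'" if c: "critical P [f, g]" and d: "ctx u f v" "ctx u' f' v'" and s: "u \<cdot> s1 f \<cdot> v = u' \<cdot> s1 f' \<cdot> v'"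
    and p: "len u + i = len u' + i'" "len u + m = len u' + m'" "pth f = [(i, a)]" "pth g = [(m, b)]" "step f"
    for u u' v v' f f' g i i' m m' a b
  proof
    assume lt: "len u < len u'"
    note d = ctxD[OF d(1)] ctxD[OF d(2)]
    have s': "u \<cdot> (s1 f \<cdot> v) = u' \<cdot> (s1 f' \<cdot> v')" using s d by (simp add: cmp0_assoc)
    have o: "one (s1 f \<cdot> v)" "one (s1 f' \<cdot> v')" "t0 u = s0 (s1 f \<cdot> v)" "t0 u' = s0 (s1 f' \<cdot> v')"
      using d by (simp_all add: one_cmp0)
    obtain z where z: "one z" "t0 u = s0 z" "t0 z = s0 (s1 f' \<cdot> v')" "u' = u \<cdot> z" "s1 f \<cdot> v = z \<cdot> (s1 f' \<cdot> v')"
      using levi[OF d(1) o(1) d(12) o(2-4) s'] lt by auto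
    have lz: "len u' = len u + len z" using z d oneD[OF z(1)] by simp
    have "len z \<le> len (s1 f)" using run_pth[OF step_cells[OF p(5)]] p(1,3) lz p(5) by simp
    then obtain w where w: "one w" "t0 z = s0 w" "s1 f = z \<cdot> w"
      using levi[OF z(1) o(2) _ d(2) z(3) _ z(5)[symmetric]] d by (metis one_s1 c2_simps(5))
    have "len z = 0" by (rule critical_trim_left[OF c z(1) w]) (use p lz in simp_all)
    then show False using lz lt by simp
  qed
  have lu: "len u = len u'"
    using A[OF c(1) k(1,3) s pos(1,3) f g l(1)] A[OF c(2) k(3,1) s[symmetric] pos(1,3)[symmetric] f' g' l(4)] by simp
  \<comment> \<open>The same on the right, once the left contexts are known to have equal length:
    the replaced factors end before the surplus \<open>z\<close>.\<close>
  have B: "\<not> len v < len v'" if c: "critical P [f, g]" and d: "ctx u f v" "ctx u' f' v'" and s: "u \<cdot> s1 f \<cdot> v = u' \<cdot> s1 f' \<cdot> v'"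
    and lu: "len u = len u'" and p: "pth f = [(i, a)]" "pth g = [(m, b)]" "pth f' = [(i, a)]" "pth g' = [(m, b)]" "step f'" "step g'" "s1 f' = s1 g'"
    for u u' v v' f f' g g' i m a b
  proof
    assume lt: "len v < len v'"
    note d = ctxD[OF d(1)] ctxD[OF d(2)]
    have o: "one (u \<cdot> s1 f)" "one (u' \<cdot> s1 f')" "t0 (u \<cdot> s1 f) = s0 v" "t0 (u' \<cdot> s1 f') = s0 v'"
      using d by (simp_all add: one_cmp0)
    have "wd (u \<cdot> s1 f) @ wd v = wd (u' \<cdot> s1 f') @ wd v'" using arg_cong[OF s, of wd] o d by simp
    then have "len (u \<cdot> s1 f) + len v = len (u' \<cdot> s1 f') + len v'" by (metis length_append)
    then have "len (u' \<cdot> s1 f') \<le> len (u \<cdot> s1 f)" using lt by linarith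
    from levi[OF o(2) d(13) o(1) d(2) o(4) o(3) s[symmetric] this] obtain z
      where z: "one z" "t0 (u' \<cdot> s1 f') = s0 z" "t0 z = s0 v" "u \<cdot> s1 f = u' \<cdot> s1 f' \<cdot> z" "v' = z \<cdot> v" by metis
    note dz = oneD[OF z(1)]
    have tz: "t0 f' = s0 z" using z(2) d by simp
    have oz: "one (s1 f' \<cdot> z)" using d tz z by (simp add: one_cmp0)
    have uf: "u \<cdot> s1 f = u' \<cdot> (s1 f' \<cdot> z)" using z(4) d dz tz by (simp add: cmp0_assoc)
    have "s1 f = s1 f' \<cdot> z"
      by (rule one_cancel_left(2)[OF d(1) _ d(12) oz _ _ uf lu]) (use d tz dz in simp_all)
    moreover have "i + slen a \<le> len (s1 f')" "m + slen b \<le> len (s1 f')"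
      using run_pth[of f'] run_pth[of g'] p wd_s1[of g'] wd_s1[of f'] by (auto simp del: wd_s1)
    moreover have "t0 (s1 f') = s0 z" "one (s1 f')" using d tz by simp_all
    ultimately have "len z = 0" using critical_trim_right[OF c z(1), of "s1 f'"] p(1,2) by simp
    then show False using z(5) lt dz d z(3) by simp
  qed
  have pp: "pth f' = [(i, a)]" "pth g' = [(m, b)]" using pos lu f' g' by simp_all
  have lv: "len v = len v'"
    using B[OF c(1) k(1,3) s lu f g pp l(4-6)] B[OF c(2) k(3,1) s[symmetric] lu[symmetric] pp f g l(1-3)] by simp
  have o: "one (s1 f \<cdot> v)" "one (s1 f' \<cdot> v')" "t0 u = s0 (s1 f \<cdot> v)" "t0 u' = s0 (s1 f' \<cdot> v')"
    using d by (simp_all add: one_cmp0)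
  have s': "u \<cdot> (s1 f \<cdot> v) = u' \<cdot> (s1 f' \<cdot> v')" using s d by (simp add: cmp0_assoc)
  note q = one_cancel_left[OF d(1) o(1) d(12) o(2-4) s' lu]
  have "len (s1 f) + len v = len (s1 f') + len v'" using arg_cong[OF q(2), of len] d by simp
  then have ls: "len (s1 f) = len (s1 f')" using lv by simp
  have pr: "one (s1 f)" "one (s1 f')" "t0 (s1 f) = s0 v" "t0 (s1 f') = s0 v'" using d by simp_all
  note q2 = one_cancel_left[OF pr(1) d(2) pr(2) d(13) pr(3,4) q(2) ls]
  have "f = f'" "g = g'" using step_eqI[OF l(1,4) q2(1)] step_eqI[OF l(2,5)] q2(1) l f g pp by simp_all
  with q(1) q2(2) show ?thesis by blast
qed

lemma whisk_whisk:
  assumes "ctx u c v" "one x" "one y" "t0 x = s0 u" "t0 v = s0 y"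
  shows "whisk x (whisk u c v) y = whisk (x \<cdot> u) c (v \<cdot> y)" "ctx (x \<cdot> u) c (v \<cdot> y)" "ctx x (whisk u c v) y"
  using F.wh_wh(2-4)[OF F.is3_id[OF ctxD(3)[OF assms(1)]] assms] by blast+

lemma whisk_unit: "c \<in> cl2 \<Longrightarrow> whisk (s0 c) c (t0 c) = c"
  by (simp add: whisk2_def)

lemma strict_peiffer_whisk:
  assumes p: "strict_peiffer P ys" and l: "local_branching P (map (\<lambda>c. whisk u c v) ys)"
    and na: "\<not> aspherical (map (\<lambda>c. whisk u c v) ys)" and uv: "one u" "one v"
  shows "strict_peiffer P (map (\<lambda>c. whisk u c v) ys)"
proof -
  let ?W = "\<lambda>c. whisk u c v"
  from p obtain v1 v2 m fs where q: "local_branching P ys" "one v1" "one v2" "\<forall>f \<in> set ys. s1 f = v1 \<cdot> v2"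
    "1 \<le> m" "m < length ys" "length fs = length ys" "set fs \<subseteq> cl2" "\<forall>j<m. ys ! j = fs ! j \<cdot> v2"
    "\<forall>j. m \<le> j \<and> j < length ys \<longrightarrow> ys ! j = v1 \<cdot> fs ! j"
    unfolding strict_peiffer_def by blast
  note d = oneD[OF uv(1)] oneD[OF uv(2)] oneD[OF q(2)] oneD[OF q(3)]
  have cs: "y \<in> cl2" "whisk u y v \<in> cl2" if "y \<in> set ys" for y
    using that q(1) l unfolding local_branching_def by (auto simp: step_iff)
  have ne: "hd ys \<in> set ys" using q(6) by (cases ys) auto
  have "v1 \<cdot> v2 \<in> cl2" using cs(1)[OF ne] q(4) ne by (metis c2_simps(1))
  then have v12: "t0 v1 = s0 v2" using cmp2D(2) d by blast
  have k: "ctx u y v" if "y \<in> set ys" for y using whiskD uv cs that by blast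
  have "s1 (hd ys) = v1 \<cdot> v2" using q(4) ne by blast
  then have "s0 (hd ys) = s0 v1" "t0 (hd ys) = t0 v2"
    using c2_simps(3,5)[OF cs(1)[OF ne]] d v12 cmp0_simps(2,3)[of v1 v2] by metis+
  then have e: "t0 u = s0 v1" "t0 v2 = s0 v" using ctxD(4,5)[OF k[OF ne]] by simp_all
  \<comment> \<open>The \<open>1\<close>-cell \<open>u\<close> is absorbed by the factors left of
    the cut, \<open>v\<close> by those right of it.\<close>
  define fs' where "fs' = map (\<lambda>j. if j < m then u \<cdot> fs ! j else fs ! j \<cdot> v) [0..<length ys]"
  have A: "fs ! j \<in> cl2" if "j < length ys" for j using q(7,8) that nth_mem[of j fs] by auto
  have B: "t0 (fs ! j) = s0 v2" "t0 u = s0 (fs ! j)" if "j < m" for j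
  proof -
    have y: "ys ! j \<in> set ys" "ys ! j = fs ! j \<cdot> v2" "j < length ys"
      using nth_mem[of j ys] that q(6) q(9)[rule_format, OF that] by simp_all
    show t: "t0 (fs ! j) = s0 v2" using cmp2D(2)[of "fs ! j" v2 0] A y cs(1) d by metis
    show "t0 u = s0 (fs ! j)" using ctxD(4)[OF k[OF y(1)]] y(2) A[OF y(3)] d t by simp
  qed
  have B': "t0 v1 = s0 (fs ! j)" "t0 (fs ! j) = s0 v" if "m \<le> j" "j < length ys" for j
  proof -
    have y: "ys ! j \<in> set ys" "ys ! j = v1 \<cdot> fs ! j"
      using nth_mem[of j ys] that q(10)[rule_format, of j] by simp_all
    show t: "t0 v1 = s0 (fs ! j)" using cmp2D(2)[of v1 "fs ! j" 0] A that y cs(1) d by metis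
    show "t0 (fs ! j) = s0 v" using ctxD(5)[OF k[OF y(1)]] y(2) A[OF that(2)] d t by simp
  qed
  have "\<forall>f \<in> set (map ?W ys). s1 f = (u \<cdot> v1) \<cdot> (v2 \<cdot> v)"
    using k q(4) d e v12 by (auto simp: cmp0_assoc)
  moreover have "\<forall>j<m. map ?W ys ! j = fs' ! j \<cdot> (v2 \<cdot> v)"
  proof (intro allI impI)
    fix j assume j: "j < m"
    then show "map ?W ys ! j = fs' ! j \<cdot> (v2 \<cdot> v)"
      using q(6,9) A[of j] B[OF j] d e by (simp add: fs'_def whisk2_def cmp0_assoc)
  qed
  moreover have "\<forall>j. m \<le> j \<and> j < length (map ?W ys) \<longrightarrow> map ?W ys ! j = (u \<cdot> v1) \<cdot> fs' ! j"
  proof (intro allI impI)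
    fix j assume j: "m \<le> j \<and> j < length (map ?W ys)"
    then have j': "m \<le> j" "j < length ys" by simp_all
    then show "map ?W ys ! j = (u \<cdot> v1) \<cdot> fs' ! j"
      using q(6,10) A[OF j'(2)] B'[OF j'] d e by (simp add: fs'_def whisk2_def cmp0_assoc)
  qed
  moreover have "set fs' \<subseteq> cl2"
  proof -
    have "fs' ! i \<in> cl2" if "i < length fs'" for i
      using that A[of i] B[of i] B'[of i] d by (simp add: fs'_def)
    then show ?thesis by (metis in_set_conv_nth subsetI)
  qed
  moreover have "length fs' = length (map ?W ys)" "m < length (map ?W ys)" using q(6) by (simp_all add: fs'_def)
  moreover have o: "one (u \<cdot> v1)" "one (v2 \<cdot> v)" using one_cmp0 uv q(2,3) e by blast+
  ultimately show ?thesis unfolding strict_peiffer_def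
    by (intro conjI l na, intro bexI[OF _ o(1)] bexI[OF _ o(2)] exI[of _ m] exI[of _ fs'] conjI q(5)) blast+
qed

lemma overlapping_unwhisk:
  assumes o: "overlapping P (map (\<lambda>c. whisk u c v) gs)" and l: "local_branching P gs" and uv: "one u" "one v"
  shows "overlapping P gs"
proof -
  let ?W = "\<lambda>c. whisk u c v"
  have "\<not> aspherical gs"
  proof
    assume "aspherical gs"
    then obtain ys i where y: "mset ys = mset gs" "Suc i < length ys" "ys ! i = ys ! Suc i"
      by (auto simp: aspherical_def perm_class_def)
    then have "mset (map ?W ys) = mset (map ?W gs)" "map ?W ys ! i = map ?W ys ! Suc i" by simp_all
    then have "aspherical (map ?W gs)" unfolding aspherical_def perm_class_def
      by (intro bexI[of _ "map ?W ys"] exI[of _ i]) (use y(2) in simp_all)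
    with o show False by (simp add: overlapping_def)
  qed
  moreover have "\<not> peiffer P gs"
  proof
    assume "peiffer P gs"
    then obtain ys where y: "mset ys = mset gs" "strict_peiffer P ys" by (auto simp: peiffer_def perm_class_def)
    then have m: "mset (map ?W ys) = mset (map ?W gs)" by simp
    then have "strict_peiffer P (map ?W ys)"
      using o[unfolded overlapping_def] aspherical_perm[OF m] local_branching_perm[OF _ m]
      by (intro strict_peiffer_whisk[OF y(2) _ _ uv]) blast+
    then have "peiffer P (map ?W gs)" using m unfolding peiffer_def perm_class_def by blast
    with o show False by (simp add: overlapping_def)
  qed
  ultimately show ?thesis using l by (simp add: overlapping_def)
qed

lemma local_branching_mapD:
  assumes "local_branching P (map (\<lambda>c. whisk u c v) gs)" "local_branching P gs" "one u" "one v" "g \<in> set gs"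
  shows "ctx u g v"
proof -
  have "step (whisk u g v)" "step g" using assms by (auto simp: local_branching_def)
  then show ?thesis using whiskD assms(3,4) by simp
qed

text \<open>An overlapping branching that is not minimal arises by a context that adds letters, so
  the \<open>1\<close>-source of the smaller branching is shorter; the smaller one is still
  overlapping, and the descent ends at a critical branching.\<close>

lemma overlapping_core:
  assumes "overlapping P fs" "fs \<noteq> []"
  shows "\<exists>u v gs. critical P gs \<and> one u \<and> one v \<and> fs = map (\<lambda>c. whisk u c v) gs \<and> (\<forall>g \<in> set gs. ctx u g v)"
  using assms
proof (induction "len (hd fs)" arbitrary: fs rule: less_induct)
  case less
  have l: "local_branching P fs" using less.prems(1) by (simp add: overlapping_def)
  have h: "hd fs \<in> set fs" using less.prems(2) by simp
  have st: "step f" "s1 f = s1 (hd fs)" "f \<in> cl2" if "f \<in> set fs" for f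
    using l h that unfolding local_branching_def by (blast, blast, simp)
  show ?case
  proof (cases "critical P fs")
    case True
    let ?u = "s0 (hd fs)" and ?v = "t0 (hd fs)"
    have e: "s0 f = ?u" "t0 f = ?v" if "f \<in> set fs" for f
      using par0'[of "hd fs" f] st[OF that] st[OF h] by simp_all
    have o: "one ?u" "one ?v" using st(3)[OF h] by (simp_all add: one_s0 one_t0)
    have "whisk ?u f ?v = f" "ctx ?u f ?v" if "f \<in> set fs" for f
      using whisk_unit[of f] e[OF that] st(3)[OF that] o st(3)[OF h] by (simp_all add: ctx_def)
    then have "fs = map (\<lambda>c. whisk ?u c ?v) fs" "\<forall>g \<in> set fs. ctx ?u g ?v" by (simp_all add: map_idI)
    with True o show ?thesis by blast
  next
    case False
    then obtain gs where "branching_le P gs fs" "gs \<noteq> fs" using less.prems by (auto simp: critical_def)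
    then obtain u v where g: "local_branching P gs" "one u" "one v" "fs = map (\<lambda>c. whisk u c v) gs" "gs \<noteq> fs"
      by (auto simp: branching_le_def)
    have k: "ctx u x v" if "x \<in> set gs" for x using local_branching_mapD[OF _ g(1-3) that] l g(4) by simp
    have ov: "overlapping P gs" using overlapping_unwhisk[OF _ g(1-3)] less.prems g(4) by simp
    have ne: "gs \<noteq> []" using g(4) less.prems(2) by auto
    then have hg: "hd gs \<in> set gs" by simp
    have hf: "hd fs = whisk u (hd gs) v" using g(4) ne by (simp add: hd_map)
    have "len (hd gs) < len (hd fs)"
    proof (rule ccontr)
      assume "\<not> len (hd gs) < len (hd fs)"
      \<comment> \<open>If no letters are added, the context consists of identities of
        \<open>0\<close>-cells and whiskering by it changes nothing, contrary to
        \<open>gs \<noteq> fs\<close>.\<close>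
      then have "wd u = []" "wd v = []" using hf k[OF hg] by simp_all
      then have uv: "s0 u = u" "s0 v = v" using wd_Nil g(2,3) by blast+
      have "whisk u x v = x" if "x \<in> set gs" for x
      proof -
        note d = ctxD[OF k[OF that]]
        have "t0 u = u" using c2_simps(17)[of u] uv d by simp
        then have "u = s0 x" using d by simp
        moreover have "v = t0 x" using uv d by simp
        ultimately show ?thesis using whisk_unit d(3) by simp
      qed
      then have "fs = gs" using g(4) by (simp add: map_idI)
      with g(5) show False by simp
    qed
    from less.hyps[OF this ov ne] obtain x y hs where
      h: "critical P hs" "one x" "one y" "gs = map (\<lambda>c. whisk x c y) hs" "\<forall>c \<in> set hs. ctx x c y" by blast
    have "hs \<noteq> []" using h(4) ne by auto
    then have hh: "hd hs \<in> set hs" by simp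
    have "ctx u (whisk x (hd hs) y) v" using k[of "whisk x (hd hs) y"] h(4) hh by simp
    moreover have kh: "ctx x (hd hs) y" using h(5) hh by blast
    ultimately have t: "t0 u = s0 x" "t0 y = s0 v" using ctxD(4,5)[of u "whisk x (hd hs) y" v] by simp_all
    have o: "one (u \<cdot> x)" "one (y \<cdot> v)" using one_cmp0 g(2,3) h(2,3) t by blast+
    have "whisk u (whisk x c y) v = whisk (u \<cdot> x) c (y \<cdot> v)" "ctx (u \<cdot> x) c (y \<cdot> v)" if "c \<in> set hs" for c
      using whisk_whisk[OF _ g(2,3) t] h(5) that by blast+
    then have "fs = map (\<lambda>c. whisk (u \<cdot> x) c (y \<cdot> v)) hs" "\<forall>c \<in> set hs. ctx (u \<cdot> x) c (y \<cdot> v)"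
      using g(4) h(4) by simp_all
    with h(1) o show ?thesis by blast
  qed
qed

lemma pair_fillingD:
  assumes "pair_filling P A f g"
  obtains a b where "step f" "step g" "s1 f = s1 g" "a \<in> cl2" "b \<in> cl2" "t1 f = s1 a" "t1 g = s1 b" "F.is3 A (f \<star> a) (g \<star> b)"
proof -
  from assms obtain a b where p: "local_branching P [f, g]" "A \<in> cl3" "a \<in> cl2" "b \<in> cl2"
    "src (free3 P) 2 A = up3 P (f \<star> a)" "tgt (free3 P) 2 A = up3 P (g \<star> b)"
    by (auto simp: pair_filling_def)
  note l = p(1)[unfolded local_branching2]
  have i: "F.is3 A (f \<star> a) (g \<star> b)" using F_is3I p by blast
  then have "f \<star> a \<in> cl2" "g \<star> b \<in> cl2" using F.is3D by blast+
  then have "t1 f = s1 a" "t1 g = s1 b" using cmp2D(2) l p step_cells by blast+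
  with l p i show ?thesis using that by blast
qed

end

section \<open>Existence, uniqueness and symmetry of canonical fillings\<close>

context squier_polygraph
begin

abbreviation "can \<equiv> canonical_filling P \<phi>"

lemma squierD:
  "bij_betw \<phi> (gens3 P) (critical_classes P 2)"
  "x \<in> gens3 P \<Longrightarrow> \<exists>f g. \<phi> x = perm_class [f, g] \<and> critical P [f, g] \<and> pair_filling P (gen3 x) f g"
proof -
  show b: "bij_betw \<phi> (gens3 P) (critical_classes P 2)" using squier by (simp add: squier2_by_def)
  assume x: "x \<in> gens3 P"
  then obtain f g where f: "[f, g] \<in> \<phi> x" "pair_filling P (gen3 x) f g" using squier unfolding squier2_by_def by blast
  have cc: "\<phi> x \<in> critical_classes P 2" using b x bij_betwE by blast
  obtain f' g' where g: "\<phi> x = perm_class [f', g']" "critical P [f', g']"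
  proof -
    obtain fs where fs: "\<phi> x = perm_class fs" "length fs = 2" "critical P fs"
      using cc by (auto simp: critical_classes_def)
    obtain f' g' where "fs = [f', g']" using fs(2) by (auto simp: numeral_2_eq_2 length_Suc_conv)
    with fs show ?thesis using that by blast
  qed
  have "[f, g] = [f', g'] \<or> [f, g] = [g', f']" using f(1) unfolding g(1) perm_class2 by simp
  then have "\<phi> x = perm_class [f, g] \<and> critical P [f, g]"
  proof
    assume "[f, g] = [f', g']" then show ?thesis using g by simp
  next
    assume e: "[f, g] = [g', f']"
    have "perm_class [f', g'] = perm_class [g', f']" unfolding perm_class2 by (rule insert_commute)
    then show ?thesis using g(1) critical2_swap[OF g(2)] e by simp
  qed
  with f show "\<exists>f g. \<phi> x = perm_class [f, g] \<and> critical P [f, g] \<and> pair_filling P (gen3 x) f g" by blast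
qed

lemma critical_gen:
  assumes "critical P [f, g]"
  obtains x where "x \<in> gens3 P" "\<phi> x = perm_class [f, g]"
proof -
  have "perm_class [f, g] \<in> critical_classes P 2"
    unfolding critical_classes_def using assms by (intro CollectI exI[of _ "[f, g]"]) simp
  then have "perm_class [f, g] \<in> \<phi> ` gens3 P" using bij_betw_imp_surj_on[OF squierD(1)] by simp
  then show ?thesis using that by (metis imageE)
qed

text \<open>The orientation of a generating \<open>3\<close>-cell is unambiguous: filling the pair
  in both orders would make its source a \<open>2\<close>-cell beginning with \<open>f\<close> and
  also with \<open>g\<close>, which \<open>steps_eq_cases\<close> excludes for overlapping
  steps.\<close>

lemma gen_filling_cases:
  assumes "critical P [f, g]" "x \<in> gens3 P" "\<phi> x = perm_class [f, g]"
  shows "pair_filling P (gen3 x) f g \<noteq> pair_filling P (gen3 x) g f"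
proof -
  obtain f' g' where "\<phi> x = perm_class [f', g']" "pair_filling P (gen3 x) f' g'" using squierD(2)[OF assms(2)] by blast
  then have "[f', g'] \<in> perm_class [f, g]" using assms(3) by (auto simp: perm_class2)
  then have A: "pair_filling P (gen3 x) f g \<or> pair_filling P (gen3 x) g f"
    using \<open>pair_filling P (gen3 x) f' g'\<close> by (auto simp: perm_class2)
  have "\<not> (pair_filling P (gen3 x) f g \<and> pair_filling P (gen3 x) g f)"
  proof
    assume "pair_filling P (gen3 x) f g \<and> pair_filling P (gen3 x) g f"
    then have p: "pair_filling P (gen3 x) f g" and q: "pair_filling P (gen3 x) g f" by blast+
    obtain a b where 1: "step f" "step g" "a \<in> cl2" "t1 f = s1 a" "F.is3 (gen3 x) (f \<star> a) (g \<star> b)" using p by (rule pair_fillingD)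
    obtain c d where 2: "c \<in> cl2" "t1 g = s1 c" "F.is3 (gen3 x) (g \<star> c) (f \<star> d)" using q by (rule pair_fillingD)
    have "up3 P (f \<star> a) = up3 P (g \<star> c)" using F.is3D(2)[OF 1(5)] F.is3D(2)[OF 2(3)] by simp
    then have e: "f \<star> a = g \<star> c" using up3_inj F.is3D(4)[OF 1(5)] by simp
    have n: "f \<noteq> g" "\<not> left_of f g" "\<not> left_of g f"
      using assms(1) unfolding critical_def overlapping2_iff by blast+
    show False
      by (rule steps_eq_cases[OF 1(1,2,3) 2(1) 1(4) 2(2) e]) (use n split_pairD(3) 1(1,2) in blast)+
  qed
  with A show ?thesis by blast
qed

text \<open>The two rules of \<open>canonical_filling\<close> for critical pairs, with no
  context.\<close>

definition core_filling :: "('a, 'b, 'c) cell2 \<Rightarrow> ('a, 'b, 'c) cell2 \<Rightarrow> ('a, 'b, 'c, 'd) cell3 \<Rightarrow> bool" where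
  "core_filling f g B \<longleftrightarrow> critical P [f, g] \<and> (\<exists>x \<in> gens3 P. \<phi> x = perm_class [f, g] \<and>
     (if pair_filling P (gen3 x) f g then B = gen3 x else inverse_cells (free3 P) 2 (gen3 x) B))"

lemma core_filling_can: "core_filling f g B \<Longrightarrow> can f g B"
  unfolding core_filling_def using critical_filling critical_filling' by (metis (no_types, lifting))

lemma core_filling_ex: "critical P [f, g] \<Longrightarrow> \<exists>B. core_filling f g B"
proof -
  assume c: "critical P [f, g]"
  then obtain x where x: "x \<in> gens3 P" "\<phi> x = perm_class [f, g]" by (rule critical_gen)
  obtain f' g' where "pair_filling P (gen3 x) f' g'" using squierD(2)[OF x(1)] by blast
  then have "gen3 x \<in> cl3" by (simp add: pair_filling_def)
  then obtain B where "inverse_cells (free3 P) 2 (gen3 x) B" using inverse3_ex by blast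
  with c x show ?thesis unfolding core_filling_def by metis
qed

lemma core_filling_unique:
  assumes "core_filling f g B" "core_filling f g B'" shows "B = B'"
proof -
  obtain x x' where x: "x \<in> gens3 P" "\<phi> x = perm_class [f, g]" "if pair_filling P (gen3 x) f g then B = gen3 x else inverse_cells (free3 P) 2 (gen3 x) B"
    "x' \<in> gens3 P" "\<phi> x' = perm_class [f, g]" "if pair_filling P (gen3 x') f g then B' = gen3 x' else inverse_cells (free3 P) 2 (gen3 x') B'"
    using assms unfolding core_filling_def by blast
  have "x = x'" using squierD(1) x(1,2,4,5) by (metis bij_betw_imp_inj_on inj_onD)
  with x(3,6) show ?thesis using inverse_cells_unique[of "free3 P" 2 "gen3 x" B B'] by (auto split: if_splits)
qed

lemma core_filling_is3:
  assumes "core_filling f g B"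
  obtains a b where "step f" "step g" "s1 f = s1 g" "a \<in> cl2" "b \<in> cl2" "t1 f = s1 a" "t1 g = s1 b" "F.is3 B (f \<star> a) (g \<star> b)"
proof -
  obtain x where x: "critical P [f, g]" "x \<in> gens3 P" "\<phi> x = perm_class [f, g]" "if pair_filling P (gen3 x) f g then B = gen3 x else inverse_cells (free3 P) 2 (gen3 x) B"
    using assms unfolding core_filling_def by blast
  show ?thesis
  proof (cases "pair_filling P (gen3 x) f g")
    case True
    then show ?thesis using x(4) that by (auto elim: pair_fillingD)
  next
    case False
    then have "pair_filling P (gen3 x) g f" using gen_filling_cases[OF x(1-3)] by blast
    then obtain a b where p: "step g" "step f" "s1 g = s1 f" "a \<in> cl2" "b \<in> cl2" "t1 g = s1 a" "t1 f = s1 b" "F.is3 (gen3 x) (g \<star> a) (f \<star> b)"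
      by (rule pair_fillingD)
    have "F.is3 B (f \<star> b) (g \<star> a)" using F.is3_of_inverse(1)[OF p(8)] x(4) False by simp
    with p show ?thesis using that[of b a] by simp
  qed
qed

lemma inverse_cells_sym:
  assumes "strict_category E" "inverse_cells E i x y" "i < dim E" shows "inverse_cells E i y x"
  using assms by (auto simp: inverse_cells_def)

lemma core_filling_swap:
  assumes "core_filling f g B" "inverse_cells (free3 P) 2 B B'"
  shows "core_filling g f B'"
proof -
  obtain x where x: "critical P [f, g]" "x \<in> gens3 P" "\<phi> x = perm_class [f, g]" "if pair_filling P (gen3 x) f g then B = gen3 x else inverse_cells (free3 P) 2 (gen3 x) B"
    using assms unfolding core_filling_def by blast
  have c: "critical P [g, f]" "\<phi> x = perm_class [g, f]" using critical2_swap[OF x(1)] x(3) by (auto simp: perm_class2)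
  note e = gen_filling_cases[OF x(1-3)]
  show ?thesis
  proof (cases "pair_filling P (gen3 x) f g")
    case True
    then show ?thesis unfolding core_filling_def using c x(2,4) e assms(2) by (metis (full_types))
  next
    case False
    then have "B' = gen3 x"
      using x(4) inverse_cells_unique[of "free3 P" 2 B "gen3 x" B'] inverse_cells_sym[of "free3 P" 2 "gen3 x" B] assms(2) by simp
    then show ?thesis unfolding core_filling_def using c x(2) e False by metis
  qed
qed

lemma split_pair_can:
  assumes "split_pair f g f' g'" "step f" "step g"
  shows "can f g (up3 P (f' \<cdot> g'))" "can g f (up3 P (f' \<cdot> g'))"
proof -
  note D = split_pairD[OF assms]
  have l: "local_branching P [f, g]" "local_branching P [g, f]" using assms(2,3) D(4) by (simp_all add: local_branching2)
  then have p: "peiffer P [f, g]" "peiffer P [g, f]" using D(3) peiffer2_iff by blast+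
  have c: "f' \<in> cl2" "g' \<in> cl2" "f = f' \<cdot> s1 g'" "g = s1 f' \<cdot> g'" using assms(1) by (auto simp: split_pair_def)
  show "can f g (up3 P (f' \<cdot> g'))" using peiffer_filling[OF c(1,2) refl refl c(3,4) p(1)] .
  show "can g f (up3 P (f' \<cdot> g'))" using peiffer_filling'[OF c(2,1) refl refl c(4,3) p(2)] .
qed

lemma can_wh: "can f g A \<Longrightarrow> one u \<Longrightarrow> one v \<Longrightarrow> local_branching P [whisk u f v, whisk u g v] \<Longrightarrow>
    can (whisk u f v) (whisk u g v) (F.wh u A v)"
  using whisker_filling by (simp add: F.wh_def F.wl_def F.wr_def)

lemma core_filling_unit:
  assumes "core_filling f g B"
  shows "ctx (s0 f) f (t0 f)" "ctx (s0 f) g (t0 f)" "f = whisk (s0 f) f (t0 f)" "g = whisk (s0 f) g (t0 f)"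
    "B = F.wh (s0 f) B (t0 f)"
proof -
  obtain a b where l: "step f" "step g" "s1 f = s1 g" "a \<in> cl2" "t1 f = s1 a" "F.is3 B (f \<star> a) (g \<star> b)"
    using assms by (rule core_filling_is3)
  have p: "s0 g = s0 f" "t0 g = t0 f" using par0'[of f g] l by simp_all
  then show "ctx (s0 f) f (t0 f)" "ctx (s0 f) g (t0 f)" "f = whisk (s0 f) f (t0 f)" "g = whisk (s0 f) g (t0 f)"
    using l(1,2) whisk_unit[of f] whisk_unit[of g] by (simp_all add: ctx_def one_s0 one_t0)
  have "s0 (f \<star> a) = s0 f" "t0 (f \<star> a) = t0 f" using l by simp_all
  then show "B = F.wh (s0 f) B (t0 f)" unfolding F.wh_def using F.wl_one[OF l(6)] F.wr_one[OF l(6)] by simp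
qed

text \<open>A derivation may whisker several times and around any of the basic shapes. Nested
  contexts compose, and whiskered identities and Peiffer squares are again of their kind, so one
  context around a critical core remains.\<close>

lemma can_cases:
  assumes "can f g A"
  shows "step f \<and> step g \<and> s1 f = s1 g \<and>
    (f = g \<and> A = up3 P f \<or> (\<exists>f' g'. split_pair f g f' g' \<and> A = up3 P (f' \<cdot> g')) \<or>
     (\<exists>f' g'. split_pair g f f' g' \<and> A = up3 P (f' \<cdot> g')) \<or>
     (\<exists>u f0 g0 v B. core_filling f0 g0 B \<and> ctx u f0 v \<and> ctx u g0 v \<and> f = whisk u f0 v \<and> g = whisk u g0 v \<and> A = F.wh u B v))"
  using assms
proof (induction rule: canonical_filling.induct)
  case (aspherical_filling f) then show ?case by simp
next
  case (peiffer_filling f' g' v1 v2 f g)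
  have l: "step f" "step g" "s1 f = s1 g" using peiffer_local[OF peiffer_filling(7)] by (auto simp: local_branching2)
  have "f' \<cdot> s1 g' \<in> cl2" using step_cells[OF l(1)] unfolding peiffer_filling(3,5) .
  then have "t0 f' = s0 g'" using cmp2D(2)[of f' "s1 g'" 0] peiffer_filling(1,2) by simp
  then have "split_pair f g f' g'" using peiffer_filling(1-6) unfolding split_pair_def by blast
  with l show ?case by blast
next
  case (peiffer_filling' f' g' v1 v2 f g)
  have l: "step f" "step g" "s1 f = s1 g" using peiffer_local[OF peiffer_filling'(7)] by (auto simp: local_branching2)
  have "g' \<cdot> s1 f' \<in> cl2" using step_cells[OF l(2)] unfolding peiffer_filling'(4,6) .
  then have "t0 g' = s0 f'" using cmp2D(2)[of g' "s1 f'" 0] peiffer_filling'(1,2) by simp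
  then have "split_pair g f g' f'" using peiffer_filling'(1-6) unfolding split_pair_def by blast
  with l show ?case by blast
next
  case (critical_filling f g x)
  then have c: "core_filling f g (gen3 x)" unfolding core_filling_def by auto
  then obtain l: "step f" "step g" "s1 f = s1 g" by (rule core_filling_is3)
  show ?case using l c core_filling_unit[OF c] by blast
next
  case (critical_filling' f g x B)
  then have c: "core_filling f g B" unfolding core_filling_def by auto
  then obtain l: "step f" "step g" "s1 f = s1 g" by (rule core_filling_is3)
  show ?case using l c core_filling_unit[OF c] by blast
next
  case (whisker_filling f g A u v)
  let ?A = "cmp (free3 P) 0 (cmp (free3 P) 0 (up3 P u) A) (up3 P v)"
  have A: "?A = F.wh u A v" by (simp add: F.wh_def F.wl_def F.wr_def)
  have l: "step (whisk u f v)" "step (whisk u g v)" "s1 (whisk u f v) = s1 (whisk u g v)"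
    using whisker_filling(4) unfolding local_branching2 by blast+
  have l0: "step f" "step g" "s1 f = s1 g" using whisker_filling.IH by blast+
  have k: "ctx u f v" "ctx u g v" using whiskD whisker_filling(2,3) l l0 step_cells by blast+
  from whisker_filling.IH consider "f = g" "A = up3 P f" | f' g' where "split_pair f g f' g'" "A = up3 P (f' \<cdot> g')"
    | f' g' where "split_pair g f f' g'" "A = up3 P (f' \<cdot> g')"
    | x f0 g0 y B where "core_filling f0 g0 B" "ctx x f0 y" "ctx x g0 y" "f = whisk x f0 y" "g = whisk x g0 y" "A = F.wh x B y"
    by blast
  then show ?case
  proof cases
    case 1
    then show ?thesis using l A k by simp
  next
    case 2
    then show ?thesis using l A split_pair_whisk[OF 2(1) k(1)] by (metis F.wh_id)
  next
    case 3
    then show ?thesis using l A split_pair_whisk[OF 3(1) k(2)] by (metis F.wh_id)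
  next
    case 4
    obtain a b where c: "a \<in> cl2" "f0 \<in> cl2" "t1 f0 = s1 a" "F.is3 B (f0 \<star> a) (g0 \<star> b)"
      using core_filling_is3[OF 4(1)] step_cells by metis
    have t: "t0 u = s0 x" "t0 y = s0 v" using ctxD(4,5)[OF k(1)] 4(2,4) by simp_all
    have k': "ctx x (f0 \<star> a) y" using F.ctx_cmp1(1)[OF c(2,1,3)] 4(2) by simp
    have "F.wh u A v = F.wh (u \<cdot> x) B (y \<cdot> v)"
      unfolding 4(6) using F.wh_wh(1)[OF c(4) k' whisker_filling(2,3) t] .
    moreover have "whisk u f v = whisk (u \<cdot> x) f0 (y \<cdot> v)" "ctx (u \<cdot> x) f0 (y \<cdot> v)"
      unfolding 4(4) using whisk_whisk(1,2)[OF 4(2) whisker_filling(2,3) t] by blast+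
    moreover have "whisk u g v = whisk (u \<cdot> x) g0 (y \<cdot> v)" "ctx (u \<cdot> x) g0 (y \<cdot> v)"
      unfolding 4(5) using whisk_whisk(1,2)[OF 4(3) whisker_filling(2,3) t] by blast+
    ultimately show ?thesis using l 4(1) unfolding A by blast
  qed
qed

lemma core_not_left:
  assumes "core_filling f0 g0 B" "ctx u f0 v" "ctx u g0 v"
  shows "whisk u f0 v \<noteq> whisk u g0 v" "\<not> left_of (whisk u f0 v) (whisk u g0 v)" "\<not> left_of (whisk u g0 v) (whisk u f0 v)"
proof -
  have c: "critical P [f0, g0]" using assms(1) unfolding core_filling_def by blast
  then have l: "step f0" "step g0" "s1 f0 = s1 g0" "f0 \<noteq> g0" "\<not> left_of f0 g0" "\<not> left_of g0 f0"
    unfolding critical_def overlapping2_iff local_branching2 by blast+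
  then show "whisk u f0 v \<noteq> whisk u g0 v" "\<not> left_of (whisk u f0 v) (whisk u g0 v)" "\<not> left_of (whisk u g0 v) (whisk u f0 v)"
    using whisk_inj[OF l(1-3) assms(2,3)] left_of_whisk[OF l(1,2) assms(2,3)] left_of_whisk[OF l(2,1) assms(3,2)] by blast+
qed

text \<open>The relative position of the two steps decides which shape of \<open>can_cases\<close>
  occurs. In the Peiffer case the factors may vary but their composite does not; in the overlapping
  case the critical core and its context are determined, and so is the generator by injectivity of
  \<open>\<phi>\<close>.\<close>

lemma can_unique:
  assumes "can f g A" "can f g A'"
  shows "A = A'"
proof -
  note a = can_cases[OF assms(1)] and b = can_cases[OF assms(2)]
  have l: "step f" "step g" using a by blast+
  consider "f = g" | "left_of f g" | "left_of g f" | "f \<noteq> g" "\<not> left_of f g" "\<not> left_of g f" by blast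
  then show ?thesis
  proof cases
    case 1
    have "X = up3 P f" if "can f g X" for X
      using can_cases[OF that] 1 core_not_left(1) split_pairD(3)[OF _ l] split_pairD(3)[OF _ l(2,1)] left_of_neq by blast
    from this[OF assms(1)] this[OF assms(2)] show ?thesis by simp
  next
    case 2
    have "\<exists>f' g'. split_pair f g f' g' \<and> X = up3 P (f' \<cdot> g')" if "can f g X" for X
      using can_cases[OF that] 2 core_not_left(2) split_pairD(3)[OF _ l(2,1)] left_of_neq left_of_asym by blast
    from this[OF assms(1)] this[OF assms(2)] show ?thesis using split_pair_cell_unique l by metis
  next
    case 3
    have "\<exists>f' g'. split_pair g f f' g' \<and> X = up3 P (f' \<cdot> g')" if "can f g X" for X
      using can_cases[OF that] 3 core_not_left(3) split_pairD(3)[OF _ l(1,2)] left_of_neq left_of_asym by blast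
    from this[OF assms(1)] this[OF assms(2)] show ?thesis using split_pair_cell_unique l by metis
  next
    case 4
    have X: "\<exists>u f0 g0 v B. core_filling f0 g0 B \<and> ctx u f0 v \<and> ctx u g0 v \<and> f = whisk u f0 v \<and> g = whisk u g0 v \<and> X = F.wh u B v"
      if "can f g X" for X
      using can_cases[OF that] 4 split_pairD(3)[OF _ l(1,2)] split_pairD(3)[OF _ l(2,1)] by blast
    obtain u f0 g0 v B where 1: "core_filling f0 g0 B" "ctx u f0 v" "ctx u g0 v" "f = whisk u f0 v" "g = whisk u g0 v" "A = F.wh u B v"
      using X[OF assms(1)] by blast
    obtain u' f0' g0' v' B' where 2: "core_filling f0' g0' B'" "ctx u' f0' v'" "ctx u' g0' v'" "f = whisk u' f0' v'" "g = whisk u' g0' v'" "A' = F.wh u' B' v'"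
      using X[OF assms(2)] by blast
    have "critical P [f0, g0]" "critical P [f0', g0']" using 1(1) 2(1) unfolding core_filling_def by blast+
    from critical_core_unique[OF this 1(2,3) 2(2,3)] 1(4,5) 2(4,5)
    have e: "u = u'" "v = v'" "f0 = f0'" "g0 = g0'" by simp_all
    have "B = B'" using core_filling_unique 1(1) 2(1) e by simp
    with e show ?thesis using 1(6) 2(6) by simp
  qed
qed

text \<open>Identities and Peiffer fillings are their own inverses; for a critical core the opposite
  order uses the opposite orientation of the same generator. This makes the comparison of
  \<open>g\<close> with \<open>f\<close> inverse to that of \<open>f\<close> with
  \<open>g\<close>.\<close>

lemma can_swap:
  assumes "can f g A" "inverse_cells (free3 P) 2 A A'"
  shows "can g f A'"
proof -
  note a = can_cases[OF assms(1)]
  have l: "step f" "step g" "s1 f = s1 g" using a by blast+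
  have id: "X = up3 P c" if "inverse_cells (free3 P) 2 (up3 P c) X" "c \<in> cl2" for c X
  proof -
    have "inverse_cells (free3 P) 2 (up3 P c) (up3 P c)" unfolding inverse_cells_def
      using that(2) F.comp_id(1)[OF F.is3_id[OF that(2)]] by simp
    then show ?thesis using inverse_cells_unique[of "free3 P" 2 "up3 P c"] that(1) by simp
  qed
  from a consider "f = g" "A = up3 P f" | f' g' where "split_pair f g f' g'" "A = up3 P (f' \<cdot> g')"
    | f' g' where "split_pair g f f' g'" "A = up3 P (f' \<cdot> g')"
    | x f0 g0 y B where "core_filling f0 g0 B" "ctx x f0 y" "ctx x g0 y" "f = whisk x f0 y" "g = whisk x g0 y" "A = F.wh x B y"
    by blast
  then show ?thesis
  proof cases
    case 1
    then show ?thesis using id[of f A'] assms l by simp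
  next
    case 2
    have "A' = A" using id[of "f' \<cdot> g'" A'] assms(2) 2(2) split_pair_square(3)[OF 2(1)] by simp
    then show ?thesis using split_pair_can(2)[OF 2(1) l(1,2)] 2(2) by simp
  next
    case 3
    have "A' = A" using id[of "f' \<cdot> g'" A'] assms(2) 3(2) split_pair_square(3)[OF 3(1)] by simp
    then show ?thesis using split_pair_can(1)[OF 3(1) l(2,1)] 3(2) by simp
  next
    case 4
    obtain a b where c: "step f0" "step g0" "a \<in> cl2" "t1 f0 = s1 a" "F.is3 B (f0 \<star> a) (g0 \<star> b)"
      using 4(1) by (rule core_filling_is3)
    obtain B' where B: "F.is3 B' (g0 \<star> b) (f0 \<star> a)" "cmp (free3 P) 2 B B' = up3 P (f0 \<star> a)" "cmp (free3 P) 2 B' B = up3 P (g0 \<star> b)"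
      "inverse_cells (free3 P) 2 B B'"
      using F.is3_inverse[OF c(5)] by blast
    have k: "ctx x (f0 \<star> a) y" using F.ctx_cmp1(1)[OF step_cells[OF c(1)] c(3,4)] 4(2) by simp
    have k': "ctx x (g0 \<star> b) y" using F.ctx_par[OF c(5)] k by blast
    have i: "inverse_cells (free3 P) 2 A (F.wh x B' y)"
      unfolding inverse_cells_def 4(6)
      using F.is3D(1-3)[OF F.is3_wh[OF c(5) k]] F.is3D(1-3)[OF F.is3_wh[OF B(1) k']]
        F.wh_comp[OF c(5) B(1) k] F.wh_comp[OF B(1) c(5) k'] B(2,3) k k' by simp
    then have "A' = F.wh x B' y" using inverse_cells_unique[of "free3 P" 2 A A'] assms(2) by simp
    moreover have "can g0 f0 B'" by (rule core_filling_can[OF core_filling_swap[OF 4(1) B(4)]])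
    ultimately show ?thesis
      using can_wh[of g0 f0 B' x y] 4(4,5) l ctxD(1,2)[OF 4(2)] by (simp add: local_branching2)
  qed
qed

lemma can_is3:
  assumes "can f g A"
  obtains a b where "step f" "step g" "s1 f = s1 g" "a \<in> cl2" "b \<in> cl2" "t1 f = s1 a" "t1 g = s1 b" "F.is3 A (f \<star> a) (g \<star> b)"
proof -
  note a = can_cases[OF assms(1)]
  have l: "step f" "step g" "s1 f = s1 g" using a by blast+
  note th = that[OF l]
  from a consider "f = g" "A = up3 P f" | f' g' where "split_pair f g f' g'" "A = up3 P (f' \<cdot> g')"
    | f' g' where "split_pair g f f' g'" "A = up3 P (f' \<cdot> g')"
    | x f0 g0 y B where "core_filling f0 g0 B" "ctx x f0 y" "ctx x g0 y" "f = whisk x f0 y" "g = whisk x g0 y" "A = F.wh x B y"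
    by blast
  then show ?thesis
  proof cases
    case 1
    then show ?thesis using th[of "t1 f" "t1 g"] F.is3_id[of f] l by simp
  next
    case 2
    note q = split_pair_square[OF 2(1)]
    show ?thesis by (rule th[OF q(6,7,4,5)]) (use q(1-3) 2(2) F.is3_id in simp)
  next
    case 3
    note q = split_pair_square[OF 3(1)]
    show ?thesis by (rule th[OF q(7,6,5,4)]) (use q(1-3) 3(2) F.is3_id in simp)
  next
    case 4
    obtain a b where c: "step f0" "step g0" "s1 f0 = s1 g0" "a \<in> cl2" "b \<in> cl2" "t1 f0 = s1 a" "t1 g0 = s1 b" "F.is3 B (f0 \<star> a) (g0 \<star> b)"
      using 4(1) by (rule core_filling_is3)
    note c2 = step_cells[OF c(1)] step_cells[OF c(2)]
    have k: "ctx x (f0 \<star> a) y" "ctx x a y" using F.ctx_cmp1[OF c2(1) c(4,6)] 4(2) by simp_all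
    have k': "ctx x b y" using F.ctx_cmp1[OF c2(2) c(5,7)] 4(3) by simp
    show ?thesis
    proof (rule th[of "whisk x a y" "whisk x b y"])
      show "F.is3 A (f \<star> whisk x a y) (g \<star> whisk x b y)"
        using F.is3_wh[OF c(8) k(1)] F.whisk_cmp1[OF c2(1) c(4,6) 4(2)] F.whisk_cmp1[OF c2(2) c(5,7) 4(3)]
        unfolding 4(4-6) by simp
      show "t1 f = s1 (whisk x a y)" "t1 g = s1 (whisk x b y)" unfolding 4(4,5) using 4(2,3) k k' c(6,7) by simp_all
    qed (use k k' in simp_all)
  qed
qed

lemma can_ex:
  assumes "step f" "step g" "s1 f = s1 g"
  shows "\<exists>A. can f g A"
proof -
  consider "f = g" | "left_of f g" | "left_of g f" | "overlapping P [f, g]"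
    using assms unfolding overlapping2_iff local_branching2 by blast
  then show ?thesis
  proof cases
    case 1 then show ?thesis using aspherical_filling assms by blast
  next
    case 2 then show ?thesis using left_of_split[OF assms] split_pair_can(1) assms by metis
  next
    case 3 then show ?thesis using left_of_split[OF assms(2,1) assms(3)[symmetric]] split_pair_can(2) assms by metis
  next
    case 4
    from overlapping_core[OF this list.distinct(2)] obtain u v gs
      where g': "critical P gs \<and> one u \<and> one v \<and> [f, g] = map (\<lambda>c. whisk u c v) gs \<and> (\<forall>c \<in> set gs. ctx u c v)"
      by (elim exE)
    then have g: "critical P gs" "one u" "one v" "[f, g] = map (\<lambda>c. whisk u c v) gs" by simp_all
    then obtain f0 g0 where fg: "gs = [f0, g0]" "f = whisk u f0 v" "g = whisk u g0 v" by (auto simp: map_eq_Cons_conv Cons_eq_map_conv)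
    obtain B where "can f0 g0 B" using core_filling_ex core_filling_can g(1) fg(1) by blast
    from can_wh[OF this g(2,3)] show ?thesis using assms fg by (auto simp: local_branching2)
  qed
qed

end

section \<open>Coherence below a normal form\<close>

text \<open>
  \<open>D\<close> is a \<open>(3,2)\<close>-category obtained from the free one by a functor \<open>\<pi>\<close> that does not identify \<open>2\<close>-cells
  and makes, for each critical triple, the boundary of a filling commute.
\<close>

locale coherent_model = squier_polygraph P \<phi> + three_cells P D j
  for P :: "('a, 'b, 'c, 'd, 'e) polygraph" and \<phi> and D :: "'x ncat" and j +
  fixes \<pi> :: "('a, 'b, 'c, 'd) cell3 \<Rightarrow> 'x"
  assumes functor_\<pi>: "ncat_functor (free3 P) D \<pi>"
    and \<pi>_up3: "c \<in> cl2 \<Longrightarrow> \<pi> (up3 P c) = j c"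
    and \<pi>_surj: "K \<in> cells D \<Longrightarrow> \<exists>A \<in> cl3. K = \<pi> A"
    and j_inj: "c \<in> cl2 \<Longrightarrow> d \<in> cl2 \<Longrightarrow> j c = j d \<Longrightarrow> c = d"
    and critical_triple: "critical P fs \<Longrightarrow> length fs = 3 \<Longrightarrow>
      \<exists>f g h Afg Agh Afh a b c A B1 B2. mset [f, g, h] = mset fs \<and>
        can f g Afg \<and> can g h Agh \<and> can f h Afh \<and> a \<in> cl2 \<and> b \<in> cl2 \<and> c \<in> cl2 \<and>
        A \<in> cl3 \<and> B1 \<in> cl3 \<and> B2 \<in> cl3 \<and>
        cmp (free3 P) 2 (cmp (free3 P) 2 (F.rw Afg a) (F.lw g A)) (F.rw Agh b) \<in> cl3 \<and>
        cmp (free3 P) 2 (cmp (free3 P) 2 (F.lw f B1) (F.rw Afh c)) (F.lw h B2) \<in> cl3 \<and>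
        \<pi> (cmp (free3 P) 2 (cmp (free3 P) 2 (F.rw Afg a) (F.lw g A)) (F.rw Agh b)) =
        \<pi> (cmp (free3 P) 2 (cmp (free3 P) 2 (F.lw f B1) (F.rw Afh c)) (F.lw h B2))"
begin

lemma \<pi>_simps: "A \<in> cl3 \<Longrightarrow> \<pi> A \<in> cells D \<and> src D i (\<pi> A) = \<pi> (src (free3 P) i A) \<and> tgt D i (\<pi> A) = \<pi> (tgt (free3 P) i A)"
  using functor_\<pi> by (simp add: ncat_functor_def)

lemma \<pi>_is3: "F.is3 A c d \<Longrightarrow> is3 (\<pi> A) c d"
  using \<pi>_simps[of A] \<pi>_up3[of c] \<pi>_up3[of d] by (simp add: F.is3_def is3_def)

lemma is3_lift:
  assumes "is3 K c d"
  obtains A where "F.is3 A c d" "K = \<pi> A"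
proof -
  note k = is3D[OF assms]
  obtain A where A: "A \<in> cl3" "K = \<pi> A" using \<pi>_surj k(1) by blast
  obtain c' d' where c: "F.is3 A c' d'" using F_is3_ex[OF A(1)] .
  have "is3 K c' d'" using \<pi>_is3[OF c] A(2) by simp
  then have "c' = c" "d' = d" using is3D(2-5) k(2-5) j_inj by metis+
  with c A(2) show ?thesis using that by blast
qed

lemma \<pi>_cmp: "A \<in> cl3 \<Longrightarrow> B \<in> cl3 \<Longrightarrow> i < 3 \<Longrightarrow> tgt (free3 P) i A = src (free3 P) i B \<Longrightarrow>
    \<pi> (cmp (free3 P) i A B) = cmp D i (\<pi> A) (\<pi> B)"
  using functor_\<pi> by (simp add: ncat_functor_def)

lemma \<pi>_comp: "F.is3 A c d \<Longrightarrow> F.is3 B d e \<Longrightarrow> \<pi> (cmp (free3 P) 2 A B) = \<pi> A \<bullet> \<pi> B"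
  using F.is3D(1,3)[of A c d] F.is3D(1,2)[of B d e] by (intro \<pi>_cmp) simp_all

lemma \<pi>_cmp1: "F.is3 A c d \<Longrightarrow> F.is3 B c' d' \<Longrightarrow> t1 c = s1 c' \<Longrightarrow> \<pi> (cmp (free3 P) 1 A B) = cmp D 1 (\<pi> A) (\<pi> B)"
  using F.is3D(1,9)[of A c d] F.is3D(1,8)[of B c' d'] by (intro \<pi>_cmp) simp_all

lemma \<pi>_cmp0: "F.is3 A c d \<Longrightarrow> F.is3 B c' d' \<Longrightarrow> t0 c = s0 c' \<Longrightarrow> \<pi> (cmp (free3 P) 0 A B) = cmp D 0 (\<pi> A) (\<pi> B)"
  using F.is3D(1,11)[of A c d] F.is3D(1,10)[of B c' d'] by (intro \<pi>_cmp) simp_all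

lemma \<pi>_lw: "F.is3 A c d \<Longrightarrow> f \<in> cl2 \<Longrightarrow> t1 f = s1 c \<Longrightarrow> \<pi> (F.lw f A) = lw f (\<pi> A)"
  using \<pi>_cmp1[OF F.is3_id, of f A c d] \<pi>_up3[of f] by (simp add: F.lw_def lw_def)

lemma \<pi>_rw: "F.is3 A c d \<Longrightarrow> f \<in> cl2 \<Longrightarrow> t1 c = s1 f \<Longrightarrow> \<pi> (F.rw A f) = rw (\<pi> A) f"
  using \<pi>_cmp1[OF _ F.is3_id, of A c d f] \<pi>_up3[of f] by (simp add: F.rw_def rw_def)

lemma \<pi>_wl: "F.is3 A c d \<Longrightarrow> f \<in> cl2 \<Longrightarrow> t0 f = s0 c \<Longrightarrow> \<pi> (F.wl f A) = wl f (\<pi> A)"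
  using \<pi>_cmp0[OF F.is3_id, of f A c d] \<pi>_up3[of f] by (simp add: F.wl_def wl_def)

lemma \<pi>_wr: "F.is3 A c d \<Longrightarrow> f \<in> cl2 \<Longrightarrow> t0 c = s0 f \<Longrightarrow> \<pi> (F.wr A f) = wr (\<pi> A) f"
  using \<pi>_cmp0[OF _ F.is3_id, of A c d f] \<pi>_up3[of f] by (simp add: F.wr_def wr_def)

lemma \<pi>_wh:
  assumes "F.is3 A c d" "ctx u c v"
  shows "\<pi> (F.wh u A v) = wh u (\<pi> A) v"
  using \<pi>_wr[OF F.is3_wl[OF assms(1), of u], of v] \<pi>_wl[OF assms(1), of u] ctxD[OF assms(2)]
  by (simp add: F.wh_def wh_def)

definition lt :: "('a, 'b, 'c) cell2 \<Rightarrow> ('a, 'b, 'c) cell2 \<Rightarrow> bool" (infix "\<prec>" 50) where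
  "v \<prec> u \<longleftrightarrow> (\<exists>f \<in> cl2. s1 f = u \<and> t1 f = v \<and> \<not> one f)"

lemma wfp_lt: "wfp (\<prec>)"
proof -
  have "(\<prec>) = (\<lambda>v u. \<exists>f. two_cell P f u v \<and> f \<notin> kcells (free2 P) 1)"
    by (auto simp: lt_def two_cell_def fun_eq_iff)
  then show ?thesis using terminating by simp
qed

lemma lt_irrefl: "\<not> v \<prec> v"
  using wfp_lt by (meson wfp_imp_irreflp irreflpD)

lemma not_one_cmp1:
  assumes "c \<in> cl2" "d \<in> cl2" "t1 c = s1 d" "\<not> one c \<or> \<not> one d"
  shows "\<not> one (c \<star> d)"
proof
  assume "one (c \<star> d)"
  then have "pth c @ pth d = []" using pth_cmp1[OF assms(1-3)] by simp
  then have "pth c = []" "pth d = []" by simp_all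
  moreover have "one x" if "x \<in> cl2" "pth x = []" for x
    using that spell_iff[of x "[]"] by (auto elim: spell.cases)
  ultimately show False using assms by blast
qed

lemma lt_trans_cell: "v \<prec> w \<Longrightarrow> c \<in> cl2 \<Longrightarrow> s1 c = v \<Longrightarrow> t1 c \<prec> w"
  unfolding lt_def using not_one_cmp1 by (metis cmp1_simps(1,4,5))

lemma step_not_one: "step f \<Longrightarrow> \<not> one f"
  by (auto simp: step_iff)

lemma step_lt: "step f \<Longrightarrow> t1 f \<prec> s1 f"
  unfolding lt_def using step_not_one step_cells by blast

end

text \<open>One stage of the well-founded induction, with the normal form \<open>n\<close> fixed:
  \<open>below\<close> is the induction hypothesis and \<open>reach\<close> says that
  \<open>n\<close> is a normal form of the current \<open>1\<close>-cell \<open>w\<close>.\<close>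

locale coherent_stage = coherent_model P \<phi> D j \<pi>
  for P :: "('a, 'b, 'c, 'd, 'e) polygraph" and \<phi> and D :: "'x ncat" and j \<pi> +
  fixes n w :: "('a, 'b, 'c) cell2"
  assumes normal: "normal_form P n"
    and reach: "\<exists>c \<in> cl2. s1 c = w \<and> t1 c = n"
    and below: "c \<in> cl2 \<Longrightarrow> d \<in> cl2 \<Longrightarrow> s1 c = s1 d \<Longrightarrow> t1 c = n \<Longrightarrow> t1 d = n \<Longrightarrow> s1 c \<prec> w \<Longrightarrow> \<exists>!K. is3 K c d"
begin

lemma one_n: "one n"
  using normal by (simp add: normal_form_def)

lemma from_n: "c \<in> cl2 \<Longrightarrow> s1 c = n \<Longrightarrow> t1 c = n \<and> c = n"
proof -
  assume c: "c \<in> cl2" "s1 c = n"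
  then have "rew P n (t1 c)" by (auto simp: rew_def two_cell_def)
  then have t: "t1 c = n" using normal by (simp add: normal_form_def)
  have "one c" using lt_irrefl[of n] c t unfolding lt_def by blast
  with c t show ?thesis by (simp add: oneD)
qed

definition sg :: "('a, 'b, 'c) cell2 \<Rightarrow> ('a, 'b, 'c) cell2" where
  "sg v = (SOME c. c \<in> cl2 \<and> s1 c = v \<and> t1 c = n)"

text \<open>Confluence joins \<open>c\<close> with a \<open>2\<close>-cell from \<open>w\<close> to
  \<open>n\<close>, and since \<open>n\<close> is normal the joining \<open>2\<close>-cell out of
  \<open>n\<close> stays there.\<close>

lemma sg:
  assumes "c \<in> cl2" "s1 c = w"
  shows "sg (t1 c) \<in> cl2" "s1 (sg (t1 c)) = t1 c" "t1 (sg (t1 c)) = n"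
proof -
  obtain d where d: "d \<in> cl2" "s1 d = w" "t1 d = n" using reach by blast
  have "confluent2 P" using squier by (simp add: squier2_by_def convergent2_def)
  then obtain c' d' where e: "c' \<in> cl2" "d' \<in> cl2" "t1 c = s1 c'" "t1 d = s1 d'" "t1 (c \<star> c') = t1 (d \<star> d')"
    using assms d unfolding confluent2_def by metis
  have "t1 d' = n" using from_n[of d'] d e oneD(3)[OF one_n] by simp
  then have "t1 c' = n" using e assms d by simp
  then have "\<exists>c'. c' \<in> cl2 \<and> s1 c' = t1 c \<and> t1 c' = n" using e by metis
  from someI_ex[OF this] show "sg (t1 c) \<in> cl2" "s1 (sg (t1 c)) = t1 c" "t1 (sg (t1 c)) = n"
    unfolding sg_def by simp_all
qed

section \<open>Comparisons below \<open>w\<close> and their transfer to steps at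
  \<open>w\<close>\<close>

definition Z :: "('a, 'b, 'c) cell2 \<Rightarrow> ('a, 'b, 'c) cell2 \<Rightarrow> 'x" where
  "Z c d = (THE K. is3 K c d)"

text \<open>The \<open>2\<close>-cells covered by the induction hypothesis: between any two of them
  with the same source, \<open>Z\<close> is the only \<open>3\<close>-cell.\<close>

definition low :: "('a, 'b, 'c) cell2 \<Rightarrow> ('a, 'b, 'c) cell2 \<Rightarrow> bool" where
  "low v c \<longleftrightarrow> c \<in> cl2 \<and> s1 c = v \<and> t1 c = n \<and> v \<prec> w"

lemma Z_is3: "low v c \<Longrightarrow> low v d \<Longrightarrow> is3 (Z c d) c d"
  unfolding Z_def low_def by (rule theI') (rule below, simp_all)

lemma Z_eq:
  assumes "is3 K c d" "low v c" shows "K = Z c d"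
proof -
  have l: "low v d" using assms(2) is3D[OF assms(1)] by (simp add: low_def)
  have "\<exists>!K. is3 K c d" using below[of c d] assms(2) l by (simp add: low_def)
  then show ?thesis using assms(1) Z_is3[OF assms(2) l] by blast
qed

lemma is3_low_unique: "is3 K c d \<Longrightarrow> is3 K' c d \<Longrightarrow> low v c \<Longrightarrow> K = K'"
  using Z_eq by metis

lemma Z_comp: "low v c \<Longrightarrow> low v d \<Longrightarrow> low v e \<Longrightarrow> Z c d \<bullet> Z d e = Z c e"
  using Z_eq[OF is3_comp[OF Z_is3 Z_is3]] by blast

lemma Z_refl: "low v c \<Longrightarrow> Z c c = j c"
  using Z_eq[OF is3_id] by (metis low_def)

abbreviation stepw where "stepw f \<equiv> step f \<and> s1 f = w"

lemma low_sg: "stepw f \<Longrightarrow> low (t1 f) (sg (t1 f))"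
  using sg[of f] step_lt[of f] by (simp add: low_def)

lemma low_ext: "stepw f \<Longrightarrow> a \<in> cl2 \<Longrightarrow> s1 a = t1 f \<Longrightarrow> q \<in> cl2 \<Longrightarrow> s1 q = t1 a \<Longrightarrow> t1 q = n \<Longrightarrow> low (t1 f) (a \<star> q)"
  using step_lt[of f] by (simp add: low_def)

lemma low_later: "stepw f \<Longrightarrow> a \<in> cl2 \<Longrightarrow> s1 a = t1 f \<Longrightarrow> q \<in> cl2 \<Longrightarrow> s1 q = t1 a \<Longrightarrow> t1 q = n \<Longrightarrow> low (t1 a) q"
  using step_lt[of f] lt_trans_cell[of "t1 f" w a] by (simp add: low_def)

text \<open>A \<open>3\<close>-cell between \<open>2\<close>-cells beginning with the steps \<open>f\<close> and \<open>g\<close>, as a comparison of the chosen normalizations.\<close>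

definition transfer where
  "transfer f a K g b q = lw f (Z (sg (t1 f)) (a \<star> q)) \<bullet> (rw K q \<bullet> lw g (Z (b \<star> q) (sg (t1 g))))"

definition typed where
  "typed f a K g b \<longleftrightarrow> stepw f \<and> stepw g \<and> a \<in> cl2 \<and> b \<in> cl2 \<and> t1 f = s1 a \<and> t1 g = s1 b \<and> is3 K (f \<star> a) (g \<star> b)"

definition ends where "ends a q \<longleftrightarrow> q \<in> cl2 \<and> s1 q = t1 a \<and> t1 q = n"

lemma typedD:
  assumes "typed f a K g b"
  shows "stepw f" "stepw g" "a \<in> cl2" "b \<in> cl2" "t1 f = s1 a" "t1 g = s1 b" "is3 K (f \<star> a) (g \<star> b)" "t1 b = t1 a"
    "f \<in> cl2" "g \<in> cl2"
proof -
  show a: "stepw f" "stepw g" "a \<in> cl2" "b \<in> cl2" "t1 f = s1 a" "t1 g = s1 b" "is3 K (f \<star> a) (g \<star> b)"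
    using assms unfolding typed_def by blast+
  show c: "f \<in> cl2" "g \<in> cl2" using a by simp_all
  show "t1 b = t1 a" using is3D(7)[OF a(7)] a(3-6) c by simp
qed

lemma typed_lw: "stepw f \<Longrightarrow> is3 A a b \<Longrightarrow> t1 f = s1 a \<Longrightarrow> typed f a (lw f A) f b"
  using is3_lw[of A a b f] is3D[of A a b] by (simp add: typed_def)

lemma typed_comp: "typed f a K g b \<Longrightarrow> typed g b L h c \<Longrightarrow> typed f a (K \<bullet> L) h c"
  using is3_comp unfolding typed_def by blast

lemma typed_rw:
  assumes "typed f a K g b" "e \<in> cl2" "t1 a = s1 e"
  shows "typed f (a \<star> e) (rw K e) g (b \<star> e)"
proof -
  note t = typedD[OF assms(1)]
  have "is3 (rw K e) (f \<star> a \<star> e) (g \<star> b \<star> e)" using is3_rw[OF t(7) assms(2)] t assms by simp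
  then have "is3 (rw K e) (f \<star> (a \<star> e)) (g \<star> (b \<star> e))" using t assms by (simp add: cmp1_assoc)
  then show ?thesis unfolding typed_def using t assms by simp
qed

lemma transfer_parts:
  assumes "typed f a K g b" "ends a q"
  shows "is3 (lw f (Z (sg (t1 f)) (a \<star> q))) (f \<star> sg (t1 f)) (f \<star> a \<star> q)"
    "is3 (rw K q) (f \<star> a \<star> q) (g \<star> b \<star> q)"
    "is3 (lw g (Z (b \<star> q) (sg (t1 g)))) (g \<star> b \<star> q) (g \<star> sg (t1 g))"
    "is3 (lw f (Z (a \<star> q) (sg (t1 f)))) (f \<star> a \<star> q) (f \<star> sg (t1 f))"
    "is3 (lw g (Z (sg (t1 g)) (b \<star> q))) (g \<star> sg (t1 g)) (g \<star> b \<star> q)"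
    "low (t1 f) (a \<star> q)" "low (t1 g) (b \<star> q)"
proof -
  note t = typedD[OF assms(1)]
  have q: "q \<in> cl2" "s1 q = t1 a" "t1 q = n" using assms(2) by (simp_all add: ends_def)
  show l: "low (t1 f) (a \<star> q)" "low (t1 g) (b \<star> q)"
    using low_ext[OF t(1,3) t(5)[symmetric] q] low_ext[OF t(2,4) t(6)[symmetric] q(1) _ q(3)] q(2) t(8) by simp_all
  have s: "low (t1 f) (sg (t1 f))" "low (t1 g) (sg (t1 g))" using low_sg t by blast+
  have e: "f \<star> a \<star> q = f \<star> (a \<star> q)" "g \<star> b \<star> q = g \<star> (b \<star> q)" using t q by (simp_all add: cmp1_assoc)
  have st: "s1 (sg (t1 f)) = t1 f" "s1 (sg (t1 g)) = t1 g" using s by (simp_all add: low_def)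
  show "is3 (lw f (Z (sg (t1 f)) (a \<star> q))) (f \<star> sg (t1 f)) (f \<star> a \<star> q)"
    unfolding e by (rule is3_lw[OF Z_is3[OF s(1) l(1)] t(9) st(1)[symmetric]])
  show "is3 (lw g (Z (sg (t1 g)) (b \<star> q))) (g \<star> sg (t1 g)) (g \<star> b \<star> q)"
    unfolding e by (rule is3_lw[OF Z_is3[OF s(2) l(2)] t(10) st(2)[symmetric]])
  show "is3 (lw f (Z (a \<star> q) (sg (t1 f)))) (f \<star> a \<star> q) (f \<star> sg (t1 f))"
    unfolding e by (rule is3_lw[OF Z_is3[OF l(1) s(1)] t(9)]) (use t q in simp)
  show "is3 (lw g (Z (b \<star> q) (sg (t1 g)))) (g \<star> b \<star> q) (g \<star> sg (t1 g))"
    unfolding e by (rule is3_lw[OF Z_is3[OF l(2) s(2)] t(10)]) (use t q in simp)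
  show "is3 (rw K q) (f \<star> a \<star> q) (g \<star> b \<star> q)"
    by (rule is3_rw[OF t(7) q(1)]) (use t q in simp)
qed

lemma transfer_is3:
  assumes "typed f a K g b" "ends a q"
  shows "is3 (transfer f a K g b q) (f \<star> sg (t1 f)) (g \<star> sg (t1 g))"
  unfolding transfer_def
  by (rule is3_comp[OF transfer_parts(1)[OF assms] is3_comp[OF transfer_parts(2)[OF assms] transfer_parts(3)[OF assms]]])

lemma lw_Z_comp:
  assumes "stepw f" "low (t1 f) c" "low (t1 f) d" "low (t1 f) e"
  shows "lw f (Z c d) \<bullet> lw f (Z d e) = lw f (Z c e)"
  using lw_comp[OF Z_is3[OF assms(2,3)] Z_is3[OF assms(3,4)], of f] Z_comp[OF assms(2-4)] assms by (simp add: low_def)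

lemma lw_Z_refl: "stepw f \<Longrightarrow> low (t1 f) c \<Longrightarrow> lw f (Z c c) = j (f \<star> c)"
  using Z_refl[of "t1 f" c] by (simp add: low_def)

text \<open>In the middle meet two comparisons below \<open>g\<close>, one into
  \<open>sg (t1 g)\<close> and one out of it. By uniqueness below \<open>w\<close> they are inverse
  to each other and cancel.\<close>

lemma transfer_comp:
  assumes "typed f a K g b" "typed g b L h c" "ends a q"
  shows "transfer f a K g b q \<bullet> transfer g b L h c q = transfer f a (K \<bullet> L) h c q"
proof -
  note tk = typedD[OF assms(1)] and tl = typedD[OF assms(2)]
  have e2: "ends b q" using assms(3) tk(8) by (simp add: ends_def)
  have q: "q \<in> cl2" "s1 q = t1 a" using assms(3) by (simp_all add: ends_def)
  note p = transfer_parts[OF assms(1,3)] and r = transfer_parts[OF assms(2) e2]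
  let ?f = "lw f (Z (sg (t1 f)) (a \<star> q))" and ?g = "lw g (Z (b \<star> q) (sg (t1 g)))"
    and ?g' = "lw g (Z (sg (t1 g)) (b \<star> q))" and ?h = "lw h (Z (c \<star> q) (sg (t1 h)))"
  have gg: "?g \<bullet> ?g' = j (g \<star> b \<star> q)"
    using lw_Z_comp[OF tk(2) p(7) low_sg[OF tk(2)] p(7)] lw_Z_refl[OF tk(2) p(7)] tk q by (simp add: cmp1_assoc)
  have "(?f \<bullet> (rw K q \<bullet> ?g)) \<bullet> (?g' \<bullet> (rw L q \<bullet> ?h)) = ?f \<bullet> (rw K q \<bullet> (?g \<bullet> (?g' \<bullet> (rw L q \<bullet> ?h))))"
    using comp_assoc[OF p(1) is3_comp[OF p(2,3)] is3_comp[OF r(1) is3_comp[OF r(2,3)]]]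
      comp_assoc[OF p(2,3) is3_comp[OF r(1) is3_comp[OF r(2,3)]]] by simp
  also have "?g \<bullet> (?g' \<bullet> (rw L q \<bullet> ?h)) = rw L q \<bullet> ?h"
    using comp_assoc[OF p(3) r(1) is3_comp[OF r(2,3)]] gg comp_id(1)[OF is3_comp[OF r(2,3)]] by simp
  also have "rw K q \<bullet> (rw L q \<bullet> ?h) = rw (K \<bullet> L) q \<bullet> ?h"
    using comp_assoc[OF p(2) r(2,3)] rw_comp[OF tk(7) tl(7) q(1)] tk q by simp
  finally show ?thesis unfolding transfer_def .
qed

text \<open>Two continuations \<open>q\<close> and \<open>q'\<close> are joined by a unique
  \<open>3\<close>-cell, since they start below \<open>w\<close>. It can be moved from one side of
  \<open>K\<close> to the other, and on either side it is absorbed by the comparisons behind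
  \<open>f\<close> and \<open>g\<close>.\<close>

lemma transfer_ends:
  assumes "typed f a K g b" "ends a q" "ends a q'"
  shows "transfer f a K g b q = transfer f a K g b q'"
proof -
  note t = typedD[OF assms(1)]
  note p = transfer_parts[OF assms(1,2)] and p' = transfer_parts[OF assms(1,3)]
  have q: "q \<in> cl2" "s1 q = t1 a" "q' \<in> cl2" "s1 q' = t1 a" "t1 q = n" "t1 q' = n" using assms(2,3) by (simp_all add: ends_def)
  have lq: "low (t1 a) q" "low (t1 a) q'" using low_later[OF t(1,3)] t(5) q by simp_all
  let ?z = "Z q q'"
  note z = Z_is3[OF lq]
  have "lw g (lw b ?z) = lw g (Z (b \<star> q) (b \<star> q'))"
    using Z_eq[OF is3_lw[OF z, of b] p(7)] t q by simp
  then have g: "lw g (lw b ?z) \<bullet> lw g (Z (b \<star> q') (sg (t1 g))) = lw g (Z (b \<star> q) (sg (t1 g)))"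
    using lw_Z_comp[OF t(2) p(7) p'(7) low_sg[OF t(2)]] by simp
  have "lw f (lw a ?z) = lw f (Z (a \<star> q) (a \<star> q'))"
    using Z_eq[OF is3_lw[OF z, of a] p(6)] t q by simp
  then have f: "lw f (Z (sg (t1 f)) (a \<star> q)) \<bullet> lw f (lw a ?z) = lw f (Z (sg (t1 f)) (a \<star> q'))"
    using lw_Z_comp[OF t(1) low_sg[OF t(1)] p(6) p'(6)] by simp
  have lg: "lw (g \<star> b) ?z = lw g (lw b ?z)" using lw_lw[OF z t(10,4)] t q by simp
  have lf: "lw (f \<star> a) ?z = lw f (lw a ?z)" using lw_lw[OF z t(9,3)] t q by simp
  have ig: "is3 (lw (g \<star> b) ?z) (g \<star> b \<star> q) (g \<star> b \<star> q')" by (rule is3_lw[OF z]) (use t q in simp_all)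
  have if0: "is3 (lw (f \<star> a) ?z) (f \<star> a \<star> q) (f \<star> a \<star> q')" by (rule is3_lw[OF z]) (use t q in simp_all)
  \<comment> \<open>Exchange along \<open>1\<close>-cells: \<open>K\<close> first and then the
    change of continuation, or the other way round.\<close>
  have ex: "rw K q \<bullet> lw (g \<star> b) ?z = lw (f \<star> a) ?z \<bullet> rw K q'"
    using cmp1_exchange[OF t(7) z] t q by simp
  have "transfer f a K g b q = lw f (Z (sg (t1 f)) (a \<star> q)) \<bullet> (rw K q \<bullet> (lw (g \<star> b) ?z \<bullet> lw g (Z (b \<star> q') (sg (t1 g)))))"
    unfolding transfer_def lg g ..
  also have "\<dots> = lw f (Z (sg (t1 f)) (a \<star> q)) \<bullet> (lw (f \<star> a) ?z \<bullet> (rw K q' \<bullet> lw g (Z (b \<star> q') (sg (t1 g)))))"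
    using comp_assoc[OF p(2) ig p'(3)] comp_assoc[OF if0 p'(2,3)] ex by simp
  also have "\<dots> = transfer f a K g b q'"
    unfolding transfer_def using comp_assoc[OF p(1) if0 is3_comp[OF p'(2,3)]] f lf by simp
  finally show ?thesis .
qed

text \<open>A \<open>3\<close>-cell that takes place behind the step \<open>f\<close> lies below
  \<open>w\<close>, so after the continuation it is one of the \<open>Z\<close>. All three factors
  of the transfer then compose to an identity.\<close>

lemma transfer_lw:
  assumes "stepw f" "is3 A a b" "t1 f = s1 a" "ends a q"
  shows "transfer f a (lw f A) f b q = j (f \<star> sg (t1 f))"
proof -
  note ty = typed_lw[OF assms(1-3)]
  note t = typedD[OF ty] and p = transfer_parts[OF ty assms(4)]
  have q: "q \<in> cl2" "s1 q = t1 a" "t1 q = n" using assms(4) by (simp_all add: ends_def)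
  have "rw (lw f A) q = lw f (rw A q)" by (rule lw_rw[OF assms(2)]) (use t q in simp_all)
  also have "rw A q = Z (a \<star> q) (b \<star> q)" by (rule Z_eq[OF is3_rw[OF assms(2)] p(6)]) (use t q in simp_all)
  finally have r: "rw (lw f A) q = lw f (Z (a \<star> q) (b \<star> q))" .
  have s: "low (t1 f) (sg (t1 f))" using low_sg assms(1) .
  show ?thesis unfolding transfer_def r
    using lw_Z_comp[OF assms(1) p(6,7) s] lw_Z_comp[OF assms(1) s p(6) s] lw_Z_refl[OF assms(1) s] by simp
qed

lemma transfer_rw:
  assumes "typed f a K g b" "e \<in> cl2" "t1 a = s1 e" "ends e q"
  shows "transfer f (a \<star> e) (rw K e) g (b \<star> e) q = transfer f a K g b (e \<star> q)" "ends a (e \<star> q)" "ends (a \<star> e) q"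
proof -
  note t = typedD[OF assms(1)]
  have q: "q \<in> cl2" "s1 q = t1 e" "t1 q = n" using assms(4) by (simp_all add: ends_def)
  show "ends a (e \<star> q)" "ends (a \<star> e) q" using q assms t by (simp_all add: ends_def)
  have "rw (rw K e) q = rw K (e \<star> q)" by (rule rw_rw[OF t(7)]) (use t q assms in simp_all)
  moreover have "a \<star> e \<star> q = a \<star> (e \<star> q)" "b \<star> e \<star> q = b \<star> (e \<star> q)" using t q assms by (simp_all add: cmp1_assoc)
  ultimately show "transfer f (a \<star> e) (rw K e) g (b \<star> e) q = transfer f a K g b (e \<star> q)"
    unfolding transfer_def by simp
qed

lemma ends_sg: "stepw f \<Longrightarrow> a \<in> cl2 \<Longrightarrow> t1 f = s1 a \<Longrightarrow> ends a (sg (t1 a))"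
  using sg[of "f \<star> a"] by (simp add: ends_def)

definition T :: "('a, 'b, 'c) cell2 \<Rightarrow> ('a, 'b, 'c) cell2 \<Rightarrow> 'x" where
  "T f g = (THE M. \<exists>A a b. can f g A \<and> a \<in> cl2 \<and> t1 f = s1 a \<and> t1 g = s1 b \<and> F.is3 A (f \<star> a) (g \<star> b) \<and> b \<in> cl2 \<and>
     M = transfer f a (\<pi> A) g b (sg (t1 a)))"

lemma typed_\<pi>: "stepw f \<Longrightarrow> stepw g \<Longrightarrow> a \<in> cl2 \<Longrightarrow> b \<in> cl2 \<Longrightarrow> t1 f = s1 a \<Longrightarrow> t1 g = s1 b \<Longrightarrow>
    F.is3 A (f \<star> a) (g \<star> b) \<Longrightarrow> typed f a (\<pi> A) g b"
  unfolding typed_def using \<pi>_is3 by blast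

text \<open>Nothing in the definition of \<open>T\<close> depends on the choices made: the canonical
  filling is unique, \<open>a\<close> and \<open>b\<close> are determined by left cancellation of
  \<open>f\<close> and \<open>g\<close>, and the continuation is immaterial by
  \<open>transfer_ends\<close>.\<close>

lemma T_eq:
  assumes c: "can f g A" and t: "stepw f" "stepw g" "a \<in> cl2" "b \<in> cl2" "t1 f = s1 a" "t1 g = s1 b" "F.is3 A (f \<star> a) (g \<star> b)"
    and e: "ends a q"
  shows "T f g = transfer f a (\<pi> A) g b q"
proof -
  have ty: "typed f a (\<pi> A) g b" by (rule typed_\<pi>[OF t])
  have q: "transfer f a (\<pi> A) g b q = transfer f a (\<pi> A) g b (sg (t1 a))"
    by (rule transfer_ends[OF ty e ends_sg[OF t(1,3,5)]])
  show ?thesis unfolding T_def q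
  proof (rule the_equality)
    show "\<exists>A' a' b'. can f g A' \<and> a' \<in> cl2 \<and> t1 f = s1 a' \<and> t1 g = s1 b' \<and> F.is3 A' (f \<star> a') (g \<star> b') \<and> b' \<in> cl2 \<and>
      transfer f a (\<pi> A) g b (sg (t1 a)) = transfer f a' (\<pi> A') g b' (sg (t1 a'))"
      using c t by blast
    fix M assume "\<exists>A' a' b'. can f g A' \<and> a' \<in> cl2 \<and> t1 f = s1 a' \<and> t1 g = s1 b' \<and> F.is3 A' (f \<star> a') (g \<star> b') \<and> b' \<in> cl2 \<and>
      M = transfer f a' (\<pi> A') g b' (sg (t1 a'))"
    then obtain A' a' b' where x: "can f g A'" "a' \<in> cl2" "t1 f = s1 a'" "t1 g = s1 b'" "F.is3 A' (f \<star> a') (g \<star> b')" "b' \<in> cl2"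
      "M = transfer f a' (\<pi> A') g b' (sg (t1 a'))" by blast
    have A: "A' = A" using can_unique x(1) c by blast
    have "f \<star> a' = f \<star> a" "g \<star> b' = g \<star> b"
      using F.is3D(2-5)[OF x(5)] F.is3D(2-5)[OF t(7)] up3_inj unfolding A by metis+
    then have "a' = a" "b' = b"
      using step_cancel[of f a' a] step_cancel[of g b' b] t(1-6) x(2-4,6) by blast+
    then show "M = transfer f a (\<pi> A) g b (sg (t1 a))" using x(7) A by simp
  qed
qed

lemma can_typed:
  assumes "stepw f" "stepw g"
  obtains A a b where "can f g A" "a \<in> cl2" "b \<in> cl2" "t1 f = s1 a" "t1 g = s1 b" "F.is3 A (f \<star> a) (g \<star> b)"
proof -
  obtain A where A: "can f g A" using can_ex[of f g] assms by auto
  show ?thesis by (rule can_is3[OF A]) (rule that[OF A])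
qed

lemma T_is3: "stepw f \<Longrightarrow> stepw g \<Longrightarrow> is3 (T f g) (f \<star> sg (t1 f)) (g \<star> sg (t1 g))"
proof -
  assume s: "stepw f" "stepw g"
  obtain A a b where A: "can f g A" "a \<in> cl2" "b \<in> cl2" "t1 f = s1 a" "t1 g = s1 b" "F.is3 A (f \<star> a) (g \<star> b)"
    using can_typed[OF s] .
  have e: "ends a (sg (t1 a))" by (rule ends_sg[OF s(1) A(2,4)])
  show ?thesis unfolding T_eq[OF A(1) s A(2-6) e] by (rule transfer_is3[OF typed_\<pi>[OF s A(2-6)] e])
qed

lemma T_refl: "stepw f \<Longrightarrow> T f f = j (f \<star> sg (t1 f))"
proof -
  assume s: "stepw f"
  have f: "f \<in> cl2" using s by simp
  have c: "can f f (up3 P f)" using aspherical_filling s by blast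
  have i: "F.is3 (up3 P f) (f \<star> t1 f) (f \<star> t1 f)" using F.is3_id[OF f] f by simp
  have e: "ends (t1 f) (sg (t1 f))" using ends_sg[OF s, of "t1 f"] f by simp
  have "T f f = transfer f (t1 f) (j f) f (t1 f) (sg (t1 f))"
    using T_eq[OF c s s _ _ _ _ i e] f \<pi>_up3[OF f] by simp
  also have "j f = lw f (j (t1 f))" using f by simp
  also have "transfer f (t1 f) (lw f (j (t1 f))) f (t1 f) (sg (t1 f)) = j (f \<star> sg (t1 f))"
    by (rule transfer_lw[OF s is3_id _ e]) (use f in simp_all)
  finally show ?thesis .
qed

lemma T_inverse: "stepw f \<Longrightarrow> stepw g \<Longrightarrow> T f g \<bullet> T g f = j (f \<star> sg (t1 f))"
proof -
  assume s: "stepw f" "stepw g"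
  obtain A a b where A: "can f g A" "a \<in> cl2" "b \<in> cl2" "t1 f = s1 a" "t1 g = s1 b" "F.is3 A (f \<star> a) (g \<star> b)"
    using can_typed[OF s] .
  obtain B where B: "F.is3 B (g \<star> b) (f \<star> a)" "cmp (free3 P) 2 A B = up3 P (f \<star> a)"
    "cmp (free3 P) 2 B A = up3 P (g \<star> b)" "inverse_cells (free3 P) 2 A B"
    by (rule F.is3_inverse[OF A(6)])
  have c: "can g f B" by (rule can_swap[OF A(1) B(4)])
  note ty = typed_\<pi>[OF s A(2-6)] and ty' = typed_\<pi>[OF s(2,1) A(3,2,5,4) B(1)]
  have e: "ends a (sg (t1 a))" by (rule ends_sg[OF s(1) A(2,4)])
  then have e': "ends b (sg (t1 a))" using typedD(8)[OF ty] by (simp add: ends_def)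
  have f: "f \<in> cl2" using s by simp
  have "T f g \<bullet> T g f = transfer f a (\<pi> A \<bullet> \<pi> B) f a (sg (t1 a))"
    unfolding T_eq[OF A(1) s A(2-6) e] T_eq[OF c s(2,1) A(3,2,5,4) B(1) e'] by (rule transfer_comp[OF ty ty' e])
  also have "\<pi> A \<bullet> \<pi> B = j (f \<star> a)"
    unfolding \<pi>_comp[OF A(6) B(1), symmetric] B(2) using \<pi>_up3 A f by simp
  also have "j (f \<star> a) = lw f (j a)" using f A by simp
  also have "transfer f a (lw f (j a)) f a (sg (t1 a)) = j (f \<star> sg (t1 f))"
    by (rule transfer_lw[OF s(1) is3_id[OF A(2)] A(4) e])
  finally show ?thesis .
qed

section \<open>The cocycle identity for triples of steps at \<open>w\<close>\<close>

definition cocycle where "cocycle f g h \<longleftrightarrow> T f g \<bullet> T g h = T f h"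

lemma cocycle_swap12:
  assumes s: "stepw f" "stepw g" "stepw h" and c: "cocycle f g h"
  shows "cocycle g f h"
proof -
  have "T g f \<bullet> T f h = T g f \<bullet> (T f g \<bullet> T g h)" using c by (simp add: cocycle_def)
  also have "\<dots> = T g f \<bullet> T f g \<bullet> T g h" using comp_assoc[OF T_is3[OF s(2,1)] T_is3[OF s(1,2)] T_is3[OF s(2,3)]] by simp
  also have "\<dots> = T g h" using T_inverse[OF s(2,1)] comp_id(1)[OF T_is3[OF s(2,3)]] by simp
  finally show ?thesis by (simp add: cocycle_def)
qed

lemma cocycle_swap23:
  assumes s: "stepw f" "stepw g" "stepw h" and c: "cocycle f g h"
  shows "cocycle f h g"
proof -
  have "T f h \<bullet> T h g = T f g \<bullet> T g h \<bullet> T h g" using c by (simp add: cocycle_def)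
  also have "\<dots> = T f g \<bullet> (T g h \<bullet> T h g)" using comp_assoc[OF T_is3[OF s(1,2)] T_is3[OF s(2,3)] T_is3[OF s(3,2)]] by simp
  also have "\<dots> = T f g" using T_inverse[OF s(2,3)] comp_id(2)[OF T_is3[OF s(1,2)]] by simp
  finally show ?thesis by (simp add: cocycle_def)
qed

lemma perm3_cases:
  assumes "mset [x, y, z] = mset [f, g, h]"
  shows "(f, g, h) \<in> {(x, y, z), (y, x, z), (x, z, y), (y, z, x), (z, x, y), (z, y, x)}"
  using assms by (auto simp: add_eq_conv_ex)

text \<open>Required because a generating \<open>4\<close>-cell fills only one representative of its
  class of critical triples, and Peiffer triples are strict only after a permutation.\<close>

lemma cocycle_perm:
  assumes s: "stepw x" "stepw y" "stepw z" and c: "cocycle x y z" and m: "mset [x, y, z] = mset [f, g, h]"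
  shows "cocycle f g h"
proof -
  have 1: "cocycle y x z" by (rule cocycle_swap12[OF s c])
  have 2: "cocycle x z y" by (rule cocycle_swap23[OF s c])
  have 3: "cocycle y z x" by (rule cocycle_swap23[OF s(2,1,3) 1])
  have 4: "cocycle z x y" by (rule cocycle_swap12[OF s(1,3,2) 2])
  have 5: "cocycle z y x" by (rule cocycle_swap12[OF s(2,3,1) 3])
  show ?thesis using perm3_cases[OF m] c 1 2 3 4 5 by auto
qed

lemma cocycle_aspherical: "stepw f \<Longrightarrow> stepw h \<Longrightarrow> cocycle f f h"
  unfolding cocycle_def using T_refl comp_id(1)[OF T_is3] by metis

text \<open>The case where the comparison \<open>B\<close> of \<open>f\<close> and \<open>g\<close> also takes place after the step \<open>h\<close>.\<close>

lemma cocycle_slide: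
  assumes s: "stepw f" "stepw g" "stepw h"
    and ty: "typed f a B g b" "typed f a (j (f \<star> a)) h c" "typed h d (j (g \<star> b)) g b"
    and C: "is3 C c d" "B = lw h C"
    and T: "T f g = transfer f a B g b q" "T f h = transfer f a (j (f \<star> a)) h c q" "T h g = transfer h d (j (g \<star> b)) g b q"
    and e: "ends a q"
  shows "cocycle f h g"
proof -
  note t = typedD[OF ty(1)] and t2 = typedD[OF ty(2)] and t3 = typedD[OF ty(3)]
  have ec: "ends c q" "ends d q" using e t(8) t2(8) t3(8) by (simp_all add: ends_def)
  have tc: "typed h c B h d" unfolding C(2) by (rule typed_lw[OF s(3) C(1) t2(6)])
  have "T f h \<bullet> j (h \<star> sg (t1 h)) \<bullet> T h g = transfer f a (j (f \<star> a) \<bullet> B \<bullet> j (g \<star> b)) g b q"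
    unfolding T transfer_lw[OF s(3) C(1) t2(6) ec(1), symmetric] C(2)[symmetric]
    by (simp only: transfer_comp[OF ty(2) tc e] transfer_comp[OF typed_comp[OF ty(2) tc] ty(3) e])
  also have "j (f \<star> a) \<bullet> B \<bullet> j (g \<star> b) = B" using comp_id[OF t(7)] by simp
  finally show ?thesis unfolding cocycle_def T(1) using comp_id(2)[OF T_is3[OF s(1,3)]] by simp
qed

text \<open>The canonical filling of disjoint steps is an identity and remains one when both sides
  are continued by the same \<open>c\<close>. The freedom in \<open>c\<close> lets the comparison be
  written along the same \<open>2\<close>-cells as those of the other pairs in a triple.\<close>

lemma T_split_pair:
  assumes sp: "split_pair f h f' h'" and s: "stepw f" "stepw h"
    and c: "c \<in> cl2" "s1 c = t1 f' \<cdot> t1 h'" and e: "ends c q"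
  defines "a \<equiv> (t1 f' \<cdot> h') \<star> c" and "b \<equiv> (f' \<cdot> t1 h') \<star> c"
  shows "typed f a (j (f \<star> a)) h b" "T f h = transfer f a (j (f \<star> a)) h b q"
    "typed h b (j (h \<star> b)) f a" "T h f = transfer h b (j (h \<star> b)) f a q" "f \<star> a = h \<star> b" "ends a q" "ends b q"
proof -
  note sq = split_pair_square[OF sp]
  have i: "F.is3 (up3 P (f' \<cdot> h')) (f \<star> (t1 f' \<cdot> h')) (h \<star> (f' \<cdot> t1 h'))"
    "F.is3 (up3 P (f' \<cdot> h')) (h \<star> (f' \<cdot> t1 h')) (f \<star> (t1 f' \<cdot> h'))"
    unfolding sq(1,2) by (rule F.is3_id[OF sq(3)])+
  note cn = split_pair_can[OF sp conjunct1[OF s(1)] conjunct1[OF s(2)]]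
  note ty = typed_\<pi>[OF s sq(6,7,4,5) i(1)] typed_\<pi>[OF s(2,1) sq(7,6,5,4) i(2)]
  have tc: "t1 (t1 f' \<cdot> h') = s1 c" "t1 (f' \<cdot> t1 h') = s1 c" using sq(10,11) c(2) by simp_all
  note r = transfer_rw[OF ty(1) c(1) tc(1) e] transfer_rw[OF ty(2) c(1) tc(2) e]
  have k: "t1 (f' \<cdot> h') = s1 c" using sq(1) sq(4,6,8) tc(1) by (metis cmp1_simps(5))
  have jj: "rw (\<pi> (up3 P (f' \<cdot> h'))) c = j (f' \<cdot> h' \<star> c)" using \<pi>_up3[OF sq(3)] rw_id[OF c(1) sq(3) k] by simp
  have fa: "f \<star> a = f' \<cdot> h' \<star> c" unfolding a_def using cmp1_assoc[OF sq(8,6) c(1) sq(4) tc(1)] sq(1) by simp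
  have hb: "h \<star> b = f' \<cdot> h' \<star> c" unfolding b_def using cmp1_assoc[OF sq(9,7) c(1) sq(5) tc(2)] sq(2) by simp
  show "f \<star> a = h \<star> b" using fa hb by simp
  show "ends a q" "ends b q" using r(3) r(6) unfolding a_def b_def by blast+
  show "typed f a (j (f \<star> a)) h b" "typed h b (j (h \<star> b)) f a"
    using typed_rw[OF ty(1) c(1) tc(1)] typed_rw[OF ty(2) c(1) tc(2)] unfolding jj fa hb a_def[symmetric] b_def[symmetric] by blast+
  show "T f h = transfer f a (j (f \<star> a)) h b q"
    using T_eq[OF cn(1) s sq(6,7,4,5) i(1) r(2)] r(1) unfolding jj fa a_def[symmetric] b_def[symmetric] by simp
  show "T h f = transfer h b (j (h \<star> b)) f a q"
    using T_eq[OF cn(2) s(2,1) sq(7,6,5,4) i(2) r(5)] r(4) unfolding jj hb a_def[symmetric] b_def[symmetric] by simp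
qed

text \<open>\<open>f\<close> and \<open>g\<close> may interact, while \<open>h\<close> acts to the
  right of both. The filling \<open>A\<close> of the left factors, performed next to
  \<open>h'\<close>, can be read as the canonical filling of \<open>(f, g)\<close> followed by
  \<open>h\<close>, and as \<open>A\<close> taking place behind the step \<open>h\<close>; the
  latter is below \<open>w\<close>, so \<open>cocycle_slide\<close> applies.\<close>

lemma cocycle_peiffer_right:
  assumes f: "split_pair f h f' h'" and g: "split_pair g h g' h'" and s: "stepw f" "stepw g" "stepw h" and e: "s1 f' = s1 g'"
  shows "cocycle f h g"
proof -
  have c: "f' \<in> cl2" "g' \<in> cl2" "h' \<in> cl2" "t0 f' = s0 h'" "t0 g' = s0 h'" "f = f' \<cdot> s1 h'" "g = g' \<cdot> s1 h'" "h = s1 f' \<cdot> h'"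
    using f g by (auto simp: split_pair_def)
  have st: "step f'" "step g'" using split_pairD(1)[OF f] split_pairD(1)[OF g] s by blast+
  obtain A where A: "can f' g' A" using can_ex[OF st e] by blast
  obtain a b where ab: "a \<in> cl2" "b \<in> cl2" "t1 f' = s1 a" "t1 g' = s1 b" "F.is3 A (f' \<star> a) (g' \<star> b)" using A by (rule can_is3)
  note i = \<pi>_is3[OF ab(5)]
  have t: "t1 b = t1 a" "s1 (g' \<star> b) = s1 (f' \<star> a)" using is3D(6,7)[OF i] c(1,2) ab(1-4) by simp_all
  have p: "t0 a = s0 h'" "t0 b = s0 h'" "s0 a = s0 f'" "s0 b = s0 g'"
    using par0[OF c(1) ab(1,3)] par0[OF c(2) ab(2,4)] c(4,5) by simp_all
  have s0: "s0 g' = s0 f'" using par0'[OF c(1,2) e] by simp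
  have o: "one (s1 h')" "one (s0 f')" using c by (simp_all add: one_s0)
  have wf: "whisk (s0 f') f' (s1 h') = f" "whisk (s0 f') g' (s1 h') = g" "whisk (s0 f') a (s1 h') = a \<cdot> s1 h'"
    "whisk (s0 f') b (s1 h') = b \<cdot> s1 h'"
    using c c2_simps(21)[of f'] c2_simps(21)[of g'] c2_simps(21)[of a] c2_simps(21)[of b] s0 p ab by (simp_all add: whisk2_def)
  have k: "ctx (s0 f') (f' \<star> a) (s1 h')" "ctx (s0 f') f' (s1 h')" "ctx (s0 f') g' (s1 h')"
    using c ab o p s0 by (simp_all add: ctx_def)
  let ?A = "F.wh (s0 f') A (s1 h')"
  have can: "can f g ?A"
    using can_wh[OF A o(2,1)] s unfolding wf local_branching2 by simp
  have ww: "whisk (s0 f') (f' \<star> a) (s1 h') = f \<star> (a \<cdot> s1 h')" "whisk (s0 f') (g' \<star> b) (s1 h') = g \<star> (b \<cdot> s1 h')"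
    using whisk_cmp1[OF c(1) ab(1,3) k(2)] whisk_cmp1[OF c(2) ab(2,4) k(3)] wf by simp_all
  have iA: "F.is3 ?A (f \<star> (a \<cdot> s1 h')) (g \<star> (b \<cdot> s1 h'))" using F.is3_wh[OF ab(5) k(1)] ww by simp
  have \<pi>A: "\<pi> ?A = wr (\<pi> A) (s1 h')"
    using \<pi>_wh[OF ab(5) k(1)] wl_one[OF i] c ab by (simp add: wh_def)
  have ca: "a \<cdot> s1 h' \<in> cl2" "b \<cdot> s1 h' \<in> cl2" "t1 f = s1 (a \<cdot> s1 h')" "t1 g = s1 (b \<cdot> s1 h')"
    using c ab p by simp_all
  let ?e = "t1 a \<cdot> h'"
  have ce: "?e \<in> cl2" "t1 (a \<cdot> s1 h') = s1 ?e" using c ab p by simp_all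
  \<comment> \<open>The two readings of \<open>A\<close> next to \<open>h'\<close>: with
    \<open>h'\<close> done last it is the canonical filling of \<open>(f, g)\<close> continued by
    \<open>?e\<close>, with \<open>h'\<close> done first it is a cell behind the step
    \<open>h\<close>.\<close>
  have sl: "wr (\<pi> A) h' = rw (\<pi> ?A) ?e" "wr (\<pi> A) h' = lw h (wr (\<pi> A) (t1 h'))"
    using wr_slide[OF i c(3)] \<pi>A c ab p by simp_all
  define q where "q = sg (t1 ?e)"
  have eq: "ends ?e q"
    using sg[of "f \<star> ((a \<cdot> s1 h') \<star> ?e)"] s ca ce by (simp add: ends_def q_def del: cmp0_simps(4,5))
  note ty = typed_\<pi>[OF s(1,2) ca iA]
  note r = transfer_rw[OF ty ce eq]
  have ea: "a \<cdot> s1 h' \<star> ?e = a \<cdot> h'" "b \<cdot> s1 h' \<star> ?e = b \<cdot> h'"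
    using exch1[OF ab(1) c(3) p(1)] exch1[OF ab(2) c(3) p(2)] t by simp_all
  have ca': "a \<cdot> t1 h' \<in> cl2" "b \<cdot> t1 h' \<in> cl2" "s1 (a \<cdot> t1 h') = t1 f' \<cdot> t1 h'" "s1 (b \<cdot> t1 h') = t1 g' \<cdot> t1 h'"
    "ends (a \<cdot> t1 h') q" "ends (b \<cdot> t1 h') q"
    using c ab p eq t by (simp_all add: ends_def)
  have ea': "(t1 f' \<cdot> h') \<star> (a \<cdot> t1 h') = a \<cdot> h'" "(t1 g' \<cdot> h') \<star> (b \<cdot> t1 h') = b \<cdot> h'"
    using exch2[OF ab(1) c(3) p(1)] exch2[OF ab(2) c(3) p(2)] ab by simp_all
  note F = T_split_pair[OF f s(1,3) ca'(1,3,5), unfolded ea']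
  note G = T_split_pair[OF g s(2,3) ca'(2,4,6), unfolded ea']
  have cc: "(f' \<cdot> t1 h') \<star> (a \<cdot> t1 h') = (f' \<star> a) \<cdot> t1 h'" "(g' \<cdot> t1 h') \<star> (b \<cdot> t1 h') = (g' \<star> b) \<cdot> t1 h'"
    using whisker_r[of "t1 h'" f' a] whisker_r[of "t1 h'" g' b] c ab by simp_all
  have C: "is3 (wr (\<pi> A) (t1 h')) ((f' \<cdot> t1 h') \<star> (a \<cdot> t1 h')) ((g' \<cdot> t1 h') \<star> (b \<cdot> t1 h'))"
    unfolding cc by (rule is3_wr[OF i]) (use c ab in simp_all)
  have tB: "typed f (a \<cdot> h') (wr (\<pi> A) h') g (b \<cdot> h')"
    using typed_rw[OF ty ce] unfolding ea sl(1)[symmetric] .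
  have TB: "T f g = transfer f (a \<cdot> h') (wr (\<pi> A) h') g (b \<cdot> h') q"
    using T_eq[OF can s(1,2) ca iA r(2)] r(1) unfolding ea sl(1)[symmetric] by simp
  show ?thesis
    by (rule cocycle_slide[OF s tB F(1) G(3)[folded G(5)] C sl(2) TB F(2) G(4)[folded G(5)] F(6)])
qed

text \<open>The mirror image: the two steps that may interact, \<open>g\<close> and
  \<open>h\<close>, now act to the right of \<open>f\<close>.\<close>

lemma cocycle_peiffer_left:
  assumes g: "split_pair f g f' g'" and h: "split_pair f h f' h'" and s: "stepw f" "stepw g" "stepw h" and e: "s1 g' = s1 h'"
  shows "cocycle g f h"
proof -
  have c: "f' \<in> cl2" "g' \<in> cl2" "h' \<in> cl2" "t0 f' = s0 g'" "t0 f' = s0 h'" "g = s1 f' \<cdot> g'" "h = s1 f' \<cdot> h'" "f = f' \<cdot> s1 h'"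
    using g h by (auto simp: split_pair_def)
  have st: "step g'" "step h'" using split_pairD(2)[OF g] split_pairD(2)[OF h] s by blast+
  obtain A where A: "can g' h' A" using can_ex[OF st e] by blast
  obtain a b where ab: "a \<in> cl2" "b \<in> cl2" "t1 g' = s1 a" "t1 h' = s1 b" "F.is3 A (g' \<star> a) (h' \<star> b)" using A by (rule can_is3)
  note i = \<pi>_is3[OF ab(5)]
  have t: "t1 b = t1 a" "s1 (h' \<star> b) = s1 (g' \<star> a)" using is3D(6,7)[OF i] c(2,3) ab(1-4) by simp_all
  have p: "t0 f' = s0 a" "t0 f' = s0 b" "t0 a = t0 g'" "t0 b = t0 h'"
    using par0[OF c(2) ab(1,3)] par0[OF c(3) ab(2,4)] c(4,5) by simp_all
  have t0: "t0 h' = t0 g'" using par0'[OF c(2,3) e] by simp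
  have o: "one (s1 f')" "one (t0 g')" using c by (simp_all add: one_t0)
  have wf: "whisk (s1 f') g' (t0 g') = g" "whisk (s1 f') h' (t0 g') = h" "whisk (s1 f') a (t0 g') = s1 f' \<cdot> a"
    "whisk (s1 f') b (t0 g') = s1 f' \<cdot> b"
    using c c2_simps(22)[of "s1 f' \<cdot> g'"] c2_simps(22)[of "s1 f' \<cdot> h'"] c2_simps(22)[of "s1 f' \<cdot> a"]
      c2_simps(22)[of "s1 f' \<cdot> b"] t0 p ab by (simp_all add: whisk2_def)
  have k: "ctx (s1 f') (g' \<star> a) (t0 g')" "ctx (s1 f') g' (t0 g')" "ctx (s1 f') h' (t0 g')"
    using c ab o p t0 by (simp_all add: ctx_def)
  let ?A = "F.wh (s1 f') A (t0 g')"
  have can: "can g h ?A"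
    using can_wh[OF A o] s unfolding wf local_branching2 by simp
  have ww: "whisk (s1 f') (g' \<star> a) (t0 g') = g \<star> (s1 f' \<cdot> a)" "whisk (s1 f') (h' \<star> b) (t0 g') = h \<star> (s1 f' \<cdot> b)"
    using whisk_cmp1[OF c(2) ab(1,3) k(2)] whisk_cmp1[OF c(3) ab(2,4) k(3)] wf by simp_all
  have iA: "F.is3 ?A (g \<star> (s1 f' \<cdot> a)) (h \<star> (s1 f' \<cdot> b))" using F.is3_wh[OF ab(5) k(1)] ww by simp
  have iw: "is3 (wl (s1 f') (\<pi> A)) (s1 f' \<cdot> (g' \<star> a)) (s1 f' \<cdot> (h' \<star> b))"
    by (rule is3_wl[OF i]) (use c ab in simp_all)
  have \<pi>A: "\<pi> ?A = wl (s1 f') (\<pi> A)"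
    using \<pi>_wh[OF ab(5) k(1)] wr_one[OF iw] c ab by (simp add: wh_def)
  have ca: "s1 f' \<cdot> a \<in> cl2" "s1 f' \<cdot> b \<in> cl2" "t1 g = s1 (s1 f' \<cdot> a)" "t1 h = s1 (s1 f' \<cdot> b)"
    using c ab p by simp_all
  let ?e = "f' \<cdot> t1 a"
  have ce: "?e \<in> cl2" "t1 (s1 f' \<cdot> a) = s1 ?e" using c ab p by simp_all
  have sl: "wl f' (\<pi> A) = rw (\<pi> ?A) ?e" "wl f' (\<pi> A) = lw f (wl (t1 f') (\<pi> A))"
    using wl_slide[OF i c(1)] \<pi>A c ab p e by simp_all
  define q where "q = sg (t1 ?e)"
  have eq: "ends ?e q"
    using sg[of "g \<star> ((s1 f' \<cdot> a) \<star> ?e)"] s ca ce by (simp add: ends_def q_def del: cmp0_simps(4,5))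
  note ty = typed_\<pi>[OF s(2,3) ca iA]
  note r = transfer_rw[OF ty ce eq]
  have ea: "s1 f' \<cdot> a \<star> ?e = f' \<cdot> a" "s1 f' \<cdot> b \<star> ?e = f' \<cdot> b"
    using exch2[OF c(1) ab(1) p(1)] exch2[OF c(1) ab(2) p(2)] t by simp_all
  have ca': "t1 f' \<cdot> a \<in> cl2" "t1 f' \<cdot> b \<in> cl2" "s1 (t1 f' \<cdot> a) = t1 f' \<cdot> t1 g'" "s1 (t1 f' \<cdot> b) = t1 f' \<cdot> t1 h'"
    "ends (t1 f' \<cdot> a) q" "ends (t1 f' \<cdot> b) q"
    using c ab p eq t by (simp_all add: ends_def)
  have ea': "(f' \<cdot> t1 g') \<star> (t1 f' \<cdot> a) = f' \<cdot> a" "(f' \<cdot> t1 h') \<star> (t1 f' \<cdot> b) = f' \<cdot> b"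
    using exch1[OF c(1) ab(1) p(1)] exch1[OF c(1) ab(2) p(2)] ab by simp_all
  note G = T_split_pair[OF g s(1,2) ca'(1,3,5), unfolded ea']
  note H = T_split_pair[OF h s(1,3) ca'(2,4,6), unfolded ea']
  have cc: "(t1 f' \<cdot> g') \<star> (t1 f' \<cdot> a) = t1 f' \<cdot> (g' \<star> a)" "(t1 f' \<cdot> h') \<star> (t1 f' \<cdot> b) = t1 f' \<cdot> (h' \<star> b)"
    using whisker_l[of "t1 f'" g' a] whisker_l[of "t1 f'" h' b] c ab by simp_all
  have C: "is3 (wl (t1 f') (\<pi> A)) ((t1 f' \<cdot> g') \<star> (t1 f' \<cdot> a)) ((t1 f' \<cdot> h') \<star> (t1 f' \<cdot> b))"
    unfolding cc by (rule is3_wl[OF i]) (use c ab in simp_all)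
  have tB: "typed g (f' \<cdot> a) (wl f' (\<pi> A)) h (f' \<cdot> b)"
    using typed_rw[OF ty ce] unfolding ea sl(1)[symmetric] .
  have TB: "T g h = transfer g (f' \<cdot> a) (wl f' (\<pi> A)) h (f' \<cdot> b) q"
    using T_eq[OF can s(2,3) ca iA r(2)] r(1) unfolding ea sl(1)[symmetric] by simp
  show ?thesis
    by (rule cocycle_slide[OF s(2,3,1) tB G(3) H(1)[unfolded H(5)] C sl(2) TB G(4) H(2)[unfolded H(5)] G(7)])
qed

text \<open>In the boundary of a filling the parts \<open>A\<close>, \<open>B1\<close> and
  \<open>B2\<close> take place behind the steps \<open>g\<close>, \<open>f\<close> and
  \<open>h\<close>, so they transfer to identities. The transfer of the equation \<open>eq\<close>
  is therefore the cocycle identity.\<close>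

lemma cocycle_of_filling:
  assumes s: "stepw f" "stepw g" "stepw h"
    and can: "can f g Afg" "can g h Agh" "can f h Afh"
    and t1: "a1 \<in> cl2" "b1 \<in> cl2" "t1 f = s1 a1" "t1 g = s1 b1" "F.is3 Afg (f \<star> a1) (g \<star> b1)"
    and t2: "a2 \<in> cl2" "b2 \<in> cl2" "t1 g = s1 a2" "t1 h = s1 b2" "F.is3 Agh (g \<star> a2) (h \<star> b2)"
    and t3: "a3 \<in> cl2" "b3 \<in> cl2" "t1 f = s1 a3" "t1 h = s1 b3" "F.is3 Afh (f \<star> a3) (h \<star> b3)"
    and w: "a \<in> cl2" "t1 a1 = s1 a" "b \<in> cl2" "t1 a2 = s1 b" "c \<in> cl2" "t1 a3 = s1 c"
    and m: "is3 A (b1 \<star> a) (a2 \<star> b)" "is3 B1 (a1 \<star> a) (a3 \<star> c)" "is3 B2 (b3 \<star> c) (b2 \<star> b)"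
    and eq: "rw (\<pi> Afg) a \<bullet> lw g A \<bullet> rw (\<pi> Agh) b = lw f B1 \<bullet> rw (\<pi> Afh) c \<bullet> lw h B2"
  shows "cocycle f g h"
proof -
  note ty1 = typed_\<pi>[OF s(1,2) t1] and ty2 = typed_\<pi>[OF s(2,3) t2] and ty3 = typed_\<pi>[OF s(1,3) t3]
  have tt: "t1 (b1 \<star> a) = t1 (a2 \<star> b)" "t1 (a1 \<star> a) = t1 (a3 \<star> c)"
    using is3D(7)[OF m(1)] is3D(7)[OF m(2)] by simp_all
  then have te: "t1 b = t1 a" "t1 c = t1 a"
    using t1 t2 t3 w typedD(8)[OF ty1] by simp_all
  define q where "q = sg (t1 a)"
  have e: "ends (a1 \<star> a) q" using ends_sg[OF s(1), of "a1 \<star> a"] t1 w by (simp add: q_def)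
  then have ea: "ends a q" "ends b q" "ends c q" using t1 w te by (simp_all add: ends_def)
  note R1 = transfer_rw[OF ty1 w(1,2) ea(1)] and R2 = transfer_rw[OF ty2 w(3,4) ea(2)] and R3 = transfer_rw[OF ty3 w(5,6) ea(3)]
  note Y1 = typed_rw[OF ty1 w(1,2)] and Y2 = typed_rw[OF ty2 w(3,4)] and Y3 = typed_rw[OF ty3 w(5,6)]
  have sb: "t1 g = s1 (b1 \<star> a)" "t1 f = s1 (a1 \<star> a)" "t1 h = s1 (b3 \<star> c)"
    using Y1 Y3 unfolding typed_def by blast+
  have eb: "ends (b1 \<star> a) q" "ends (b3 \<star> c) q" using e typedD(8)[OF Y1] typedD(8)[OF Y3] R3(3) by (simp_all add: ends_def)
  note L = typed_lw[OF s(2) m(1) sb(1)] and L1 = typed_lw[OF s(1) m(2) sb(2)] and L2 = typed_lw[OF s(3) m(3) sb(3)]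
  have "transfer f (a1 \<star> a) (rw (\<pi> Afg) a \<bullet> lw g A \<bullet> rw (\<pi> Agh) b) h (b2 \<star> b) q
    = T f g \<bullet> j (g \<star> sg (t1 g)) \<bullet> T g h"
    unfolding T_eq[OF can(1) s(1,2) t1 R1(2)] T_eq[OF can(2) s(2,3) t2 R2(2)] R1(1)[symmetric] R2(1)[symmetric]
      transfer_lw[OF s(2) m(1) sb(1) eb(1), symmetric]
    by (simp only: transfer_comp[OF Y1 L e] transfer_comp[OF typed_comp[OF Y1 L] Y2 e])
  moreover have "transfer f (a1 \<star> a) (lw f B1 \<bullet> rw (\<pi> Afh) c \<bullet> lw h B2) h (b2 \<star> b) q
    = j (f \<star> sg (t1 f)) \<bullet> T f h \<bullet> j (h \<star> sg (t1 h))"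
    unfolding T_eq[OF can(3) s(1,3) t3 R3(2)] R3(1)[symmetric]
      transfer_lw[OF s(1) m(2) sb(2) e, symmetric] transfer_lw[OF s(3) m(3) sb(3) eb(2), symmetric]
    by (simp only: transfer_comp[OF L1 Y3 e] transfer_comp[OF typed_comp[OF L1 Y3] L2 e])
  ultimately show ?thesis
    unfolding cocycle_def eq using comp_id[OF T_is3[OF s(1,3)]] comp_id(2)[OF T_is3[OF s(1,2)]] by simp
qed

end

text \<open>With the empty set as the only other value, composites built from cells can be analysed
  from the outside: if the whole is a cell, no part is empty.\<close>

lemma cmp_free_ext_cell_or_empty:
  assumes "strict_category (base E)" "attached E"
    and "K \<in> cells (free_ext E) \<or> K = {}" "L \<in> cells (free_ext E) \<or> L = {}"
  shows "cmp (free_ext E) i K L \<in> cells (free_ext E) \<or> cmp (free_ext E) i K L = {}"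
proof (cases "K = {} \<or> L = {}")
  case True
  then show ?thesis by (auto simp: free_ext_def)
next
  case False
  then obtain a b where ab: "K = tcls E a" "L = tcls E b" using assms(3,4) by (auto simp: cells_free_ext)
  have e: "cmp (free_ext E) i K L = tcls E (Comp i a b)" unfolding ab by (rule cmp_free_ext[OF assms(1,2)])
  show ?thesis
  proof (cases "wft E (Comp i a b)")
    case True
    then show ?thesis unfolding e cells_free_ext by blast
  next
    case False
    then have "tcls E (Comp i a b) = {}" using teq_sound[OF assms(1,2)] unfolding tcls_def by blast
    then show ?thesis unfolding e by blast
  qed
qed

lemma empty_not_cell: "{} \<notin> cells (free_ext E)"
  using teq_refl by (fastforce simp: cells_free_ext tcls_def)

lemma cmp_free_ext_cellD:
  assumes "strict_category (base E)" "attached E"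
    and "K \<in> cells (free_ext E) \<or> K = {}" "L \<in> cells (free_ext E) \<or> L = {}"
    and "cmp (free_ext E) i K L \<in> cells (free_ext E)"
  shows "K \<in> cells (free_ext E)" "L \<in> cells (free_ext E)"
  using assms(3-5) empty_not_cell[of E] by (auto simp: free_ext_def)

lemma distinct_not_aspherical: "distinct fs \<Longrightarrow> \<not> aspherical fs"
proof
  assume d: "distinct fs" and "aspherical fs"
  then obtain ys i where y: "mset ys = mset fs" "Suc i < length ys" "ys ! i = ys ! Suc i"
    by (auto simp: aspherical_def perm_class_def)
  have "distinct ys" using d y(1) mset_eq_imp_distinct_iff by blast
  then show False using y(2,3) nth_eq_iff_index_eq[of ys i "Suc i"] by simp
qed

context free_polygraph
begin

definition cell_or_empty :: "('a, 'b, 'c, 'd) cell3 \<Rightarrow> bool" where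
  "cell_or_empty A \<longleftrightarrow> A \<in> cl3 \<or> A = {}"

lemma cell_or_empty_cmp: "cell_or_empty A \<Longrightarrow> cell_or_empty B \<Longrightarrow> cell_or_empty (cmp (free3 P) i A B)"
  using cmp_free_ext_cell_or_empty[of "ext3 P" A B i] by (simp add: cell_or_empty_def free3_def)

lemma cmp3_cellD:
  "cell_or_empty A \<Longrightarrow> cell_or_empty B \<Longrightarrow> cmp (free3 P) i A B \<in> cl3 \<Longrightarrow> A \<in> cl3 \<and> B \<in> cl3"
  using cmp_free_ext_cellD[of "ext3 P" A B i] by (simp add: cell_or_empty_def free3_def)

lemma F_rwD: "F.is3 A c d \<Longrightarrow> a \<in> cl2 \<Longrightarrow> F.rw A a \<in> cl3 \<Longrightarrow> t1 c = s1 a"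
  using cmp3D(2)[of A "up3 P a" 1] F.is3D(1,4,9)[of A c d] up3_inj[of "t1 c" "s1 a"] by (simp add: F.rw_def up3_simps)

lemma F_lwD: "F.is3 A c d \<Longrightarrow> f \<in> cl2 \<Longrightarrow> F.lw f A \<in> cl3 \<Longrightarrow> t1 f = s1 c"
  using cmp3D(2)[of "up3 P f" A 1] F.is3D(1,4,8)[of A c d] up3_inj[of "t1 f" "s1 c"] by (simp add: F.lw_def up3_simps)

lemma F_compD: "F.is3 A c d \<Longrightarrow> F.is3 B e f \<Longrightarrow> cmp (free3 P) 2 A B \<in> cl3 \<Longrightarrow> d = e"
  using cmp3D(2)[of A B 2] F.is3D(1,3,5)[of A c d] F.is3D(1,2)[of B e f] up3_inj[of d e] by simp

lemma peiffer_factor_left: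
  assumes "f \<in> cl2" "one v1" "one v2" "t0 v1 = s0 v2" "s1 f = v1 \<cdot> v2" "f = f' \<cdot> v2" "f' \<in> cl2"
  shows "t0 f' = s0 v2" "s1 f' = v1"
proof -
  note d = oneD[OF assms(2)] oneD[OF assms(3)]
  show t: "t0 f' = s0 v2" using cmp2D(2)[of f' v2 0] assms(1,6,7) d by simp
  have e: "s1 f' \<cdot> v2 = v1 \<cdot> v2" using assms(5,6,7) d t by simp
  have "wd (s1 f') @ wd v2 = wd v1 @ wd v2" using arg_cong[OF e, of wd] d t assms(4,7) by simp
  then have "len (s1 f') = len v1" by simp
  then show "s1 f' = v1" using one_cancel_left(1)[OF _ assms(3,2,3) _ assms(4) e] assms(7) t by simp
qed

lemma peiffer_factor_right:
  assumes "f \<in> cl2" "one v1" "one v2" "t0 v1 = s0 v2" "s1 f = v1 \<cdot> v2" "f = v1 \<cdot> f'" "f' \<in> cl2"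
  shows "t0 v1 = s0 f'" "s1 f' = v2"
proof -
  note d = oneD[OF assms(2)] oneD[OF assms(3)]
  show t: "t0 v1 = s0 f'" using cmp2D(2)[of v1 f' 0] assms(1,6,7) d by simp
  have e: "v1 \<cdot> s1 f' = v1 \<cdot> v2" using assms(5,6,7) d t by simp
  show "s1 f' = v2" using one_cancel_left(2)[OF assms(2) _ assms(2,3) _ assms(4) e] assms(7) t by simp
qed

text \<open>The cut falls behind the first or behind the second step; in both cases \<open>x\<close>
  and \<open>z\<close> are on different sides of it.\<close>

lemma strict_peiffer3:
  assumes "strict_peiffer P [x, y, z]"
  obtains x' y' z' where "split_pair x y x' y'" "split_pair x z x' z'" "s1 y' = s1 z'"
  | x' y' z' where "split_pair x z x' z'" "split_pair y z y' z'" "s1 x' = s1 y'"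
proof -
  from assms obtain v1 v2 m fs where p: "local_branching P [x, y, z]" "one v1" "one v2" "\<forall>f \<in> set [x, y, z]. s1 f = v1 \<cdot> v2"
    "1 \<le> m" "m < 3" "length fs = 3" "set fs \<subseteq> cl2" "\<forall>j<m. [x, y, z] ! j = fs ! j \<cdot> v2"
    "\<forall>j. m \<le> j \<and> j < 3 \<longrightarrow> [x, y, z] ! j = v1 \<cdot> fs ! j"
    unfolding strict_peiffer_def by (auto simp: numeral_3_eq_3)
  obtain x' y' z' where fs: "fs = [x', y', z']" using p(7) by (auto simp: numeral_3_eq_3 length_Suc_conv)
  have c: "x \<in> cl2" "y \<in> cl2" "z \<in> cl2" using p(1) by (simp_all add: local_branching_def)
  have c': "x' \<in> cl2" "y' \<in> cl2" "z' \<in> cl2" using p(8) fs by simp_all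
  have s: "s1 x = v1 \<cdot> v2" "s1 y = v1 \<cdot> v2" "s1 z = v1 \<cdot> v2" using p(4) by simp_all
  have "v1 \<cdot> v2 \<in> cl2" unfolding s(1)[symmetric] using c(1) by simp
  then have t: "t0 v1 = s0 v2" using cmp2D(2) oneD(1)[OF p(2)] oneD(1)[OF p(3)] by blast
  have x: "x = x' \<cdot> v2" using p(5) p(9)[rule_format, of 0] fs by simp
  have z: "z = v1 \<cdot> z'" using p(6) p(10)[rule_format, of 2] fs by (simp add: numeral_2_eq_2)
  note X = peiffer_factor_left[OF c(1) p(2,3) t s(1) x c'(1)] and Z = peiffer_factor_right[OF c(3) p(2,3) t s(3) z c'(3)]
  have xz: "split_pair x z x' z'" unfolding split_pair_def using c' X Z x z c2_simps(3)[of z'] by simp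
  consider "m = 1" | "m = 2" using p(5,6) by linarith
  then show ?thesis
  proof cases
    case 1
    have y: "y = v1 \<cdot> y'" using p(10)[rule_format, of 1] 1 fs by (simp add: One_nat_def)
    note Y = peiffer_factor_right[OF c(2) p(2,3) t s(2) y c'(2)]
    have "split_pair x y x' y'" unfolding split_pair_def using c' X Y x y c2_simps(3)[of y'] by simp
    then show ?thesis using that(1) xz Y(2) Z(2) by metis
  next
    case 2
    have y: "y = y' \<cdot> v2" using p(9)[rule_format, of 1] 2 fs by (simp add: One_nat_def)
    note Y = peiffer_factor_left[OF c(2) p(2,3) t s(2) y c'(2)]
    have "split_pair y z y' z'" unfolding split_pair_def using c' Y Z y z c2_simps(3)[of z'] by simp
    then show ?thesis using that(2) xz X(2) Y(2) by metis
  qed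
qed

end

section \<open>Critical triples, and the cocycle identity in general\<close>

context coherent_stage
begin

text \<open>A filling does not state the boundaries of \<open>A\<close>, \<open>B1\<close> and
  \<open>B2\<close>. They are recovered because the two composites are cells: neighbouring
  \<open>2\<close>-cells must agree, and left cancellation of the steps removes the common heads.
  The resulting equation is then whiskered by \<open>u\<close> and \<open>v\<close>.\<close>

lemma cocycle_critical:
  assumes cr: "critical P hs" "length hs = 3"
    and k: "\<forall>c \<in> set hs. ctx u c v" "one u" "one v" "\<forall>c \<in> set hs. stepw (whisk u c v)"
    and m: "mset [f, g, h] = mset (map (\<lambda>c. whisk u c v) hs)"
  shows "cocycle f g h"
proof -
  obtain f0 g0 h0 Afg Agh Afh a b c A B1 B2 where x: "mset [f0, g0, h0] = mset hs"
    "can f0 g0 Afg" "can g0 h0 Agh" "can f0 h0 Afh" "a \<in> cl2" "b \<in> cl2" "c \<in> cl2"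
    "A \<in> cl3" "B1 \<in> cl3" "B2 \<in> cl3"
    and X: "cmp (free3 P) 2 (cmp (free3 P) 2 (F.rw Afg a) (F.lw g0 A)) (F.rw Agh b) \<in> cl3"
    "cmp (free3 P) 2 (cmp (free3 P) 2 (F.lw f0 B1) (F.rw Afh c)) (F.lw h0 B2) \<in> cl3"
    "\<pi> (cmp (free3 P) 2 (cmp (free3 P) 2 (F.rw Afg a) (F.lw g0 A)) (F.rw Agh b)) =
     \<pi> (cmp (free3 P) 2 (cmp (free3 P) 2 (F.lw f0 B1) (F.rw Afh c)) (F.lw h0 B2))"
    using critical_triple[OF cr] by (elim exE conjE)
  let ?W = "\<lambda>c. whisk u c v"
  obtain a1 b1 where 1: "a1 \<in> cl2" "b1 \<in> cl2" "t1 f0 = s1 a1" "t1 g0 = s1 b1" "F.is3 Afg (f0 \<star> a1) (g0 \<star> b1)" "step f0" "step g0"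
    using x(2) by (rule can_is3)
  obtain a2 b2 where 2: "a2 \<in> cl2" "b2 \<in> cl2" "t1 g0 = s1 a2" "t1 h0 = s1 b2" "F.is3 Agh (g0 \<star> a2) (h0 \<star> b2)" "step h0"
    using x(3) by (rule can_is3)
  obtain a3 b3 where 3: "a3 \<in> cl2" "b3 \<in> cl2" "t1 f0 = s1 a3" "t1 h0 = s1 b3" "F.is3 Afh (f0 \<star> a3) (h0 \<star> b3)"
    using x(4) by (rule can_is3)
  note cl = step_cells[OF 1(6)] step_cells[OF 1(7)] step_cells[OF 2(6)]
  have ce: "cell_or_empty Y" if "Y \<in> cl3" for Y using that by (simp add: cell_or_empty_def)
  note up = ce[OF up3_simps(1)] and is3c = F.is3D(1)
  \<comment> \<open>Each factor is a cell or empty, and a composite with an empty factor is empty;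
    since both boundaries are cells, all six factors are.\<close>
  have e: "cell_or_empty (F.rw Afg a)" "cell_or_empty (F.lw g0 A)" "cell_or_empty (F.rw Agh b)"
    "cell_or_empty (F.lw f0 B1)" "cell_or_empty (F.rw Afh c)" "cell_or_empty (F.lw h0 B2)"
    unfolding F.rw_def F.lw_def
    by (intro cell_or_empty_cmp up ce is3c[OF 1(5)] is3c[OF 2(5)] is3c[OF 3(5)] x cl)+
  note l1 = cmp3_cellD[OF cell_or_empty_cmp[OF e(1,2)] e(3) X(1)] and r1 = cmp3_cellD[OF cell_or_empty_cmp[OF e(4,5)] e(6) X(2)]
  note l2 = cmp3_cellD[OF e(1,2) conjunct1[OF l1]] and r2 = cmp3_cellD[OF e(4,5) conjunct1[OF r1]]
  obtain p p' where pA: "F.is3 A p p'" using F_is3_ex[OF x(8)] .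
  obtain q q' where pB1: "F.is3 B1 q q'" using F_is3_ex[OF x(9)] .
  obtain r r' where pB2: "F.is3 B2 r r'" using F_is3_ex[OF x(10)] .
  note dA = F.is3D(4-7)[OF pA] and dB1 = F.is3D(4-7)[OF pB1] and dB2 = F.is3D(4-7)[OF pB2]
  have w: "t1 a1 = s1 a" "t1 a2 = s1 b" "t1 a3 = s1 c"
    using F_rwD[OF 1(5) x(5)] F_rwD[OF 2(5) x(6)] F_rwD[OF 3(5) x(7)] l1 l2 r2 1(1,3) 2(1,3) 3(1,3) cl by simp_all
  have w': "t1 g0 = s1 p" "t1 f0 = s1 q" "t1 h0 = s1 r"
    using F_lwD[OF pA cl(2)] F_lwD[OF pB1 cl(1)] F_lwD[OF pB2 cl(3)] l2 r1 r2 by blast+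
  have wb: "t1 b1 = s1 a" "t1 b2 = s1 b" "t1 b3 = s1 c"
    using F.is3D(7)[OF 1(5)] F.is3D(7)[OF 2(5)] F.is3D(7)[OF 3(5)] w 1(1-4) 2(1-4) 3(1-4) cl by simp_all
  have i1: "F.is3 (F.rw Afg a) (f0 \<star> (a1 \<star> a)) (g0 \<star> (b1 \<star> a))"
    using F.is3_rw[OF 1(5) x(5)] 1(1-4) cl w(1) wb(1) x(5) by (simp add: cmp1_assoc)
  have i2: "F.is3 (F.rw Agh b) (g0 \<star> (a2 \<star> b)) (h0 \<star> (b2 \<star> b))"
    using F.is3_rw[OF 2(5) x(6)] 2(1-4) cl w(2) wb(2) x(6) by (simp add: cmp1_assoc)
  have i3: "F.is3 (F.rw Afh c) (f0 \<star> (a3 \<star> c)) (h0 \<star> (b3 \<star> c))"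
    using F.is3_rw[OF 3(5) x(7)] 3(1-4) cl w(3) wb(3) x(7) by (simp add: cmp1_assoc)
  note iA = F.is3_lw[OF pA cl(2) w'(1)] and iB1 = F.is3_lw[OF pB1 cl(1) w'(2)] and iB2 = F.is3_lw[OF pB2 cl(3) w'(3)]
  have g1: "g0 \<star> (b1 \<star> a) = g0 \<star> p" using F_compD[OF i1 iA] l1 by blast
  have i12: "F.is3 (cmp (free3 P) 2 (F.rw Afg a) (F.lw g0 A)) (f0 \<star> (a1 \<star> a)) (g0 \<star> p')"
    using F.is3_comp[OF i1] iA g1 by simp
  have g2: "g0 \<star> p' = g0 \<star> (a2 \<star> b)" using F_compD[OF i12 i2 X(1)] .
  have g3: "f0 \<star> q' = f0 \<star> (a3 \<star> c)" using F_compD[OF iB1 i3] r1 by blast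
  have i13: "F.is3 (cmp (free3 P) 2 (F.lw f0 B1) (F.rw Afh c)) (f0 \<star> q) (h0 \<star> (b3 \<star> c))"
    using F.is3_comp[OF iB1] i3 g3 by simp
  have g4: "h0 \<star> (b3 \<star> c) = h0 \<star> r" using F_compD[OF i13 iB2 X(2)] .
  have iL: "F.is3 (cmp (free3 P) 2 (cmp (free3 P) 2 (F.rw Afg a) (F.lw g0 A)) (F.rw Agh b)) (f0 \<star> (a1 \<star> a)) (h0 \<star> (b2 \<star> b))"
    using F.is3_comp[OF i12] i2 g2 by simp
  have iR: "F.is3 (cmp (free3 P) 2 (cmp (free3 P) 2 (F.lw f0 B1) (F.rw Afh c)) (F.lw h0 B2)) (f0 \<star> q) (h0 \<star> r')"
    using F.is3_comp[OF i13] iB2 g4 by simp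
  note jL = \<pi>_is3[OF iL] and jR = \<pi>_is3[OF iR, folded X(3)]
  \<comment> \<open>The two boundaries have the same image in \<open>D\<close>, hence the same
    \<open>2\<close>-source and \<open>2\<close>-target there, and \<open>j\<close> is
    injective.\<close>
  have g5: "f0 \<star> (a1 \<star> a) = f0 \<star> q" "h0 \<star> (b2 \<star> b) = h0 \<star> r'"
    using j_inj is3D(2-5)[OF jL] is3D(2-5)[OF jR] by metis+
  have cm: "b1 \<star> a \<in> cl2" "a2 \<star> b \<in> cl2" "a3 \<star> c \<in> cl2" "b3 \<star> c \<in> cl2" "a1 \<star> a \<in> cl2" "b2 \<star> b \<in> cl2"
    "t1 g0 = s1 (b1 \<star> a)" "t1 g0 = s1 (a2 \<star> b)" "t1 f0 = s1 (a3 \<star> c)" "t1 h0 = s1 (b3 \<star> c)" "t1 f0 = s1 (a1 \<star> a)" "t1 h0 = s1 (b2 \<star> b)"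
    using 1(1-4) 2(1-4) 3(1-4) w wb x(5-7) by simp_all
  have q1: "b1 \<star> a = p" by (rule step_cancel[OF 1(7) cm(1) dA(1) cm(7) w'(1) g1])
  have q2: "p' = a2 \<star> b" by (rule step_cancel[OF 1(7) dA(2) cm(2) _ cm(8) g2]) (use w' dA in simp)
  have q3: "q' = a3 \<star> c" by (rule step_cancel[OF 1(6) dB1(2) cm(3) _ cm(9) g3]) (use w' dB1 in simp)
  have q4: "b3 \<star> c = r" by (rule step_cancel[OF 2(6) cm(4) dB2(1) cm(10) w'(3) g4])
  have q5: "a1 \<star> a = q" by (rule step_cancel[OF 1(6) cm(5) dB1(1) cm(11) w'(2) g5(1)])
  have q6: "b2 \<star> b = r'" by (rule step_cancel[OF 2(6) cm(6) dB2(2) cm(12) _ g5(2)]) (use w' dB2 in simp)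
  have iA': "F.is3 A (b1 \<star> a) (a2 \<star> b)" and iB1': "F.is3 B1 (a1 \<star> a) (a3 \<star> c)" and iB2': "F.is3 B2 (b3 \<star> c) (b2 \<star> b)"
    using pA pB1 pB2 q1 q2 q3 q4 q5 q6 by simp_all
  have set: "f0 \<in> set hs" "g0 \<in> set hs" "h0 \<in> set hs" using mset_eq_setD[OF x(1)] by auto
  have kx: "ctx u f0 v" "ctx u g0 v" "ctx u h0 v" using k(1) set by blast+
  have sw: "stepw (?W f0)" "stepw (?W g0)" "stepw (?W h0)" using k(4) set by blast+
  have kk: "ctx u a1 v" "ctx u b1 v" "ctx u a2 v" "ctx u b2 v" "ctx u a3 v" "ctx u b3 v"
    using ctx_cmp1(1,2)[of f0 a1 u v] ctx_cmp1(1,2)[of g0 b1 u v] ctx_cmp1(1,2)[of g0 a2 u v] ctx_cmp1(1,2)[of h0 b2 u v]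
      ctx_cmp1(1,2)[of f0 a3 u v] ctx_cmp1(1,2)[of h0 b3 u v] kx 1(1-4) 2(1-4) 3(1-4) cl by blast+
  have kw: "ctx u a v" "ctx u b v" "ctx u c v"
    using ctx_cmp1(1,2)[of a1 a u v] ctx_cmp1(1,2)[of a2 b u v] ctx_cmp1(1,2)[of a3 c u v] kk 1(1) 2(1) 3(1) w x(5-7) by blast+
  have wc: "?W (x \<star> y) = ?W x \<star> ?W y \<and> ctx u (x \<star> y) v" if "x \<in> cl2" "y \<in> cl2" "t1 x = s1 y" "ctx u x v" for x y
    using whisk_cmp1[OF that] ctx_cmp1(1)[OF that(1-3)] that(4) by blast
  have ws: "?W x \<in> cl2 \<and> ?W y \<in> cl2 \<and> t1 (?W x) = s1 (?W y)" if "ctx u x v" "ctx u y v" "t1 x = s1 y" for x y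
    using that by simp
  have sl: "local_branching P [?W f0, ?W g0]" "local_branching P [?W g0, ?W h0]" "local_branching P [?W f0, ?W h0]"
    using sw by (simp_all add: local_branching2)
  note cans = can_wh[OF x(2) k(2,3) sl(1)] can_wh[OF x(3) k(2,3) sl(2)] can_wh[OF x(4) k(2,3) sl(3)]
  have j1: "F.is3 (F.wh u Afg v) (?W f0 \<star> ?W a1) (?W g0 \<star> ?W b1)"
    using F.is3_wh[OF 1(5), of u v] wc[OF cl(1) 1(1,3) kx(1)] wc[OF cl(2) 1(2,4) kx(2)] by simp
  have j2: "F.is3 (F.wh u Agh v) (?W g0 \<star> ?W a2) (?W h0 \<star> ?W b2)"
    using F.is3_wh[OF 2(5), of u v] wc[OF cl(2) 2(1,3) kx(2)] wc[OF cl(3) 2(2,4) kx(3)] by simp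
  have j3: "F.is3 (F.wh u Afh v) (?W f0 \<star> ?W a3) (?W h0 \<star> ?W b3)"
    using F.is3_wh[OF 3(5), of u v] wc[OF cl(1) 3(1,3) kx(1)] wc[OF cl(3) 3(2,4) kx(3)] by simp
  have m1: "is3 (wh u (\<pi> A) v) (?W b1 \<star> ?W a) (?W a2 \<star> ?W b)"
    using is3_wh[OF \<pi>_is3[OF iA'], of u v] wc[OF 1(2) x(5) wb(1) kk(2)] wc[OF 2(1) x(6) w(2) kk(3)] by simp
  have m2: "is3 (wh u (\<pi> B1) v) (?W a1 \<star> ?W a) (?W a3 \<star> ?W c)"
    using is3_wh[OF \<pi>_is3[OF iB1'], of u v] wc[OF 1(1) x(5) w(1) kk(1)] wc[OF 3(1) x(7) w(3) kk(5)] by simp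
  have m3: "is3 (wh u (\<pi> B2) v) (?W b3 \<star> ?W c) (?W b2 \<star> ?W b)"
    using is3_wh[OF \<pi>_is3[OF iB2'], of u v] wc[OF 3(2) x(7) wb(3) kk(6)] wc[OF 2(2) x(6) wb(2) kk(4)] by simp
  have iAl: "F.is3 (F.lw g0 A) (g0 \<star> (b1 \<star> a)) (g0 \<star> (a2 \<star> b))" and iB1l: "F.is3 (F.lw f0 B1) (f0 \<star> (a1 \<star> a)) (f0 \<star> (a3 \<star> c))"
    and iB2l: "F.is3 (F.lw h0 B2) (h0 \<star> (b3 \<star> c)) (h0 \<star> (b2 \<star> b))"
    using iA iB1 iB2 q1 q2 q3 q4 q5 q6 by simp_all
  have kf: "ctx u (f0 \<star> (a1 \<star> a)) v" "ctx u (f0 \<star> a1) v" "ctx u (g0 \<star> a2) v" "ctx u (f0 \<star> a3) v" "ctx u (b1 \<star> a) v" "ctx u (a1 \<star> a) v" "ctx u (b3 \<star> c) v"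
    using wc[OF cl(1) cm(5,11) kx(1)] wc[OF cl(1) 1(1,3) kx(1)] wc[OF cl(2) 2(1,3) kx(2)] wc[OF cl(1) 3(1,3) kx(1)]
      wc[OF 1(2) x(5) wb(1) kk(2)] wc[OF 1(1) x(5) w(1) kk(1)] wc[OF 3(2) x(7) wb(3) kk(6)] by blast+
  have tc: "t1 (f0 \<star> a1) = s1 a" "t1 (g0 \<star> a2) = s1 b" "t1 (f0 \<star> a3) = s1 c" using 1(1,3) 2(1,3) 3(1,3) cl w by simp_all
  have E1: "\<pi> (F.wh u (F.rw Afg a) v) = rw (\<pi> (F.wh u Afg v)) (?W a)"
    using F.wh_rw[OF 1(5) x(5) tc(1) kf(2)] \<pi>_rw[OF F.is3_wh[OF 1(5) kf(2)], of "?W a"] kw kf(2) tc(1) by simp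
  have E2: "\<pi> (F.wh u (F.rw Agh b) v) = rw (\<pi> (F.wh u Agh v)) (?W b)"
    using F.wh_rw[OF 2(5) x(6) tc(2) kf(3)] \<pi>_rw[OF F.is3_wh[OF 2(5) kf(3)], of "?W b"] kw kf(3) tc(2) by simp
  have E3: "\<pi> (F.wh u (F.rw Afh c) v) = rw (\<pi> (F.wh u Afh v)) (?W c)"
    using F.wh_rw[OF 3(5) x(7) tc(3) kf(4)] \<pi>_rw[OF F.is3_wh[OF 3(5) kf(4)], of "?W c"] kw kf(4) tc(3) by simp
  have L1: "wh u (\<pi> (F.lw g0 A)) v = lw (?W g0) (wh u (\<pi> A) v)"
    using \<pi>_lw[OF iA' cl(2) cm(7)] wh_lw[OF \<pi>_is3[OF iA'] cl(2) cm(7) kf(5)] by simp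
  have L2: "wh u (\<pi> (F.lw f0 B1)) v = lw (?W f0) (wh u (\<pi> B1) v)"
    using \<pi>_lw[OF iB1' cl(1) cm(11)] wh_lw[OF \<pi>_is3[OF iB1'] cl(1) cm(11) kf(6)] by simp
  have L3: "wh u (\<pi> (F.lw h0 B2)) v = lw (?W h0) (wh u (\<pi> B2) v)"
    using \<pi>_lw[OF iB2' cl(3) cm(10)] wh_lw[OF \<pi>_is3[OF iB2'] cl(3) cm(10) kf(7)] by simp
  have kg: "ctx u (g0 \<star> (a2 \<star> b)) v" "ctx u (f0 \<star> (a3 \<star> c)) v"
    using wc[OF cl(2) cm(2,8) kx(2)] wc[OF cl(1) cm(3,9) kx(1)] by blast+
  have "wh u (\<pi> (cmp (free3 P) 2 (cmp (free3 P) 2 (F.rw Afg a) (F.lw g0 A)) (F.rw Agh b))) v =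
    rw (\<pi> (F.wh u Afg v)) (?W a) \<bullet> lw (?W g0) (wh u (\<pi> A) v) \<bullet> rw (\<pi> (F.wh u Agh v)) (?W b)"
    unfolding \<pi>_comp[OF F.is3_comp[OF i1 iAl] i2] \<pi>_comp[OF i1 iAl]
      wh_comp[OF is3_comp[OF \<pi>_is3[OF i1] \<pi>_is3[OF iAl]] \<pi>_is3[OF i2] kf(1)] wh_comp[OF \<pi>_is3[OF i1] \<pi>_is3[OF iAl] kf(1)]
      L1 E1[symmetric] E2[symmetric] \<pi>_wh[OF i1 kf(1)] \<pi>_wh[OF i2 kg(1)] ..
  moreover have "wh u (\<pi> (cmp (free3 P) 2 (cmp (free3 P) 2 (F.lw f0 B1) (F.rw Afh c)) (F.lw h0 B2))) v =
    lw (?W f0) (wh u (\<pi> B1) v) \<bullet> rw (\<pi> (F.wh u Afh v)) (?W c) \<bullet> lw (?W h0) (wh u (\<pi> B2) v)"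
    unfolding \<pi>_comp[OF F.is3_comp[OF iB1l i3] iB2l] \<pi>_comp[OF iB1l i3]
      wh_comp[OF is3_comp[OF \<pi>_is3[OF iB1l] \<pi>_is3[OF i3]] \<pi>_is3[OF iB2l] kf(1)] wh_comp[OF \<pi>_is3[OF iB1l] \<pi>_is3[OF i3] kf(1)]
      L2 L3 E3[symmetric] \<pi>_wh[OF i3 kg(2)] ..
  ultimately have eq: "rw (\<pi> (F.wh u Afg v)) (?W a) \<bullet> lw (?W g0) (wh u (\<pi> A) v) \<bullet> rw (\<pi> (F.wh u Agh v)) (?W b) =
    lw (?W f0) (wh u (\<pi> B1) v) \<bullet> rw (\<pi> (F.wh u Afh v)) (?W c) \<bullet> lw (?W h0) (wh u (\<pi> B2) v)"
    using X(3) by simp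
  have c0: "cocycle (?W f0) (?W g0) (?W h0)"
    by (rule cocycle_of_filling[OF sw cans _ _ _ _ j1 _ _ _ _ j2 _ _ _ _ j3 _ _ _ _ _ _ m1 m2 m3 eq])
      (use kk kw kx w 1(3,4) 2(3,4) 3(3,4) in simp_all)
  have "mset [?W f0, ?W g0, ?W h0] = mset [f, g, h]"
    unfolding m mset_map x(1)[symmetric] by simp
  then show ?thesis by (rule cocycle_perm[OF sw c0])
qed

lemma cocycle_all:
  assumes s: "stepw f" "stepw g" "stepw h"
  shows "cocycle f g h"
proof (cases "distinct [f, g, h]")
  case False
  then consider "f = g" | "g = h" | "f = h" by auto
  then show ?thesis
  proof cases
    case 1 then show ?thesis using cocycle_aspherical s by simp
  next
    case 2
    have "cocycle h h f" by (rule cocycle_aspherical[OF s(3,1)])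
    then show ?thesis using cocycle_perm[OF s(3,3,1)] 2 by simp
  next
    case 3
    have "cocycle h h g" by (rule cocycle_aspherical[OF s(3,2)])
    then show ?thesis using cocycle_perm[OF s(3,3,2)] 3 by simp
  qed
next
  case True
  have lb: "local_branching P [f, g, h]" using s unfolding local_branching_def by simp
  have na: "\<not> aspherical [f, g, h]" by (rule distinct_not_aspherical[OF True])
  show ?thesis
  proof (cases "peiffer P [f, g, h]")
    case True
    then obtain ys where ys: "mset ys = mset [f, g, h]" "strict_peiffer P ys" by (auto simp: peiffer_def perm_class_def)
    have "length ys = 3" using mset_eq_length[OF ys(1)] by simp
    then obtain x y z where xyz: "ys = [x, y, z]" by (auto simp: numeral_3_eq_3 length_Suc_conv)
    have "set [x, y, z] = set [f, g, h]" using mset_eq_setD[OF ys(1)] xyz by simp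
    then have t: "stepw x" "stepw y" "stepw z" using s by auto
    note m = ys(1)[unfolded xyz]
    from ys(2)[unfolded xyz] show ?thesis
    proof (cases rule: strict_peiffer3)
      case (1 x' y' z')
      have "cocycle y x z" by (rule cocycle_peiffer_left[OF 1(1,2) t 1(3)])
      moreover have "mset [y, x, z] = mset [f, g, h]" using m by (simp add: add_mset_commute)
      ultimately show ?thesis using cocycle_perm[OF t(2,1,3)] by blast
    next
      case (2 x' y' z')
      have "cocycle x z y" by (rule cocycle_peiffer_right[OF 2(1,2) t 2(3)])
      moreover have "mset [x, z, y] = mset [f, g, h]" using m by (simp add: add_mset_commute)
      ultimately show ?thesis using cocycle_perm[OF t(1,3,2)] by blast
    qed
  next
    case False
    then have "overlapping P [f, g, h]" using lb na by (simp add: overlapping_def)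
    from overlapping_core[OF this list.distinct(2)] obtain u v gs
      where g': "critical P gs \<and> one u \<and> one v \<and> [f, g, h] = map (\<lambda>c. whisk u c v) gs \<and> (\<forall>c \<in> set gs. ctx u c v)"
      by (elim exE)
    then have g: "critical P gs" "one u" "one v" "[f, g, h] = map (\<lambda>c. whisk u c v) gs" "\<forall>c \<in> set gs. ctx u c v" by simp_all
    have l: "length gs = 3" using arg_cong[OF g(4), of length] by simp
    have "set [f, g, h] = (\<lambda>c. whisk u c v) ` set gs" unfolding g(4) by simp
    then have "\<forall>c \<in> set gs. whisk u c v \<in> {f, g, h}" by auto
    then have "\<forall>c \<in> set gs. stepw (whisk u c v)" using s by (metis insertE emptyE)
    then show ?thesis by (rule cocycle_critical[OF g(1) l g(5,2,3)]) (simp only: g(4))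
  qed
qed

section \<open>A coherent comparison of all two-cells from \<open>w\<close> with
  \<open>sg w\<close>\<close>

lemma one_w: "one w"
  using reach by auto

definition from_w :: "('a, 'b, 'c) cell2 \<Rightarrow> bool" where
  "from_w v \<longleftrightarrow> (\<exists>e \<in> cl2. s1 e = w \<and> t1 e = v)"

lemma from_w_w: "from_w w"
  using oneD[OF one_w] unfolding from_w_def by blast

lemma from_w_cell: "c \<in> cl2 \<Longrightarrow> from_w (s1 c) \<Longrightarrow> from_w (t1 c)"
  unfolding from_w_def by (metis cmp1_simps(1,4,5))

lemma from_w_cases: "from_w v \<Longrightarrow> v = w \<or> v \<prec> w"
  unfolding from_w_def lt_def using oneD by metis

lemma sg_from_w:
  assumes "from_w v"
  shows "sg v \<in> cl2" "s1 (sg v) = v" "t1 (sg v) = n"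
  using assms sg unfolding from_w_def by blast+

lemma low_from_w: "from_w v \<Longrightarrow> v \<noteq> w \<Longrightarrow> c \<in> cl2 \<Longrightarrow> s1 c = v \<Longrightarrow> t1 c = n \<Longrightarrow> low v c"
  using from_w_cases by (auto simp: low_def)

text \<open>A cocycle is trivialised by a base point. Take for \<open>f0\<close> a first step of
  \<open>sg w\<close>, which compares directly with \<open>sg w\<close> by some \<open>k\<close>
  below \<open>w\<close>, and put \<open>K f = T f f0 \<bullet> k\<close>. If \<open>sg w\<close> is
  an identity, then \<open>w = n\<close> and there are no steps at all.\<close>

lemma stepw_ex_K:
  "\<exists>K. (\<forall>f. stepw f \<longrightarrow> is3 (K f) (f \<star> sg (t1 f)) (sg w)) \<and> (\<forall>f g. stepw f \<and> stepw g \<longrightarrow> K f = T f g \<bullet> K g)"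
proof -
  note sw = sg_from_w[OF from_w_w]
  from sw(1) show ?thesis
  proof (cases rule: cell_cases)
    case 1
    have "w = n" using oneD(2,3)[OF 1] sw(2,3) by simp
    have "\<not> stepw f" for f
    proof
      assume f: "stepw f"
      then have "f = n" using from_n[of f] \<open>w = n\<close> by simp
      then show False using f step_not_one one_n by blast
    qed
    then show ?thesis by blast
  next
    case (2 f0 a0)
    have f0: "stepw f0" using 2 sw by simp
    have la: "low (t1 f0) a0" using step_lt[of f0] 2 f0 sw(3) by (simp add: low_def)
    let ?k = "lw f0 (Z (sg (t1 f0)) a0)"
    have k: "is3 ?k (f0 \<star> sg (t1 f0)) (sg w)" unfolding 2(4)
      by (rule is3_lw[OF Z_is3[OF low_sg[OF f0] la]]) (use sg[of f0] f0 in simp_all)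
    have "is3 (T f f0 \<bullet> ?k) (f \<star> sg (t1 f)) (sg w)" if "stepw f" for f
      by (rule is3_comp[OF T_is3[OF that f0] k])
    moreover have "T f f0 \<bullet> ?k = T f g \<bullet> (T g f0 \<bullet> ?k)" if "stepw f \<and> stepw g" for f g
      using comp_assoc[OF T_is3[of f g] T_is3[of g f0] k] cocycle_all[of f g f0] that f0 by (simp add: cocycle_def)
    ultimately show ?thesis by (intro exI[of _ "\<lambda>f. T f f0 \<bullet> ?k"]) blast
  qed
qed

definition K :: "('a, 'b, 'c) cell2 \<Rightarrow> 'x" where
  "K = (SOME K. (\<forall>f. stepw f \<longrightarrow> is3 (K f) (f \<star> sg (t1 f)) (sg w)) \<and> (\<forall>f g. stepw f \<and> stepw g \<longrightarrow> K f = T f g \<bullet> K g))"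

lemma K_is3: "stepw f \<Longrightarrow> is3 (K f) (f \<star> sg (t1 f)) (sg w)"
  and K_eq: "stepw f \<Longrightarrow> stepw g \<Longrightarrow> K f = T f g \<bullet> K g"
  using someI_ex[OF stepw_ex_K, folded K_def] by blast+

text \<open>Behind the first step the comparison with \<open>sg (t1 f)\<close> is forced;
  \<open>K f\<close> then leads to \<open>sg w\<close>.\<close>

definition head_value where
  "head_value f a = lw f (Z (a \<star> sg (t1 a)) (sg (t1 f))) \<bullet> K f"

text \<open>Away from \<open>w\<close> there is only one candidate. The identity of \<open>w\<close>
  has no first step and is treated apart; for the other cells the description is meaningful because
  all possible first steps give the same value, as \<open>S_step\<close> shows.\<close>

definition S :: "('a, 'b, 'c) cell2 \<Rightarrow> 'x" where
  "S c = (if s1 c \<noteq> w then Z (c \<star> sg (t1 c)) (sg (s1 c)) else if one c then j (sg w) else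
     (THE M. \<exists>f a. stepw f \<and> a \<in> cl2 \<and> t1 f = s1 a \<and> c = f \<star> a \<and> M = head_value f a))"

lemma head_parts:
  assumes "stepw f" "a \<in> cl2" "t1 f = s1 a"
  shows "low (t1 f) (a \<star> sg (t1 a))" "sg (t1 a) \<in> cl2" "s1 (sg (t1 a)) = t1 a" "t1 (sg (t1 a)) = n"
    "is3 (lw f (Z (a \<star> sg (t1 a)) (sg (t1 f)))) (f \<star> a \<star> sg (t1 a)) (f \<star> sg (t1 f))"
proof -
  show q: "sg (t1 a) \<in> cl2" "s1 (sg (t1 a)) = t1 a" "t1 (sg (t1 a)) = n" using sg[of "f \<star> a"] assms by simp_all
  show l: "low (t1 f) (a \<star> sg (t1 a))" using low_ext[OF assms(1,2) assms(3)[symmetric] q] .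
  have "is3 (lw f (Z (a \<star> sg (t1 a)) (sg (t1 f)))) (f \<star> (a \<star> sg (t1 a))) (f \<star> sg (t1 f))"
    by (rule is3_lw[OF Z_is3[OF l low_sg[OF assms(1)]]]) (use assms q in simp_all)
  then show "is3 (lw f (Z (a \<star> sg (t1 a)) (sg (t1 f)))) (f \<star> a \<star> sg (t1 a)) (f \<star> sg (t1 f))"
    using assms q by (simp add: cmp1_assoc)
qed

text \<open>For disjoint first steps of one \<open>2\<close>-cell, \<open>T f g\<close> is built
  from an identity and two comparisons below \<open>w\<close>. The first of them cancels against the
  one in \<open>head_value\<close>, and \<open>K f = T f g \<bullet> K g\<close> does the
  rest.\<close>

lemma head_value_split:
  assumes sp: "split_pair f g f' g'" and s: "stepw f" "stepw g" and e: "e \<in> cl2" "s1 e = t1 f' \<cdot> t1 g'"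
  shows "head_value f ((t1 f' \<cdot> g') \<star> e) = head_value g ((f' \<cdot> t1 g') \<star> e)"
proof -
  define a where "a = (t1 f' \<cdot> g') \<star> e"
  define b where "b = (f' \<cdot> t1 g') \<star> e"
  note sq = split_pair_square[OF sp]
  have ca: "a \<in> cl2" "b \<in> cl2" "t1 f = s1 a" "t1 g = s1 b" "t1 a = t1 e" "t1 b = t1 e"
    unfolding a_def b_def using sq e by (simp_all del: cmp0_simps)
  note hf = head_parts[OF s(1) ca(1,3)] and hg = head_parts[OF s(2) ca(2,4)]
  let ?q = "sg (t1 e)"
  have ee: "ends e ?q" using hf(2-4) ca(5) by (simp add: ends_def)
  note ts = T_split_pair[OF sp s e ee, folded a_def b_def]
  have lf: "lw f (Z (a \<star> ?q) (sg (t1 f))) \<bullet> lw f (Z (sg (t1 f)) (a \<star> ?q)) = j (f \<star> a \<star> ?q)"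
    using lw_Z_comp[OF s(1) hf(1) low_sg[OF s(1)] hf(1)] lw_Z_refl[OF s(1) hf(1)] ca hf(2-4) s by (simp add: cmp1_assoc)
  note p = transfer_parts[OF ts(1,6)]
  have r: "rw (j (f \<star> a)) ?q = j (f \<star> a \<star> ?q)" using s ca hf(2,3) by simp
  \<comment> \<open>The middle factor of the transfer is a whiskered identity and drops out.\<close>
  have T: "T f g = lw f (Z (sg (t1 f)) (a \<star> ?q)) \<bullet> lw g (Z (b \<star> ?q) (sg (t1 g)))"
    unfolding ts(2) transfer_def r
    using comp_id(1)[OF p(3)] ts(5) by simp
  have p3: "is3 (lw g (Z (b \<star> ?q) (sg (t1 g)))) (f \<star> a \<star> ?q) (g \<star> sg (t1 g))" using p(3) ts(5) by simp
  have "head_value f a = lw f (Z (a \<star> ?q) (sg (t1 f))) \<bullet> (T f g \<bullet> K g)"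
    unfolding head_value_def ca(5) K_eq[OF s, symmetric] ..
  also have "\<dots> = lw f (Z (a \<star> ?q) (sg (t1 f))) \<bullet> T f g \<bullet> K g"
    using comp_assoc[OF p(4) T_is3[OF s] K_is3[OF s(2)]] by simp
  also have "lw f (Z (a \<star> ?q) (sg (t1 f))) \<bullet> T f g = lw g (Z (b \<star> ?q) (sg (t1 g)))"
    unfolding T using comp_assoc[OF p(4) p(1) p3] lf comp_id(1)[OF p3] by simp
  finally show ?thesis unfolding head_value_def ca(6) a_def[symmetric] b_def[symmetric] .
qed

text \<open>By \<open>steps_eq_cases\<close> two decompositions of a \<open>2\<close>-cell into
  first step and rest are equal or differ by an exchange of disjoint steps, which is
  \<open>head_value_split\<close>.\<close>

lemma S_step:
  assumes "stepw f" "a \<in> cl2" "t1 f = s1 a"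
  shows "S (f \<star> a) = head_value f a"
proof -
  have n1: "\<not> one (f \<star> a)" using not_one_cmp1[of f a] step_not_one assms by simp
  have "(THE M. \<exists>g b. stepw g \<and> b \<in> cl2 \<and> t1 g = s1 b \<and> f \<star> a = g \<star> b \<and> M = head_value g b) = head_value f a"
  proof (rule the_equality)
    show "\<exists>g b. stepw g \<and> b \<in> cl2 \<and> t1 g = s1 b \<and> f \<star> a = g \<star> b \<and> head_value f a = head_value g b"
      using assms by blast
    fix M assume "\<exists>g b. stepw g \<and> b \<in> cl2 \<and> t1 g = s1 b \<and> f \<star> a = g \<star> b \<and> M = head_value g b"
    then obtain g b where g: "stepw g" "b \<in> cl2" "t1 g = s1 b" "f \<star> a = g \<star> b" "M = head_value g b" by blast
    have "head_value f a = head_value g b"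
      using steps_eq_cases[OF conjunct1[OF assms(1)] conjunct1[OF g(1)] assms(2) g(2) assms(3) g(3,4)]
        head_value_split[OF _ assms(1) g(1)] head_value_split[OF _ g(1) assms(1)] by metis
    then show "M = head_value f a" using g(5) by simp
  qed
  then show ?thesis unfolding S_def using n1 assms by simp
qed

lemma S_one: "one c \<Longrightarrow> s1 c = w \<Longrightarrow> S c = j (sg w)"
  by (simp add: S_def)

lemma S_low: "s1 c \<noteq> w \<Longrightarrow> S c = Z (c \<star> sg (t1 c)) (sg (s1 c))"
  by (simp add: S_def)

lemma cell_from_w_cases:
  assumes "c \<in> cl2" "s1 c = w"
  obtains "one c" "c = w" | f a where "stepw f" "a \<in> cl2" "t1 f = s1 a" "c = f \<star> a" "t1 c \<noteq> w"
proof -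
  from assms(1) show ?thesis
  proof (cases rule: cell_cases)
    case 1
    have "c = w" using trans[OF oneD(2)[OF 1, symmetric] assms(2)] .
    then show ?thesis by (rule that(1)[OF 1])
  next
    case (2 f a)
    have s: "stepw f" using 2 assms(2) by simp
    have "\<not> one c" using not_one_cmp1[of f a] step_not_one 2 by simp
    then have "t1 c \<prec> w" using assms unfolding lt_def by blast
    then have "t1 c \<noteq> w" using lt_irrefl by metis
    then show ?thesis using that(2)[OF s 2(2-4)] by simp
  qed
qed

lemma S_is3:
  assumes "c \<in> cl2" "from_w (s1 c)"
  shows "is3 (S c) (c \<star> sg (t1 c)) (sg (s1 c))"
proof (cases "s1 c = w")
  case False
  note q = sg_from_w[OF from_w_cell[OF assms]]
  have "low (s1 c) (c \<star> sg (t1 c))" using low_from_w[OF assms(2) False, of "c \<star> sg (t1 c)"] assms(1) q by simp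
  moreover have "low (s1 c) (sg (s1 c))" using low_from_w[OF assms(2) False] sg_from_w[OF assms(2)] by simp
  ultimately show ?thesis unfolding S_low[OF False] by (rule Z_is3)
next
  case True
  note sw = sg_from_w[OF from_w_w]
  from assms(1) True show ?thesis
  proof (cases rule: cell_from_w_cases)
    case 1
    have "w \<star> sg w = sg w" using c2_simps(19)[OF sw(1)] sw(2) by simp
    then show ?thesis using S_one[OF 1(1) True] 1(2) oneD(2,3)[OF one_w] is3_id[OF sw(1)] by simp
  next
    case (2 f a)
    have t: "t1 c = t1 a" using 2 by simp
    show ?thesis unfolding 2(4) S_step[OF 2(1-3)] head_value_def
      using is3_comp[OF head_parts(5)[OF 2(1-3)] K_is3[OF 2(1)]] 2 True by simp
  qed
qed

text \<open>If \<open>c\<close> is not an identity at \<open>w\<close>, then \<open>d\<close> starts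
  below \<open>w\<close>; only the first step of \<open>c\<close> carries information, and both
  sides use the same one.\<close>

lemma S_cmp:
  assumes "c \<in> cl2" "d \<in> cl2" "t1 c = s1 d" "from_w (s1 c)"
  shows "S (c \<star> d) = lw c (S d) \<bullet> S c"
proof -
  have fd: "from_w (s1 d)" using from_w_cell[OF assms(1,4)] assms(3) by simp
  note qd = sg_from_w[OF from_w_cell[OF assms(2) fd]] and qs = sg_from_w[OF fd]
  have ld: "is3 (lw c (S d)) (c \<star> d \<star> sg (t1 d)) (c \<star> sg (s1 d))"
    using is3_lw[OF S_is3[OF assms(2) fd] assms(1)] assms qd by (simp add: cmp1_assoc)
  have sc: "is3 (S c) (c \<star> sg (s1 d)) (sg (s1 c))" using S_is3[OF assms(1,4)] assms(3) by simp
  have scd: "is3 (S (c \<star> d)) (c \<star> d \<star> sg (t1 d)) (sg (s1 c))" using S_is3[of "c \<star> d"] assms by simp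
  show ?thesis
  proof (cases "s1 c = w")
    case False
    have "low (s1 c) (c \<star> d \<star> sg (t1 d))" using low_from_w[OF assms(4) False, of "c \<star> d \<star> sg (t1 d)"] assms qd by simp
    then show ?thesis using is3_low_unique[OF scd is3_comp[OF ld sc]] by blast
  next
    case True
    from assms(1) True show ?thesis
    proof (cases rule: cell_from_w_cases)
      case 1
      have w: "s1 d = w" using 1 assms(3) oneD(3)[OF one_w] by simp
      note sd = S_is3[OF assms(2) fd]
      have "lw c (S d) = S d" using lw_one[OF sd] 1(2) w assms qd by simp
      moreover have "c \<star> d = d" using 1(2) w c2_simps(19)[OF assms(2)] by simp
      ultimately show ?thesis using S_one[OF 1(1) True] comp_id(2)[OF sd] w by simp
    next
      case (2 f a)
      have ta: "t1 a = s1 d" using 2 assms(3) by simp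
      have nw: "s1 d \<noteq> w" using 2(5) assms(3) by simp
      have Sd: "S d = Z (d \<star> sg (t1 d)) (sg (s1 d))" by (rule S_low[OF nw])
      note f = step_cells[OF conjunct1[OF 2(1)]]
      have ad: "a \<star> d \<in> cl2" "t1 f = s1 (a \<star> d)" "t1 (a \<star> d) = t1 d" using 2 assms ta by simp_all
      note ha = head_parts[OF 2(1-3)] and had = head_parts[OF 2(1) ad(1,2)]
      have cd: "c \<star> d = f \<star> (a \<star> d)" using 2 assms ta f by (simp add: cmp1_assoc)
      have zd: "is3 (S d) (d \<star> sg (t1 d)) (sg (s1 d))" by (rule S_is3[OF assms(2) fd])
      have "lw c (S d) = lw f (lw a (S d))"
        unfolding 2(4) using lw_lw[OF zd f 2(2,3)] ta assms qd by simp
      \<comment> \<open>Behind the step \<open>f\<close> everything is below \<open>w\<close>, so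
        this is the only \<open>3\<close>-cell between its \<open>2\<close>-cells.\<close>
      also have "lw a (S d) = Z (a \<star> d \<star> sg (t1 d)) (a \<star> sg (t1 a))"
      proof (rule Z_eq)
        show "is3 (lw a (S d)) (a \<star> d \<star> sg (t1 d)) (a \<star> sg (t1 a))"
          using is3_lw[OF zd 2(2)] ta 2(2) assms qd by (simp add: cmp1_assoc)
        show "low (t1 f) (a \<star> d \<star> sg (t1 d))" using had(1) ad(3) by simp
      qed
      finally have L: "lw c (S d) = lw f (Z (a \<star> d \<star> sg (t1 d)) (a \<star> sg (t1 a)))" .
      have l: "low (t1 f) (a \<star> d \<star> sg (t1 d))" using had(1) ad(3) by simp
      have i: "is3 (lw c (S d)) (c \<star> d \<star> sg (t1 d)) (f \<star> a \<star> sg (t1 a))" using ld 2(4) ta by simp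
      have "lw c (S d) \<bullet> S c = lw c (S d) \<bullet> lw f (Z (a \<star> sg (t1 a)) (sg (t1 f))) \<bullet> K f"
        unfolding 2(4) S_step[OF 2(1-3)] head_value_def
        using comp_assoc[OF i ha(5) K_is3[OF 2(1)]] 2(4) by simp
      also have "\<dots> = lw f (Z (a \<star> d \<star> sg (t1 d)) (sg (t1 f))) \<bullet> K f"
        unfolding L lw_Z_comp[OF 2(1) l ha(1) low_sg[OF 2(1)]] ..
      also have "\<dots> = S (c \<star> d)" unfolding cd S_step[OF 2(1) ad(1,2)] head_value_def ad(3) ..
      finally show ?thesis by simp
    qed
  qed
qed

text \<open>\<open>S\<close> compares every \<open>2\<close>-cell with the chosen one; the claim is that all \<open>3\<close>-cells respect it.\<close>

definition natural :: "('a, 'b, 'c, 'd) cell3 \<Rightarrow> bool" where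
  "natural A \<longleftrightarrow> (\<forall>c d. F.is3 A c d \<longrightarrow> from_w (s1 c) \<longrightarrow> rw (\<pi> A) (sg (t1 c)) \<bullet> S d = S c)"

section \<open>Naturality of all three-cells with respect to \<open>S\<close>\<close>

lemma natural_parts:
  assumes "F.is3 A c d" "from_w (s1 c)"
  shows "sg (t1 c) \<in> cl2" "s1 (sg (t1 c)) = t1 c" "t1 (sg (t1 c)) = n"
    "is3 (rw (\<pi> A) (sg (t1 c))) (c \<star> sg (t1 c)) (d \<star> sg (t1 c))"
    "is3 (S c) (c \<star> sg (t1 c)) (sg (s1 c))" "is3 (S d) (d \<star> sg (t1 c)) (sg (s1 c))" "from_w (s1 d)"
proof -
  note k = F.is3D(4-7)[OF assms(1)]
  show q: "sg (t1 c) \<in> cl2" "s1 (sg (t1 c)) = t1 c" "t1 (sg (t1 c)) = n"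
    using sg_from_w[OF from_w_cell[OF k(1) assms(2)]] by simp_all
  show "is3 (rw (\<pi> A) (sg (t1 c))) (c \<star> sg (t1 c)) (d \<star> sg (t1 c))"
    by (rule is3_rw[OF \<pi>_is3[OF assms(1)] q(1)]) (simp add: q(2))
  show "is3 (S c) (c \<star> sg (t1 c)) (sg (s1 c))" by (rule S_is3[OF k(1) assms(2)])
  show f: "from_w (s1 d)" using assms(2) k(3) by simp
  show "is3 (S d) (d \<star> sg (t1 c)) (sg (s1 c))" using S_is3[OF k(2) f] k(3,4) by simp
qed

text \<open>Both sides are \<open>3\<close>-cells between the same two \<open>2\<close>-cells, and
  below \<open>w\<close> there is only one.\<close>

lemma natural_low:
  assumes "F.is3 A c d" "from_w (s1 c)" "s1 c \<noteq> w"
  shows "rw (\<pi> A) (sg (t1 c)) \<bullet> S d = S c"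
proof -
  note p = natural_parts[OF assms(1,2)]
  have "low (s1 c) (c \<star> sg (t1 c))"
    using low_from_w[OF assms(2,3), of "c \<star> sg (t1 c)"] F.is3D(4)[OF assms(1)] p by simp
  then show ?thesis using is3_low_unique[OF is3_comp[OF p(4,6)] p(5)] by blast
qed

lemma F_is3_same: "F.is3 A c d \<Longrightarrow> F.is3 A c' d' \<Longrightarrow> c' = c \<and> d' = d"
  using F.is3D(2,3,4,5)[of A c d] F.is3D(2,3,4,5)[of A c' d'] up3_inj by metis

lemma naturalI: "F.is3 A c d \<Longrightarrow> (from_w (s1 c) \<Longrightarrow> rw (\<pi> A) (sg (t1 c)) \<bullet> S d = S c) \<Longrightarrow> natural A"
  unfolding natural_def using F_is3_same by blast

lemma naturalD: "natural A \<Longrightarrow> F.is3 A c d \<Longrightarrow> from_w (s1 c) \<Longrightarrow> rw (\<pi> A) (sg (t1 c)) \<bullet> S d = S c"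
  unfolding natural_def by blast

lemma natural_up3: "c \<in> cl2 \<Longrightarrow> natural (up3 P c)"
proof (rule naturalI[OF F.is3_id])
  assume c: "c \<in> cl2" and f: "from_w (s1 c)"
  note p = natural_parts[OF F.is3_id[OF c] f]
  have "rw (\<pi> (up3 P c)) (sg (t1 c)) = j (c \<star> sg (t1 c))" using \<pi>_up3[OF c] c p by simp
  then show "rw (\<pi> (up3 P c)) (sg (t1 c)) \<bullet> S c = S c" using comp_id(1)[OF p(5)] by simp
qed

lemma natural_comp:
  assumes "natural A" "natural B" "F.is3 A c d" "F.is3 B d e"
  shows "natural (cmp (free3 P) 2 A B)"
proof (rule naturalI[OF F.is3_comp[OF assms(3,4)]])
  assume f: "from_w (s1 c)"
  note p = natural_parts[OF assms(3) f]
  note r = natural_parts[OF assms(4) p(7)]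
  have t: "t1 d = t1 c" "s1 d = s1 c" using F.is3D(6,7)[OF assms(3)] by simp_all
  have "rw (\<pi> (cmp (free3 P) 2 A B)) (sg (t1 c)) = rw (\<pi> A) (sg (t1 c)) \<bullet> rw (\<pi> B) (sg (t1 c))"
    unfolding \<pi>_comp[OF assms(3,4)] by (rule rw_comp[OF \<pi>_is3[OF assms(3)] \<pi>_is3[OF assms(4)] p(1)]) (simp add: p(2))
  then show "rw (\<pi> (cmp (free3 P) 2 A B)) (sg (t1 c)) \<bullet> S e = S c"
    using comp_assoc[OF p(4) r(4)[unfolded t] r(6)[unfolded t]] naturalD[OF assms(2,4) p(7)] naturalD[OF assms(1,3) f] t by simp
qed

lemma natural_inverse:
  assumes "natural A" "F.is3 A c d" "inverse_cells (free3 P) 2 A B"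
  shows "natural B"
proof -
  note B = F.is3_of_inverse[OF assms(2,3)]
  show ?thesis
  proof (rule naturalI[OF B(1)])
    assume f: "from_w (s1 d)"
    have t: "t1 d = t1 c" "s1 d = s1 c" using F.is3D(6,7)[OF assms(2)] by simp_all
    have f': "from_w (s1 c)" using f t by simp
    note p = natural_parts[OF assms(2) f'] and r = natural_parts[OF B(1) f]
    have d: "d \<in> cl2" using F.is3D(5)[OF assms(2)] .
    have "rw (\<pi> B) (sg (t1 c)) \<bullet> rw (\<pi> A) (sg (t1 c)) = rw (\<pi> B \<bullet> \<pi> A) (sg (t1 c))"
      by (rule rw_comp[OF \<pi>_is3[OF B(1)] \<pi>_is3[OF assms(2)] p(1), symmetric]) (simp add: p(2) t)
    also have "\<pi> B \<bullet> \<pi> A = j d" unfolding \<pi>_comp[OF B(1) assms(2), symmetric] B(3) by (rule \<pi>_up3[OF d])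
    also have "rw (j d) (sg (t1 c)) = j (d \<star> sg (t1 c))" using p(1,2) d t by simp
    finally have i: "rw (\<pi> B) (sg (t1 c)) \<bullet> rw (\<pi> A) (sg (t1 c)) = j (d \<star> sg (t1 c))" .
    have "rw (\<pi> B) (sg (t1 c)) \<bullet> S c = rw (\<pi> B) (sg (t1 c)) \<bullet> (rw (\<pi> A) (sg (t1 c)) \<bullet> S d)"
      using naturalD[OF assms(1,2) f'] by simp
    also have "\<dots> = S d" using comp_assoc[OF r(4)[unfolded t] p(4,6)] i comp_id(1)[OF p(6)] by simp
    finally show "rw (\<pi> B) (sg (t1 d)) \<bullet> S c = S d" using t by simp
  qed
qed

text \<open>\<open>S_cmp\<close> splits \<open>S (d \<star> d')\<close>. Naturality of
  \<open>B\<close> replaces \<open>d'\<close> by \<open>c'\<close>, exchange moves the result across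
  \<open>A\<close>, and naturality of \<open>A\<close> replaces \<open>d\<close> by
  \<open>c\<close>.\<close>

lemma natural_cmp1:
  assumes "natural A" "natural B" "F.is3 A c d" "F.is3 B c' d'" "t1 c = s1 c'"
  shows "natural (cmp (free3 P) 1 A B)"
proof (rule naturalI[OF F.is3_cmp1[OF assms(3-5)]])
  note ka = F.is3D(4-7)[OF assms(3)] and kb = F.is3D(4-7)[OF assms(4)]
  assume "from_w (s1 (c \<star> c'))"
  then have f: "from_w (s1 c)" using ka kb assms(5) by simp
  then have f': "from_w (s1 c')" using from_w_cell[OF ka(1)] assms(5) by simp
  note p = natural_parts[OF assms(3) f] and r = natural_parts[OF assms(4) f']
  note iA = \<pi>_is3[OF assms(3)] and iB = \<pi>_is3[OF assms(4)]
  have t: "t1 (c \<star> c') = t1 c'" "t1 d = s1 d'" using ka kb assms(5) by simp_all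
  let ?q = "sg (t1 c')"
  have "rw (\<pi> (cmp (free3 P) 1 A B)) ?q = rw (rw (\<pi> A) c' \<bullet> lw d (\<pi> B)) ?q"
    unfolding \<pi>_cmp1[OF assms(3-5)] cmp1_exchange(1)[OF iA iB assms(5)] ..
  also have "\<dots> = rw (rw (\<pi> A) c') ?q \<bullet> rw (lw d (\<pi> B)) ?q"
  proof (rule rw_comp)
    show "is3 (rw (\<pi> A) c') (c \<star> c') (d \<star> c')" by (rule is3_rw[OF iA kb(1) assms(5)])
    show "is3 (lw d (\<pi> B)) (d \<star> c') (d \<star> d')" by (rule is3_lw[OF iB ka(2)]) (use ka assms(5) in simp)
    show "?q \<in> cl2" "t1 (c \<star> c') = s1 ?q" using r t by simp_all
  qed
  also have "rw (rw (\<pi> A) c') ?q = rw (\<pi> A) (c' \<star> ?q)" by (rule rw_rw[OF iA kb(1) r(1)]) (use r assms(5) in simp_all)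
  also have "rw (lw d (\<pi> B)) ?q = lw d (rw (\<pi> B) ?q)" by (rule lw_rw[OF iB ka(2) r(1)]) (use r ka assms(5) in simp_all)
  finally have E: "rw (\<pi> (cmp (free3 P) 1 A B)) ?q = rw (\<pi> A) (c' \<star> ?q) \<bullet> lw d (rw (\<pi> B) ?q)" .
  have cq: "c' \<star> ?q \<in> cl2" "s1 (c' \<star> ?q) = t1 c" using kb r assms(5) by simp_all
  have i1: "is3 (rw (\<pi> A) (c' \<star> ?q)) (c \<star> (c' \<star> ?q)) (d \<star> (c' \<star> ?q))" by (rule is3_rw[OF iA cq(1)]) (simp add: cq)
  have td: "t1 d = s1 (c' \<star> ?q)" using ka cq by simp
  have i2: "is3 (lw d (rw (\<pi> B) ?q)) (d \<star> (c' \<star> ?q)) (d \<star> (d' \<star> ?q))" by (rule is3_lw[OF r(4) ka(2) td])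
  have td': "t1 d = s1 (d' \<star> ?q)" using td is3D(6)[OF r(4)] by simp
  have i3: "is3 (lw d (S d')) (d \<star> (d' \<star> ?q)) (d \<star> sg (s1 c'))" by (rule is3_lw[OF r(6) ka(2) td'])
  have i4: "is3 (S d) (d \<star> sg (s1 c')) (sg (s1 c))" using p(6) assms(5) by simp
  have i5: "is3 (lw d (S c')) (d \<star> (c' \<star> ?q)) (d \<star> sg (s1 c'))" by (rule is3_lw[OF r(5) ka(2) td])
  have i6: "is3 (lw c (S c')) (c \<star> (c' \<star> ?q)) (c \<star> sg (s1 c'))" by (rule is3_lw[OF r(5) ka(1)]) (simp add: cq)
  have i7: "is3 (rw (\<pi> A) (sg (s1 c'))) (c \<star> sg (s1 c')) (d \<star> sg (s1 c'))" using p(4) assms(5) by simp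
  have "rw (\<pi> (cmp (free3 P) 1 A B)) ?q \<bullet> S (d \<star> d') = rw (\<pi> A) (c' \<star> ?q) \<bullet> lw d (rw (\<pi> B) ?q) \<bullet> (lw d (S d') \<bullet> S d)"
    unfolding E S_cmp[OF ka(2) kb(2) t(2) p(7)] ..
  also have "\<dots> = rw (\<pi> A) (c' \<star> ?q) \<bullet> (lw d (rw (\<pi> B) ?q) \<bullet> lw d (S d')) \<bullet> S d"
    using comp_assoc[OF i1 i2 is3_comp[OF i3 i4]] comp_assoc[OF i2 i3 i4] comp_assoc[OF i1 is3_comp[OF i2 i3] i4] by simp
  also have "lw d (rw (\<pi> B) ?q) \<bullet> lw d (S d') = lw d (S c')"
    using lw_comp[OF r(4,6) ka(2) td] naturalD[OF assms(2,4) f'] by simp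
  \<comment> \<open>\<open>S c'\<close> acts on what follows \<open>A\<close>, so it may be
    performed before or after \<open>A\<close>.\<close>
  also have "rw (\<pi> A) (c' \<star> ?q) \<bullet> lw d (S c') = lw c (S c') \<bullet> rw (\<pi> A) (sg (s1 c'))"
    using cmp1_exchange[OF iA r(5)] cq by simp
  also have "lw c (S c') \<bullet> rw (\<pi> A) (sg (s1 c')) \<bullet> S d = lw c (S c') \<bullet> S c"
    using comp_assoc[OF i6 i7 i4] naturalD[OF assms(1,3) f] assms(5) by simp
  also have "\<dots> = S (c \<star> c')" by (rule S_cmp[OF ka(1) kb(1) assms(5) f, symmetric])
  finally show "rw (\<pi> (cmp (free3 P) 1 A B)) (sg (t1 (c \<star> c'))) \<bullet> S (d \<star> d') = S (c \<star> c')" unfolding t(1) .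
qed

text \<open>The only place where naturality at \<open>w\<close> has content: a generator in context
  is the canonical filling of a pair of steps \<open>f\<close>, \<open>g\<close>, its transfer is
  \<open>T f g\<close>, and the claim unfolds to \<open>K f = T f g \<bullet> K g\<close>.\<close>

lemma natural_gen:
  assumes "x \<in> gens3 P" "F.is3 (gen3 x) c d" "ctx u c v"
  shows "natural (F.wh u (gen3 x) v)"
proof (rule naturalI[OF F.is3_wh[OF assms(2,3)]])
  assume f: "from_w (s1 (whisk u c v))"
  note iw = F.is3_wh[OF assms(2,3)]
  show "rw (\<pi> (F.wh u (gen3 x) v)) (sg (t1 (whisk u c v))) \<bullet> S (whisk u d v) = S (whisk u c v)"
  proof (cases "s1 (whisk u c v) = w")
    case False
    then show ?thesis using natural_low[OF iw f] by simp
  next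
    case True
    obtain f0 g0 where x: "\<phi> x = perm_class [f0, g0]" "critical P [f0, g0]" "pair_filling P (gen3 x) f0 g0"
      using squierD(2)[OF assms(1)] by blast
    have can: "can f0 g0 (gen3 x)" using x assms(1) by (intro critical_filling)
    obtain a b where ab: "step f0" "step g0" "s1 f0 = s1 g0" "a \<in> cl2" "b \<in> cl2" "t1 f0 = s1 a" "t1 g0 = s1 b"
      "F.is3 (gen3 x) (f0 \<star> a) (g0 \<star> b)" using x(3) by (rule pair_fillingD)
    note cl = step_cells[OF ab(1)] step_cells[OF ab(2)]
    have cd: "c = f0 \<star> a" "d = g0 \<star> b" using F_is3_same[OF assms(2) ab(8)] by simp_all
    have kd: "ctx u d v" using F.ctx_par[OF assms(2)] assms(3) by blast
    have k: "ctx u f0 v" "ctx u a v" "ctx u g0 v" "ctx u b v"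
      using ctx_cmp1[OF cl(1) ab(4,6)] ctx_cmp1[OF cl(2) ab(5,7)] assms(3) kd unfolding cd by blast+
    define f where "f = whisk u f0 v" define g where "g = whisk u g0 v"
    define a' where "a' = whisk u a v" define b' where "b' = whisk u b v"
    let ?A = "F.wh u (gen3 x) v"
    have w: "whisk u c v = f \<star> a'" "whisk u d v = g \<star> b'"
      unfolding cd f_def g_def a'_def b'_def
      using whisk_cmp1[OF cl(1) ab(4,6) k(1)] whisk_cmp1[OF cl(2) ab(5,7) k(3)] by simp_all
    have st: "step f" "step g" unfolding f_def g_def using step_whisk_iff k ab(1,2) by blast+
    have c': "a' \<in> cl2" "b' \<in> cl2" "t1 f = s1 a'" "t1 g = s1 b'"
      unfolding f_def g_def a'_def b'_def using k ab(6,7) by simp_all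
    have iA: "F.is3 ?A (f \<star> a') (g \<star> b')" using iw w by simp
    have sf: "stepw f" using st True w c' by simp
    have sg': "stepw g" using st sf F.is3D(6)[OF iA] c' by simp
    have "local_branching P [f, g]" using sf sg' by (simp add: local_branching2)
    then have can': "can f g ?A" using can_wh[OF can ctxD(1,2)[OF k(1)]] unfolding f_def g_def by blast
    note ty = typed_\<pi>[OF sf sg' c' iA]
    let ?q = "sg (t1 a')"
    have e: "ends a' ?q" by (rule ends_sg[OF sf c'(1,3)])
    note p = transfer_parts[OF ty e]
    have tb: "t1 b' = t1 a'" by (rule typedD(8)[OF ty])
    have q: "?q \<in> cl2" "s1 ?q = t1 a'" using e by (simp_all add: ends_def)
    have tf: "t1 (f \<star> a') = t1 a'" using c' st by simp
    note pk = K_is3[OF sg']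
    have Kf: "K f = lw f (Z (sg (t1 f)) (a' \<star> ?q)) \<bullet> (rw (\<pi> ?A) ?q \<bullet> lw g (Z (b' \<star> ?q) (sg (t1 g)))) \<bullet> K g"
      using K_eq[OF sf sg'] T_eq[OF can' sf sg' c' iA e] unfolding transfer_def by simp
    have ff: "lw f (Z (a' \<star> ?q) (sg (t1 f))) \<bullet> lw f (Z (sg (t1 f)) (a' \<star> ?q)) = j (f \<star> a' \<star> ?q)"
      using lw_Z_comp[OF sf p(6) low_sg[OF sf] p(6)] lw_Z_refl[OF sf p(6)] c' q st by (simp add: cmp1_assoc)
    note i23 = is3_comp[OF p(2,3)]
    have "S (f \<star> a') = lw f (Z (a' \<star> ?q) (sg (t1 f))) \<bullet> K f"
      unfolding S_step[OF sf c'(1,3)] head_value_def ..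
    also have "\<dots> = lw f (Z (a' \<star> ?q) (sg (t1 f))) \<bullet> lw f (Z (sg (t1 f)) (a' \<star> ?q)) \<bullet> (rw (\<pi> ?A) ?q \<bullet> lw g (Z (b' \<star> ?q) (sg (t1 g)))) \<bullet> K g"
      unfolding Kf using comp_assoc[OF p(4) is3_comp[OF p(1) i23] pk] comp_assoc[OF p(4) p(1) i23] by simp
    also have "\<dots> = rw (\<pi> ?A) ?q \<bullet> (lw g (Z (b' \<star> ?q) (sg (t1 g))) \<bullet> K g)"
      unfolding ff using comp_id(1)[OF i23] comp_assoc[OF p(2,3) pk] by simp
    also have "\<dots> = rw (\<pi> ?A) ?q \<bullet> S (g \<star> b')"
      unfolding S_step[OF sg' c'(2,4)] head_value_def tb ..
    finally show ?thesis unfolding w tf by simp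
  qed
qed

text \<open>Naturality is stated for cells with a given \<open>1\<close>-source and is not
  compatible with composition along \<open>0\<close>-cells as it stands. Carrying an arbitrary
  context through the induction repairs this: a neighbour in a \<open>0\<close>-composite is turned
  into context.\<close>

lemma natural_trm:
  assumes "wft (ext3 P) t" "F.is3 (tcls (ext3 P) t) c d" "ctx u c v"
  shows "natural (F.wh u (tcls (ext3 P) t) v)"
  using assms
proof (induction t arbitrary: c d u v)
  case (Old k)
  then have k: "k \<in> cl2" by simp
  have e: "tcls (ext3 P) (Old k) = up3 P k" by (simp add: old_cell_def)
  have "k = c" using F_is3_same[OF Old(2)[unfolded e] F.is3_id[OF k]] by simp
  then show ?case using natural_up3[of "whisk u k v"] Old(3) unfolding e by simp
next
  case (Gen x)
  then show ?case using natural_gen[of x c d u v] by (simp add: gen_cell_def)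
next
  case (Comp i s t)
  have ws: "wft (ext3 P) s" "wft (ext3 P) t" "i \<le> 2" "ttgt (ext3 P) i s = tsrc (ext3 P) i t" using Comp.prems(1) by auto
  let ?A = "tcls (ext3 P) s" and ?B = "tcls (ext3 P) t"
  have cl: "?A \<in> cl3" "?B \<in> cl3" using ws by (auto simp: free3_def cells_free_ext)
  have comp: "tgt (free3 P) i ?A = src (free3 P) i ?B"
    using composable_free_ext[of "ext3 P" s t i] ws by (simp add: free3_def)
  have e: "tcls (ext3 P) (Comp i s t) = cmp (free3 P) i ?A ?B" by (simp add: free3_def cmp_free_ext)
  obtain a a' where A: "F.is3 ?A a a'" using F_is3_ex[OF cl(1)] .
  obtain b b' where B: "F.is3 ?B b b'" using F_is3_ex[OF cl(2)] .
  note ka = F.is3D[OF A] and kb = F.is3D[OF B]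
  consider "i = 2" | "i = 1" | "i = 0" using ws(3) by linarith
  then show ?case
  proof cases
    case 1
    have ab: "a' = b" using comp ka(3) kb(2) 1 up3_inj[OF ka(5)] by simp
    have i: "F.is3 ?B a' b'" using B ab by simp
    have "c = a" using F_is3_same[OF Comp.prems(2)[unfolded 1 e[unfolded 1]] F.is3_comp[OF A i]] by blast
    then have k: "ctx u a v" using Comp.prems(3) by simp
    then have k': "ctx u b v" using F.ctx_par[OF A] ab by blast
    show ?thesis unfolding 1 e[unfolded 1] F.wh_comp[OF A i k]
      using natural_comp[OF Comp.IH(1)[OF ws(1) A k] Comp.IH(2)[OF ws(2) B k'] F.is3_wh[OF A k]] F.is3_wh[OF B k'] ab by simp
  next
    case 2
    have ab: "t1 a = s1 b" using comp ka(9) kb(8) 2 up3_inj[of "t1 a" "s1 b"] ka(4) by simp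
    have "c = a \<star> b" using F_is3_same[OF Comp.prems(2)[unfolded 2 e[unfolded 2]] F.is3_cmp1[OF A B ab]] by simp
    then have k: "ctx u a v" "ctx u b v" using Comp.prems(3) ctx_cmp1[OF ka(4) kb(4) ab] by blast+
    have "t1 (whisk u a v) = s1 (whisk u b v)" using k ab by simp
    then show ?thesis unfolding 2 e[unfolded 2] F.wh_cmp1[OF A B ab k(1)]
      by (rule natural_cmp1[OF Comp.IH(1)[OF ws(1) A k(1)] Comp.IH(2)[OF ws(2) B k(2)] F.is3_wh[OF A k(1)] F.is3_wh[OF B k(2)]])
  next
    case 3
    have ab: "t0 a = s0 b" using comp ka(11) kb(10) 3 up3_inj[of "t0 a" "s0 b"] ka(4) by simp
    have "c = a \<cdot> b" using F_is3_same[OF Comp.prems(2)[unfolded 3 e[unfolded 3]] F.is3_cmp0[OF A B ab]] by simp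
    then have k: "one u" "one v" "t0 u = s0 a" "t0 b = s0 v" using Comp.prems(3) ka(4) kb(4) ab by (simp_all add: ctx_def)
    note d = oneD[OF k(1)] oneD[OF k(2)]
    \<comment> \<open>\<open>A\<close> is performed while its neighbour is still the source of
      \<open>b\<close>, then \<open>B\<close> beside the target of \<open>a\<close>; these
      \<open>1\<close>-cells are moved into the contexts of the induction hypotheses.\<close>
    have kA: "ctx u a (s1 b \<cdot> v)" and kB: "ctx (u \<cdot> t1 a) b v"
      using k ka(4) kb(4) ab d by (simp_all add: ctx_def one_cmp0)
    have iA: "F.is3 (F.wr ?A (s1 b)) (a \<cdot> s1 b) (a' \<cdot> s1 b)" by (rule F.is3_wr[OF A]) (use kb(4) ab in simp_all)
    have iB: "F.is3 (F.wl (t1 a) ?B) (t1 a \<cdot> b) (t1 a \<cdot> b')" by (rule F.is3_wl[OF B]) (use ka(4) ab in simp_all)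
    have k2: "ctx u (a \<cdot> s1 b) v" "ctx u (t1 a \<cdot> b) v" using k ka(4) kb(4) ab by (simp_all add: ctx_def)
    have t: "t1 (a \<cdot> s1 b) = s1 (t1 a \<cdot> b)" using ka(4) kb(4) ab by simp
    have iuA: "F.is3 (F.wl u ?A) (u \<cdot> a) (u \<cdot> a')" by (rule F.is3_wl[OF A d(1) k(3)])
    have "F.wh u (F.wr ?A (s1 b)) v = F.wr (F.wl u (F.wr ?A (s1 b))) v" by (simp add: F.wh_def)
    also have "F.wl u (F.wr ?A (s1 b)) = F.wr (F.wl u ?A) (s1 b)"
      by (rule F.wl_wr[OF A d(1), symmetric]) (use k ka(4) kb(4) ab in simp_all)
    also have "F.wr (F.wr (F.wl u ?A) (s1 b)) v = F.wh u ?A (s1 b \<cdot> v)"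
      unfolding F.wh_def by (rule F.wr_wr[OF iuA]) (use k ka(4) kb(4) ab d in simp_all)
    finally have eA: "F.wh u (F.wr ?A (s1 b)) v = F.wh u ?A (s1 b \<cdot> v)" .
    have eB: "F.wh u (F.wl (t1 a) ?B) v = F.wh (u \<cdot> t1 a) ?B v"
      unfolding F.wh_def using F.wl_wl[OF B d(1), of "t1 a"] k ka(4) ab by simp
    have nA: "natural (F.wh u (F.wr ?A (s1 b)) v)" unfolding eA by (rule Comp.IH(1)[OF ws(1) A kA])
    have nB: "natural (F.wh u (F.wl (t1 a) ?B) v)" unfolding eB by (rule Comp.IH(2)[OF ws(2) B kB])
    have t': "t1 (whisk u (a \<cdot> s1 b) v) = s1 (whisk u (t1 a \<cdot> b) v)" using k2 t by simp
    show ?thesis unfolding 3 e[unfolded 3] F.cmp0_exchange(1)[OF A B ab] F.wh_cmp1[OF iA iB t k2(1)]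
      by (rule natural_cmp1[OF nA nB F.is3_wh[OF iA k2(1)] F.is3_wh[OF iB k2(2)] t'])
  qed
next
  case (Inv s)
  have ws: "wft (ext3 P) s" using Inv.prems(1) by simp
  let ?A = "tcls (ext3 P) s" and ?B = "tcls (ext3 P) (Inv s)"
  have iv: "inverse_cells (free3 P) 2 ?A ?B"
    using inverse_cells_free_ext[of "ext3 P" s] ws by (simp add: free3_def)
  have cl: "?A \<in> cl3" using ws by (auto simp: free3_def cells_free_ext)
  obtain a a' where A: "F.is3 ?A a a'" using F_is3_ex[OF cl] .
  note B = F.is3_of_inverse[OF A iv]
  have "c = a'" using F_is3_same[OF Inv.prems(2) B(1)] by simp
  then have k': "ctx u a' v" using Inv.prems(3) by simp
  then have k: "ctx u a v" using F.ctx_par[OF A] by blast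
  note iA = F.is3_wh[OF A k] and iB = F.is3_wh[OF B(1) k']
  have "inverse_cells (free3 P) 2 (F.wh u ?A v) (F.wh u ?B v)"
    unfolding inverse_cells_def
    using F.is3D(1-3)[OF iA] F.is3D(1-3)[OF iB] F.wh_comp[OF A B(1) k] F.wh_comp[OF B(1) A k'] B(2,3) k k' by simp
  then show ?case by (rule natural_inverse[OF Inv.IH[OF ws A k] iA])
qed

lemma natural_all: "A \<in> cl3 \<Longrightarrow> natural A"
proof -
  assume A: "A \<in> cl3"
  then obtain t where t: "wft (ext3 P) t" "A = tcls (ext3 P) t" by (auto simp: free3_def cells_free_ext)
  obtain c d where i: "F.is3 A c d" using F_is3_ex[OF A] .
  note c = F.is3D(4)[OF i]
  have k: "ctx (s0 c) c (t0 c)" using c by (simp add: ctx_def one_s0 one_t0)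
  have "F.wh (s0 c) A (t0 c) = A" unfolding F.wh_def F.wl_one[OF i] F.wr_one[OF i] ..
  then show ?thesis using natural_trm[OF t(1) i[unfolded t(2)] k] t(2) by simp
qed

text \<open>\<open>S c\<close> followed by the inverse of \<open>S d\<close> is one
  \<open>3\<close>-cell. Any other has the form \<open>\<pi> A\<close>, and naturality of
  \<open>A\<close> fixes its composite with the invertible \<open>S d\<close>.\<close>

lemma contractible:
  assumes c: "c \<in> cl2" "d \<in> cl2" "s1 c = w" "s1 d = w" "t1 c = n" "t1 d = n"
  shows "\<exists>!K. is3 K c d"
proof -
  have fn: "from_w n" using from_w_cell[OF c(1)] c(3,5) from_w_w by simp
  \<comment> \<open>Only the identity starts at the normal form, so the continuations hidden in
    \<open>S\<close> and in naturality disappear.\<close>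
  have sn: "sg n = n" using from_n[OF sg_from_w(1,2)[OF fn]] by blast
  have cn: "c \<star> n = c" "d \<star> n = d" using c2_simps(20)[OF c(1)] c2_simps(20)[OF c(2)] c(5,6) by simp_all
  have ic: "is3 (S c) c (sg w)" using S_is3[OF c(1)] c(3,5) from_w_w sn cn by simp
  have id: "is3 (S d) d (sg w)" using S_is3[OF c(2)] c(4,6) from_w_w sn cn by simp
  obtain I where I: "is3 I (sg w) d" using is3_inverse[OF id] by metis
  have "is3 (S c \<bullet> I) c d" by (rule is3_comp[OF ic I])
  moreover have "X = Y" if X: "is3 X c d" and Y: "is3 Y c d" for X Y
  proof -
    have "X \<bullet> S d = S c" if X: "is3 X c d" for X
    proof -
      obtain A where A: "F.is3 A c d" "X = \<pi> A" using is3_lift[OF X] .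
      have "rw (\<pi> A) (sg (t1 c)) \<bullet> S d = S c"
        using naturalD[OF natural_all[OF F.is3D(1)[OF A(1)]] A(1)] c(3) from_w_w by simp
      moreover have "rw (\<pi> A) (sg (t1 c)) = \<pi> A" using rw_one[OF \<pi>_is3[OF A(1)]] sn c(5) by simp
      ultimately show ?thesis using A(2) by simp
    qed
    from this[OF X] this[OF Y] show ?thesis using comp_cancel_right[OF id X Y] by simp
  qed
  ultimately show ?thesis by blast
qed

end

context coherent_model
begin

theorem coherence:
  assumes "normal_form P n" "c \<in> cl2" "d \<in> cl2" "s1 c = s1 d" "t1 c = n" "t1 d = n"
  shows "\<exists>!K. is3 K c d"
proof -
  have "\<forall>c d. c \<in> cl2 \<longrightarrow> d \<in> cl2 \<longrightarrow> s1 c = w \<longrightarrow> s1 d = w \<longrightarrow> t1 c = n \<longrightarrow> t1 d = n \<longrightarrow> (\<exists>!K. is3 K c d)" for w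
    using wfp_lt
  proof (induction w rule: wfp_induct_rule)
    case (less w)
    show ?case
    proof (intro allI impI)
      fix c d assume c: "c \<in> cl2" "d \<in> cl2" "s1 c = w" "s1 d = w" "t1 c = n" "t1 d = n"
      \<comment> \<open>A stage at \<open>w\<close> requires some \<open>2\<close>-cell from
        \<open>w\<close> to \<open>n\<close>; here \<open>c\<close> is one.\<close>
      interpret coherent_stage P \<phi> D j \<pi> n w
        using assms(1) c less by unfold_locales (blast, blast, metis)
      show "\<exists>!K. is3 K c d" by (rule contractible[OF c])
    qed
  qed
  then show ?thesis using assms by metis
qed

end

section \<open>The quotient by four-cells\<close>

definition quotient_ncat :: "'c ncat \<Rightarrow> ('c \<Rightarrow> 'c \<Rightarrow> bool) \<Rightarrow> 'c set ncat" where
  "quotient_ncat C R = \<lparr> dim = dim C, cells = {{y. R x y} | x. x \<in> cells C},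
     src = (\<lambda>i K. {y. R (src C i (SOME x. x \<in> K)) y}),
     tgt = (\<lambda>i K. {y. R (tgt C i (SOME x. x \<in> K)) y}),
     cmp = (\<lambda>i K L. {y. R (cmp C i (SOME x. x \<in> K) (SOME x. x \<in> L)) y}) \<rparr>"

text \<open>\<open>R_boundary\<close> makes related cells parallel, so only cells of the top
  dimension are ever identified. Lower cells survive in the quotient, and in the embedding of
  \<open>2\<close>-cells injectivity is not lost.\<close>

locale ncat_congruence = strict_category C for C :: "'c ncat" +
  fixes R :: "'c \<Rightarrow> 'c \<Rightarrow> bool"
  assumes R_cells: "R x y \<Longrightarrow> x \<in> cells C \<and> y \<in> cells C"
    and R_refl: "x \<in> cells C \<Longrightarrow> R x x"
    and R_sym: "R x y \<Longrightarrow> R y x"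
    and R_trans: "R x y \<Longrightarrow> R y z \<Longrightarrow> R x z"
    and R_boundary: "R x y \<Longrightarrow> i < dim C \<Longrightarrow> src C i x = src C i y \<and> tgt C i x = tgt C i y"
    and R_cmp: "R x x' \<Longrightarrow> R y y' \<Longrightarrow> i < dim C \<Longrightarrow> tgt C i x = src C i y \<Longrightarrow> R (cmp C i x y) (cmp C i x' y')"
begin

abbreviation "Q \<equiv> quotient_ncat C R"

definition cls :: "'c \<Rightarrow> 'c set" where "cls x = {y. R x y}"

lemma cls_eq_iff: "x \<in> cells C \<Longrightarrow> cls x = cls y \<longleftrightarrow> R x y"
  unfolding cls_def using R_refl R_sym R_trans by blast

lemma some_cls: "x \<in> cells C \<Longrightarrow> R x (SOME y. y \<in> cls x)"
  unfolding cls_def using someI_ex[of "R x"] R_refl[of x] by auto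

lemma dim_Q [simp]: "dim Q = dim C"
  by (simp add: quotient_ncat_def)

lemma cells_Q: "K \<in> cells Q \<longleftrightarrow> (\<exists>x \<in> cells C. K = cls x)"
  by (auto simp: quotient_ncat_def cls_def)

lemma src_Q: "x \<in> cells C \<Longrightarrow> src Q i (cls x) = cls (src C i x)"
proof -
  assume x: "x \<in> cells C"
  let ?y = "SOME y. y \<in> cls x"
  have r: "R x ?y" by (rule some_cls[OF x])
  have "R (src C i x) (src C i ?y)"
  proof (cases "i < dim C")
    case True then show ?thesis using R_boundary[OF r] R_refl src_closed[OF x] by metis
  next
    case False then show ?thesis using r R_cells[OF r] by (simp add: src_top)
  qed
  then have "cls (src C i ?y) = cls (src C i x)" using cls_eq_iff src_closed[OF x] by metis
  then show ?thesis by (simp add: quotient_ncat_def cls_def)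
qed

lemma tgt_Q: "x \<in> cells C \<Longrightarrow> tgt Q i (cls x) = cls (tgt C i x)"
proof -
  assume x: "x \<in> cells C"
  let ?y = "SOME y. y \<in> cls x"
  have r: "R x ?y" by (rule some_cls[OF x])
  have "R (tgt C i x) (tgt C i ?y)"
  proof (cases "i < dim C")
    case True then show ?thesis using R_boundary[OF r] R_refl tgt_closed[OF x] by metis
  next
    case False then show ?thesis using r R_cells[OF r] by (simp add: tgt_top)
  qed
  then have "cls (tgt C i ?y) = cls (tgt C i x)" using cls_eq_iff tgt_closed[OF x] by metis
  then show ?thesis by (simp add: quotient_ncat_def cls_def)
qed

text \<open>No new composites appear in the quotient, because related boundaries of dimension
  \<open>i\<close> are equal; so operations can be computed on representatives.\<close>

lemma composable_Q:
  assumes "x \<in> cells C" "y \<in> cells C" "i < dim C"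
  shows "tgt Q i (cls x) = src Q i (cls y) \<longleftrightarrow> tgt C i x = src C i y"
proof
  assume "tgt Q i (cls x) = src Q i (cls y)"
  then have "R (tgt C i x) (src C i y)" using assms cls_eq_iff tgt_closed by (simp add: src_Q tgt_Q)
  from R_boundary[OF this assms(3)] show "tgt C i x = src C i y"
    using assms by (simp add: src_tgt src_src)
qed (use assms in \<open>simp add: src_Q tgt_Q\<close>)

lemma cmp_Q:
  assumes "x \<in> cells C" "y \<in> cells C" "i < dim C" "tgt C i x = src C i y"
  shows "cmp Q i (cls x) (cls y) = cls (cmp C i x y)"
proof -
  have "R (cmp C i x y) (cmp C i (SOME z. z \<in> cls x) (SOME z. z \<in> cls y))"
    by (rule R_cmp[OF some_cls some_cls]) (use assms in simp_all)
  then have "cls (cmp C i (SOME z. z \<in> cls x) (SOME z. z \<in> cls y)) = cls (cmp C i x y)"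
    using cls_eq_iff R_cells by metis
  then show ?thesis by (simp add: quotient_ncat_def cls_def)
qed

lemma strict_category_Q: "strict_category Q"
proof
  note simps = src_Q tgt_Q cmp_Q cells_Q
  fix K L i k
  assume K: "K \<in> cells Q"
  then obtain x where x: "x \<in> cells C" "K = cls x" by (auto simp: cells_Q)
  show "src Q i K \<in> cells Q" "tgt Q i K \<in> cells Q" using x by (auto simp: simps src_closed tgt_closed)
  show "dim Q \<le> i \<Longrightarrow> src Q i K = K" "dim Q \<le> i \<Longrightarrow> tgt Q i K = K" using x by (simp_all add: simps src_top tgt_top)
  show "src Q i (src Q k K) = src Q (min i k) K" "tgt Q i (tgt Q k K) = tgt Q (min i k) K"
    "src Q i (tgt Q k K) = (if i < k then src Q i K else tgt Q k K)"
    "tgt Q i (src Q k K) = (if i < k then tgt Q i K else src Q k K)"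
    using x by (simp_all add: simps src_closed tgt_closed src_src tgt_tgt src_tgt tgt_src)
  show "i < dim Q \<Longrightarrow> cmp Q i (src Q i K) K = K" "i < dim Q \<Longrightarrow> cmp Q i K (tgt Q i K) = K"
    using x by (simp_all add: simps src_closed tgt_closed tgt_src src_tgt unit_left unit_right)
  assume i: "i < dim Q" and L: "L \<in> cells Q" "tgt Q i K = src Q i L"
  then obtain y where y: "y \<in> cells C" "L = cls y" by (auto simp: cells_Q)
  have c: "tgt C i x = src C i y" using L(2) i composable_Q x y by simp
  then show "cmp Q i K L \<in> cells Q" using x y i by (auto simp: simps cmp_closed)
  have lk: "tgt C i (src C k x) = src C i (src C k y)" "tgt C i (tgt C k x) = src C i (tgt C k y)" if "\<not> k \<le> i"
    using that x y c by (simp_all add: src_src tgt_src tgt_tgt src_tgt min_def)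
  show "src Q k (cmp Q i K L) = (if k \<le> i then src Q k K else cmp Q i (src Q k K) (src Q k L))"
    "tgt Q k (cmp Q i K L) = (if k \<le> i then tgt Q k L else cmp Q i (tgt Q k K) (tgt Q k L))"
    using x y i c lk by (simp_all add: simps cmp_closed src_closed tgt_closed src_cmp tgt_cmp)
  fix M assume M: "M \<in> cells Q" "tgt Q i L = src Q i M"
  then obtain z where z: "z \<in> cells C" "M = cls z" by (auto simp: cells_Q)
  have c': "tgt C i y = src C i z" using M(2) i composable_Q y z by simp
  show "cmp Q i (cmp Q i K L) M = cmp Q i K (cmp Q i L M)"
    using x y z i c c' by (simp add: simps cmp_closed src_cmp tgt_cmp cmp_assoc)
next
  fix K L M N i k
  assume a: "K \<in> cells Q" "L \<in> cells Q" "M \<in> cells Q" "N \<in> cells Q" "i < k" "k < dim Q"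
    "tgt Q k K = src Q k L" "tgt Q k M = src Q k N" "tgt Q i K = src Q i M"
  then obtain x y z t where x: "x \<in> cells C" "K = cls x" "y \<in> cells C" "L = cls y" "z \<in> cells C" "M = cls z" "t \<in> cells C" "N = cls t"
    by (auto simp: cells_Q)
  have c: "tgt C k x = src C k y" "tgt C k z = src C k t" "tgt C i x = src C i z"
    using a x composable_Q by auto
  have i: "i < dim C" "k < dim C" using a by simp_all
  have e: "tgt C i y = tgt C i x" "src C i t = src C i z"
    using globular[OF x(1,3) a(5) c(1)] globular[OF x(5,7) a(5) c(2)] by simp_all
  have c2: "tgt C i (cmp C k x y) = src C i (cmp C k z t)" "tgt C i y = src C i t"
    "tgt C k (cmp C i x z) = src C k (cmp C i y t)"
    using x c e i a(5) by (simp_all add: tgt_cmp src_cmp)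
  show "cmp Q i (cmp Q k K L) (cmp Q k M N) = cmp Q k (cmp Q i K M) (cmp Q i L N)"
    using x c c2 i by (simp add: cmp_Q cmp_closed interchange[OF x(1,3,5,7) a(5) i(2) c])
qed

lemma functor_cls: "ncat_functor C Q cls"
  unfolding ncat_functor_def using cells_Q src_Q tgt_Q cmp_Q by auto

lemma inverse_cells_cls: "i < dim C \<Longrightarrow> inverse_cells C i x y \<Longrightarrow> inverse_cells Q i (cls x) (cls y)"
  unfolding inverse_cells_def by (auto simp: cells_Q src_Q tgt_Q cmp_Q)

end

section \<open>Four-cells as a congruence on three-cells\<close>

context free_polygraph
begin

definition four_cell :: "('a, 'b, 'c, 'd) cell3 \<Rightarrow> ('a, 'b, 'c, 'd) cell3 \<Rightarrow> bool" where
  "four_cell A B \<longleftrightarrow> (\<exists>\<alpha> \<in> cells (free4 P). src (free4 P) 3 \<alpha> = up4 P A \<and> tgt (free4 P) 3 \<alpha> = up4 P B)"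

lemma up4_simps:
  assumes "A \<in> cl3"
  shows "up4 P A \<in> cells (free4 P)" "src (free4 P) i (up4 P A) = up4 P (src (free3 P) i A)"
    "tgt (free4 P) i (up4 P A) = up4 P (tgt (free3 P) i A)"
proof -
  have w: "wft (ext4 P) (Old A)" using assms by simp
  then show "up4 P A \<in> cells (free4 P)" by (auto simp: free4_def cells_free_ext old_cell_def simp del: wft.simps)
  show "src (free4 P) i (up4 P A) = up4 P (src (free3 P) i A)" "tgt (free4 P) i (up4 P A) = up4 P (tgt (free3 P) i A)"
    using src_free_ext[of "ext4 P", OF _ _ w] tgt_free_ext[of "ext4 P", OF _ _ w] assms
    by (auto simp: free4_def old_cell_def c3.src_top c3.tgt_top)
qed

lemma up4_inj: "A \<in> cl3 \<Longrightarrow> up4 P A = up4 P B \<longleftrightarrow> A = B"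
  using Old_eq_iff[of "ext4 P" A B] by (simp add: old_cell_def)

lemma up4_cmp:
  assumes "A \<in> cl3" "B \<in> cl3" "i < 3" "tgt (free3 P) i A = src (free3 P) i B"
  shows "up4 P (cmp (free3 P) i A B) = cmp (free4 P) i (up4 P A) (up4 P B)"
  using tcls_Comp_Old[of "ext4 P" i A B] assms by (simp add: free4_def old_cell_def cmp_free_ext)

lemma four_cellD:
  assumes "src (free4 P) 3 \<alpha> = up4 P A" "tgt (free4 P) 3 \<alpha> = up4 P B" "\<alpha> \<in> cells (free4 P)"
  shows "A \<in> cl3" "B \<in> cl3"
    "i < 3 \<Longrightarrow> src (free4 P) i \<alpha> = up4 P (src (free3 P) i A)" "i < 3 \<Longrightarrow> tgt (free4 P) i \<alpha> = up4 P (tgt (free3 P) i A)"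
    "i < 3 \<Longrightarrow> src (free4 P) i \<alpha> = up4 P (src (free3 P) i B)" "i < 3 \<Longrightarrow> tgt (free4 P) i \<alpha> = up4 P (tgt (free3 P) i B)"
proof -
  have c: "up4 P A \<in> cells (free4 P)" "up4 P B \<in> cells (free4 P)"
    using c4.src_closed[OF assms(3)] c4.tgt_closed[OF assms(3)] assms(1,2) by metis+
  then show A: "A \<in> cl3" "B \<in> cl3"
    using old_cell_cells[of "ext4 P" A] old_cell_cells[of "ext4 P" B] by (simp_all add: free4_def)
  assume i: "i < 3"
  have "src (free4 P) i (src (free4 P) 3 \<alpha>) = src (free4 P) i \<alpha>" "src (free4 P) i (tgt (free4 P) 3 \<alpha>) = src (free4 P) i \<alpha>"
    "tgt (free4 P) i (src (free4 P) 3 \<alpha>) = tgt (free4 P) i \<alpha>" "tgt (free4 P) i (tgt (free4 P) 3 \<alpha>) = tgt (free4 P) i \<alpha>"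
    using i assms(3) by (simp_all add: c4.src_src c4.src_tgt c4.tgt_src c4.tgt_tgt)
  then show "src (free4 P) i \<alpha> = up4 P (src (free3 P) i A)" "tgt (free4 P) i \<alpha> = up4 P (tgt (free3 P) i A)"
    "src (free4 P) i \<alpha> = up4 P (src (free3 P) i B)" "tgt (free4 P) i \<alpha> = up4 P (tgt (free3 P) i B)"
    unfolding assms(1,2) using up4_simps A by metis+
qed

lemma four_cell_cells: "four_cell A B \<Longrightarrow> A \<in> cl3 \<and> B \<in> cl3"
  unfolding four_cell_def using four_cellD(1,2) by blast

lemma inverse4_ex: "\<alpha> \<in> cells (free4 P) \<Longrightarrow> \<exists>\<beta>. inverse_cells (free4 P) 3 \<alpha> \<beta>"
proof -
  assume A: "\<alpha> \<in> cells (free4 P)"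
  then have "\<alpha> \<in> kcells (free4 P) (Suc 3)" by (simp add: kcells_def c4.src_top)
  moreover have "2 \<le> (3::nat) \<and> 3 < (4::nat)" by simp
  ultimately show ?thesis using np_category_free(3)[OF poly] unfolding np_category_def by blast
qed

text \<open>Symmetry is where invertibility of \<open>4\<close>-cells enters. Compatibility with
  composition holds because \<open>4\<close>-cells compose along cells of every lower
  dimension.\<close>

sublocale Q: ncat_congruence "free3 P" four_cell
proof
  show "A \<in> cl3 \<and> B \<in> cl3" if "four_cell A B" for A B using four_cell_cells that .
  show "four_cell A A" if "A \<in> cl3" for A
    unfolding four_cell_def using up4_simps(1)[OF that] up4_simps(2,3)[OF that, of 3] that by (intro bexI[of _ "up4 P A"]) (simp_all add: c3.src_top c3.tgt_top)
  show "four_cell B A" if AB: "four_cell A B" for A B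
  proof -
    obtain \<alpha> where a: "\<alpha> \<in> cells (free4 P)" "src (free4 P) 3 \<alpha> = up4 P A" "tgt (free4 P) 3 \<alpha> = up4 P B"
      using AB unfolding four_cell_def by blast
    obtain \<beta> where "inverse_cells (free4 P) 3 \<alpha> \<beta>" using inverse4_ex[OF a(1)] by blast
    then show ?thesis unfolding four_cell_def inverse_cells_def using a by metis
  qed
  show "four_cell A E" if AB: "four_cell A B" and BE: "four_cell B E" for A B E
  proof -
    obtain \<alpha> where a: "\<alpha> \<in> cells (free4 P)" "src (free4 P) 3 \<alpha> = up4 P A" "tgt (free4 P) 3 \<alpha> = up4 P B"
      using AB unfolding four_cell_def by blast
    obtain \<beta> where b: "\<beta> \<in> cells (free4 P)" "src (free4 P) 3 \<beta> = up4 P B" "tgt (free4 P) 3 \<beta> = up4 P E"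
      using BE unfolding four_cell_def by blast
    show ?thesis unfolding four_cell_def
      by (rule bexI[of _ "cmp (free4 P) 3 \<alpha> \<beta>"]) (use a b in \<open>simp_all add: c4.src_cmp c4.tgt_cmp c4.cmp_closed\<close>)
  qed
  show "src (free3 P) i A = src (free3 P) i B \<and> tgt (free3 P) i A = tgt (free3 P) i B"
    if AB: "four_cell A B" and i: "i < dim (free3 P)" for A B i
  proof -
    obtain \<alpha> where a: "\<alpha> \<in> cells (free4 P)" "src (free4 P) 3 \<alpha> = up4 P A" "tgt (free4 P) 3 \<alpha> = up4 P B"
      using AB unfolding four_cell_def by blast
    note D = four_cellD[OF a(2,3,1)]
    have "up4 P (src (free3 P) i A) = up4 P (src (free3 P) i B)" "up4 P (tgt (free3 P) i A) = up4 P (tgt (free3 P) i B)"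
      using D(3-6)[of i] i by simp_all
    then show ?thesis using up4_inj c3.src_closed[OF D(1)] c3.tgt_closed[OF D(1)] by blast
  qed
  show "four_cell (cmp (free3 P) i A B) (cmp (free3 P) i A' B')"
    if AB: "four_cell A A'" "four_cell B B'" and i: "i < dim (free3 P)" "tgt (free3 P) i A = src (free3 P) i B" for A A' B B' i
  proof -
    obtain \<alpha> where a: "\<alpha> \<in> cells (free4 P)" "src (free4 P) 3 \<alpha> = up4 P A" "tgt (free4 P) 3 \<alpha> = up4 P A'"
      using AB unfolding four_cell_def by blast
    obtain \<beta> where b: "\<beta> \<in> cells (free4 P)" "src (free4 P) 3 \<beta> = up4 P B" "tgt (free4 P) 3 \<beta> = up4 P B'"
      using AB unfolding four_cell_def by blast
    have i3: "i < 3" using i(1) by simp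
    note D = four_cellD[OF a(2,3,1)] and E = four_cellD[OF b(2,3,1)]
    have c: "tgt (free4 P) i \<alpha> = src (free4 P) i \<beta>" using D(4)[OF i3] E(3)[OF i3] i(2) by simp
    have "up4 P (tgt (free3 P) i A') = up4 P (src (free3 P) i B')" using c D(6)[OF i3] E(5)[OF i3] by simp
    then have c': "tgt (free3 P) i A' = src (free3 P) i B'" using up4_inj c3.tgt_closed[OF D(2)] by blast
    have "src (free4 P) 3 (cmp (free4 P) i \<alpha> \<beta>) = up4 P (cmp (free3 P) i A B)"
      "tgt (free4 P) 3 (cmp (free4 P) i \<alpha> \<beta>) = up4 P (cmp (free3 P) i A' B')"
      using a b c i3 up4_cmp[OF D(1) E(1) i3 i(2)] up4_cmp[OF D(2) E(2) i3 c'] by (simp_all add: c4.src_cmp c4.tgt_cmp)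
    moreover have "cmp (free4 P) i \<alpha> \<beta> \<in> cells (free4 P)" using a b c i3 by (simp add: c4.cmp_closed)
    ultimately show ?thesis unfolding four_cell_def by blast
  qed
qed

abbreviation "quot3 \<equiv> quotient_ncat (free3 P) four_cell"

lemma three_cells_quotient: "three_cells P quot3 (\<lambda>c. Q.cls (up3 P c))"
proof -
  interpret D: strict_category quot3 by (rule Q.strict_category_Q)
  show ?thesis
  proof unfold_locales
    show "dim quot3 = 3" by simp
    show "ncat_functor (free2 P) quot3 (\<lambda>c. Q.cls (up3 P c))"
    proof -
      have "up3 P (cmp (free2 P) i c d) = cmp (free3 P) i (up3 P c) (up3 P d)"
        if "c \<in> cl2" "d \<in> cl2" "i < 2" "tgt (free2 P) i c = src (free2 P) i d" for c d i
        using up3_functor that by (simp add: ncat_functor_def)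
      then show ?thesis unfolding ncat_functor_def
        by (intro conjI ballI allI impI) (auto simp: Q.cells_Q Q.src_Q Q.tgt_Q Q.cmp_Q up3_simps)
    qed
    show "\<exists>L. inverse_cells quot3 2 K L" if K: "K \<in> cells quot3" for K
    proof -
      obtain A where A: "A \<in> cl3" "K = Q.cls A" using K by (auto simp: Q.cells_Q)
      obtain B where "inverse_cells (free3 P) 2 A B" using inverse3_ex[OF A(1)] by blast
      then show ?thesis using Q.inverse_cells_cls[of 2 A B] A(2) by auto
    qed
  qed
qed

lemma coherent_model_quotient:
  assumes s: "squier2_by P \<phi>" and \<psi>: "bij_betw \<psi> (gens4 P) (critical_classes P 3)"
    and fill: "\<forall>x \<in> gens4 P. \<exists>f g h. [f, g, h] \<in> \<psi> x \<and> triple_filling P \<phi> (gen_cell (ext4 P) x) f g h"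
  shows "coherent_model P \<phi> quot3 (\<lambda>c. Q.cls (up3 P c)) Q.cls"
proof -
  interpret squier_polygraph P \<phi> using s by unfold_locales
  interpret M: three_cells P quot3 "\<lambda>c. Q.cls (up3 P c)" by (rule three_cells_quotient)
  show ?thesis
  proof unfold_locales
    show "ncat_functor (free3 P) quot3 Q.cls" by (rule Q.functor_cls)
    show "\<exists>A\<in>cl3. K = Q.cls A" if "K \<in> cells quot3" for K using that by (simp add: Q.cells_Q)
    show "c = d" if "c \<in> cl2" "d \<in> cl2" "Q.cls (up3 P c) = Q.cls (up3 P d)" for c d
    proof -
      have "four_cell (up3 P c) (up3 P d)" using that Q.cls_eq_iff up3_simps(1) by blast
      from Q.R_boundary[OF this, of 2] show ?thesis using that by (simp add: up3_simps up3_inj)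
    qed
    fix fs assume fs: "critical P fs" "length fs = 3"
    \<comment> \<open>Surjectivity of \<open>\<psi>\<close> provides a generator for every critical
      triple. It fills some ordering of the triple, which is why the locale asks for a filling only
      up to permutation.\<close>
    then have "perm_class fs \<in> critical_classes P 3" unfolding critical_classes_def by blast
    then obtain x where x: "x \<in> gens4 P" "\<psi> x = perm_class fs"
      using bij_betw_imp_surj_on[OF \<psi>] by (metis imageE)
    then obtain f g h where f: "[f, g, h] \<in> perm_class fs" "triple_filling P \<phi> (gen_cell (ext4 P) x) f g h"
      using fill by metis
    then obtain Afg Agh Afh a b c A B1 B2 where y: "can f g Afg" "can g h Agh" "can f h Afh"
      "a \<in> cl2" "b \<in> cl2" "c \<in> cl2" "A \<in> cl3" "B1 \<in> cl3" "B2 \<in> cl3" "gen_cell (ext4 P) x \<in> cells (free4 P)"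
      "src (free4 P) 3 (gen_cell (ext4 P) x) = up4 P (cmp (free3 P) 2 (cmp (free3 P) 2 (F.rw Afg a) (F.lw g A)) (F.rw Agh b))"
      "tgt (free4 P) 3 (gen_cell (ext4 P) x) = up4 P (cmp (free3 P) 2 (cmp (free3 P) 2 (F.lw f B1) (F.rw Afh c)) (F.lw h B2))"
      unfolding triple_filling_def F.rw_def F.lw_def by blast
    let ?L = "cmp (free3 P) 2 (cmp (free3 P) 2 (F.rw Afg a) (F.lw g A)) (F.rw Agh b)"
    let ?R = "cmp (free3 P) 2 (cmp (free3 P) 2 (F.lw f B1) (F.rw Afh c)) (F.lw h B2)"
    have r: "four_cell ?L ?R" unfolding four_cell_def using y(10-12) by blast
    note cl = four_cell_cells[OF r]
    have e: "Q.cls ?L = Q.cls ?R" using Q.cls_eq_iff cl r by blast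
    have m: "mset [f, g, h] = mset fs" using f(1) by (simp add: perm_class_def)
    show "\<exists>f g h Afg Agh Afh a b c A B1 B2. mset [f, g, h] = mset fs \<and>
        can f g Afg \<and> can g h Agh \<and> can f h Afh \<and> a \<in> cl2 \<and> b \<in> cl2 \<and> c \<in> cl2 \<and>
        A \<in> cl3 \<and> B1 \<in> cl3 \<and> B2 \<in> cl3 \<and>
        cmp (free3 P) 2 (cmp (free3 P) 2 (F.rw Afg a) (F.lw g A)) (F.rw Agh b) \<in> cl3 \<and>
        cmp (free3 P) 2 (cmp (free3 P) 2 (F.lw f B1) (F.rw Afh c)) (F.lw h B2) \<in> cl3 \<and>
        Q.cls (cmp (free3 P) 2 (cmp (free3 P) 2 (F.rw Afg a) (F.lw g A)) (F.rw Agh b)) =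
        Q.cls (cmp (free3 P) 2 (cmp (free3 P) 2 (F.lw f B1) (F.rw Afh c)) (F.lw h B2))"
      by (intro exI conjI; fact m y cl[THEN conjunct1] cl[THEN conjunct2] e)
  qed simp
qed

end

theorem theorem1p4p9:
  fixes P :: "('a, 'b, 'c, 'd, 'e) polygraph"
    and A B :: "('a, 'b, 'c, 'd) cell3"
    and u :: "('a, 'b, 'c) cell2"
  assumes "polygraph42 P"
    and "squier2_depth2 P"
    and "parallel_cells (free3 P) 3 A B"
    and "normal_form P u"
    and "tgt (free3 P) 1 A = up3 P u"
    and "tgt (free3 P) 1 B = up3 P u"
  shows "\<exists>\<alpha> \<in> cells (free4 P). src (free4 P) 3 \<alpha> = up4 P A \<and> tgt (free4 P) 3 \<alpha> = up4 P B"
proof -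
  interpret free_polygraph P using assms(1) by unfold_locales
  obtain \<phi> \<psi> where s: "squier2_by P \<phi>" "bij_betw \<psi> (gens4 P) (critical_classes P 3)"
    "\<forall>x \<in> gens4 P. \<exists>f g h. [f, g, h] \<in> \<psi> x \<and> triple_filling P \<phi> (gen_cell (ext4 P) x) f g h"
    using assms(2) unfolding squier2_depth2_def by blast
  interpret M: coherent_model P \<phi> quot3 "\<lambda>c. Q.cls (up3 P c)" Q.cls by (rule coherent_model_quotient[OF s])
  have AB: "A \<in> cl3" "B \<in> cl3" "src (free3 P) 2 A = src (free3 P) 2 B" "tgt (free3 P) 2 A = tgt (free3 P) 2 B"
    using assms(3) by (auto simp: parallel_cells_def kcells_def)
  obtain c d where A: "F.is3 A c d" using F_is3_ex[OF AB(1)] .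
  have B: "F.is3 B c d" using F_is3I[OF AB(2)] F.is3D(2,3)[OF A] AB(3,4) by simp
  note k = F.is3D[OF A]
  have "up3 P (t1 c) = up3 P u" using k(9) assms(5) by simp
  then have t: "t1 c = u" using up3_inj[of "t1 c" u] k(4) by simp
  have "\<exists>!K. M.is3 K c d" by (rule M.coherence[OF assms(4) k(4,5)]) (use k t in simp_all)
  \<comment> \<open>Both classes are \<open>3\<close>-cells of the quotient from \<open>c\<close> to
    \<open>d\<close>, and there is only one; equality of the classes is the existence of a
    \<open>4\<close>-cell.\<close>
  then have "Q.cls A = Q.cls B" using M.\<pi>_is3[OF A] M.\<pi>_is3[OF B] by blast
  then have "four_cell A B" using Q.cls_eq_iff[OF AB(1)] by blast
  then show ?thesis unfolding four_cell_def .
qed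

end
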